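(* (1) For each $i\ge 0$, up to isomorphism, $\tau^{-i}P_2$ is the unique Gabriel-Roiter submodule of $\tau^{-(i+1)}P_3$. (2) For each $i\ge 1$, up to isomorphism, $\tau^{-i}P_3$ is the unique Gabriel-Roiter submodule of $\tau^{-i}P_1$. (3) For each $i\ge 0$, a Gabriel-Roiter submodule of $\tau^{-i}P_2$ is isomorphic to $\tau^{-(i-1)}P_1$ if $i$ is odd, and to $\tau^{-i}P_3$ if $i$ is even.
   Context: Let $k$ be an algebraically closed field and $Q$ the quiver with vertices $1,2,3$, one arrow $1\to 2$ and two arrows $2\to 3$. A module is a finite-dimensional representation of $Q$ over $k$; $|M|$ denotes the length of $M$, and $\tau$ is the Auslander-Reiten translation. $P_i$ is the indecomposable projective module at vertex $i$; the dimension vectors of $P_1,P_2,P_3$ are $(1,1,2),(0,1,2),(0,0,1)$. Order on subsets of $\mathbb{N}_1=\{1,2,3,\ldots\}$: for $I\ne J$ put $I<J$ if the smallest element of $(I\setminus J)\cup(J\setminus I)$ belongs to $J$. The Gabriel-Roiter measure $\mu(M)$ of a nonzero module $M$ is the maximum, in this order, of the sets $\{|M_1|,\ldots,|M_t|\}$ over all chains $M_1\subsetneq\cdots\subsetneq M_t$ of indecomposable submodules of $M$. A Gabriel-Roiter submodule of an indecomposable module $M$ is an indecomposable proper submodule $X\subsetneq M$ with $\mu(M)=\mu(X)\cup\{|M|\}$ (equivalently, an indecomposable proper submodule of maximal Gabriel-Roiter measure). *)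

theory Defs
  imports "HOL-Computational_Algebra.Polynomial" "HOL-Library.Function_Algebras"
begin

section \<open>Linear algebra in function spaces\<close>

text \<open>
  All vector spaces are subspaces of function spaces \<open>'b \<Rightarrow> 'k\<close> with pointwise operations.  A linear map
  between subspaces \<open>S\<close> and \<open>T\<close> is represented by the unique total function that agrees with it
  on \<open>S\<close> and is 0 outside \<open>S\<close>; hence two linear maps are equal iff they are equal as functions.
\<close>

definition vscale :: "'k::field \<Rightarrow> ('b \<Rightarrow> 'k) \<Rightarrow> ('b \<Rightarrow> 'k)" where
  "vscale c x = (\<lambda>b. c * x b)"

global_interpretation fun_vs: vector_space "vscale :: 'k::field \<Rightarrow> ('b \<Rightarrow> 'k) \<Rightarrow> ('b \<Rightarrow> 'k)"
  by unfold_locales (auto simp: vscale_def fun_eq_iff algebra_simps)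

definition linear_map :: "('k \<Rightarrow> 'x \<Rightarrow> 'x) \<Rightarrow> ('k \<Rightarrow> 'y \<Rightarrow> 'y) \<Rightarrow> 'x set \<Rightarrow> 'y set
    \<Rightarrow> ('x::ab_group_add \<Rightarrow> 'y::ab_group_add) \<Rightarrow> bool" where
  "linear_map s1 s2 S T f \<longleftrightarrow>
     (\<forall>x\<in>S. f x \<in> T) \<and> (\<forall>x. x \<notin> S \<longrightarrow> f x = 0) \<and>
     (\<forall>x\<in>S. \<forall>y\<in>S. f (x + y) = f x + f y) \<and> (\<forall>c. \<forall>x\<in>S. f (s1 c x) = s2 c (f x))"

definition finite_dimensional :: "('b \<Rightarrow> 'k::field) set \<Rightarrow> bool" where
  "finite_dimensional S \<longleftrightarrow> (\<exists>B. finite B \<and> fun_vs.span B = S)"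


section \<open>Quivers and their representations\<close>

text \<open>The vertices and the arrows are all elements of the types \<open>'v\<close> and \<open>'a\<close>.\<close>

record ('v, 'a) quiver =
  src :: "'a \<Rightarrow> 'v"
  tgt :: "'a \<Rightarrow> 'v"

definition opposite :: "('v, 'a) quiver \<Rightarrow> ('v, 'a) quiver" where
  "opposite Q = \<lparr>src = tgt Q, tgt = src Q\<rparr>"

fun is_path :: "('v, 'a) quiver \<Rightarrow> 'v \<Rightarrow> 'a list \<Rightarrow> 'v \<Rightarrow> bool" where
  "is_path Q u [] w \<longleftrightarrow> u = w"
| "is_path Q u (a # p) w \<longleftrightarrow> src Q a = u \<and> is_path Q (tgt Q a) p w"

record ('v, 'a, 'b, 'k) rep =
  sp :: "'v \<Rightarrow> ('b \<Rightarrow> 'k) set"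
  mp :: "'a \<Rightarrow> ('b \<Rightarrow> 'k) \<Rightarrow> ('b \<Rightarrow> 'k)"

definition is_module :: "('v, 'a) quiver \<Rightarrow> ('v, 'a, 'b, 'k::field) rep \<Rightarrow> bool" where
  "is_module Q M \<longleftrightarrow>
     (\<forall>v. fun_vs.subspace (sp M v) \<and> finite_dimensional (sp M v)) \<and>
     (\<forall>a. linear_map vscale vscale (sp M (src Q a)) (sp M (tgt Q a)) (mp M a))"

definition hom :: "('v, 'a) quiver \<Rightarrow> ('v, 'a, 'b, 'k::field) rep \<Rightarrow> ('v, 'a, 'c, 'k) rep
    \<Rightarrow> ('v \<Rightarrow> ('b \<Rightarrow> 'k) \<Rightarrow> ('c \<Rightarrow> 'k)) set" where
  "hom Q M N = {h. (\<forall>v. linear_map vscale vscale (sp M v) (sp N v) (h v)) \<and>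
     (\<forall>a. \<forall>x \<in> sp M (src Q a). h (tgt Q a) (mp M a x) = mp N a (h (src Q a) x))}"

definition hom_comp :: "('v \<Rightarrow> 'y \<Rightarrow> 'z) \<Rightarrow> ('v \<Rightarrow> 'x \<Rightarrow> 'y) \<Rightarrow> 'v \<Rightarrow> 'x \<Rightarrow> 'z" where
  "hom_comp g f = (\<lambda>v. g v \<circ> f v)"

definition surjective :: "('v, 'a, 'b, 'k) rep \<Rightarrow> ('v, 'a, 'c, 'k) rep
    \<Rightarrow> ('v \<Rightarrow> ('b \<Rightarrow> 'k) \<Rightarrow> ('c \<Rightarrow> 'k)) \<Rightarrow> bool" where
  "surjective M N h \<longleftrightarrow> (\<forall>v. h v ` sp M v = sp N v)"

definition isomorphic :: "('v, 'a) quiver \<Rightarrow> ('v, 'a, 'b, 'k::field) rep \<Rightarrow> ('v, 'a, 'c, 'k) rep \<Rightarrow> bool" where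
  "isomorphic Q M N \<longleftrightarrow> (\<exists>h \<in> hom Q M N. \<forall>v. bij_betw (h v) (sp M v) (sp N v))"

text \<open>Because structure maps vanish off their domain, a submodule is determined by its subspaces, and
  two submodules of a module are the same iff they are equal as records.\<close>

definition submodule :: "('v, 'a) quiver \<Rightarrow> ('v, 'a, 'b, 'k::field) rep \<Rightarrow> ('v, 'a, 'b, 'k) rep \<Rightarrow> bool" where
  "submodule Q X M \<longleftrightarrow> is_module Q X \<and> is_module Q M \<and> (\<forall>v. sp X v \<subseteq> sp M v) \<and>
     (\<forall>a. \<forall>x \<in> sp X (src Q a). mp X a x = mp M a x)"

definition proper_submodule :: "('v, 'a) quiver \<Rightarrow> ('v, 'a, 'b, 'k::field) rep \<Rightarrow> ('v, 'a, 'b, 'k) rep \<Rightarrow> bool" where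
  "proper_submodule Q X M \<longleftrightarrow> submodule Q X M \<and> X \<noteq> M"

definition is_zero :: "('v, 'a, 'b, 'k::field) rep \<Rightarrow> bool" where
  "is_zero M \<longleftrightarrow> (\<forall>v. sp M v = {0})"

definition indecomposable :: "('v, 'a) quiver \<Rightarrow> ('v, 'a, 'b, 'k::field) rep \<Rightarrow> bool" where
  "indecomposable Q M \<longleftrightarrow> is_module Q M \<and> \<not> is_zero M \<and>
     (\<forall>U W. submodule Q U M \<and> submodule Q W M \<and>
        (\<forall>v. sp U v \<inter> sp W v = {0} \<and> {x + y |x y. x \<in> sp U v \<and> y \<in> sp W v} = sp M v)
        \<longrightarrow> is_zero U \<or> is_zero W)"

definition mod_length :: "('v, 'a) quiver \<Rightarrow> ('v, 'a, 'b, 'k::field) rep \<Rightarrow> nat" where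
  "mod_length Q M = Max {n. \<exists>Ms. length Ms = Suc n \<and> sorted_wrt (proper_submodule Q) Ms \<and>
                              (\<forall>X \<in> set Ms. submodule Q X M)}"


section \<open>Projective modules, duality and the Auslander-Reiten translation\<close>

text \<open>The projective module \<open>P\<^sub>i\<close>: its space at \<open>v\<close> has the paths from \<open>i\<close> to \<open>v\<close> as
  a basis (so it is finite-dimensional when the quiver has finitely many paths), and an arrow acts by
  appending it to a path.\<close>

definition append_arrow :: "'a \<Rightarrow> ('a list \<Rightarrow> 'k::zero) \<Rightarrow> ('a list \<Rightarrow> 'k)" where
  "append_arrow a x = (\<lambda>p. if p \<noteq> [] \<and> last p = a then x (butlast p) else 0)"

definition prepend_arrow :: "'a \<Rightarrow> ('a list \<Rightarrow> 'k::zero) \<Rightarrow> ('a list \<Rightarrow> 'k)" where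
  "prepend_arrow a x = (\<lambda>p. if p \<noteq> [] \<and> hd p = a then x (tl p) else 0)"

definition proj_module :: "('v, 'a) quiver \<Rightarrow> 'v \<Rightarrow> ('v, 'a, 'a list, 'k::field) rep" where
  "proj_module Q i =
     (let S = (\<lambda>v. {x. \<forall>p. x p \<noteq> 0 \<longrightarrow> is_path Q i p v})
      in \<lparr>sp = S, mp = (\<lambda>a x. if x \<in> S (src Q a) then append_arrow a x else 0)\<rparr>)"

text \<open>The lifting property is tested on modules with the same index type \<open>'b\<close>.  If \<open>'b\<close> is
  infinite (below it is \<open>'a list\<close>), every module is isomorphic to one of these.\<close>

definition projective :: "('v, 'a) quiver \<Rightarrow> ('v, 'a, 'b, 'k::field) rep \<Rightarrow> bool" where
  "projective Q P \<longleftrightarrow> is_module Q P \<and>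
     (\<forall>(M :: ('v, 'a, 'b, 'k) rep) (N :: ('v, 'a, 'b, 'k) rep). is_module Q M \<and> is_module Q N \<longrightarrow>
        (\<forall>g \<in> hom Q M N. surjective M N g \<longrightarrow>
           (\<forall>h \<in> hom Q P N. \<exists>h' \<in> hom Q P M. hom_comp g h' = h)))"

text \<open>\<open>f\<close> is an essential epimorphism from \<open>P\<close> onto its image.\<close>

definition essential :: "('v, 'a) quiver \<Rightarrow> ('v, 'a, 'b, 'k::field) rep
    \<Rightarrow> ('v \<Rightarrow> ('b \<Rightarrow> 'k) \<Rightarrow> ('c \<Rightarrow> 'k)) \<Rightarrow> bool" where
  "essential Q P f \<longleftrightarrow>
     (\<forall>U. submodule Q U P \<and> (\<forall>v. f v ` sp U v = f v ` sp P v) \<longrightarrow> U = P)"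

definition minimal_projective_presentation :: "('v, 'a) quiver
    \<Rightarrow> ('v, 'a, 'b, 'k::field) rep \<Rightarrow> ('v \<Rightarrow> ('b \<Rightarrow> 'k) \<Rightarrow> ('b \<Rightarrow> 'k))
    \<Rightarrow> ('v, 'a, 'b, 'k) rep \<Rightarrow> ('v \<Rightarrow> ('b \<Rightarrow> 'k) \<Rightarrow> ('c \<Rightarrow> 'k))
    \<Rightarrow> ('v, 'a, 'c, 'k) rep \<Rightarrow> bool" where
  "minimal_projective_presentation Q P1 f P0 g X \<longleftrightarrow>
     projective Q P1 \<and> projective Q P0 \<and> f \<in> hom Q P1 P0 \<and> g \<in> hom Q P0 X \<and>
     surjective P0 X g \<and> (\<forall>v. f v ` sp P1 v = {x \<in> sp P0 v. g v x = 0}) \<and>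
     essential Q P0 g \<and> essential Q P1 f"

text \<open>
  The functor \<open>Hom(-, A)\<close>, for \<open>A\<close> the path algebra of \<open>Q\<close>, sends a module \<open>X\<close> to the
  representation of the opposite quiver with space \<open>Hom(X, P\<^sub>i)\<close> at the vertex \<open>i\<close>.  An arrow
  \<open>a : i \<rightarrow> j\<close> of the opposite quiver acts by composition with \<open>P\<^sub>i \<rightarrow> P\<^sub>j\<close>, which
  prepends \<open>a\<close> (an arrow \<open>j \<rightarrow> i\<close> of \<open>Q\<close>) to a path.  The module \<open>T\<close> is a transpose
  of \<open>X\<close> if there is an exact sequence \<open>Hom(P0, A) \<rightarrow> Hom(P1, A) \<rightarrow> T \<rightarrow> 0\<close> of such
  representations, where \<open>P1 \<rightarrow> P0 \<rightarrow> X \<rightarrow> 0\<close> is a minimal projective presentation and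
  \<open>e\<close> below is the map to \<open>T\<close>.
\<close>

definition is_transpose :: "('v, 'a) quiver \<Rightarrow> ('v, 'a, 'b, 'k::field) rep
    \<Rightarrow> ('v, 'a, 'a list, 'k) rep \<Rightarrow> bool" where
  "is_transpose Q X T \<longleftrightarrow> is_module Q X \<and> is_module (opposite Q) T \<and>
     (\<exists>(P1 :: ('v, 'a, 'a list, 'k) rep) (P0 :: ('v, 'a, 'a list, 'k) rep) f g.
        minimal_projective_presentation Q P1 f P0 g X \<and>
        (\<exists>e :: 'v \<Rightarrow> ('v \<Rightarrow> ('a list \<Rightarrow> 'k) \<Rightarrow> ('a list \<Rightarrow> 'k)) \<Rightarrow> ('a list \<Rightarrow> 'k).
           (\<forall>i. linear_map (\<lambda>c h v x. vscale c (h v x)) vscale (hom Q P1 (proj_module Q i)) (sp T i) (e i)) \<and>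
           (\<forall>a. \<forall>h \<in> hom Q P1 (proj_module Q (tgt Q a)).
              e (src Q a) (\<lambda>v x. prepend_arrow a (h v x)) = mp T a (e (tgt Q a) h)) \<and>
           (\<forall>i. e i ` hom Q P1 (proj_module Q i) = sp T i) \<and>
           (\<forall>i. {h \<in> hom Q P1 (proj_module Q i). e i h = 0} = {hom_comp h f |h. h \<in> hom Q P0 (proj_module Q i)})))"

text \<open>The standard duality \<open>D = Hom(-, k)\<close> from modules over \<open>Q\<close> to modules over the opposite
  quiver.\<close>

definition dual :: "('v, 'a) quiver \<Rightarrow> ('v, 'a, 'b, 'k::field) rep \<Rightarrow> ('v, 'a, 'b \<Rightarrow> 'k, 'k) rep" where
  "dual Q M =
     (let S = (\<lambda>v. {\<phi>. linear_map vscale (*) (sp M v) UNIV \<phi>})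
      in \<lparr>sp = S, mp = (\<lambda>a \<phi>. if \<phi> \<in> S (tgt Q a) then \<phi> \<circ> mp M a else 0)\<rparr>)"

text \<open>\<open>\<tau>\<^sup>-\<close> is \<open>Tr D\<close>, which is determined up to isomorphism only; \<open>tau_inv\<close> chooses a
  representative.\<close>

definition tau_inv :: "('v, 'a) quiver \<Rightarrow> ('v, 'a, 'a list, 'k::field) rep \<Rightarrow> ('v, 'a, 'a list, 'k) rep" where
  "tau_inv Q M = (SOME N. is_transpose (opposite Q) (dual Q M) N)"


section \<open>Gabriel-Roiter measure\<close>

definition gr_less :: "nat set \<Rightarrow> nat set \<Rightarrow> bool" where
  "gr_less I J \<longleftrightarrow> I \<noteq> J \<and> (LEAST n. n \<in> (I - J) \<union> (J - I)) \<in> J"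

definition chain_lengths :: "('v, 'a) quiver \<Rightarrow> ('v, 'a, 'b, 'k::field) rep \<Rightarrow> nat set set" where
  "chain_lengths Q M = {mod_length Q ` set Ms |Ms. Ms \<noteq> [] \<and> sorted_wrt (proper_submodule Q) Ms \<and>
                          (\<forall>X \<in> set Ms. submodule Q X M \<and> indecomposable Q X)}"

definition gr_measure :: "('v, 'a) quiver \<Rightarrow> ('v, 'a, 'b, 'k::field) rep \<Rightarrow> nat set" where
  "gr_measure Q M = (THE I. I \<in> chain_lengths Q M \<and> (\<forall>J \<in> chain_lengths Q M. J = I \<or> gr_less J I))"

definition gr_submodule :: "('v, 'a) quiver \<Rightarrow> ('v, 'a, 'b, 'k::field) rep \<Rightarrow> ('v, 'a, 'b, 'k) rep \<Rightarrow> bool" where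
  "gr_submodule Q X M \<longleftrightarrow> indecomposable Q M \<and> indecomposable Q X \<and> proper_submodule Q X M \<and>
     gr_measure Q M = gr_measure Q X \<union> {mod_length Q M}"


section \<open>The quiver with one arrow from 1 to 2 and two arrows from 2 to 3\<close>

datatype vertex = V1 | V2 | V3

datatype arrow = A12 | A23 | B23

definition quiver_Q :: "(vertex, arrow) quiver" where
  "quiver_Q = \<lparr>src = (\<lambda>a. case a of A12 \<Rightarrow> V1 | A23 \<Rightarrow> V2 | B23 \<Rightarrow> V2),
               tgt = (\<lambda>a. case a of A12 \<Rightarrow> V2 | A23 \<Rightarrow> V3 | B23 \<Rightarrow> V3)\<rparr>"

end

theory Submission
  imports Defs
begin

text \<open>
  The functor \<open>\<tau>\<^sup>-\<close> is made explicit: for the modules \<open>A\<close> in question, a minimal projective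
  presentation of \<open>D A\<close> identifies \<open>\<tau>\<^sup>- A\<close> with the inverse Coxeter transform of \<open>A\<close> (locale \<open>cox\<close>).
  This transform is fully faithful on these modules and preserves exact sequences, so the three
  meshes \<open>P\<^sub>3 \<rightarrow> P\<^sub>2\<^sup>2 \<rightarrow> \<tau>\<^sup>- P\<^sub>3\<close>, \<open>P\<^sub>2 \<rightarrow> P\<^sub>1 \<oplus> \<tau>\<^sup>- P\<^sub>3\<^sup>2 \<rightarrow> \<tau>\<^sup>- P\<^sub>2\<close> and
  \<open>P\<^sub>1 \<rightarrow> \<tau>\<^sup>- P\<^sub>2 \<rightarrow> \<tau>\<^sup>- P\<^sub>1\<close> propagate along the preprojective component.  They are almost
  split on the right, so an indecomposable proper submodule \<open>X\<close> of \<open>M\<close> embeds into a sum of copies of the modules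
  \<open>Y\<^sub>j\<close> with irreducible maps to \<open>M\<close>.  Since these maps are injective, Gabriel's main property shows that
  the Gabriel-Roiter submodules of \<open>M\<close> are the \<open>Y\<^sub>j\<close> of largest measure.  For \<open>\<tau>\<^sup>-\<^sup>i P\<^sub>2\<close> the two candidates
  are compared by induction on \<open>i\<close>, and the larger one alternates.
\<close>

section \<open>Linear algebra\<close>

text \<open>\<open>tau_inv\<close> chooses a module that is determined up to isomorphism only. So
  nothing is computed with it directly: \<open>cox A N gm\<close> records what is used about
  \<open>N\<close>, and it holds for whichever transpose is chosen. The obstacle is that the formula
  describes \<open>\<tau>\<^sup>-\<close> only if the dual of \<open>A\<close> is generated at the
  vertex 3; \<open>kgood\<close> ensures this and passes to the transform, so the step can be
  iterated.

  Almost splitness comes from a vanishing of extensions: if there is no nonzero map from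
  \<open>N\<close> to \<open>X\<close>, then every map from \<open>X\<close> to \<open>N\<close>
  lifts along a sequence ending in \<open>N\<close>. For a proper submodule \<open>X\<close> this
  holds because \<open>N\<close> is a brick, a property that full faithfulness carries along the
  orbit.

  The two candidates in \<open>\<tau>\<^sup>-\<^sup>i P\<^sub>2\<close> have no nonzero maps between
  them, which makes the irreducible maps out of the larger one injective. At the start their
  measures extend the measure of \<open>P\<^sub>2\<close> by the lengths 4 and 5, and the smaller
  number wins. The winner enters the measure of the next
  \<open>\<tau>\<^sup>-\<^sup>i P\<^sub>3\<close>, whereas the next
  \<open>\<tau>\<^sup>-\<^sup>i P\<^sub>1\<close> is always built on the current
  \<open>\<tau>\<^sup>-\<^sup>i P\<^sub>3\<close>; this is what makes the comparison swap.\<close>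

abbreviation "subsp \<equiv> fun_vs.subspace"
abbreviation "vspan \<equiv> fun_vs.span"
abbreviation "vindep \<equiv> fun_vs.independent"
abbreviation "vdim \<equiv> fun_vs.dim"
abbreviation "findim \<equiv> finite_dimensional"
abbreviation "functional \<equiv> Vector_Spaces.linear vscale (*)"
lemmas subsp_0 = fun_vs.subspace_0 and subsp_add = fun_vs.subspace_add and subsp_scale = fun_vs.subspace_scale
  and subsp_diff = fun_vs.subspace_diff and subsp_sum = fun_vs.subspace_sum and subsp_def = fun_vs.subspace_def

section \<open>Maps that are linear on a subspace\<close>

lemma fun_pair: "vector_space_pair (vscale :: 'k::field => ('b => 'k) => ('b => 'k))
    (vscale :: 'k => ('c => 'k) => ('c => 'k))"
  by unfold_locales

lemma functional_pair: "vector_space_pair (vscale :: 'k::field => ('b => 'k) => ('b => 'k)) (*)"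
  by unfold_locales (auto simp: algebra_simps)

text \<open>Nothing is asked outside \<open>S\<close>, so restrictions, sums and composites stay
  linear without being renormalised. The convention of vanishing off the domain is restored by
  \<open>cut\<close> where \<open>hom\<close> demands it.\<close>

definition lin :: "('b => 'k::field) set => (('b => 'k) => ('c => 'k)) => bool" where
  "lin S f \<longleftrightarrow> (\<forall>x\<in>S. \<forall>y\<in>S. f (x + y) = f x + f y) & (\<forall>c. \<forall>x\<in>S. f (vscale c x) = vscale c (f x))"

lemma lin_add: "lin S f ==> x \<in> S ==> y \<in> S ==> f (x + y) = f x + f y"
  and lin_scale: "lin S f ==> x \<in> S ==> f (vscale c x) = vscale c (f x)"
  by (auto simp: lin_def)

lemma lin_0: "lin S f ==> x \<in> S ==> f 0 = 0"
  using lin_scale[of S f x 0] by simp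

lemma lin_minus: "lin S f ==> x \<in> S ==> f (- x) = - f x"
  using lin_scale[of S f x "-1"] by simp

lemma lin_diff: "lin S f ==> subsp S ==> x \<in> S ==> y \<in> S ==> f (x - y) = f x - f y"
  using lin_add[of S f x "- y"] lin_minus[of S f y] fun_vs.subspace_neg[of S y] by simp

lemma lin_sum: "lin S f ==> subsp S ==> (\<And>i. i \<in> I ==> g i \<in> S) ==>
    f (\<Sum>i\<in>I. g i) = (\<Sum>i\<in>I. f (g i))"
proof (induction I rule: infinite_finite_induct)
  case (insert i I)
  have "f (g i + sum g I) = f (g i) + f (sum g I)"
    using insert subsp_sum[of S I g] by (intro lin_add) auto
  moreover have "f (sum g I) = (\<Sum>i\<in>I. f (g i))" using insert by blast
  ultimately show ?case by (simp only: sum.insert[OF insert(1,2)])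
qed (auto simp: lin_0[OF _ subsp_0])

lemma lin_subset: "lin T f ==> S \<subseteq> T ==> lin S f"
  unfolding lin_def by blast

lemma lin_comp: "lin S f ==> f ` S \<subseteq> T ==> lin T g ==> lin S (\<lambda>x. g (f x))"
  unfolding lin_def image_subset_iff by metis

lemma linear_lin: "Vector_Spaces.linear vscale vscale f ==> lin S f"
  unfolding lin_def using vector_space_pair.linear_add[OF fun_pair] vector_space_pair.linear_scale[OF fun_pair] by blast

text \<open>A linear relation that is total on \<open>S\<close> contains the graph of a linear map:
  choose values on a basis, extend linearly, and carry the relation along linear combinations by
  \<open>add\<close> and \<open>scale\<close>. This serves wherever a map is defined by lifting or
  by choosing representatives, as the choices then add up automatically.\<close>

lemma lin_select:
  fixes R :: "('b => 'k::field) => ('c => 'k) => bool"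
  assumes S: "subsp S"
    and add: "\<And>x y x' y'. R x y ==> R x' y' ==> R (x + x') (y + y')"
    and scale: "\<And>c x y. R x y ==> R (vscale c x) (vscale c y)"
    and ex: "\<And>x. x \<in> S ==> \<exists>y. R x y"
  shows "\<exists>f. lin S f & (\<forall>x\<in>S. R x (f x))"
proof -
  obtain B where B: "B \<subseteq> S" "vindep B" "S \<subseteq> vspan B" "card B = vdim S"
    by (rule fun_vs.basis_exists[of S])
  obtain g where g: "\<And>x. x \<in> B ==> R x (g x)" using ex B(1) by (metis subsetD)
  obtain h where h: "Vector_Spaces.linear vscale vscale h" "\<And>x. x \<in> B ==> h x = g x"
    using vector_space_pair.linear_independent_extend[OF fun_pair B(2)] by blast
  obtain y0 where "R 0 y0" using ex subsp_0[OF S] by blast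
  then have R0: "R 0 0" using scale[of 0 y0 0] by simp
  have "R x (h x)" if "x \<in> vspan B" for x
    using that
  proof (induction rule: fun_vs.span_induct_alt)
    case base
    show ?case using R0 by (simp only: vector_space_pair.linear_0[OF fun_pair h(1)])
  next
    case (step c x y)
    have "R (vscale c x) (vscale c (h x))" using g h(2) scale step.hyps by force
    then have "R (vscale c x + y) (vscale c (h x) + h y)" using add step.IH by blast
    then show ?case
      by (simp only: vector_space_pair.linear_add[OF fun_pair h(1)] vector_space_pair.linear_scale[OF fun_pair h(1)])
  qed
  then show ?thesis using h(1) B(3) linear_lin by blast
qed

text \<open>Passes to a map that is linear on the whole function space, so that the library facts on
  images and spans apply.\<close>

lemma lin_total:
  assumes "subsp S" "lin S f"
  shows "\<exists>h. Vector_Spaces.linear vscale vscale h & (\<forall>x\<in>S. h x = f x)"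
proof -
  obtain B where B: "B \<subseteq> S" "vindep B" "S \<subseteq> vspan B" "card B = vdim S"
    by (rule fun_vs.basis_exists[of S])
  obtain h where h: "Vector_Spaces.linear vscale vscale h" "\<And>x. x \<in> B ==> h x = f x"
    using vector_space_pair.linear_independent_extend[OF fun_pair B(2)] by blast
  have "x \<in> S & h x = f x" if "x \<in> vspan B" for x
    using that
  proof (induction rule: fun_vs.span_induct_alt)
    case base
    then show ?case using assms subsp_0 lin_0 vector_space_pair.linear_0[OF fun_pair h(1)] by metis
  next
    case (step c x y)
    then have x: "x \<in> S" "vscale c x \<in> S" "vscale c x + y \<in> S"
      using B assms(1) subsp_scale subsp_add by blast+
    have "h (vscale c x + y) = vscale c (h x) + h y"
      by (simp only: vector_space_pair.linear_add[OF fun_pair h(1)] vector_space_pair.linear_scale[OF fun_pair h(1)])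
    also have "\<dots> = vscale c (f x) + f y" using step h(2) by simp
    also have "\<dots> = f (vscale c x + y)"
      using lin_add[OF assms(2), of "vscale c x" y] lin_scale[OF assms(2), of x c] x step by simp
    finally show ?case using x by blast
  qed
  then show ?thesis using h(1) B(3) by blast
qed

text \<open>A basis of \<open>U\<close> stays independent after adding \<open>y\<close>; take the
  coordinate at \<open>y\<close>.\<close>

lemma separating_functional:
  fixes U :: "('b => 'k::field) set"
  assumes U: "subsp U" and y: "y \<notin> U"
  shows "\<exists>\<xi>. functional \<xi> & (\<forall>x\<in>U. \<xi> x = 0) & \<xi> y = (1::'k)"
proof -
  obtain B where B: "B \<subseteq> U" "vindep B" "U \<subseteq> vspan B" "card B = vdim U"
    by (rule fun_vs.basis_exists[of U])
  have span: "vspan B = U" using B U by (metis fun_vs.span_subspace)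
  have "vindep (insert y B)" using B y span by (simp add: fun_vs.independent_insertI)
  then obtain \<xi> where \<xi>: "functional \<xi>"
      "\<And>x. x \<in> insert y B ==> \<xi> x = (if x = y then 1 else 0 :: 'k)"
    using vector_space_pair.linear_independent_extend[OF functional_pair, of "insert y B" "\<lambda>x. if x = y then 1 else 0"] by blast
  have "\<xi> x = 0" if "x \<in> U" for x
  proof -
    have "y \<notin> B" using y B(1) by blast
    then have "\<And>b. b \<in> B ==> \<xi> b = 0" using \<xi>(2) by auto
    then show ?thesis
      using vector_space_pair.linear_eq_0_on_span[OF functional_pair \<xi>(1)] that span by blast
  qed
  then show ?thesis using \<xi> by auto
qed

lemma functional_nonzero:
  fixes y :: "'b => 'k::field"
  assumes "\<And>\<xi>. functional \<xi> ==> \<xi> y = (0::'k)"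
  shows "y = 0"
proof (rule ccontr)
  assume "y ~= 0"
  then obtain \<xi> where "functional \<xi>" "\<xi> y = (1::'k)"
    using separating_functional[of "{0}" y] fun_vs.subspace_single_0 by blast
  then show False using assms[of \<xi>] by simp
qed

section \<open>Finite-dimensional spaces and dimension\<close>

lemma fd_subspace: "findim S ==> subsp S"
  unfolding finite_dimensional_def using fun_vs.subspace_span by blast

lemma fd_subset:
  assumes "findim T" "subsp S" "S \<subseteq> T"
  shows "findim S"
proof -
  obtain C where C: "finite C" "vspan C = T" using assms(1) by (auto simp: finite_dimensional_def)
  obtain B where B: "B \<subseteq> S" "vindep B" "S \<subseteq> vspan B" "card B = vdim S"
    by (rule fun_vs.basis_exists[of S])
  have "finite B" using fun_vs.independent_span_bound[OF C(1) B(2)] B C assms(3) by blast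
  moreover have "vspan B = S" using B assms by (metis fun_vs.span_subspace)
  ultimately show ?thesis by (auto simp: finite_dimensional_def)
qed

lemma fd_basis_extend:
  assumes "findim S" "vindep A" "A \<subseteq> S"
  shows "\<exists>B. A \<subseteq> B & finite B & vindep B & vspan B = S & card B = vdim S"
proof -
  obtain C where C: "finite C" "vspan C = S" using assms(1) by (auto simp: finite_dimensional_def)
  obtain B where B: "A \<subseteq> B" "B \<subseteq> S" "vindep B" "S \<subseteq> vspan B"
    by (rule fun_vs.maximal_independent_subset_extend[OF assms(3,2)])
  have "finite B" using fun_vs.independent_span_bound[OF C(1) B(3)] B C assms(3) by blast
  moreover have "vspan B = S" using B assms fd_subspace by (metis fun_vs.span_subspace)
  moreover have "card B = vdim S" using B fun_vs.basis_card_eq_dim by blast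
  ultimately show ?thesis using B by blast
qed

lemma fd_basis:
  assumes "findim S"
  shows "\<exists>B. finite B & vindep B & vspan B = S & card B = vdim S"
  using fd_basis_extend[OF assms fun_vs.independent_empty] by blast

lemma fd_dim_mono:
  assumes "findim T" "S \<subseteq> T"
  shows "vdim S \<le> vdim T"
proof -
  obtain B where B: "finite B" "vspan B = T" "card B = vdim T" using fd_basis[OF assms(1)] by blast
  then show ?thesis using fun_vs.dim_le_card[of S B] assms by simp
qed

lemma fd_dim_eq:
  assumes "findim T" "subsp S" "S \<subseteq> T" "vdim T \<le> vdim S"
  shows "S = T"
proof -
  obtain A where A: "finite A" "vindep A" "vspan A = S" "card A = vdim S"
    using fd_basis[OF fd_subset[OF assms(1-3)]] by blast
  have "A \<subseteq> T" using A(3) assms(3) fun_vs.span_superset by blast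
  then obtain B where B: "A \<subseteq> B" "finite B" "vspan B = T" "card B = vdim T"
    using fd_basis_extend[OF assms(1) A(2)] by blast
  then have "A = B" using A assms(4) card_seteq[of B A] by simp
  then show ?thesis using A B by simp
qed

lemma dim_zero [simp]: "vdim {0 :: 'b => 'k::field} = 0"
  using fun_vs.dim_unique[of "{}" "{0}" 0] fun_vs.independent_empty by simp

lemma fd_zero [simp]: "findim {0}"
  unfolding finite_dimensional_def by (rule exI[of _ "{}"]) simp

lemma fd_dim_0: "findim S ==> vdim S = 0 \<longleftrightarrow> S = {0}"
  using fd_dim_eq[of S "{0}"] fd_subspace[of S] subsp_0[of S] by auto

lemma fd_codim1:
  assumes "findim S" "S ~= {0}"
  shows "\<exists>T. subsp T & T \<subseteq> S & Suc (vdim T) = vdim S"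
proof -
  obtain B where B: "finite B" "vindep B" "vspan B = S" "card B = vdim S"
    using fd_basis[OF assms(1)] by blast
  have "B ~= {}" using B assms by auto
  then obtain x where x: "x \<in> B" by blast
  have ind: "vindep (B - {x})" using B(2) by (metis Diff_subset fun_vs.independent_mono)
  have "vdim (vspan (B - {x})) = card (B - {x})"
    using ind by (simp add: fun_vs.dim_eq_card_independent)
  then have "Suc (vdim (vspan (B - {x}))) = vdim S"
    using B x by (metis card_Suc_Diff1)
  moreover have "vspan (B - {x}) \<subseteq> S" using B by (metis Diff_subset fun_vs.span_mono)
  ultimately show ?thesis by blast
qed

section \<open>Images, kernels and the rank formula\<close>

lemma lin_image_subspace:
  assumes "subsp S" "lin S f" shows "subsp (f ` S)"
proof -
  obtain h where h: "Vector_Spaces.linear vscale vscale h" "\<forall>x\<in>S. h x = f x" using lin_total[OF assms] by blast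
  then have "f ` S = h ` S" by auto
  then show ?thesis using vector_space_pair.linear_subspace_image[OF fun_pair h(1) assms(1)] by simp
qed

lemma lin_kernel_subspace:
  assumes "subsp S" "lin S f" shows "subsp {x \<in> S. f x = 0}"
  using assms lin_0[OF assms(2)] unfolding subsp_def lin_def by auto

lemma lin_image_fd:
  assumes "findim S" "lin S f" shows "findim (f ` S)"
proof -
  obtain h where h: "Vector_Spaces.linear vscale vscale h" "\<forall>x\<in>S. h x = f x"
    using lin_total[OF fd_subspace[OF assms(1)] assms(2)] by blast
  obtain B where B: "finite B" "vspan B = S" using assms by (auto simp: finite_dimensional_def)
  have "f ` S = h ` S" using h by auto
  then have "vspan (h ` B) = f ` S" using vector_space_pair.linear_span_image[OF fun_pair h(1), of B] B by simp
  then show ?thesis using B unfolding finite_dimensional_def by blast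
qed

theorem rank_nullity:
  assumes S: "findim S" and f: "lin S f"
  shows "vdim S = vdim {x \<in> S. f x = 0} + vdim (f ` S)"
proof -
  let ?K = "{x \<in> S. f x = 0}"
  have sS: "subsp S" by (rule fd_subspace[OF S])
  have fdK: "findim ?K"
    by (rule fd_subset[OF S lin_kernel_subspace[OF sS f]]) blast
  obtain A where A: "finite A" "vindep A" "vspan A = ?K" "card A = vdim ?K"
    using fd_basis[OF fdK] by blast
  have "A \<subseteq> S" using A(3) fun_vs.span_superset[of A] by auto
  then obtain B where B: "A \<subseteq> B" "finite B" "vindep B" "vspan B = S" "card B = vdim S"
    using fd_basis_extend[OF S A(2)] by blast
  obtain h where h: "Vector_Spaces.linear vscale vscale h" "\<forall>x\<in>S. h x = f x" using lin_total[OF sS f] by blast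
  let ?C = "B - A"
  \<comment> \<open>\<open>g\<close> kills the span of \<open>A\<close> and fixes the span of
    \<open>?C\<close>, so a vector in both spans is zero; this gives injectivity of \<open>h\<close>
    on the complement of the kernel.\<close>
  obtain g where g: "Vector_Spaces.linear vscale vscale g" "\<And>x. x \<in> B ==> g x = (if x \<in> A then 0 else x)"
    using vector_space_pair.linear_independent_extend[OF fun_pair B(3), of "\<lambda>x. if x \<in> A then 0 else x"] by blast
  have gA: "g x = 0" if "x \<in> vspan A" for x
    by (rule vector_space_pair.linear_eq_0_on_span[OF fun_pair g(1) _ that]) (use g(2) B(1) in auto)
  have gC: "g x = x" if "x \<in> vspan ?C" for x
    by (rule vector_space_pair.linear_eq_on[OF fun_pair g(1) fun_vs.linear_ident that]) (use g(2) in auto)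
  have CS: "vspan ?C \<subseteq> S" using B(4) by (metis Diff_subset fun_vs.span_mono)
  have inj: "inj_on h (vspan ?C)"
  proof (rule inj_onI)
    fix x y assume xy: "x \<in> vspan ?C" "y \<in> vspan ?C" "h x = h y"
    have d: "x - y \<in> vspan ?C" using xy fun_vs.span_diff by blast
    have "h (x - y) = 0" using xy by (simp add: vector_space_pair.linear_diff[OF fun_pair h(1)])
    then have "x - y \<in> ?K" using d CS h(2) by auto
    then have "x - y = 0" using gA gC d A(3) by metis
    then show "x = y" by simp
  qed
  have indC: "vindep ?C" using B(3) by (metis Diff_subset fun_vs.independent_mono)
  have ind: "vindep (h ` ?C)"
    by (rule vector_space_pair.linear_independent_injective_image[OF fun_pair h(1) indC inj])
  have cardC: "card (h ` ?C) = card ?C"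
    by (rule card_image) (use inj fun_vs.span_superset in \<open>metis inj_on_subset\<close>)
  have "f ` S = h ` S" using h by auto
  also have "\<dots> = vspan (h ` B)" using vector_space_pair.linear_span_image[OF fun_pair h(1), of B] B by simp
  also have "\<dots> = vspan (h ` ?C)"
  proof (rule antisym)
    have hA: "h x = 0" if "x \<in> A" for x
    proof -
      have "x \<in> ?K" using that A(3) fun_vs.span_superset by blast
      then show ?thesis using h(2) by auto
    qed
    have "h ` B \<subseteq> vspan (h ` ?C)"
    proof
      fix y assume "y \<in> h ` B"
      then obtain x where x: "x \<in> B" "y = h x" by blast
      show "y \<in> vspan (h ` ?C)"
        by (cases "x \<in> A") (use x hA fun_vs.span_zero fun_vs.span_base[of y "h ` ?C"] in auto)
    qed
    then show "vspan (h ` B) \<subseteq> vspan (h ` ?C)" by (simp add: fun_vs.span_minimal)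
    show "vspan (h ` ?C) \<subseteq> vspan (h ` B)" by (rule fun_vs.span_mono) auto
  qed
  finally have "vdim (f ` S) = card ?C"
    using ind cardC by (simp add: fun_vs.dim_eq_card_independent)
  then show ?thesis using A B card_mono[OF B(2,1)] by (simp add: card_Diff_subset)
qed

lemma dim_inj_image:
  assumes S: "findim S" and f: "lin S f" and inj: "\<And>x. x \<in> S ==> f x = 0 ==> x = 0"
  shows "vdim (f ` S) = vdim S"
proof -
  have "{x \<in> S. f x = 0} = {0}"
    using inj lin_0[OF f] subsp_0[OF fd_subspace[OF S]] by auto
  then show ?thesis using rank_nullity[OF S f] by simp
qed

lemma dim_image_le: "findim S ==> lin S f ==> vdim (f ` S) \<le> vdim S"
  using rank_nullity[of S f] by simp

subsection \<open>Pairs of vectors\<close>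

text \<open>The tag keeps the direct sum of two function spaces inside a function space, so that
  dimension and rank theory apply to it unchanged.\<close>

definition vpair :: "('b => 'k) => ('b => 'k) => (bool \<times> 'b => 'k)" where
  "vpair x y = (\<lambda>(t, b). if t then x b else y b)"

definition vfst :: "(bool \<times> 'b => 'k) => ('b => 'k)" where "vfst z = (\<lambda>b. z (True, b))"
definition vsnd :: "(bool \<times> 'b => 'k) => ('b => 'k)" where "vsnd z = (\<lambda>b. z (False, b))"

lemma vpair_sel [simp]: "vfst (vpair x y) = x" "vsnd (vpair x y) = y" "vpair (vfst z) (vsnd z) = z"
  by (auto simp: vpair_def vfst_def vsnd_def fun_eq_iff)

lemma vpair_inject [simp]: "vpair x y = vpair x' y' \<longleftrightarrow> x = x' & y = y'"
  by (metis vpair_sel(1,2))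

lemma vpair_linear:
  "vpair (x + x') (y + y') = vpair x y + vpair x' y'"
  "vpair (vscale c x) (vscale c y) = vscale c (vpair x y)"
  "vpair 0 0 = (0 :: _ => 'k::field)"
  by (auto simp: vpair_def vscale_def fun_eq_iff)

lemma vfst_linear [simp]: "vfst (z + z') = vfst z + vfst z'" "vfst (vscale c z) = vscale c (vfst z)" "vfst 0 = 0"
  and vsnd_linear [simp]: "vsnd (z + z') = vsnd z + vsnd z'" "vsnd (vscale c z) = vscale c (vsnd z)" "vsnd 0 = 0"
  by (auto simp: vfst_def vsnd_def vscale_def fun_eq_iff)

definition vprod :: "('b => 'k) set => ('b => 'k) set => (bool \<times> 'b => 'k) set" where
  "vprod S T = {vpair x y |x y. x \<in> S & y \<in> T}"

lemma vprod_iff: "z \<in> vprod S T \<longleftrightarrow> vfst z \<in> S & vsnd z \<in> T"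
  unfolding vprod_def by (auto, metis vpair_sel(3))

lemma vprod_subspace: "subsp S ==> subsp T ==> subsp (vprod S T)"
  by (auto simp: subsp_def vprod_iff)

lemma vprod_fd:
  assumes "findim S" "findim T"
  shows "findim (vprod S T)"
proof -
  obtain A B where A: "finite A" "vspan A = S" and B: "finite B" "vspan B = T"
    using assms by (auto simp: finite_dimensional_def)
  let ?f = "\<lambda>x. vpair x 0" and ?g = "\<lambda>y. vpair 0 y"
  let ?C = "?f ` A \<union> ?g ` B"
  have lf: "Vector_Spaces.linear vscale vscale ?f" "Vector_Spaces.linear vscale vscale ?g"
    by (auto simp: Vector_Spaces.linear_iff fun_vs.vector_space_axioms vpair_def vscale_def fun_eq_iff)
  have "vspan ?C = {x + y |x y. x \<in> ?f ` S & y \<in> ?g ` T}"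
    using vector_space_pair.linear_span_image[OF fun_pair lf(1), of A] vector_space_pair.linear_span_image[OF fun_pair lf(2), of B] A B
    by (simp add: fun_vs.span_Un)
  also have "\<dots> = vprod S T"
  proof -
    have *: "vpair x y = vpair x 0 + vpair 0 y" for x y :: "'a => 'b"
      by (auto simp: vpair_def fun_eq_iff)
    show ?thesis
    proof (intro set_eqI iffI)
      fix z assume "z \<in> vprod S T"
      then show "z \<in> {x + y |x y. x \<in> ?f ` S & y \<in> ?g ` T}"
        using *[of "vfst z" "vsnd z"] by (auto simp: vprod_iff)
    next
      fix z assume "z \<in> {x + y |x y. x \<in> ?f ` S & y \<in> ?g ` T}"
      then obtain x y where "x \<in> S" "y \<in> T" "z = ?f x + ?g y" by auto
      then show "z \<in> vprod S T" using *[of x y] by (simp add: vprod_iff)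
    qed
  qed
  finally have "vspan ?C = vprod S T" .
  then show ?thesis using A(1) B(1) unfolding finite_dimensional_def by (intro exI[of _ ?C]) simp
qed

text \<open>Rank formula for the first projection, whose kernel is a copy of
  \<open>T\<close>.\<close>

lemma vprod_dim:
  assumes "findim S" "findim T"
  shows "vdim (vprod S T) = vdim S + vdim T"
proof -
  have sub: "subsp S" "subsp T" using assms fd_subspace by auto
  have l: "lin (vprod S T) vfst" by (simp add: lin_def)
  have "vfst ` vprod S T = S"
  proof
    show "S \<subseteq> vfst ` vprod S T"
    proof
      fix x assume "x \<in> S"
      then have "vpair x 0 \<in> vprod S T" using subsp_0[OF sub(2)] by (simp add: vprod_iff)
      then show "x \<in> vfst ` vprod S T" by (metis imageI vpair_sel(1))
    qed
  qed (auto simp: vprod_iff)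
  moreover have "vdim {z \<in> vprod S T. vfst z = 0} = vdim T"
  proof -
    have l2: "lin {z \<in> vprod S T. vfst z = 0} vsnd" by (simp add: lin_def)
    have "vsnd ` {z \<in> vprod S T. vfst z = 0} = T"
    proof
      show "T \<subseteq> vsnd ` {z \<in> vprod S T. vfst z = 0}"
      proof
        fix y assume "y \<in> T"
        then have "vpair 0 y \<in> {z \<in> vprod S T. vfst z = 0}" using subsp_0[OF sub(1)] by (simp add: vprod_iff)
        then show "y \<in> vsnd ` {z \<in> vprod S T. vfst z = 0}" using image_eqI[of y vsnd "vpair 0 y"] by simp
      qed
    qed (auto simp: vprod_iff)
    moreover have "findim {z \<in> vprod S T. vfst z = 0}"
      by (rule fd_subset[OF vprod_fd[OF assms] lin_kernel_subspace[OF vprod_subspace[OF sub] l]]) blast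
    moreover have "z = 0" if "z \<in> {z \<in> vprod S T. vfst z = 0}" "vsnd z = 0" for z
      using that vpair_sel(3)[of z] by (simp add: vpair_linear)
    ultimately show ?thesis using dim_inj_image[OF _ l2] by simp
  qed
  ultimately show ?thesis using rank_nullity[OF vprod_fd[OF assms] l] by simp
qed

subsection \<open>Nondegenerate forms\<close>

text \<open>The coordinate dot product of a basis. With symmetry, the last clause makes it a perfect
  pairing; later it replaces the dual of the space of \<open>A\<close> at the vertex 3 by that space
  itself.\<close>

lemma form_exists:
  fixes S :: "('b => 'k::field) set"
  assumes S: "findim S"
  shows "\<exists>\<beta> :: ('b => 'k) => ('b => 'k) => 'k.
    (\<forall>x\<in>S. \<forall>y\<in>S. \<forall>z\<in>S. \<beta> (x + y) z = \<beta> x z + \<beta> y z) &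
    (\<forall>c. \<forall>x\<in>S. \<forall>z\<in>S. \<beta> (vscale c x) z = c * \<beta> x z) &
    (\<forall>x\<in>S. \<forall>y\<in>S. \<beta> x y = \<beta> y x) &
    (\<forall>\<phi>. (\<forall>x\<in>S. \<forall>y\<in>S. \<phi> (x + y) = \<phi> x + \<phi> y) & (\<forall>c. \<forall>x\<in>S. \<phi> (vscale c x) = c * \<phi> x) -->
       (\<exists>w\<in>S. \<forall>x\<in>S. \<phi> x = \<beta> w x))"
proof -
  obtain B where B: "finite B" "vindep B" "vspan B = S" using fd_basis[OF S] by blast
  let ?r = "fun_vs.representation B"
  let ?\<beta> = "\<lambda>x y. \<Sum>b\<in>B. ?r x b * ?r y b"
  have BS: "B \<subseteq> S" using B(3) fun_vs.span_superset by blast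
  have "\<exists>w\<in>S. \<forall>x\<in>S. \<phi> x = ?\<beta> w x" if \<phi>: "\<forall>x\<in>S. \<forall>y\<in>S. \<phi> (x + y) = \<phi> x + \<phi> y"
      "\<forall>c. \<forall>x\<in>S. \<phi> (vscale c x) = c * \<phi> x" for \<phi> :: "('b => 'k) => 'k"
  proof
    let ?w = "\<Sum>b\<in>B. vscale (\<phi> b) b"
    show wS: "?w \<in> S" using B(3) BS fun_vs.subspace_span
      by (metis (no_types, lifting) fun_vs.span_base fun_vs.span_scale fun_vs.span_sum)
    have rw: "?r ?w b = \<phi> b" if "b \<in> B" for b
    proof -
      have "?r ?w = (\<lambda>b. if b \<in> B then \<phi> b else 0)"
        using B wS by (intro fun_vs.representation_eqI) (auto split: if_splits intro: sum.mono_neutral_cong_left)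
      then show ?thesis using that by simp
    qed
    show "\<forall>x\<in>S. \<phi> x = ?\<beta> ?w x"
    proof
      fix x assume x: "x \<in> S"
      have sub: "subsp S" using S fd_subspace by blast
      have ph0: "\<phi> 0 = 0" using \<phi>(2) subsp_0[OF sub] by (metis mult_zero_left fun_vs.scale_zero_left)
      have sum: "\<phi> (\<Sum>b\<in>C. vscale (u b) b) = (\<Sum>b\<in>C. u b * \<phi> b)" if "C \<subseteq> B" "finite C" for C u
        using that(2,1)
      proof (induction C rule: finite_induct)
        case (insert b C)
        have m: "b \<in> S" "vscale (u b) b \<in> S"
          using insert BS by (auto intro: subsp_scale[OF sub])
        have "(\<Sum>b\<in>C. vscale (u b) b) \<in> S" using insert BS by (intro subsp_sum[OF sub] subsp_scale[OF sub]) auto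
        then have "\<phi> (vscale (u b) b + (\<Sum>b\<in>C. vscale (u b) b)) = u b * \<phi> b + (\<Sum>b\<in>C. u b * \<phi> b)"
          using insert m \<phi> by simp
        then show ?case using insert by (simp only: sum.insert[OF insert(1,2)])
      qed (simp add: ph0)
      have "x = (\<Sum>b\<in>B. vscale (?r x b) b)"
        using fun_vs.sum_representation_eq[OF B(2) _ B(1) order_refl, of x] x B(3) by simp
      then have "\<phi> x = (\<Sum>b\<in>B. ?r x b * \<phi> b)" using sum[OF order_refl B(1)] by metis
      also have "\<dots> = ?\<beta> ?w x" by (intro sum.cong) (auto simp: rw)
      finally show "\<phi> x = ?\<beta> ?w x" .
    qed
  qed
  moreover have "?r (x + y) b = ?r x b + ?r y b" "?r (vscale c x) b = c * ?r x b" if "x \<in> S" "y \<in> S" for x y c b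
    using that B by (simp_all add: fun_vs.representation_add fun_vs.representation_scale)
  ultimately show ?thesis
    by (intro exI[of _ ?\<beta>]) (auto simp: sum.distrib algebra_simps sum_distrib_left)
qed

section \<open>Representations of quivers\<close>

type_synonym ('b, 'k) qrep = "(vertex, arrow, 'b, 'k) rep"

abbreviation "ma M \<equiv> mp M A12"
abbreviation "mb M \<equiv> mp M A23"
abbreviation "mc M \<equiv> mp M B23"

lemma quiver_Q_sel [simp]:
  "src quiver_Q A12 = V1" "src quiver_Q A23 = V2" "src quiver_Q B23 = V2"
  "tgt quiver_Q A12 = V2" "tgt quiver_Q A23 = V3" "tgt quiver_Q B23 = V3"
  by (auto simp: quiver_Q_def)

lemma opposite_sel [simp]: "src (opposite G) = tgt G" "tgt (opposite G) = src G"
  by (auto simp: opposite_def)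

lemma all_vertex: "(\<forall>v. P v) \<longleftrightarrow> P V1 & P V2 & P V3"
  by (metis vertex.exhaust)

lemma all_arrow: "(\<forall>a. P a) \<longleftrightarrow> P A12 & P A23 & P B23"
  by (metis arrow.exhaust)

lemma module_subspace: "is_module G M ==> subsp (sp M v)"
  and module_fd: "is_module G M ==> findim (sp M v)"
  and module_mp: "is_module G M ==> x \<in> sp M (src G a) ==> mp M a x \<in> sp M (tgt G a)"
  and module_outside: "is_module G M ==> x \<notin> sp M (src G a) ==> mp M a x = 0"
  by (auto simp: is_module_def linear_map_def)

lemmas module_add = subsp_add[OF module_subspace] and module_scale = subsp_scale[OF module_subspace]
  and module_diff = subsp_diff[OF module_subspace]

lemma module_lin: "is_module G M ==> lin (sp M (src G a)) (mp M a)"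
  by (auto simp: is_module_def linear_map_def lin_def)

lemma module_0: "is_module G M ==> 0 \<in> sp M v"
  by (rule subsp_0[OF module_subspace])

lemma module_mp_0: "is_module G M ==> mp M a 0 = 0"
  using lin_0[OF module_lin module_0] by metis

lemma is_moduleI:
  assumes "\<And>v. findim (sp M v)"
    and "\<And>a. lin (sp M (src G a)) (mp M a)"
    and "\<And>a x. x \<in> sp M (src G a) ==> mp M a x \<in> sp M (tgt G a)"
    and "\<And>a x. x \<notin> sp M (src G a) ==> mp M a x = 0"
  shows "is_module G M"
  using assms fd_subspace[OF assms(1)] unfolding is_module_def linear_map_def lin_def by blast

definition restr :: "('v, 'a) quiver => ('v, 'a, 'b, 'k::field) rep => ('v => ('b => 'k) set) => ('v, 'a, 'b, 'k) rep" where
  "restr G M S = \<lparr>sp = S, mp = (\<lambda>a x. if x \<in> S (src G a) then mp M a x else 0)\<rparr>"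

lemma sp_restr [simp]: "sp (restr G M S) = S" by (simp add: restr_def)

lemma restr_submodule:
  assumes M: "is_module G M" and S: "\<And>v. subsp (S v)" "\<And>v. S v \<subseteq> sp M v"
    and cl: "\<And>a x. x \<in> S (src G a) ==> mp M a x \<in> S (tgt G a)"
  shows "submodule G (restr G M S) M"
proof -
  have "is_module G (restr G M S)"
  proof (rule is_moduleI)
    show "lin (sp (restr G M S) (src G a)) (mp (restr G M S) a)" for a
      using lin_subset[OF module_lin[OF M] S(2)[of "src G a"]] subsp_add[OF S(1)] subsp_scale[OF S(1)]
      by (auto simp: lin_def restr_def)
  qed (use fd_subset[OF module_fd[OF M] S] cl in \<open>auto simp: restr_def\<close>)
  then show ?thesis using M S(2) by (simp add: submodule_def restr_def)
qed

lemma submodule_module: "submodule G X M ==> is_module G X" "submodule G X M ==> is_module G M"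
  and submodule_sp: "submodule G X M ==> x \<in> sp X v ==> x \<in> sp M v"
  and submodule_mp: "submodule G X M ==> x \<in> sp X (src G a) ==> mp X a x = mp M a x"
  by (auto simp: submodule_def)

lemma submodule_refl: "is_module G M ==> submodule G M M"
  by (simp add: submodule_def)

lemma submodule_trans: "submodule G X Y ==> submodule G Y M ==> submodule G X M"
  unfolding submodule_def subset_iff by simp

lemma rep_eqI: "sp (M :: ('v, 'a, 'b, 'k) rep) = sp N ==> mp M = mp N ==> M = N"
  by simp

lemma submodule_eqI:
  assumes "submodule G X M" "submodule G Y M" "\<And>v. sp X v = sp Y v"
  shows "X = Y"
proof (rule rep_eqI)
  show sp: "sp X = sp Y" using assms(3) by blast
  show "mp X = mp Y"
  proof (rule ext, rule ext)
    fix a x show "mp X a x = mp Y a x"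
    proof (cases "x \<in> sp X (src G a)")
      case True
      then show ?thesis using submodule_mp[OF assms(1)] submodule_mp[OF assms(2)] sp by simp
    next
      case False
      then show ?thesis using module_outside[OF submodule_module(1)[OF assms(1)]]
          module_outside[OF submodule_module(1)[OF assms(2)]] sp by simp
    qed
  qed
qed

lemma submodule_subset:
  assumes "submodule G X M" "submodule G Y M" "\<And>v. sp X v \<subseteq> sp Y v"
  shows "submodule G X Y"
  using assms unfolding submodule_def by (metis subsetD)

subsection \<open>Linear maps commuting with the arrows\<close>

text \<open>Unlike the elements of \<open>hom\<close>, these need not vanish outside the spaces of the module.\<close>

definition qhom :: "('v, 'a) quiver => ('v, 'a, 'b, 'k::field) rep => ('v, 'a, 'c, 'k) rep
    => ('v => ('b => 'k) => ('c => 'k)) => bool" where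
  "qhom G M N f \<longleftrightarrow> (\<forall>v. lin (sp M v) (f v)) & (\<forall>v. \<forall>x\<in>sp M v. f v x \<in> sp N v) &
     (\<forall>a. \<forall>x\<in>sp M (src G a). f (tgt G a) (mp M a x) = mp N a (f (src G a) x))"

definition qinj :: "('v, 'a, 'b, 'k::field) rep => ('v => ('b => 'k) => ('c => 'k)) => bool" where
  "qinj M f \<longleftrightarrow> (\<forall>v. \<forall>x\<in>sp M v. f v x = 0 --> x = 0)"

definition qzero :: "('v, 'a, 'b, 'k::field) rep => ('v => ('b => 'k) => ('c => 'k)) => bool" where
  "qzero M f \<longleftrightarrow> (\<forall>v. \<forall>x\<in>sp M v. f v x = 0)"

lemma qhom_lin: "qhom G M N f ==> lin (sp M v) (f v)"
  and qhom_sp: "qhom G M N f ==> x \<in> sp M v ==> f v x \<in> sp N v"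
  and qhom_mp: "qhom G M N f ==> x \<in> sp M (src G a) ==> f (tgt G a) (mp M a x) = mp N a (f (src G a) x)"
  by (auto simp: qhom_def)

lemmas qhom_plus = lin_add[OF qhom_lin] and qhom_scale = lin_scale[OF qhom_lin] and qhom_minus = lin_diff[OF qhom_lin]

lemma qhom_0: "qhom G M N f ==> is_module G M ==> f v 0 = 0"
  using lin_0[OF qhom_lin module_0] by metis

lemma qinjD: "qinj M f ==> x \<in> sp M v ==> f v x = 0 ==> x = 0"
  by (auto simp: qinj_def)

lemma qinj_eq:
  assumes "qinj M f" "qhom G M N f" "is_module G M" "x \<in> sp M v" "y \<in> sp M v" "f v x = f v y"
  shows "x = y"
proof -
  have "f v (x - y) = 0"
    using qhom_minus[OF assms(2) module_subspace[OF assms(3)] assms(4,5)] assms(6) by simp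
  then have "x - y = 0"
    using qinjD[OF assms(1)] module_diff[OF assms(3) assms(4,5)] by blast
  then show ?thesis by simp
qed

lemma qhom_comp:
  assumes "qhom G M N f" "qhom G N L g"
  shows "qhom G M L (\<lambda>v x. g v (f v x))"
  unfolding qhom_def
  using lin_comp[OF qhom_lin[OF assms(1)] _ qhom_lin[OF assms(2)]] qhom_sp[OF assms(1)] qhom_sp[OF assms(2)]
    qhom_mp[OF assms(1)] qhom_mp[OF assms(2)] by (auto simp: image_subset_iff)

lemma qhom_restrict:
  assumes "submodule G X M" "qhom G M N f"
  shows "qhom G X N f"
  unfolding qhom_def
  using lin_subset[OF qhom_lin[OF assms(2)]] qhom_sp[OF assms(2)] qhom_mp[OF assms(2)]
    submodule_sp[OF assms(1)] submodule_mp[OF assms(1)] by (metis subsetI)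

lemma qhom_corestrict:
  assumes "submodule G Y N" "qhom G M N f" "\<And>v x. x \<in> sp M v ==> f v x \<in> sp Y v"
  shows "qhom G M Y f"
  unfolding qhom_def
  using qhom_lin[OF assms(2)] assms(3) qhom_mp[OF assms(2)] submodule_mp[OF assms(1)] by metis

lemma qhom_extend_cod:
  assumes "submodule G Y N" "qhom G M Y f"
  shows "qhom G M N f"
  unfolding qhom_def
  using qhom_lin[OF assms(2)] qhom_sp[OF assms(2)] submodule_sp[OF assms(1)] qhom_mp[OF assms(2)] submodule_mp[OF assms(1)]
  by metis

lemma qhom_inclusion: "submodule G X M ==> qhom G X M (\<lambda>v x. x)"
  unfolding qhom_def by (simp add: submodule_def subset_iff lin_def)

lemma qhom_add:
  assumes "is_module G N" "qhom G M N f" "qhom G M N g"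
  shows "qhom G M N (\<lambda>v x. f v x + g v x)"
  unfolding qhom_def
proof (intro conjI allI ballI)
  show "lin (sp M v) (\<lambda>x. f v x + g v x)" for v
    unfolding lin_def
    using qhom_plus[OF assms(2)] qhom_plus[OF assms(3)]
      qhom_scale[OF assms(2)] qhom_scale[OF assms(3)]
    by (simp add: add_ac fun_vs.scale_right_distrib)
  show "f v x + g v x \<in> sp N v" if "x \<in> sp M v" for v x
    using that qhom_sp[OF assms(2)] qhom_sp[OF assms(3)] module_add[OF assms(1)] by blast
  show "f (tgt G a) (mp M a x) + g (tgt G a) (mp M a x) = mp N a (f (src G a) x + g (src G a) x)"
    if "x \<in> sp M (src G a)" for a x
    using that qhom_mp[OF assms(2)] qhom_mp[OF assms(3)] qhom_sp[OF assms(2)] qhom_sp[OF assms(3)]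
      lin_add[OF module_lin[OF assms(1)]] by simp
qed

section \<open>Images and kernels of homomorphisms\<close>

definition qimage :: "('v, 'a) quiver => ('v, 'a, 'b, 'k::field) rep => ('v, 'a, 'c, 'k) rep
    => ('v => ('b => 'k) => ('c => 'k)) => ('v, 'a, 'c, 'k) rep" where
  "qimage G M N f = restr G N (\<lambda>v. f v ` sp M v)"

lemma sp_qimage [simp]: "sp (qimage G M N f) v = f v ` sp M v"
  by (simp add: qimage_def)

lemma qimage_submodule:
  assumes "is_module G M" "is_module G N" "qhom G M N f"
  shows "submodule G (qimage G M N f) N"
  unfolding qimage_def
proof (rule restr_submodule[OF assms(2)])
  show "subsp (f v ` sp M v)" for v
    by (rule lin_image_subspace[OF module_subspace[OF assms(1)] qhom_lin[OF assms(3)]])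
  show "f v ` sp M v \<subseteq> sp N v" for v using qhom_sp[OF assms(3)] by blast
  show "mp N a x \<in> f (tgt G a) ` sp M (tgt G a)" if "x \<in> f (src G a) ` sp M (src G a)" for a x
  proof -
    obtain y where "y \<in> sp M (src G a)" "x = f (src G a) y" using \<open>x \<in> _\<close> by blast
    then show ?thesis using qhom_mp[OF assms(3), of y a] module_mp[OF assms(1), of y a] by (auto intro: rev_image_eqI)
  qed
qed

definition qkernel :: "('v, 'a) quiver => ('v, 'a, 'b, 'k::field) rep
    => ('v => ('b => 'k) => ('c => 'k)) => ('v, 'a, 'b, 'k) rep" where
  "qkernel G M f = restr G M (\<lambda>v. {x \<in> sp M v. f v x = 0})"

lemma sp_qkernel [simp]: "sp (qkernel G M f) v = {x \<in> sp M v. f v x = 0}"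
  by (simp add: qkernel_def)

lemma qkernel_submodule:
  assumes "is_module G M" "is_module G N" "qhom G M N f"
  shows "submodule G (qkernel G M f) M"
  unfolding qkernel_def
proof (rule restr_submodule[OF assms(1)])
  show "subsp {x \<in> sp M v. f v x = 0}" for v
    by (rule lin_kernel_subspace[OF module_subspace[OF assms(1)] qhom_lin[OF assms(3)]])
  show "mp M a x \<in> {x \<in> sp M (tgt G a). f (tgt G a) x = 0}" if "x \<in> {x \<in> sp M (src G a). f (src G a) x = 0}" for a x
    using that qhom_mp[OF assms(3)] module_mp[OF assms(1)] module_mp_0[OF assms(2)] by simp
qed auto

lemma qhom_inverse:
  assumes M: "is_module G M" and f: "qhom G M N f" and inj: "qinj M f"
    and surj: "\<And>v y. y \<in> sp N v ==> \<exists>x\<in>sp M v. f v x = y"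
  shows "\<exists>g. qhom G N M g & qinj N g & (\<forall>v. \<forall>x\<in>sp M v. g v (f v x) = x) & (\<forall>v. \<forall>y\<in>sp N v. f v (g v y) = y)"
proof -
  obtain g where g: "\<And>v y. y \<in> sp N v ==> g v y \<in> sp M v & f v (g v y) = y"
  proof -
    have "\<forall>v y. \<exists>x. y \<in> sp N v --> x \<in> sp M v & f v x = y" using surj by blast
    then show ?thesis using that by metis
  qed
  have gf: "g v (f v x) = x" if "x \<in> sp M v" for v x
    using that g[of "f v x" v] qhom_sp[OF f that] qinj_eq[OF inj f M, of "g v (f v x)" v x] by blast
  have "qhom G N M g"
    unfolding qhom_def lin_def
  proof (intro conjI allI ballI)
    show "g v y \<in> sp M v" if "y \<in> sp N v" for v y using g that by blast
    show "g v (y + z) = g v y + g v z" if "y \<in> sp N v" "z \<in> sp N v" for v y z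
    proof -
      have "g v y + g v z \<in> sp M v" using g that module_add[OF M] by blast
      moreover have "f v (g v y + g v z) = y + z" using g that qhom_plus[OF f] by simp
      ultimately show ?thesis using gf by metis
    qed
    show "g v (vscale c y) = vscale c (g v y)" if "y \<in> sp N v" for v y c
    proof -
      have "vscale c (g v y) \<in> sp M v" using g that module_scale[OF M] by blast
      moreover have "f v (vscale c (g v y)) = vscale c y" using g that qhom_scale[OF f] by simp
      ultimately show ?thesis using gf by metis
    qed
    show "g (tgt G a) (mp N a y) = mp M a (g (src G a) y)" if "y \<in> sp N (src G a)" for a y
      using qhom_mp[OF f, of "g (src G a) y" a] g[OF that] gf[OF module_mp[OF M, of "g (src G a) y" a]] by simp
  qed
  moreover have "qinj N g" unfolding qinj_def using g qhom_0[OF f M] by metis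
  ultimately show ?thesis using g gf by blast
qed

text \<open>Turns a family that matters only on the spaces of \<open>M\<close> into the normalised
  representative that \<open>hom\<close> demands.\<close>

definition cut :: "('v, 'a, 'b, 'k::field) rep => ('v => ('b => 'k) => ('c => 'k)) => 'v => ('b => 'k) => ('c => 'k)" where
  "cut M f = (\<lambda>v x. if x \<in> sp M v then f v x else 0)"

lemma cut_apply [simp]: "x \<in> sp M v ==> cut M f v x = f v x"
  by (simp add: cut_def)

lemma hom_iff: "f \<in> hom G M N \<longleftrightarrow> qhom G M N f & (\<forall>v x. x \<notin> sp M v --> f v x = 0)"
  by (auto simp: hom_def qhom_def linear_map_def lin_def)

lemma cut_hom:
  assumes "is_module G M" "qhom G M N f"
  shows "cut M f \<in> hom G M N"
  unfolding hom_iff qhom_def lin_def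
  using assms(2) module_add[OF assms(1)] module_scale[OF assms(1)]
    module_mp[OF assms(1)]
  by (auto simp: cut_def qhom_def lin_def)

lemma isomorphicI:
  assumes M: "is_module G M" and f: "qhom G M N f" and inj: "qinj M f"
    and surj: "\<And>v y. y \<in> sp N v ==> \<exists>x\<in>sp M v. f v x = y"
  shows "isomorphic G M N"
  unfolding isomorphic_def
proof (intro bexI allI)
  show "cut M f \<in> hom G M N" by (rule cut_hom[OF M f])
  show "bij_betw (cut M f v) (sp M v) (sp N v)" for v
    unfolding bij_betw_def
  proof
    show "inj_on (cut M f v) (sp M v)"
      by (rule inj_onI) (use qinj_eq[OF inj f M] in simp)
    show "cut M f v ` sp M v = sp N v"
      using surj[of _ v] qhom_sp[OF f] by (auto simp: cut_def image_iff)
  qed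
qed

subsection \<open>Length\<close>

text \<open>The total dimension, a computable substitute for the length;
  \<open>mod_length_len\<close> identifies the two.\<close>

definition len :: "(vertex, arrow, 'b, 'k::field) rep => nat" where
  "len M = vdim (sp M V1) + vdim (sp M V2) + vdim (sp M V3)"

lemma dim_sub_mono: "submodule G X M ==> vdim (sp X v) \<le> vdim (sp M v)"
  by (meson fd_dim_mono module_fd submodule_module(2) submodule_sp subsetI)

lemma len_mono: "submodule G X M ==> len X \<le> len M"
  unfolding len_def using dim_sub_mono[of G X M V1] dim_sub_mono[of G X M V2] dim_sub_mono[of G X M V3] by simp

lemma len_eq_imp_eq:
  assumes "submodule G X M" "len M \<le> len X"
  shows "X = M"
proof (rule submodule_eqI[OF assms(1) submodule_refl[OF submodule_module(2)[OF assms(1)]]])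
  have "\<forall>v. vdim (sp M v) \<le> vdim (sp X v)"
    using assms(2) dim_sub_mono[OF assms(1), of V1] dim_sub_mono[OF assms(1), of V2] dim_sub_mono[OF assms(1), of V3]
    unfolding len_def all_vertex by linarith
  then show "sp X v = sp M v" for v
    using fd_dim_eq[OF module_fd[OF submodule_module(2)[OF assms(1)]] module_subspace[OF submodule_module(1)[OF assms(1)]], of v v]
      submodule_sp[OF assms(1)] by blast
qed

lemma proper_len: "proper_submodule G X M ==> len X < len M"
  unfolding proper_submodule_def using len_eq_imp_eq[of G X M] by (meson not_less)

lemma proper_submodule_len: "submodule G X M ==> len X < len M ==> proper_submodule G X M"
  by (auto simp: proper_submodule_def)

lemma is_zero_len: "is_module G M ==> is_zero M \<longleftrightarrow> len M = 0"
  by (simp add: is_zero_def len_def all_vertex fd_dim_0[OF module_fd])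

lemma len_qinj:
  assumes "is_module G M" "qhom G M N f" "qinj M f"
  shows "len (qimage G M N f) = len M"
  unfolding len_def sp_qimage
  using dim_inj_image[OF module_fd[OF assms(1)] qhom_lin[OF assms(2)]] qinjD[OF assms(3)] by metis

lemma len_image_le:
  assumes "is_module G M" "qhom G M N f"
  shows "len (qimage G M N f) \<le> len M"
  unfolding len_def sp_qimage
  using dim_image_le[OF module_fd[OF assms(1)] qhom_lin[OF assms(2)]] add_mono by metis

lemma rank_nullity_len:
  assumes "is_module G M" "qhom G M N f"
  shows "len M = len (qkernel G M f) + len (qimage G M N f)"
  unfolding len_def using rank_nullity[OF module_fd[OF assms(1)] qhom_lin[OF assms(2)]] by simp

lemma qinj_surj:
  assumes "is_module G M" "is_module G N" "qhom G M N f" "qinj M f" "len N \<le> len M" "y \<in> sp N v"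
  shows "\<exists>x\<in>sp M v. f v x = y"
proof -
  have "qimage G M N f = N"
    using len_eq_imp_eq[OF qimage_submodule[OF assms(1-3)]] len_qinj[OF assms(1,3,4)] assms(5) by simp
  then show ?thesis using assms(6) sp_qimage[of G M N f v] by (metis imageE)
qed

text \<open>Take the first of the vertices 1, 2, 3 with a nonzero space. All arrows into it start in
  a zero space, so any hyperplane there gives a submodule.\<close>

lemma submodule_codim1:
  assumes M: "is_module quiver_Q M" and nz: "\<not> is_zero M"
  shows "\<exists>X. submodule quiver_Q X M & Suc (len X) = len M"
proof -
  have step: ?thesis if v: "sp M v ~= {0}" and z: "\<And>a. tgt quiver_Q a = v ==> sp M (src quiver_Q a) = {0}" for v
  proof -
    obtain T where T: "subsp T" "T \<subseteq> sp M v" "Suc (vdim T) = vdim (sp M v)"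
      using fd_codim1[OF module_fd[OF M] v] by blast
    let ?X = "restr quiver_Q M ((sp M)(v := T))"
    have "submodule quiver_Q ?X M"
    proof (rule restr_submodule[OF M])
      fix a x assume x: "x \<in> ((sp M)(v := T)) (src quiver_Q a)"
      then have xM: "x \<in> sp M (src quiver_Q a)" using T(2) by (auto split: if_splits)
      show "mp M a x \<in> ((sp M)(v := T)) (tgt quiver_Q a)"
      proof (cases "tgt quiver_Q a = v")
        case True
        then have "x = 0" using z xM by blast
        then show ?thesis using True module_mp_0[OF M] subsp_0[OF T(1)] by simp
      qed (use module_mp[OF M xM] in simp)
    qed (use T module_subspace[OF M] in auto)
    moreover have "Suc (len ?X) = len M"
      using T(3) by (cases v) (auto simp: len_def)
    ultimately show ?thesis by blast
  qed
  have src: "src quiver_Q a = (case a of A12 => V1 | _ => V2)" "tgt quiver_Q a = (case a of A12 => V2 | _ => V3)" for a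
    by (cases a; simp)+
  consider "sp M V1 ~= {0}" | "sp M V1 = {0}" "sp M V2 ~= {0}" | "sp M V2 = {0}" "sp M V3 ~= {0}"
    using nz unfolding is_zero_def all_vertex by metis
  then show ?thesis
  proof cases
    case 1
    show ?thesis by (rule step[OF 1]) (simp add: src split: arrow.splits)
  next
    case 2
    show ?thesis by (rule step[OF 2(2)]) (use 2 in \<open>simp add: src split: arrow.splits\<close>)
  next
    case 3
    show ?thesis by (rule step[OF 3(2)]) (use 3 in \<open>simp add: src split: arrow.splits\<close>)
  qed
qed

lemma chain_exists:
  assumes "is_module quiver_Q M"
  shows "\<exists>Ms. length Ms = Suc (len M) & sorted_wrt (proper_submodule quiver_Q) Ms & (\<forall>X \<in> set Ms. submodule quiver_Q X M)"
  using assms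
proof (induction "len M" arbitrary: M)
  case 0
  then show ?case by (intro exI[of _ "[M]"]) (simp add: submodule_refl)
next
  case (Suc n)
  then have "\<not> is_zero M" using is_zero_len[OF Suc.prems] by simp
  then obtain X where X: "submodule quiver_Q X M" "Suc (len X) = len M" using submodule_codim1[OF Suc.prems] by blast
  then have "n = len X" using Suc by simp
  then obtain Ms where Ms: "length Ms = Suc (len X)" "sorted_wrt (proper_submodule quiver_Q) Ms"
      "\<forall>Y\<in>set Ms. submodule quiver_Q Y X" using Suc.hyps(1) submodule_module(1)[OF X(1)] by blast
  have "proper_submodule quiver_Q Y M" if "Y \<in> set Ms" for Y
    using Ms(3) that X len_mono[of quiver_Q Y X] submodule_trans[of quiver_Q Y X M] by (auto intro: proper_submodule_len)
  moreover have "submodule quiver_Q Y M" if "Y \<in> set Ms" for Y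
    using Ms(3) that X submodule_trans[of quiver_Q Y X M] by blast
  ultimately show ?case using Ms X submodule_refl[OF Suc.prems]
    by (intro exI[of _ "Ms @ [M]"]) (auto simp: sorted_wrt_append)
qed

lemma sorted_chain_length:
  assumes "sorted_wrt (proper_submodule quiver_Q) Ms" "\<forall>X \<in> set Ms. submodule quiver_Q X M"
  shows "length Ms \<le> Suc (len M)"
proof -
  have "sorted_wrt (<) (map len Ms)"
    using assms(1) unfolding sorted_wrt_map by (rule sorted_wrt_mono_rel[rotated]) (rule proper_len)
  then have "distinct (map len Ms)" using strict_sorted_iff by blast
  then have "length Ms = card (len ` set Ms)" by (metis distinct_card length_map set_map)
  also have "\<dots> \<le> card {..len M}" using assms(2) len_mono by (intro card_mono) auto
  finally show ?thesis by simp
qed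

text \<open>Dimensions increase strictly along a chain, which bounds its length; a chain that drops
  the dimension by one at each step attains the bound.\<close>

theorem mod_length_len:
  assumes "is_module quiver_Q M"
  shows "mod_length quiver_Q M = len M"
  unfolding mod_length_def
proof (rule Max_eqI)
  let ?A = "{n. \<exists>Ms. length Ms = Suc n & sorted_wrt (proper_submodule quiver_Q) Ms & (\<forall>X\<in>set Ms. submodule quiver_Q X M)}"
  have "?A \<subseteq> {..len M}" using sorted_chain_length[of _ M] by fastforce
  then show "finite ?A" by (rule finite_subset) simp
  show "n \<le> len M" if "n \<in> ?A" for n using that sorted_chain_length[of _ M] by fastforce
  show "len M \<in> ?A" using chain_exists[OF assms] by blast
qed

section \<open>Gabriel-Roiter measure\<close>

lemma gr_less_iff: "gr_less I J \<longleftrightarrow> (\<exists>m \<in> J - I. \<forall>k<m. k \<in> I \<longleftrightarrow> k \<in> J)"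
proof
  let ?P = "\<lambda>n. n \<in> (I - J) \<union> (J - I)"
  assume l: "gr_less I J"
  then have ex: "\<exists>n. ?P n" unfolding gr_less_def by auto
  have "(LEAST n. ?P n) \<in> J - I" using l LeastI_ex[OF ex] unfolding gr_less_def by auto
  moreover have "k \<in> I \<longleftrightarrow> k \<in> J" if "k < (LEAST n. ?P n)" for k using not_less_Least[OF that] by auto
  ultimately show "\<exists>m \<in> J - I. \<forall>k<m. k \<in> I \<longleftrightarrow> k \<in> J" by blast
next
  assume "\<exists>m \<in> J - I. \<forall>k<m. k \<in> I \<longleftrightarrow> k \<in> J"
  then obtain m where m: "m \<in> J - I" "\<forall>k<m. k \<in> I \<longleftrightarrow> k \<in> J" by blast
  have "(LEAST n. n \<in> (I - J) \<union> (J - I)) = m"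
    by (rule Least_equality) (use m in \<open>auto simp: not_le[symmetric]\<close>)
  then show "gr_less I J" using m by (auto simp: gr_less_def)
qed

lemma gr_less_irrefl: "\<not> gr_less I I" by (simp add: gr_less_def)

lemma gr_less_trans: "gr_less I J ==> gr_less J K ==> gr_less I K"
  unfolding gr_less_iff
proof (elim bexE)
  fix m n assume m: "m \<in> J - I" "\<forall>k<m. k \<in> I \<longleftrightarrow> k \<in> J" and n: "n \<in> K - J" "\<forall>k<n. k \<in> J \<longleftrightarrow> k \<in> K"
  have "m ~= n" using m n by auto
  then have "min m n \<in> K - I" using m n by (cases "m < n") (auto simp: min_def)
  moreover have "\<forall>k<min m n. k \<in> I \<longleftrightarrow> k \<in> K" using m n by simp
  ultimately show "\<exists>m\<in>K - I. \<forall>k<m. (k \<in> I) = (k \<in> K)" by blast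
qed

lemma gr_less_total: "I ~= J ==> gr_less I J \<or> gr_less J I"
proof -
  assume "I ~= J"
  then have ex: "\<exists>n. n \<in> (I - J) \<union> (J - I)" by auto
  have "(I - J) \<union> (J - I) = (J - I) \<union> (I - J)" by auto
  then show ?thesis using LeastI_ex[OF ex] \<open>I ~= J\<close> unfolding gr_less_def by auto
qed

text \<open>The deciding element lies in \<open>J\<close>, hence below \<open>n\<close>, and is not
  disturbed by \<open>n\<close>. So a length beyond all of \<open>J\<close> cannot reverse a
  comparison.\<close>

lemma gr_less_insert_left:
  assumes "gr_less I J" "\<And>k. k \<in> J ==> k < n"
  shows "gr_less (insert n I) J"
  using assms unfolding gr_less_iff by (metis DiffD1 DiffD2 DiffI insertE less_asym' less_irrefl insert_iff)

lemma gr_less_insert_right: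
  assumes "\<And>k. k \<in> I ==> k < n"
  shows "gr_less I (insert n I)"
  unfolding gr_less_iff using assms by (intro bexI[of _ n]) auto

lemma gr_less_insert_both:
  assumes "gr_less I J" "\<And>k. k \<in> J ==> k < n"
  shows "gr_less (insert n I) (insert n J)"
  using gr_less_trans[OF gr_less_insert_left[OF assms] gr_less_insert_right[OF assms(2)]] by blast

lemma gr_max_exists:
  assumes "finite A" "A ~= {}"
  shows "\<exists>I\<in>A. \<forall>J\<in>A. J = I \<or> gr_less J I"
  using assms
proof (induction rule: finite_ne_induct)
  case (insert K A)
  then obtain I where I: "I \<in> A" "\<forall>J\<in>A. J = I \<or> gr_less J I" by blast
  consider "K = I" | "gr_less K I" | "gr_less I K" using gr_less_total by blast
  then show ?case using I gr_less_trans by cases (metis insert_iff)+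
qed simp

abbreviation "subm \<equiv> submodule quiver_Q"
abbreviation "psubm \<equiv> proper_submodule quiver_Q"
abbreviation "indec \<equiv> indecomposable quiver_Q"
abbreviation "\<mu> \<equiv> gr_measure quiver_Q"

section \<open>Chains of indecomposable submodules\<close>

definition ichain :: "(vertex, arrow, 'b, 'k::field) rep => (vertex, arrow, 'b, 'k) rep list => bool" where
  "ichain M Ms \<longleftrightarrow> Ms ~= [] & sorted_wrt psubm Ms & (\<forall>X\<in>set Ms. subm X M & indec X)"

lemma indec_module: "indecomposable G M ==> is_module G M" by (simp add: indecomposable_def)

lemma chain_lengths_iff: "C \<in> chain_lengths quiver_Q M \<longleftrightarrow> (\<exists>Ms. ichain M Ms & C = len ` set Ms)"
proof -
  have "mod_length quiver_Q ` set Ms = len ` set Ms" if "ichain M Ms" for Ms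
    by (rule image_cong) (use that mod_length_len submodule_module(1) in \<open>unfold ichain_def, blast+\<close>)
  then show ?thesis unfolding chain_lengths_def by (auto simp: ichain_def) metis
qed

text \<open>\<open>f\<close> maps \<open>Z\<close> bijectively to \<open>Y\<close>, so
  \<open>X\<close> is the direct sum of \<open>Z\<close> and the kernel of \<open>f\<close>, and one
  of the two summands vanishes.\<close>

lemma dsum_kernel:
  fixes X :: "('v, 'a, 'b, 'k::field) rep" and Y :: "('v, 'a, 'c, 'k::field) rep"
  assumes X: "indecomposable G X" and Z: "submodule G Z X" and Y: "is_module G Y" and f: "qhom G X Y f"
    and inj: "qinj Z f" and surj: "\<And>v y. y \<in> sp Y v ==> \<exists>z\<in>sp Z v. f v z = y"
  shows "is_zero Z \<or> qinj X f"
proof -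
  have mX: "is_module G X" using X by (rule indec_module)
  have K: "submodule G (qkernel G X f) X" by (rule qkernel_submodule[OF mX Y f])
  have mZ: "is_module G Z" using Z by (rule submodule_module)
  have "sp Z v \<inter> sp (qkernel G X f) v = {0} &
      {x + y |x y. x \<in> sp Z v & y \<in> sp (qkernel G X f) v} = sp X v" for v
  proof
    show "sp Z v \<inter> sp (qkernel G X f) v = {0}"
      using qinjD[OF inj] module_0[OF mZ] module_0[OF submodule_module(1)[OF K]] by auto
    show "{x + y |x y. x \<in> sp Z v & y \<in> sp (qkernel G X f) v} = sp X v"
    proof (intro set_eqI iffI)
      fix x assume "x \<in> {x + y |x y. x \<in> sp Z v & y \<in> sp (qkernel G X f) v}"
      then show "x \<in> sp X v"
        using module_add[OF mX] submodule_sp[OF Z] by auto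
    next
      fix x assume x: "x \<in> sp X v"
      obtain z where z: "z \<in> sp Z v" "f v z = f v x" using surj qhom_sp[OF f x] by blast
      have zX: "z \<in> sp X v" using z submodule_sp[OF Z] by blast
      have "x - z \<in> sp (qkernel G X f) v"
        using module_diff[OF mX x zX]
          qhom_minus[OF f module_subspace[OF mX] x zX] z by simp
      then show "x \<in> {x + y |x y. x \<in> sp Z v & y \<in> sp (qkernel G X f) v}"
        using z(1) by (intro CollectI exI[of _ z] exI[of _ "x - z"]) simp
    qed
  qed
  then have "is_zero Z \<or> is_zero (qkernel G X f)" using X Z K unfolding indecomposable_def by blast
  then show ?thesis unfolding is_zero_def qinj_def by auto
qed

text \<open>The inverse isomorphism carries a decomposition of \<open>N\<close> to one of
  \<open>M\<close>.\<close>

lemma indec_transport: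
  fixes M :: "('v, 'a, 'b, 'k::field) rep" and N :: "('v, 'a, 'c, 'k::field) rep"
  assumes M: "indecomposable G M" and N: "is_module G N" and f: "qhom G M N f" "qinj M f"
    and surj: "\<And>v y. y \<in> sp N v ==> \<exists>x\<in>sp M v. f v x = y"
  shows "indecomposable G N"
proof -
  have mM: "is_module G M" using M by (rule indec_module)
  obtain g where g: "qhom G N M g" "qinj N g" "\<And>v x. x \<in> sp M v ==> g v (f v x) = x"
      "\<And>v y. y \<in> sp N v ==> f v (g v y) = y"
    using qhom_inverse[OF mM f surj] by blast
  show ?thesis
    unfolding indecomposable_def
  proof (intro conjI allI impI N)
    show "\<not> is_zero N"
    proof
      assume z: "is_zero N"
      have "sp M v = {0}" for v
      proof -
        have "x = 0" if "x \<in> sp M v" for x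
          using qinjD[OF f(2) that] qhom_sp[OF f(1) that] z by (simp add: is_zero_def)
        then show ?thesis using module_0[OF mM] by blast
      qed
      then show False using M by (simp add: indecomposable_def is_zero_def)
    qed
    fix U W :: "('v, 'a, 'c, 'k) rep"
    assume A: "submodule G U N & submodule G W N &
       (\<forall>v. sp U v \<inter> sp W v = {0} & {x + y |x y. x \<in> sp U v & y \<in> sp W v} = sp N v)"
    let ?U = "qimage G U M g" and ?W = "qimage G W M g"
    have mU: "is_module G U" "is_module G W" using A submodule_module(1) by blast+
    have gU: "qhom G U M g" "qhom G W M g" using A qhom_restrict[OF _ g(1)] by blast+
    have UN: "\<And>v x. x \<in> sp U v ==> x \<in> sp N v" "\<And>v x. x \<in> sp W v ==> x \<in> sp N v"
      using A submodule_sp by metis+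
    have "submodule G ?U M" "submodule G ?W M" using qimage_submodule[OF _ mM] mU gU by blast+
    moreover have "sp ?U v \<inter> sp ?W v = {0} & {x + y |x y. x \<in> sp ?U v & y \<in> sp ?W v} = sp M v" for v
    proof
      have "x = 0" if xUW: "x \<in> sp ?U v" "x \<in> sp ?W v" for x
      proof -
        obtain u w where uw: "u \<in> sp U v" "w \<in> sp W v" "x = g v u" "x = g v w"
          using xUW unfolding sp_qimage by blast
        then have "u = w" using qinj_eq[OF g(2,1) N] UN by metis
        then have "u = 0" using A uw by blast
        then show ?thesis using uw qhom_0[OF g(1) N] by simp
      qed
      moreover have "0 \<in> sp ?U v" "0 \<in> sp ?W v" using module_0 mU qhom_0[OF g(1) N] by (force simp: image_iff)+
      ultimately show "sp ?U v \<inter> sp ?W v = {0}" by blast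
      show "{x + y |x y. x \<in> sp ?U v & y \<in> sp ?W v} = sp M v"
      proof (intro set_eqI iffI)
        fix x assume "x \<in> {x + y |x y. x \<in> sp ?U v & y \<in> sp ?W v}"
        then show "x \<in> sp M v"
          using module_add[OF mM] qhom_sp[OF gU(1)] qhom_sp[OF gU(2)] by auto
      next
        fix x assume x: "x \<in> sp M v"
        then have "f v x \<in> {x + y |x y. x \<in> sp U v & y \<in> sp W v}" using A qhom_sp[OF f(1)] by simp
        then obtain u w where uw: "u \<in> sp U v" "w \<in> sp W v" "f v x = u + w" by blast
        then have "x = g v u + g v w" using g(3)[OF x] qhom_plus[OF g(1)] UN by metis
        then show "x \<in> {x + y |x y. x \<in> sp ?U v & y \<in> sp ?W v}" using uw by auto
      qed
    qed
    ultimately have "is_zero ?U \<or> is_zero ?W" using M unfolding indecomposable_def by blast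
    moreover have "is_zero Z" if Z: "submodule G Z N" "is_zero (qimage G Z M g)" for Z
    proof -
      have "x = 0" if "x \<in> sp Z v" for x v
        using qinjD[OF g(2) submodule_sp[OF Z(1) that]] Z(2) that by (auto simp: is_zero_def)
      then show ?thesis using module_0[OF submodule_module(1)[OF Z(1)]] unfolding is_zero_def by blast
    qed
    ultimately show "is_zero U \<or> is_zero W" using A by blast
  qed
qed

lemma indec_qimage:
  assumes "indecomposable G M" "is_module G N" "qhom G M N f" "qinj M f"
  shows "indecomposable G (qimage G M N f)"
proof (rule indec_transport[OF assms(1)])
  show "is_module G (qimage G M N f)" using qimage_submodule[OF indec_module[OF assms(1)] assms(2,3)] submodule_module by blast
  show "qhom G M (qimage G M N f) f"
    by (rule qhom_corestrict[OF qimage_submodule[OF indec_module[OF assms(1)] assms(2,3)] assms(3)]) simp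
qed (use assms in auto)

text \<open>A monomorphism preserves lengths, proper inclusions and indecomposability of
  submodules.\<close>

lemma ichain_transport:
  assumes X: "is_module quiver_Q X" and Y: "is_module quiver_Q Y" and f: "qhom quiver_Q X Y f" "qinj X f" and Ms: "ichain X Ms"
  shows "ichain Y (map (\<lambda>Z. qimage quiver_Q Z Y f) Ms)" "len ` set (map (\<lambda>Z. qimage quiver_Q Z Y f) Ms) = len ` set Ms"
proof -
  let ?i = "\<lambda>Z. qimage quiver_Q Z Y f"
  have Z: "is_module quiver_Q Z & qhom quiver_Q Z Y f & qinj Z f" if "subm Z X" for Z
    using submodule_module(1)[OF that] qhom_restrict[OF that f(1)] submodule_sp[OF that] f(2) unfolding qinj_def by blast
  have len: "len (?i Z) = len Z" if "subm Z X" for Z using Z[OF that] len_qinj by blast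
  have sub: "subm (?i Z) Y" if "subm Z X" for Z using Z[OF that] qimage_submodule[OF _ Y] by blast
  have MsX: "\<And>Z. Z \<in> set Ms ==> subm Z X" "\<And>Z. Z \<in> set Ms ==> indec Z" using Ms by (auto simp: ichain_def)
  have pr: "psubm (?i Z) (?i Z')" if "Z \<in> set Ms" "Z' \<in> set Ms" "psubm Z Z'" for Z Z'
  proof -
    have "subm (?i Z) (?i Z')"
    proof (rule submodule_subset[OF sub sub])
      show "sp (?i Z) v \<subseteq> sp (?i Z') v" for v
        using that(3) submodule_sp[of quiver_Q Z Z'] by (auto simp: proper_submodule_def)
    qed (use that MsX in auto)
    moreover have "len (?i Z) < len (?i Z')" using len MsX that proper_len by simp
    ultimately show ?thesis by (rule proper_submodule_len)
  qed
  have "sorted_wrt psubm (map ?i Ms)"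
    unfolding sorted_wrt_map
    by (rule sorted_wrt_mono_rel[of Ms psubm]) (use pr Ms in \<open>auto simp: ichain_def\<close>)
  then show "ichain Y (map ?i Ms)"
    using Ms sub indec_qimage[OF MsX(2) Y] Z[OF MsX(1)] MsX(1) by (auto simp: ichain_def)
  show "len ` set (map ?i Ms) = len ` set Ms" using MsX len by (force simp: image_iff)
qed

lemma chain_lengths_transport:
  assumes "is_module quiver_Q X" "is_module quiver_Q Y" "qhom quiver_Q X Y f" "qinj X f"
  shows "chain_lengths quiver_Q X \<subseteq> chain_lengths quiver_Q Y"
  using ichain_transport[OF assms] unfolding subset_iff chain_lengths_iff by metis

lemma chain_lengths_submodule: "subm X M ==> chain_lengths quiver_Q X \<subseteq> chain_lengths quiver_Q M"
  unfolding subset_iff chain_lengths_iff ichain_def using submodule_trans by blast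

lemma ichain_snoc:
  assumes "ichain X Ms" "psubm X M" "indec M"
  shows "ichain M (Ms @ [M])"
proof -
  have "psubm Z M" if "Z \<in> set Ms" for Z
    using that assms submodule_trans[of quiver_Q Z X M] len_mono[of quiver_Q Z X] proper_len[of quiver_Q X M]
    by (intro proper_submodule_len) (auto simp: ichain_def proper_submodule_def)
  then show ?thesis using assms submodule_refl[OF indec_module[OF assms(3)]]
    by (auto simp: ichain_def sorted_wrt_append proper_submodule_def)
qed

lemma chain_lengths_bound: "C \<in> chain_lengths quiver_Q M ==> k \<in> C ==> k \<le> len M"
  unfolding chain_lengths_iff ichain_def using len_mono by fastforce

text \<open>The summands meet in zero, so components are unique (\<open>uniq\<close>). Linearity and
  compatibility with the arrows all follow by exhibiting the expected components.\<close>

lemma dsum_projections: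
  fixes M :: "('v, 'a, 'b, 'k::field) rep"
  assumes U: "submodule G U M" and W: "submodule G W M"
    and i: "\<And>v. sp U v \<inter> sp W v = {0}" and s: "\<And>v. {x + y |x y. x \<in> sp U v & y \<in> sp W v} = sp M v"
  shows "\<exists>p q. qhom G M U p & qhom G M W q & (\<forall>v. \<forall>x\<in>sp M v. x = p v x + q v x) &
     (\<forall>v. \<forall>x\<in>sp U v. p v x = x) & (\<forall>v. \<forall>x\<in>sp W v. p v x = 0)"
proof -
  have M: "is_module G M" and mU: "is_module G U" and mW: "is_module G W" using U W submodule_module by blast+
  have "\<forall>v x. \<exists>y z. x \<in> sp M v --> y \<in> sp U v & z \<in> sp W v & x = y + z" using s by blast
  then obtain p q where pq: "\<And>v x. x \<in> sp M v ==> p v x \<in> sp U v & q v x \<in> sp W v & x = p v x + q v x" by metis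
  have uniq: "p v x = u & q v x = w" if "u \<in> sp U v" "w \<in> sp W v" "x = u + w" for v x u w
  proof -
    have "x \<in> sp M v" using that s by blast
    then have *: "p v x \<in> sp U v" "q v x \<in> sp W v" "u + w = p v x + q v x" using pq that by auto
    have "u - p v x = q v x - w" using *(3) by (simp add: algebra_simps)
    moreover have "u - p v x \<in> sp U v" using that * module_diff[OF mU] by blast
    moreover have "q v x - w \<in> sp W v" using that * module_diff[OF mW] by blast
    ultimately have "u - p v x \<in> sp U v \<inter> sp W v" by simp
    then have "u - p v x = 0" using i[of v] by blast
    moreover from this have "q v x - w = 0" using \<open>u - p v x = q v x - w\<close> by simp
    ultimately have "u - p v x = 0" "q v x - w = 0" by auto
    then show ?thesis by simp
  qed
  have add: "p v (x + y) = p v x + p v y & q v (x + y) = q v x + q v y" if "x \<in> sp M v" "y \<in> sp M v" for v x y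
  proof (rule uniq)
    show "x + y = p v x + p v y + (q v x + q v y)" using pq[OF that(1)] pq[OF that(2)] by (metis add.assoc add.left_commute)
  qed (use pq that module_add[OF mU] module_add[OF mW] in blast)+
  have sc: "p v (vscale c x) = vscale c (p v x) & q v (vscale c x) = vscale c (q v x)" if "x \<in> sp M v" for v x c
  proof (rule uniq)
    show "vscale c x = vscale c (p v x) + vscale c (q v x)" using pq[OF that] by (metis fun_vs.scale_right_distrib)
  qed (use pq that module_scale[OF mU] module_scale[OF mW] in blast)+
  have mp: "p (tgt G a) (mp M a x) = mp U a (p (src G a) x) & q (tgt G a) (mp M a x) = mp W a (q (src G a) x)"
    if "x \<in> sp M (src G a)" for a x
  proof (rule uniq)
    let ?y = "p (src G a) x" and ?z = "q (src G a) x"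
    have yz: "?y \<in> sp U (src G a)" "?z \<in> sp W (src G a)" "x = ?y + ?z" using pq[OF that] by auto
    show "mp M a x = mp U a ?y + mp W a ?z"
      using submodule_mp[OF U yz(1)] submodule_mp[OF W yz(2)]
        lin_add[OF module_lin[OF M] submodule_sp[OF U yz(1)] submodule_sp[OF W yz(2)]] yz(3) by simp
  qed (use pq[OF that] module_mp[OF mU] module_mp[OF mW] in auto)
  have "qhom G M U p" "qhom G M W q"
    unfolding qhom_def lin_def using add sc mp pq by auto
  moreover have "p v x = x" if "x \<in> sp U v" for v x using uniq[OF that module_0[OF mW]] by simp
  moreover have "p v x = 0" if "x \<in> sp W v" for v x using uniq[OF module_0[OF mU] that] by simp
  ultimately show ?thesis using pq by blast
qed

lemma dsum_len:
  assumes U: "submodule G U M" and W: "submodule G W M"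
    and i: "\<And>v. sp U v \<inter> sp W v = {0}" and s: "\<And>v. {x + y |x y. x \<in> sp U v & y \<in> sp W v} = sp M v"
  shows "len M = len U + len W"
proof -
  obtain p q where p: "qhom G M U p" "qhom G M W q" "\<And>v x. x \<in> sp M v ==> x = p v x + q v x"
     "\<And>v x. x \<in> sp U v ==> p v x = x" "\<And>v x. x \<in> sp W v ==> p v x = 0"
    using dsum_projections[OF assms] by blast
  have M: "is_module G M" using U submodule_module by blast
  have "sp (qkernel G M p) v = sp W v" for v
  proof (intro set_eqI iffI)
    fix x assume "x \<in> sp (qkernel G M p) v"
    then have "x \<in> sp M v" "p v x = 0" by auto
    then have "x = q v x" using p(3)[of x v] by simp
    then show "x \<in> sp W v" using qhom_sp[OF p(2) \<open>x \<in> sp M v\<close>] by simp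
  qed (use p(5) submodule_sp[OF W] in auto)
  moreover have "sp (qimage G M U p) v = sp U v" for v
    using qhom_sp[OF p(1)] p(4) submodule_sp[OF U] by (force simp: image_iff)
  ultimately show ?thesis using rank_nullity_len[OF M p(1)] by (simp add: len_def)
qed

text \<open>Gabriel's main property.  Shrinking the targets to images and splitting them into direct
  summands, one may assume that every target is an indecomposable proper quotient of \<open>X\<close>.  If a
  component is injective on the last term of the filtration before \<open>X\<close>, it is not onto there, as this
  term would otherwise be a direct summand of \<open>X\<close>; so the target extends the filtration by a module
  that is shorter than \<open>X\<close>.\<close>

theorem gabriel_main_property:
  assumes "Ms ~= []" "sorted_wrt psubm Ms" "\<forall>Z\<in>set Ms. indec Z" "last Ms = X"
    and "\<forall>(Y, f)\<in>set F. is_module quiver_Q Y & qhom quiver_Q X Y f"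
    and "\<And>v x. x \<in> sp X v ==> \<forall>(Y, f)\<in>set F. f v x = 0 ==> x = 0"
  shows "\<exists>(Y, f)\<in>set F. qinj X f \<or> (\<exists>C\<in>chain_lengths quiver_Q Y. gr_less (len ` set Ms) C)"
  using assms
\<comment> \<open>The squares pay for the additional entry of \<open>F\<close> when a target is
  split: for nonzero summands \<open>U\<close> and \<open>W\<close> their sum drops by
  \<open>2 * len U * len W\<close>, which exceeds one. Replacing a target by a smaller image also
  lowers the squares, and removing the last term of \<open>Ms\<close> lowers the first
  summand.\<close>
proof (induction "length Ms + length F + (\<Sum>(Y, f)\<leftarrow>F. (len Y)\<^sup>2)" arbitrary: Ms X F rule: less_induct)
  case less
  note Ms = less.prems(1-4) and F = less.prems(5) and joint = less.prems(6)
  have X: "indec X" using Ms last_in_set by blast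
  have mX: "is_module quiver_Q X" by (rule indec_module[OF X])
  show ?case
  proof (cases "\<exists>(Y, f)\<in>set F. is_zero Y")
    case True
    then obtain Y f where Yf: "(Y, f) \<in> set F" "is_zero Y" by blast
    then obtain F1 F2 where F12: "F = F1 @ (Y, f) # F2" by (meson split_list)
    have fz: "f v x = 0" if "x \<in> sp X v" for v x
    proof -
      have "qhom quiver_Q X Y f" using F Yf(1) by blast
      then show ?thesis using Yf(2) qhom_sp that by (fastforce simp: is_zero_def)
    qed
    have "\<exists>(Y, f)\<in>set (F1 @ F2). qinj X f \<or> (\<exists>C\<in>chain_lengths quiver_Q Y. gr_less (len ` set Ms) C)"
    proof (rule less.hyps[OF _ Ms])
      show "x = 0" if "x \<in> sp X v" "\<forall>(Y, f)\<in>set (F1 @ F2). f v x = 0" for v x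
        by (rule joint[OF that(1)]) (use that fz F12 in auto)
    qed (use F F12 in auto)
    then show ?thesis using F12 by auto
  next
    case nonzero: False
    show ?thesis
    proof (cases "\<exists>(Y, f)\<in>set F. len (qimage quiver_Q X Y f) < len Y")
      case True
      then obtain Y f where Yf: "(Y, f) \<in> set F" "len (qimage quiver_Q X Y f) < len Y" by blast
      then obtain F1 F2 where F12: "F = F1 @ (Y, f) # F2" by (meson split_list)
      have Y: "is_module quiver_Q Y" "qhom quiver_Q X Y f" using F Yf(1) by blast+
      let ?I = "qimage quiver_Q X Y f"
      have I: "subm ?I Y" by (rule qimage_submodule[OF mX Y])
      have hI: "qhom quiver_Q X ?I f" by (rule qhom_corestrict[OF I Y(2)]) simp
      have "(len ?I)\<^sup>2 < (len Y)\<^sup>2" using Yf(2) by (simp add: power2_eq_square mult_strict_mono)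
      then have "\<exists>(Y, f)\<in>set (F1 @ (?I, f) # F2). qinj X f \<or> (\<exists>C\<in>chain_lengths quiver_Q Y. gr_less (len ` set Ms) C)"
      proof (intro less.hyps[OF _ Ms])
        show "x = 0" if "x \<in> sp X v" "\<forall>(Y, f)\<in>set (F1 @ (?I, f) # F2). f v x = 0" for v x
          by (rule joint[OF that(1)]) (use that F12 in auto)
        show "\<forall>(Y, f)\<in>set (F1 @ (?I, f) # F2). is_module quiver_Q Y & qhom quiver_Q X Y f"
          using F F12 hI submodule_module(1)[OF I] by auto
      qed (simp add: F12)
      then show ?thesis using F12 chain_lengths_submodule[OF I] by fastforce
    next
      case surj: False
      show ?thesis
      proof (cases "\<exists>(Y, f)\<in>set F. \<not> indec Y")
        case True
        then obtain Y f where Yf: "(Y, f) \<in> set F" "\<not> indec Y" by blast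
        then obtain F1 F2 where F12: "F = F1 @ (Y, f) # F2" by (meson split_list)
        have Y: "is_module quiver_Q Y" "qhom quiver_Q X Y f" using F Yf(1) by blast+
        have "\<not> is_zero Y" using nonzero Yf(1) by blast
        then obtain U W where UW: "subm U Y" "subm W Y" "\<And>v. sp U v \<inter> sp W v = {0}"
            "\<And>v. {x + y |x y. x \<in> sp U v & y \<in> sp W v} = sp Y v" "\<not> is_zero U" "\<not> is_zero W"
          using Yf(2) Y(1) unfolding indecomposable_def by blast
        obtain p q where pq: "qhom quiver_Q Y U p" "qhom quiver_Q Y W q" "\<And>v x. x \<in> sp Y v ==> x = p v x + q v x"
          using dsum_projections[OF UW(1-4)] by blast
        have mU: "is_module quiver_Q U" "is_module quiver_Q W" using UW submodule_module by blast+
        have lenY: "len Y = len U + len W" by (rule dsum_len[OF UW(1-4)])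
        have "1 \<le> len U * len W"
          using is_zero_len[OF mU(1)] is_zero_len[OF mU(2)] UW(5,6) by (simp add: Suc_le_eq)
        moreover have "(len Y)\<^sup>2 = (len U)\<^sup>2 + (len W)\<^sup>2 + 2 * (len U * len W)"
          unfolding lenY by (simp add: power2_sum)
        ultimately have sq: "(len U)\<^sup>2 + (len W)\<^sup>2 + 1 < (len Y)\<^sup>2" by linarith
        let ?F = "F1 @ (U, \<lambda>v x. p v (f v x)) # (W, \<lambda>v x. q v (f v x)) # F2"
        have hp: "qhom quiver_Q X U (\<lambda>v x. p v (f v x))" "qhom quiver_Q X W (\<lambda>v x. q v (f v x))"
          using qhom_comp[OF Y(2)] pq by blast+
        have "\<exists>(Y, f)\<in>set ?F. qinj X f \<or> (\<exists>C\<in>chain_lengths quiver_Q Y. gr_less (len ` set Ms) C)"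
        proof (rule less.hyps[OF _ Ms])
          show "x = 0" if "x \<in> sp X v" "\<forall>(Y, f)\<in>set ?F. f v x = 0" for v x
          proof (rule joint[OF that(1)])
            have "p v (f v x) = 0" "q v (f v x) = 0" using that(2) by auto
            then have "f v x = 0" using pq(3)[OF qhom_sp[OF Y(2) that(1)]] by simp
            then show "\<forall>(Y, f)\<in>set F. f v x = 0" using that(2) F12 by auto
          qed
          show "\<forall>(Y, f)\<in>set ?F. is_module quiver_Q Y & qhom quiver_Q X Y f" using F F12 hp mU by auto
        qed (use sq F12 in auto)
        moreover have "qinj X f" if "qinj X (\<lambda>v x. p v (f v x)) \<or> qinj X (\<lambda>v x. q v (f v x))"
          using that qhom_0[OF pq(1) Y(1)] qhom_0[OF pq(2) Y(1)] by (auto simp: qinj_def)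
        ultimately show ?thesis using F12 chain_lengths_submodule[OF UW(1)] chain_lengths_submodule[OF UW(2)] by fastforce
      next
        case ind: False
        show ?thesis
        proof (cases "\<exists>(Y, f)\<in>set F. qinj X f")
          case True
          then show ?thesis by blast
        next
          case ninj: False
          have Fp: "is_module quiver_Q Y & qhom quiver_Q X Y f & indec Y & len Y < len X &
              qimage quiver_Q X Y f = Y & \<not> qinj X f" if "(Y, f) \<in> set F" for Y f
          proof -
            have Y: "is_module quiver_Q Y" "qhom quiver_Q X Y f" "indec Y" "\<not> qinj X f"
              using F that ind ninj by blast+
            have I: "subm (qimage quiver_Q X Y f) Y" by (rule qimage_submodule[OF mX Y(1,2)])
            have im: "qimage quiver_Q X Y f = Y" using that surj by (intro len_eq_imp_eq[OF I]) auto
            have "len (qkernel quiver_Q X f) ~= 0"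
              using Y(4) is_zero_len[OF submodule_module(1)[OF qkernel_submodule[OF mX Y(1,2)]]]
              by (auto simp: is_zero_def qinj_def)
            then have "len Y < len X" using rank_nullity_len[OF mX Y(2)] im by simp
            then show ?thesis using Y im by blast
          qed
          have MX: "Ms = butlast Ms @ [X]" using Ms by (metis append_butlast_last_id)
          show ?thesis
          proof (cases "butlast Ms = []")
            case True
            then have lens: "len ` set Ms = {len X}" using MX by (metis append_Nil image_empty image_insert list.simps(15) empty_set)
            have "F ~= []"
            proof
              assume "F = []"
              then have "is_zero X" using joint module_0[OF mX] by (force simp: is_zero_def)
              then show False using X by (simp add: indecomposable_def)
            qed
            then obtain Y f where Yf: "(Y, f) \<in> set F" by (metis list.set_sel(1) surj_pair)
            have "ichain Y [Y]" using Fp[OF Yf] by (simp add: ichain_def submodule_refl)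
            then have "len ` set [Y] \<in> chain_lengths quiver_Q Y" unfolding chain_lengths_iff by blast
            \<comment> \<open>Of two singletons the one with the smaller number is the larger set,
              and \<open>Y\<close> is shorter than \<open>X\<close>.\<close>
            moreover have "gr_less {len X} {len Y}" using Fp[OF Yf] unfolding gr_less_iff by auto
            ultimately show ?thesis using Yf lens by auto
          next
            case False
            define Ns where "Ns = butlast Ms"
            define Z where "Z = last Ns"
            have Ns: "Ns ~= []" "sorted_wrt psubm Ns" "\<forall>Z\<in>set Ns. indec Z" "last Ns = Z"
              using False Ms(2,3) MX unfolding Ns_def Z_def by (metis sorted_wrt_append, metis sorted_wrt_append, metis in_set_butlastD, simp)
            have ZX: "psubm Z X" using Ms(2) MX Ns(1) unfolding Z_def Ns_def
              by (metis last_in_set list.set_intros(1) sorted_wrt_append)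
            then have subZ: "subm Z X" by (simp add: proper_submodule_def)
            have iZ: "indec Z" using Ns by (metis last_in_set)
            have lens: "len ` set Ms = insert (len X) (len ` set Ns)" using MX unfolding Ns_def
              by (metis image_insert list.set(1) list.simps(15) set_append Un_insert_right sup_bot.right_neutral)
            have iNs: "ichain Z Ns"
            proof -
              have "subm Y Z" if "Y \<in> set Ns" for Y
              proof (cases "Y = Z")
                case False
                have "Ns = butlast Ns @ [Z]" using Ns by (metis append_butlast_last_id)
                then have "psubm Y Z" using Ns(2) that False by (metis UnE empty_iff empty_set list.set_intros(1) set_ConsD set_append sorted_wrt_append)
                then show ?thesis by (simp add: proper_submodule_def)
              qed (use iZ indec_module submodule_refl in blast)
              then show ?thesis using Ns by (simp add: ichain_def)
            qed
            have "\<exists>(Y, f)\<in>set F. qinj Z f \<or> (\<exists>C\<in>chain_lengths quiver_Q Y. gr_less (len ` set Ns) C)"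
            proof (rule less.hyps[OF _ Ns])
              have "length Ms = Suc (length Ns)" using MX unfolding Ns_def by (metis length_append_singleton)
              then show "length Ns + length F + (\<Sum>(Y, f)\<leftarrow>F. (len Y)\<^sup>2) < length Ms + length F + (\<Sum>(Y, f)\<leftarrow>F. (len Y)\<^sup>2)"
                by simp
              show "\<forall>(Y, f)\<in>set F. is_module quiver_Q Y & qhom quiver_Q Z Y f"
                using F qhom_restrict[OF subZ] by blast
              show "x = 0" if "x \<in> sp Z v" "\<forall>(Y, f)\<in>set F. f v x = 0" for v x
                by (rule joint[OF submodule_sp[OF subZ that(1)] that(2)])
            qed
            then obtain Y f where Yf: "(Y, f) \<in> set F"
              and alt: "qinj Z f \<or> (\<exists>C\<in>chain_lengths quiver_Q Y. gr_less (len ` set Ns) C)" by blast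
            note Y = Fp[OF Yf]
            from alt show ?thesis
            proof
              assume "\<exists>C\<in>chain_lengths quiver_Q Y. gr_less (len ` set Ns) C"
              then obtain C where C: "C \<in> chain_lengths quiver_Q Y" "gr_less (len ` set Ns) C" by blast
              \<comment> \<open>Going from \<open>Ns\<close> to \<open>Ms\<close> only adds
                \<open>len X\<close>, which exceeds every member of \<open>C\<close>.\<close>
              have "gr_less (len ` set Ms) C"
                unfolding lens by (rule gr_less_insert_left[OF C(2)]) (use chain_lengths_bound[OF C(1)] Y in fastforce)
              then show ?thesis using Yf C(1) by blast
            next
              assume inj: "qinj Z f"
              have hZ: "qhom quiver_Q Z Y f" using qhom_restrict[OF subZ] Y by blast
              have mZ: "is_module quiver_Q Z" by (rule indec_module[OF iZ])
              let ?I = "qimage quiver_Q Z Y f"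
              have I: "subm ?I Y" using qimage_submodule[OF mZ _ hZ] Y by blast
              have "?I ~= Y"
              proof
                assume "?I = Y"
                then have "\<exists>z\<in>sp Z v. f v z = y" if "y \<in> sp Y v" for v y
                  using that sp_qimage[of quiver_Q Z Y f v] by (metis imageE)
                then have "is_zero Z \<or> qinj X f" using dsum_kernel[OF X subZ _ _ inj] Y by blast
                then show False using Y iZ by (auto simp: indecomposable_def)
              qed
              then have pI: "psubm ?I Y" using I by (simp add: proper_submodule_def)
              have hZI: "qhom quiver_Q Z ?I f" by (rule qhom_corestrict[OF I hZ]) simp
              have mI: "is_module quiver_Q ?I" using I submodule_module by blast
              note tr = ichain_transport[OF mZ mI hZI inj iNs]
              have "ichain Y (map (\<lambda>Z. qimage quiver_Q Z ?I f) Ns @ [Y])"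
                using ichain_snoc[OF tr(1) pI] Y by blast
              then have C: "insert (len Y) (len ` set Ns) \<in> chain_lengths quiver_Q Y"
                unfolding chain_lengths_iff using tr(2)
                by (intro exI[of _ "map (\<lambda>Z. qimage quiver_Q Z ?I f) Ns @ [Y]"]) simp
              have "len Z < len Y" using proper_len[OF pI] len_qinj[OF mZ hZ inj] by simp
              then have lt: "k < len Y" if "k \<in> len ` set Ns" for k
                using that iNs len_mono[of quiver_Q _ Z] by (fastforce simp: ichain_def)
              \<comment> \<open>Both sets continue the lengths of \<open>Ns\<close>, one by
                \<open>len X\<close> and the other by the smaller \<open>len Y\<close>.\<close>
              have "gr_less (len ` set Ms) (insert (len Y) (len ` set Ns))"
                unfolding lens gr_less_iff using lt Y by (intro bexI[of _ "len Y"]) auto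
              then show ?thesis using Yf C by blast
            qed
          qed
        qed
      qed
    qed
  qed
qed

lemma ichain_last:
  assumes "ichain M Ms"
  shows "ichain (last Ms) Ms" "subm (last Ms) M" "indec (last Ms)"
proof -
  have Ms: "Ms ~= []" "sorted_wrt psubm Ms" "\<And>X. X \<in> set Ms ==> subm X M & indec X"
    using assms by (auto simp: ichain_def)
  show l: "subm (last Ms) M" "indec (last Ms)" using Ms last_in_set by blast+
  have "subm Y (last Ms)" if "Y \<in> set Ms" for Y
  proof (cases "Y = last Ms")
    case True
    then show ?thesis using l indec_module submodule_refl by metis
  next
    case False
    have eq: "Ms = butlast Ms @ [last Ms]" using Ms(1) by simp
    then have "Y \<in> set (butlast Ms)" using that False by (metis UnE empty_iff empty_set set_ConsD set_append)
    moreover have "sorted_wrt psubm (butlast Ms @ [last Ms])" using Ms(2) eq by simp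
    ultimately have "psubm Y (last Ms)" by (simp add: sorted_wrt_append)
    then show ?thesis by (simp add: proper_submodule_def)
  qed
  then show "ichain (last Ms) Ms" using Ms by (simp add: ichain_def)
qed

lemma ichain_cases:
  assumes "ichain M Ms"
  obtains Z where "psubm Z M" "indec Z" "ichain Z Ms"
  | "Ms = [M]"
  | Ns Z where "Ms = Ns @ [M]" "psubm Z M" "indec Z" "ichain Z Ns"
proof (cases "last Ms = M")
  case False
  then show ?thesis using that(1)[of "last Ms"] ichain_last[OF assms] by (simp add: proper_submodule_def)
next
  case True
  have Ms: "Ms ~= []" "sorted_wrt psubm Ms" "\<And>X. X \<in> set Ms ==> subm X M & indec X"
    using assms by (auto simp: ichain_def)
  have eq: "Ms = butlast Ms @ [M]" using Ms(1) True by (metis append_butlast_last_id)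
  show ?thesis
  proof (cases "butlast Ms = []")
    case True
    then show ?thesis using that(2) eq by simp
  next
    case False
    have "sorted_wrt psubm (butlast Ms @ [M])" using Ms(2) eq by simp
    then have so: "sorted_wrt psubm (butlast Ms)" "\<forall>X\<in>set (butlast Ms). psubm X M"
      by (simp_all add: sorted_wrt_append)
    then have "ichain M (butlast Ms)" using False Ms(3) by (auto simp: ichain_def dest: in_set_butlastD)
    then show ?thesis using that(3)[OF eq, of "last (butlast Ms)"] ichain_last so(2) False last_in_set by blast
  qed
qed

section \<open>The measure of an indecomposable module\<close>

lemma gr_measureI:
  assumes "I \<in> chain_lengths quiver_Q M" "\<And>J. J \<in> chain_lengths quiver_Q M ==> J = I \<or> gr_less J I"
  shows "\<mu> M = I"
  unfolding gr_measure_def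
proof (rule the_equality)
  show "I' = I" if I': "I' \<in> chain_lengths quiver_Q M & (\<forall>J\<in>chain_lengths quiver_Q M. J = I' \<or> gr_less J I')" for I'
  proof -
    have "I = I' \<or> gr_less I I'" "I' = I \<or> gr_less I' I" using I' assms by blast+
    then show ?thesis using gr_less_trans[of I I' I] gr_less_irrefl[of I] by blast
  qed
qed (use assms in blast)

lemma gr_measure_max:
  assumes "indec M"
  shows "\<mu> M \<in> chain_lengths quiver_Q M"
    and "J \<in> chain_lengths quiver_Q M ==> J = \<mu> M \<or> gr_less J (\<mu> M)"
proof -
  let ?A = "chain_lengths quiver_Q M"
  have "?A \<subseteq> Pow {..len M}" using chain_lengths_bound by blast
  then have fin: "finite ?A" by (rule finite_subset) simp
  have "ichain M [M]" using assms submodule_refl[OF indec_module[OF assms]] by (simp add: ichain_def)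
  then have "?A ~= {}" using chain_lengths_iff by blast
  then obtain I where I: "I \<in> ?A" "\<And>J. J \<in> ?A ==> J = I \<or> gr_less J I" using gr_max_exists[OF fin] by blast
  have eq: "\<mu> M = I" by (rule gr_measureI[OF I])
  show "\<mu> M \<in> ?A" using I(1) eq by simp
  show "J \<in> ?A ==> J = \<mu> M \<or> gr_less J (\<mu> M)" using I(2) eq by simp
qed

lemma gr_measure_bound: "indec M ==> k \<in> \<mu> M ==> k \<le> len M"
  using chain_lengths_bound gr_measure_max(1) by blast

text \<open>A chain with maximal lengths reaches the module itself, since appending the module would
  otherwise enlarge the set of lengths.\<close>

lemma len_in_gr_measure:
  assumes "indec M" shows "len M \<in> \<mu> M"
proof -
  obtain Ms where Ms: "ichain M Ms" "\<mu> M = len ` set Ms"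
    using gr_measure_max(1)[OF assms] chain_lengths_iff by blast
  show ?thesis
  proof (cases "last Ms = M")
    case True
    then show ?thesis using Ms by (auto simp: ichain_def)
  next
    case False
    then have p: "psubm (last Ms) M" using ichain_last[OF Ms(1)] by (simp add: proper_submodule_def)
    have "ichain M (Ms @ [M])" by (rule ichain_snoc[OF ichain_last(1)[OF Ms(1)] p assms])
    then have "len ` set (Ms @ [M]) \<in> chain_lengths quiver_Q M" using chain_lengths_iff by blast
    then have C: "insert (len M) (len ` set Ms) \<in> chain_lengths quiver_Q M" by simp
    have "gr_less (len ` set Ms) (insert (len M) (len ` set Ms))"
    proof (rule gr_less_insert_right)
      show "k < len M" if "k \<in> len ` set Ms" for k
        using that ichain_last(1)[OF Ms(1)] len_mono[of quiver_Q _ "last Ms"] proper_len[OF p]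
        by (fastforce simp: ichain_def)
    qed
    then show ?thesis using gr_measure_max(2)[OF assms C] Ms(2) gr_less_irrefl gr_less_trans by metis
  qed
qed

lemma gr_measure_mono:
  assumes "indec X" "indec Y" "qhom quiver_Q X Y f" "qinj X f"
  shows "\<mu> X = \<mu> Y \<or> gr_less (\<mu> X) (\<mu> Y)"
  using chain_lengths_transport[OF indec_module[OF assms(1)] indec_module[OF assms(2)] assms(3,4)]
    gr_measure_max(1)[OF assms(1)] gr_measure_max(2)[OF assms(2)] by blast

lemma gr_measure_iso:
  assumes "indec X" "indec Y" "qhom quiver_Q X Y f" "qinj X f" "\<And>v y. y \<in> sp Y v ==> \<exists>x\<in>sp X v. f v x = y"
  shows "\<mu> X = \<mu> Y"
proof -
  obtain g where "qhom quiver_Q Y X g" "qinj Y g" using qhom_inverse[OF indec_module[OF assms(1)] assms(3-5)] by blast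
  then show ?thesis using gr_measure_mono[OF assms(1-4)] gr_measure_mono[OF assms(2,1)] gr_less_trans gr_less_irrefl by metis
qed

text \<open>By \<open>H\<close> no proper indecomposable submodule has a larger measure than
  \<open>Y\<close>, so a best chain runs through a copy of \<open>Y\<close>. A Gabriel-Roiter
  submodule has the measure of \<open>Y\<close>, hence its length as the largest member, and the
  embedding into \<open>Y\<close> that \<open>H\<close> then supplies is bijective.\<close>

theorem gr_submodule_criterion:
  fixes M Y :: "(vertex, arrow, 'b, 'k::field) rep"
  assumes M: "indec M" and Y: "indec Y" and j: "qhom quiver_Q Y M j" "qinj Y j" and lt: "len Y < len M"
    and H: "\<And>X. psubm X M ==> indec X ==>
      gr_less (\<mu> X) (\<mu> Y) \<or> (\<exists>h. qhom quiver_Q X Y h & qinj X h)"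
  shows "\<mu> M = insert (len M) (\<mu> Y)"
    and "\<exists>X. gr_submodule quiver_Q X M"
    and "gr_submodule quiver_Q X M ==> isomorphic quiver_Q X Y"
proof -
  have mM: "is_module quiver_Q M" and mY: "is_module quiver_Q Y" using M Y indec_module by blast+
  define Y' where "Y' = qimage quiver_Q Y M j"
  have Y': "subm Y' M" unfolding Y'_def by (rule qimage_submodule[OF mY mM j(1)])
  have iY': "indec Y'" unfolding Y'_def by (rule indec_qimage[OF Y mM j])
  have jY': "qhom quiver_Q Y Y' j" by (rule qhom_corestrict[OF Y' j(1)]) (simp add: Y'_def)
  have pY': "psubm Y' M" using Y' lt len_qinj[OF mY j] by (simp add: proper_submodule_len Y'_def)
  have muY': "\<mu> Y' = \<mu> Y" using gr_measure_iso[OF Y iY' jY' j(2)] by (auto simp: Y'_def)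
  have leY: "C = \<mu> Y \<or> gr_less C (\<mu> Y)" if "psubm X M" "indec X" "C \<in> chain_lengths quiver_Q X" for X C
  proof -
    have "C = \<mu> X \<or> gr_less C (\<mu> X)" by (rule gr_measure_max(2)[OF that(2,3)])
    moreover have "\<mu> X = \<mu> Y \<or> gr_less (\<mu> X) (\<mu> Y)" using H[OF that(1,2)] gr_measure_mono[OF that(2) Y] by blast
    ultimately show ?thesis using gr_less_trans by metis
  qed
  have bd: "k < len M" if "k \<in> \<mu> Y" for k using gr_measure_bound[OF Y that] lt by simp
  show mu: "\<mu> M = insert (len M) (\<mu> Y)"
  proof (rule gr_measureI)
    obtain Ms where Ms: "ichain Y' Ms" "\<mu> Y' = len ` set Ms"
      using gr_measure_max(1)[OF iY'] chain_lengths_iff by blast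
    have "ichain M (Ms @ [M])" by (rule ichain_snoc[OF Ms(1) pY' M])
    then have "len ` set (Ms @ [M]) \<in> chain_lengths quiver_Q M" using chain_lengths_iff by blast
    then show "insert (len M) (\<mu> Y) \<in> chain_lengths quiver_Q M" using Ms(2) muY' by simp
    fix J assume "J \<in> chain_lengths quiver_Q M"
    then obtain Js where Js: "ichain M Js" "J = len ` set Js" using chain_lengths_iff by blast
    from Js(1) show "J = insert (len M) (\<mu> Y) \<or> gr_less J (insert (len M) (\<mu> Y))"
    proof (cases rule: ichain_cases)
      case (1 Z)
      then have "J \<in> chain_lengths quiver_Q Z" using Js(2) chain_lengths_iff by blast
      then have "J = \<mu> Y \<or> gr_less J (\<mu> Y)" using leY 1 by blast
      moreover have "gr_less (\<mu> Y) (insert (len M) (\<mu> Y))" by (rule gr_less_insert_right[OF bd])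
      ultimately show ?thesis using gr_less_trans by metis
    next
      case 2
      \<comment> \<open>The chain \<open>[M]\<close> is treated as a continuation of the empty set,
        the least element of the order.\<close>
      have "\<not> gr_less (\<mu> Y) {}" by (simp add: gr_less_iff)
      then have "gr_less {} (\<mu> Y)" using gr_less_total[of "{}" "\<mu> Y"] len_in_gr_measure[OF Y] by auto
      then have "gr_less {len M} (insert (len M) (\<mu> Y))" by (rule gr_less_insert_both[OF _ bd])
      then show ?thesis using 2 Js(2) by simp
    next
      case (3 Ns Z)
      then have "len ` set Ns \<in> chain_lengths quiver_Q Z" using chain_lengths_iff by blast
      then have "len ` set Ns = \<mu> Y \<or> gr_less (len ` set Ns) (\<mu> Y)" using leY 3 by blast
      moreover have "J = insert (len M) (len ` set Ns)" using Js(2) 3 by simp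
      ultimately show ?thesis using gr_less_insert_both[OF _ bd] by metis
    qed
  qed
  have ml: "mod_length quiver_Q M = len M" by (rule mod_length_len[OF mM])
  show "\<exists>X. gr_submodule quiver_Q X M"
    by (rule exI[of _ Y']) (simp add: gr_submodule_def M iY' pY' mu muY' ml)
  show "isomorphic quiver_Q X Y" if g: "gr_submodule quiver_Q X M"
  proof -
    have X: "indec X" "psubm X M" "insert (len M) (\<mu> X) = insert (len M) (\<mu> Y)"
      using g mu ml by (auto simp: gr_submodule_def)
    \<comment> \<open>\<open>len M\<close> occurs in neither measure and can therefore be cancelled
      from the equation.\<close>
    have "k < len M" if "k \<in> \<mu> X" for k using gr_measure_bound[OF X(1) that] proper_len[OF X(2)] by simp
    then have eq: "\<mu> X = \<mu> Y" using X(3) bd by (metis insert_ident less_irrefl)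
    then obtain h where h: "qhom quiver_Q X Y h" "qinj X h" using H[OF X(2,1)] gr_less_irrefl by metis
    have "len Y \<le> len X" using gr_measure_bound[OF X(1)] len_in_gr_measure[OF Y] eq by simp
    then show ?thesis
      using isomorphicI[OF indec_module[OF X(1)] h] qinj_surj[OF indec_module[OF X(1)] mY h] by blast
  qed
qed

section \<open>The inverse Coxeter functor\<close>

abbreviation "Qmod \<equiv> is_module quiver_Q"
abbreviation "Qhom \<equiv> qhom quiver_Q"

lemma qhom_Q_iff: "Qhom M N f \<longleftrightarrow>
    (\<forall>v. lin (sp M v) (f v)) & (\<forall>v. \<forall>x\<in>sp M v. f v x \<in> sp N v) &
    (\<forall>x\<in>sp M V1. f V2 (ma M x) = ma N (f V1 x)) &
    (\<forall>x\<in>sp M V2. f V3 (mb M x) = mb N (f V2 x)) &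
    (\<forall>x\<in>sp M V2. f V3 (mc M x) = mc N (f V2 x))"
  by (simp add: qhom_def all_arrow)

lemma qhom_Q_mp:
  assumes "Qhom M N f"
  shows "x \<in> sp M V1 ==> f V2 (ma M x) = ma N (f V1 x)"
    and "y \<in> sp M V2 ==> f V3 (mb M y) = mb N (f V2 y)"
    and "y \<in> sp M V2 ==> f V3 (mc M y) = mc N (f V2 y)"
  using assms by (auto simp: qhom_Q_iff)

lemma Qmod_mp:
  assumes "Qmod M"
  shows "x \<in> sp M V1 ==> ma M x \<in> sp M V2"
    and "y \<in> sp M V2 ==> mb M y \<in> sp M V3"
    and "y \<in> sp M V2 ==> mc M y \<in> sp M V3"
  using module_mp[OF assms, of _ A12] module_mp[OF assms, of _ A23] module_mp[OF assms, of _ B23] by auto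

lemma Qmod_lin:
  assumes "Qmod M"
  shows "lin (sp M V1) (ma M)" "lin (sp M V2) (mb M)" "lin (sp M V2) (mc M)"
  using module_lin[OF assms, of A12] module_lin[OF assms, of A23] module_lin[OF assms, of B23] by auto

text \<open>The second condition says that a submodule of the restriction to the vertices 2 and 3
  which is nonzero at 2 is larger at 3 than at 2. It makes the two arrows jointly injective and
  excludes the configurations that would create unwanted kernels in the transform. It speaks of all
  subspaces, not only of the whole space, because in this form it is inherited by the
  transform.\<close>

definition kgood :: "('b, 'k::field) qrep => bool" where
  "kgood A \<longleftrightarrow> (\<forall>x\<in>sp A V1. ma A x = 0 --> x = 0) &
     (\<forall>U. subsp U & U \<subseteq> sp A V2 & U ~= {0} -->
        vdim U < vdim {mb A u + mc A u' |u u'. u \<in> U & u' \<in> U})"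

lemma kgood_a: "kgood A ==> x \<in> sp A V1 ==> ma A x = 0 ==> x = 0"
  by (auto simp: kgood_def)

lemma kgoodD: "kgood A ==> subsp U ==> U \<subseteq> sp A V2 ==> U ~= {0} ==>
    vdim U < vdim {mb A u + mc A u' |u u'. u \<in> U & u' \<in> U}"
  by (auto simp: kgood_def)

lemma mp_span:
  assumes "Qmod A" "S \<subseteq> sp A V2" "finite S" "\<And>x. x \<in> S ==> mb A x \<in> T & mc A x \<in> T" "subsp T"
    "x \<in> vspan S"
  shows "x \<in> sp A V2 & mb A x \<in> T & mc A x \<in> T"
  using assms(6)
proof (induction rule: fun_vs.span_induct_alt)
  case base
  show ?case
    using module_0[OF assms(1), of V2] subsp_0[OF assms(5)] by (simp only: module_mp_0[OF assms(1)])
next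
  case (step c x y)
  have x: "x \<in> sp A V2" "vscale c x \<in> sp A V2" using step assms(2) module_scale[OF assms(1)] by blast+
  have t: "vscale c (mb A x) + mb A y \<in> T" "vscale c (mc A x) + mc A y \<in> T"
    using step assms(4) subsp_add[OF assms(5)] subsp_scale[OF assms(5)] by blast+
  then show ?case
    using x step module_add[OF assms(1), of "vscale c x" V2 y]
      lin_add[OF Qmod_lin(2)[OF assms(1)], of "vscale c x" y] lin_scale[OF Qmod_lin(2)[OF assms(1)], of x c]
      lin_add[OF Qmod_lin(3)[OF assms(1)], of "vscale c x" y] lin_scale[OF Qmod_lin(3)[OF assms(1)], of x c]
    by metis
qed

text \<open>A common zero of both arrows would span a line that generates nothing at 3.\<close>

lemma kgood_bc:
  assumes "kgood A" "Qmod A" "x \<in> sp A V2" "mb A x = 0" "mc A x = 0"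
  shows "x = 0"
proof (rule ccontr)
  assume "x ~= 0"
  let ?U = "vspan {x}"
  have U: "u \<in> sp A V2 & mb A u \<in> {0} & mc A u \<in> {0}" if "u \<in> ?U" for u
    by (rule mp_span[OF assms(2) _ _ _ _ that]) (use assms in auto)
  have "x \<in> ?U" by (rule fun_vs.span_base) simp
  then have "?U ~= {0}" using \<open>x ~= 0\<close> by blast
  moreover have "?U \<subseteq> sp A V2" using U by blast
  ultimately have lt: "vdim ?U < vdim {mb A u + mc A u' |u u'. u \<in> ?U & u' \<in> ?U}"
    using kgoodD[OF assms(1)] fun_vs.subspace_span by blast
  have "{mb A u + mc A u' |u u'. u \<in> ?U & u' \<in> ?U} \<subseteq> {0}" using U by auto
  then have "vdim {mb A u + mc A u' |u u'. u \<in> ?U & u' \<in> ?U} \<le> 0"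
    using fd_dim_mono[OF fd_zero, of "{mb A u + mc A u' |u u'. u \<in> ?U & u' \<in> ?U}"] by simp
  then show False using lt by simp
qed

text \<open>Excludes a Kronecker submodule with dimension vector \<open>(2, 1)\<close>.\<close>

lemma kgood_21:
  assumes "kgood A" "Qmod A" "x \<in> sp A V2" "y \<in> sp A V2"
    "mb A x = w" "mc A x = 0" "mb A y = 0" "mc A y = w"
  shows "w = 0"
proof -
  let ?U = "vspan {x, y}" and ?W = "vspan {w}"
  have U: "u \<in> sp A V2 & mb A u \<in> ?W & mc A u \<in> ?W" if "u \<in> ?U" for u
    by (rule mp_span[OF assms(2) _ _ _ _ that]) (use assms fun_vs.span_base[of w "{w}"] fun_vs.span_zero in auto)
  have UA: "?U \<subseteq> sp A V2" using U by blast
  have "?U = {0}"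
  proof (rule ccontr)
    assume nz: "?U ~= {0}"
    then have "vdim ?U < vdim {mb A u + mc A u' |u u'. u \<in> ?U & u' \<in> ?U}"
      using kgoodD[OF assms(1)] UA fun_vs.subspace_span by blast
    also have "\<dots> \<le> card {w}"
      by (rule fun_vs.dim_le_card) (use U fun_vs.span_add in blast)+
    finally have "vdim ?U = 0" by simp
    moreover have "findim ?U" unfolding finite_dimensional_def by (rule exI[of _ "{x, y}"]) simp
    ultimately show False using fd_dim_0 nz by blast
  qed
  then have "x = 0" using fun_vs.span_base[of x "{x, y}"] by blast
  then show ?thesis using assms(5) module_mp_0[OF assms(2)] by simp
qed

section \<open>The transform of a single module\<close>

lemma vpair_eq_0 [simp]: "vpair x y = 0 \<longleftrightarrow> x = (0 :: 'b => 'k::field) & y = 0"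
  using vpair_inject[of x y 0 0] by (simp only: vpair_linear(3))

text \<open>Linearity in the pair \<open>(w, w')\<close>, that is, a linear map on the product
  written in curried form; it is not bilinearity.\<close>

definition lin2 :: "('b => 'k::field) set => (('b => 'k) => ('b => 'k) => ('c => 'k)) => bool" where
  "lin2 S gm \<longleftrightarrow> (\<forall>w\<in>S. \<forall>w'\<in>S. \<forall>u\<in>S. \<forall>u'\<in>S. gm (w + u) (w' + u') = gm w w' + gm u u') &
     (\<forall>c. \<forall>w\<in>S. \<forall>w'\<in>S. gm (vscale c w) (vscale c w') = vscale c (gm w w'))"

lemma lin2_add: "lin2 S gm ==> w \<in> S ==> w' \<in> S ==> u \<in> S ==> u' \<in> S ==> gm (w + u) (w' + u') = gm w w' + gm u u'"
  and lin2_scale: "lin2 S gm ==> w \<in> S ==> w' \<in> S ==> gm (vscale c w) (vscale c w') = vscale c (gm w w')"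
  unfolding lin2_def by blast+

lemma lin2_vprod: "lin2 S gm ==> lin (vprod S S) (\<lambda>z. gm (vfst z) (vsnd z))"
  by (auto simp: lin2_def lin_def vprod_iff)

lemma lin2_compose:
  assumes "lin2 S gm" "lin T f" "lin T g" "\<And>x. x \<in> T ==> f x \<in> S" "\<And>x. x \<in> T ==> g x \<in> S"
  shows "lin T (\<lambda>x. gm (f x) (g x))"
  using assms unfolding lin2_def lin_def by simp

lemma lin2_0: "lin2 S gm ==> subsp S ==> gm 0 0 = 0"
  using lin2_scale[of S gm 0 0 0] subsp_0[of S] by simp

lemma lin2_diff:
  assumes "lin2 S gm" "subsp S" "w \<in> S" "w' \<in> S" "u \<in> S" "u' \<in> S"
  shows "gm (w - u) (w' - u') = gm w w' - gm u u'"
proof -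
  have "gm (w - u + u) (w' - u' + u') = gm (w - u) (w' - u') + gm u u'"
    by (rule lin2_add[OF assms(1)]) (use assms subsp_diff[OF assms(2)] in blast)+
  then show ?thesis by simp
qed

lemma lin2_split:
  assumes "lin2 S gm" "subsp S" "w \<in> S" "w' \<in> S"
  shows "gm w w' = gm w 0 + gm 0 w'"
  using lin2_add[OF assms(1), of w 0 0 w'] assms subsp_0[OF assms(2)] by simp

text \<open>\<open>N\<close> is the inverse Coxeter transform of \<open>A\<close>: by \<open>gm\<close>, \<open>N\<^sub>2\<close> is \<open>A\<^sub>3 \<times> A\<^sub>3\<close> modulo \<open>A\<^sub>1\<close>, the space
  \<open>N\<^sub>1\<close> is the image of \<open>A\<^sub>2\<close> in \<open>N\<^sub>2\<close>, and \<open>N\<^sub>3\<close> is \<open>N\<^sub>2 \<times> N\<^sub>2\<close> modulo \<open>A\<^sub>3\<close>.\<close>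

locale cox =
  fixes A :: "('b, 'k::field) qrep" and N :: "('c, 'k) qrep"
    and gm :: "('b => 'k) => ('b => 'k) => ('c => 'k)"
  assumes A: "Qmod A" and N: "Qmod N" and good: "kgood A"
    and gm_in: "\<And>w w'. w \<in> sp A V3 ==> w' \<in> sp A V3 ==> gm w w' \<in> sp N V2"
    and gm_lin: "lin2 (sp A V3) gm"
    and gm_surj: "\<And>n. n \<in> sp N V2 ==> \<exists>w\<in>sp A V3. \<exists>w'\<in>sp A V3. n = gm w w'"
    and gm_0: "\<And>w w'. w \<in> sp A V3 ==> w' \<in> sp A V3 ==> gm w w' = 0 \<longleftrightarrow>
      (\<exists>x\<in>sp A V1. w = mb A (ma A x) & w' = mc A (ma A x))"
    and a_inj: "\<And>n. n \<in> sp N V1 ==> ma N n = 0 ==> n = 0"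
    and a_image: "\<And>y. (\<exists>n\<in>sp N V1. ma N n = y) \<longleftrightarrow> (\<exists>x\<in>sp A V2. y = gm (mb A x) (mc A x))"
    and N3_gen: "\<And>n. n \<in> sp N V3 ==> \<exists>m\<in>sp N V2. \<exists>m'\<in>sp N V2. n = mb N m + mc N m'"
    and N3_rel: "\<And>m m'. m \<in> sp N V2 ==> m' \<in> sp N V2 ==> mb N m + mc N m' = 0 \<longleftrightarrow>
      (\<exists>w\<in>sp A V3. m = gm w 0 & m' = gm 0 w)"
begin

lemmas A_sub = module_subspace[OF A] and N_sub = module_subspace[OF N]
lemmas A_0 [simp] = module_0[OF A] and N_0 [simp] = module_0[OF N]
lemmas A_mp [simp] = Qmod_mp[OF A] and N_mp [simp] = Qmod_mp[OF N]

text \<open>The two equations yield \<open>ma A x\<close> and \<open>ma A y\<close> on which the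
  arrows take the values \<open>(w, 0)\<close> and \<open>(0, w)\<close>, the configuration that
  \<open>kgood_21\<close> excludes.\<close>

lemma gm_inj:
  assumes "w \<in> sp A V3" "gm w 0 = 0" "gm 0 w = 0"
  shows "w = 0"
proof -
  obtain x where x: "x \<in> sp A V1" "w = mb A (ma A x)" "0 = mc A (ma A x)"
    using gm_0[of w 0] assms by auto
  obtain y where y: "y \<in> sp A V1" "0 = mb A (ma A y)" "w = mc A (ma A y)"
    using gm_0[of 0 w] assms by auto
  show ?thesis by (rule kgood_21[OF good A, of "ma A x" "ma A y"]) (use x y in auto)
qed

lemma bc_inj: "x \<in> sp A V2 ==> mb A x = 0 ==> mc A x = 0 ==> x = 0"
  by (rule kgood_bc[OF good A])

lemma bc_eq:
  assumes "x \<in> sp A V2" "y \<in> sp A V2" "mb A x = mb A y" "mc A x = mc A y"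
  shows "x = y"
proof -
  have "x - y = 0"
    by (rule bc_inj) (use assms subsp_diff[OF A_sub] lin_diff[OF Qmod_lin(2)[OF A] A_sub]
      lin_diff[OF Qmod_lin(3)[OF A] A_sub] in auto)
  then show ?thesis by simp
qed

lemma aN_eq: "n \<in> sp N V1 ==> m \<in> sp N V1 ==> ma N n = ma N m ==> n = m"
  using a_inj[of "n - m"] subsp_diff[OF N_sub, of n V1 m] lin_diff[OF Qmod_lin(1)[OF N] N_sub, of n m] by simp

lemma gm_bc_lin: "lin (sp A V2) (\<lambda>x. gm (mb A x) (mc A x))"
  by (rule lin2_compose[OF gm_lin Qmod_lin(2,3)[OF A]]) auto

lemma gm_eq:
  assumes "w \<in> sp A V3" "w' \<in> sp A V3" "u \<in> sp A V3" "u' \<in> sp A V3" "gm w w' = gm u u'"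
  shows "\<exists>x\<in>sp A V1. w - u = mb A (ma A x) & w' - u' = mc A (ma A x)"
  using gm_0[of "w - u" "w' - u'"] lin2_diff[OF gm_lin A_sub assms(1-4)] subsp_diff[OF A_sub] assms by simp

lemma gm_a0: "x \<in> sp A V1 ==> gm (mb A (ma A x)) (mc A (ma A x)) = 0"
  using gm_0[of "mb A (ma A x)" "mc A (ma A x)"] by auto

lemma N3_lin: "lin (vprod (sp N V2) (sp N V2)) (\<lambda>z. mb N (vfst z) + mc N (vsnd z))"
  unfolding lin_def
  by (auto simp: vprod_iff lin_add[OF Qmod_lin(2)[OF N]] lin_add[OF Qmod_lin(3)[OF N]]
      lin_scale[OF Qmod_lin(2)[OF N]] lin_scale[OF Qmod_lin(3)[OF N]] fun_vs.scale_right_distrib algebra_simps)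

text \<open>On all pairs the kernel of \<open>gm\<close> is \<open>A\<^sub>1\<close>, embedded by
  the two paths from 1 to 3. The count inside a subspace \<open>W\<close> is what the inheritance of
  \<open>kgood\<close> uses.\<close>

lemma kernel_gm:
  assumes "subsp W" "W \<subseteq> sp A V3"
  shows "vdim {z \<in> vprod W W. gm (vfst z) (vsnd z) = 0} =
    vdim {x \<in> sp A V1. mb A (ma A x) \<in> W & mc A (ma A x) \<in> W}"
proof -
  let ?V = "{x \<in> sp A V1. mb A (ma A x) \<in> W & mc A (ma A x) \<in> W}"
  let ?f = "\<lambda>x. vpair (mb A (ma A x)) (mc A (ma A x))"
  have lba: "lin (sp A V1) (\<lambda>x. mb A (ma A x))" "lin (sp A V1) (\<lambda>x. mc A (ma A x))"
    by (rule lin_comp[OF Qmod_lin(1)[OF A] _ Qmod_lin(2)[OF A]], auto)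
      (rule lin_comp[OF Qmod_lin(1)[OF A] _ Qmod_lin(3)[OF A]], auto)
  have V: "subsp ?V"
    unfolding subsp_def
    using lin_add[OF lba(1)] lin_add[OF lba(2)] lin_scale[OF lba(1)] lin_scale[OF lba(2)] lin_0[OF lba(1) A_0] lin_0[OF lba(2) A_0]
      subsp_add[OF A_sub] subsp_scale[OF A_sub]
      subsp_add[OF assms(1)] subsp_scale[OF assms(1)] subsp_0[OF assms(1)] by auto
  have fdV: "findim ?V" by (rule fd_subset[OF module_fd[OF A] V]) auto
  have l: "lin ?V ?f"
    unfolding lin_def
    by (auto simp: lin_add[OF lba(1)] lin_add[OF lba(2)] lin_scale[OF lba(1)] lin_scale[OF lba(2)] vpair_linear)
  have "?f ` ?V = {z \<in> vprod W W. gm (vfst z) (vsnd z) = 0}"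
  proof (intro set_eqI iffI)
    fix z assume "z \<in> {z \<in> vprod W W. gm (vfst z) (vsnd z) = 0}"
    then have z: "vfst z \<in> W" "vsnd z \<in> W" "gm (vfst z) (vsnd z) = 0" by (auto simp: vprod_iff)
    then obtain x where x: "x \<in> sp A V1" "vfst z = mb A (ma A x)" "vsnd z = mc A (ma A x)"
      using gm_0[of "vfst z" "vsnd z"] assms(2) by blast
    then have "x \<in> ?V" "z = ?f x" using z vpair_sel(3)[of z] by auto
    then show "z \<in> ?f ` ?V" by blast
  qed (auto simp: vprod_iff gm_a0)
  moreover have "vdim (?f ` ?V) = vdim ?V"
  proof (rule dim_inj_image[OF fdV l])
    fix x assume x: "x \<in> ?V" "?f x = 0"
    then have "ma A x = 0" using bc_inj[of "ma A x"] by simp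
    then show "x = 0" using kgood_a[OF good] x by blast
  qed
  ultimately show ?thesis by simp
qed

text \<open>The relations of \<open>N\<^sub>3\<close> are the pairs \<open>(gm w 0, gm 0 w)\<close>,
  and \<open>gm_inj\<close> makes \<open>w\<close> unique. Again the count is made inside a
  subspace.\<close>

lemma kernel_N3:
  assumes "subsp U" "U \<subseteq> sp N V2"
  shows "subsp {w \<in> sp A V3. gm w 0 \<in> U & gm 0 w \<in> U}"
    and "vdim {z \<in> vprod U U. mb N (vfst z) + mc N (vsnd z) = 0} =
    vdim {w \<in> sp A V3. gm w 0 \<in> U & gm 0 w \<in> U}"
proof -
  let ?W = "{w \<in> sp A V3. gm w 0 \<in> U & gm 0 w \<in> U}"
  let ?f = "\<lambda>w. vpair (gm w 0) (gm 0 w)"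
  have lg: "lin (sp A V3) (\<lambda>w. gm w 0)" "lin (sp A V3) (\<lambda>w. gm 0 w)"
    by (rule lin2_compose[OF gm_lin]; auto simp: lin_def)+
  show W: "subsp ?W"
    unfolding subsp_def
    using lin_add[OF lg(1)] lin_add[OF lg(2)] lin_scale[OF lg(1)] lin_scale[OF lg(2)] lin_0[OF lg(1) A_0] lin_0[OF lg(2) A_0]
      subsp_add[OF A_sub] subsp_scale[OF A_sub]
      subsp_add[OF assms(1)] subsp_scale[OF assms(1)] subsp_0[OF assms(1)] by auto
  have fdW: "findim ?W" by (rule fd_subset[OF module_fd[OF A] W]) auto
  have l: "lin ?W ?f"
    unfolding lin_def
    by (auto simp: lin_add[OF lg(1)] lin_add[OF lg(2)] lin_scale[OF lg(1)] lin_scale[OF lg(2)] vpair_linear)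
  have "?f ` ?W = {z \<in> vprod U U. mb N (vfst z) + mc N (vsnd z) = 0}"
  proof (intro set_eqI iffI)
    fix z assume "z \<in> {z \<in> vprod U U. mb N (vfst z) + mc N (vsnd z) = 0}"
    then have z: "vfst z \<in> U" "vsnd z \<in> U" "mb N (vfst z) + mc N (vsnd z) = 0" by (auto simp: vprod_iff)
    then obtain w where w: "w \<in> sp A V3" "vfst z = gm w 0" "vsnd z = gm 0 w"
      using N3_rel[of "vfst z" "vsnd z"] assms(2) by blast
    then have "w \<in> ?W" "z = ?f w" using z vpair_sel(3)[of z] by auto
    then show "z \<in> ?f ` ?W" by blast
  next
    fix z assume "z \<in> ?f ` ?W"
    then obtain w where w: "w \<in> ?W" "z = ?f w" by blast
    then have "mb N (gm w 0) + mc N (gm 0 w) = 0" using N3_rel[of "gm w 0" "gm 0 w"] gm_in by auto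
    then show "z \<in> {z \<in> vprod U U. mb N (vfst z) + mc N (vsnd z) = 0}" using w by (simp add: vprod_iff)
  qed
  moreover have "vdim (?f ` ?W) = vdim ?W"
  proof (rule dim_inj_image[OF fdW l])
    fix w assume w: "w \<in> ?W" "?f w = 0"
    then show "w = 0" using gm_inj by simp
  qed
  ultimately show "vdim {z \<in> vprod U U. mb N (vfst z) + mc N (vsnd z) = 0} = vdim ?W" by simp
qed

text \<open>Rank formula for \<open>A\<^sub>3 \<times> A\<^sub>3 -> N\<^sub>2\<close> with kernel
  \<open>A\<^sub>1\<close>. Together with the counts for \<open>A\<^sub>2 -> N\<^sub>1\<close>, with
  kernel \<open>A\<^sub>1\<close>, and for \<open>N\<^sub>2 \<times> N\<^sub>2 -> N\<^sub>3\<close>,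
  with kernel \<open>A\<^sub>3\<close>, it gives the action of the inverse Coxeter transformation on
  dimension vectors.\<close>

lemma dim_V2: "vdim (sp N V2) + vdim (sp A V1) = 2 * vdim (sp A V3)"
proof -
  let ?g = "\<lambda>z. gm (vfst z) (vsnd z)"
  have "?g ` vprod (sp A V3) (sp A V3) = sp N V2"
  proof (intro set_eqI iffI)
    fix n assume "n \<in> sp N V2"
    then obtain w w' where w: "w \<in> sp A V3" "w' \<in> sp A V3" "n = gm w w'" using gm_surj by blast
    show "n \<in> ?g ` vprod (sp A V3) (sp A V3)" by (rule image_eqI[of _ _ "vpair w w'"]) (use w in \<open>auto simp: vprod_iff\<close>)
  qed (auto simp: vprod_iff gm_in)
  moreover have "{x \<in> sp A V1. mb A (ma A x) \<in> sp A V3 & mc A (ma A x) \<in> sp A V3} = sp A V1" by auto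
  ultimately show ?thesis
    using rank_nullity[OF vprod_fd[OF module_fd[OF A] module_fd[OF A]] lin2_vprod[OF gm_lin]]
      kernel_gm[OF A_sub order_refl] vprod_dim[OF module_fd[OF A] module_fd[OF A], of V3 V3] by simp
qed

lemma dim_V1: "vdim (sp N V1) + vdim (sp A V1) = vdim (sp A V2)"
proof -
  let ?g = "\<lambda>x. gm (mb A x) (mc A x)"
  have "?g ` sp A V2 = ma N ` sp N V1"
  proof (rule set_eqI)
    fix y show "y \<in> ?g ` sp A V2 \<longleftrightarrow> y \<in> ma N ` sp N V1"
      using a_image[of y] unfolding image_iff by metis
  qed
  then have "vdim (?g ` sp A V2) = vdim (sp N V1)"
    using dim_inj_image[OF module_fd[OF N] Qmod_lin(1)[OF N] a_inj] by simp
  moreover have "{x \<in> sp A V2. ?g x = 0} = ma A ` sp A V1"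
  proof (intro set_eqI iffI)
    fix x assume x: "x \<in> {x \<in> sp A V2. ?g x = 0}"
    then obtain y where "y \<in> sp A V1" "mb A x = mb A (ma A y)" "mc A x = mc A (ma A y)"
      using gm_0[of "mb A x" "mc A x"] by auto
    then show "x \<in> ma A ` sp A V1" using bc_eq[of x "ma A y"] x by auto
  qed (auto simp: gm_a0)
  moreover have "vdim (ma A ` sp A V1) = vdim (sp A V1)"
    using dim_inj_image[OF module_fd[OF A] Qmod_lin(1)[OF A] kgood_a[OF good]] by simp
  ultimately show ?thesis using rank_nullity[OF module_fd[OF A] gm_bc_lin] by simp
qed

lemma dim_V3: "vdim (sp N V3) + vdim (sp A V3) = 2 * vdim (sp N V2)"
proof -
  let ?g = "\<lambda>z. mb N (vfst z) + mc N (vsnd z)"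
  have "?g ` vprod (sp N V2) (sp N V2) = sp N V3"
  proof (intro set_eqI iffI)
    fix n assume "n \<in> sp N V3"
    then obtain w w' where w: "w \<in> sp N V2" "w' \<in> sp N V2" "n = mb N w + mc N w'" using N3_gen by blast
    show "n \<in> ?g ` vprod (sp N V2) (sp N V2)" by (rule image_eqI[of _ _ "vpair w w'"]) (use w in \<open>auto simp: vprod_iff\<close>)
  qed (auto simp: vprod_iff intro: subsp_add[OF N_sub])
  moreover have "{w \<in> sp A V3. gm w 0 \<in> sp N V2 & gm 0 w \<in> sp N V2} = sp A V3" using gm_in by auto
  ultimately show ?thesis
    using rank_nullity[OF vprod_fd[OF module_fd[OF N] module_fd[OF N]] N3_lin]
      kernel_N3[OF N_sub order_refl] vprod_dim[OF module_fd[OF N] module_fd[OF N], of V2 V2] by simp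
qed

text \<open>A subspace \<open>U\<close> violating the condition in \<open>N\<close> pulls back to a subspace \<open>W\<close> of \<open>A\<^sub>3\<close> and
  further to a subspace \<open>V\<close> of \<open>A\<^sub>1\<close> of at least the same dimension, violating it in \<open>A\<close>.\<close>

lemma kgood_N: "kgood N"
  unfolding kgood_def
proof (intro conjI allI ballI impI)
  show "ma N x = 0 ==> x = 0" if "x \<in> sp N V1" for x using a_inj that by blast
  fix U assume "subsp U & U \<subseteq> sp N V2 & U ~= {0}"
  then have U: "subsp U" "U \<subseteq> sp N V2" "U ~= {0}" by auto
  have fdU: "findim U" by (rule fd_subset[OF module_fd[OF N] U(1,2)])
  let ?g = "\<lambda>z. mb N (vfst z) + mc N (vsnd z)"
  let ?I = "{mb N u + mc N u' |u u'. u \<in> U & u' \<in> U}"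
  have im: "?g ` vprod U U = ?I"
  proof (intro set_eqI iffI)
    fix n assume "n \<in> ?I"
    then obtain w w' where w: "w \<in> U" "w' \<in> U" "n = mb N w + mc N w'" by blast
    show "n \<in> ?g ` vprod U U" by (rule image_eqI[of _ _ "vpair w w'"]) (use w in \<open>auto simp: vprod_iff\<close>)
  next
    fix n assume "n \<in> ?g ` vprod U U"
    then obtain z where "vfst z \<in> U" "vsnd z \<in> U" "n = ?g z" by (auto simp: vprod_iff)
    then show "n \<in> ?I" by blast
  qed
  show "vdim U < vdim ?I"
  proof (rule ccontr)
    assume "\<not> vdim U < vdim ?I"
    then have le: "vdim ?I \<le> vdim U" by simp
    define W where "W = {w \<in> sp A V3. gm w 0 \<in> U & gm 0 w \<in> U}"
    have W: "subsp W" "W \<subseteq> sp A V3" using kernel_N3(1)[OF U(1,2)] by (auto simp: W_def)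
    have fdW: "findim W" by (rule fd_subset[OF module_fd[OF A] W])
    have "vprod U U \<subseteq> vprod (sp N V2) (sp N V2)" using U(2) by (auto simp: vprod_iff)
    then have l: "lin (vprod U U) ?g" using lin_subset[OF N3_lin] by blast
    \<comment> \<open>By the rank formula \<open>2 * vdim U\<close> equals
      \<open>vdim W + vdim ?I\<close>, and \<open>vdim ?I\<close> is at most \<open>vdim U\<close>
      by assumption.\<close>
    have 1: "vdim U \<le> vdim W"
      using rank_nullity[OF vprod_fd[OF fdU fdU] l] kernel_N3(2)[OF U(1,2)] vprod_dim[OF fdU fdU] im le
      by (simp add: W_def)
    define V where "V = {x \<in> sp A V1. mb A (ma A x) \<in> W & mc A (ma A x) \<in> W}"
    let ?h = "\<lambda>z. gm (vfst z) (vsnd z)"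
    have "vprod W W \<subseteq> vprod (sp A V3) (sp A V3)" using W(2) by (auto simp: vprod_iff)
    then have lh: "lin (vprod W W) ?h" using lin_subset[OF lin2_vprod[OF gm_lin]] by blast
    have "?h ` vprod W W \<subseteq> U"
    proof
      fix n assume "n \<in> ?h ` vprod W W"
      then obtain w w' where w: "w \<in> W" "w' \<in> W" "n = gm w w'" by (auto simp: vprod_iff)
      then have "n = gm w 0 + gm 0 w'" using lin2_split[OF gm_lin A_sub, of w w'] by (simp add: W_def)
      then show "n \<in> U" using w subsp_add[OF U(1)] by (auto simp: W_def)
    qed
    then have "vdim (?h ` vprod W W) \<le> vdim U" by (rule fd_dim_mono[OF fdU])
    \<comment> \<open>The same count for \<open>gm\<close> on pairs from \<open>W\<close>: the image
      lies in \<open>U\<close>, which is no larger than \<open>W\<close>.\<close>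
    then have 2: "vdim W \<le> vdim V"
      using rank_nullity[OF vprod_fd[OF fdW fdW] lh] kernel_gm[OF W] vprod_dim[OF fdW fdW] 1 by (simp add: V_def)
    have lba: "lin (sp A V1) (\<lambda>x. mb A (ma A x))" "lin (sp A V1) (\<lambda>x. mc A (ma A x))"
      by (rule lin_comp[OF Qmod_lin(1)[OF A] _ Qmod_lin(2)[OF A]], auto)
        (rule lin_comp[OF Qmod_lin(1)[OF A] _ Qmod_lin(3)[OF A]], auto)
    have sV: "subsp V"
      unfolding subsp_def V_def
      using lin_add[OF lba(1)] lin_add[OF lba(2)] lin_scale[OF lba(1)] lin_scale[OF lba(2)] lin_0[OF lba(1) A_0] lin_0[OF lba(2) A_0]
        subsp_add[OF A_sub] subsp_scale[OF A_sub]
        subsp_add[OF W(1)] subsp_scale[OF W(1)] subsp_0[OF W(1)] by auto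
    have fdV: "findim V" by (rule fd_subset[OF module_fd[OF A] sV]) (auto simp: V_def)
    have la: "lin V (ma A)" by (rule lin_subset[OF Qmod_lin(1)[OF A]]) (auto simp: V_def)
    let ?X = "ma A ` V"
    have dX: "vdim ?X = vdim V"
      by (rule dim_inj_image[OF fdV la]) (use kgood_a[OF good] in \<open>auto simp: V_def\<close>)
    have sX: "subsp ?X" by (rule lin_image_subspace[OF sV la])
    have XA: "?X \<subseteq> sp A V2" by (auto simp: V_def)
    \<comment> \<open>\<open>?X\<close> has the dimension of \<open>V\<close> but generates only a
      subspace of \<open>W\<close>; if it were nonzero, \<open>kgood\<close> for \<open>A\<close>
      would give \<open>vdim V < vdim W\<close>.\<close>
    have "?X = {0}"
    proof (rule ccontr)
      assume "?X ~= {0}"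
      then have "vdim ?X < vdim {mb A u + mc A u' |u u'. u \<in> ?X & u' \<in> ?X}"
        by (rule kgoodD[OF good sX XA])
      also have "\<dots> \<le> vdim W"
        by (rule fd_dim_mono[OF fdW]) (use subsp_add[OF W(1)] in \<open>auto simp: V_def\<close>)
      finally show False using dX 2 by simp
    qed
    then have "vdim U = 0" using dX 1 2 by simp
    then show False using fd_dim_0[OF fdU] U(3) by blast
  qed
qed

text \<open>\<open>N\<close> is a cokernel, so a homomorphism out of it amounts to a map
  \<open>\<psi>\<close> on pairs from \<open>A\<^sub>3\<close> with a lift \<open>\<phi>\<close> on
  \<open>A\<^sub>2\<close>. By \<open>c1\<close> and \<open>c2\<close>, \<open>\<psi>\<close>
  vanishes on the kernel of \<open>gm\<close>; by \<open>c2\<close>, \<open>\<phi>\<close> descends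
  to \<open>N\<^sub>1\<close>; \<open>c3\<close> is the relation under which the values on
  \<open>N\<^sub>2\<close> extend to \<open>N\<^sub>3\<close>.\<close>

lemma qhom_universal:
  fixes X :: "('d, 'k) qrep"
  assumes X: "Qmod X" and \<psi>: "lin2 (sp A V3) \<psi>" "\<And>w w'. w \<in> sp A V3 ==> w' \<in> sp A V3 ==> \<psi> w w' \<in> sp X V2"
    and \<phi>: "lin (sp A V2) \<phi>" "\<And>x. x \<in> sp A V2 ==> \<phi> x \<in> sp X V1"
    and c1: "\<And>x. x \<in> sp A V2 ==> ma X (\<phi> x) = \<psi> (mb A x) (mc A x)"
    and c2: "\<And>x. x \<in> sp A V1 ==> \<phi> (ma A x) = 0"
    and c3: "\<And>w. w \<in> sp A V3 ==> mb X (\<psi> w 0) + mc X (\<psi> 0 w) = 0"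
  shows "\<exists>F. Qhom N X F & (\<forall>w\<in>sp A V3. \<forall>w'\<in>sp A V3. F V2 (gm w w') = \<psi> w w') &
    (\<forall>n\<in>sp N V1. \<forall>x\<in>sp A V2. ma N n = gm (mb A x) (mc A x) --> F V1 n = \<phi> x)"
proof -
  \<comment> \<open>Pairs with the same image differ by a pair from \<open>A\<^sub>1\<close>, on
    which \<open>c1\<close> and \<open>c2\<close> give zero.\<close>
  have wd: "\<psi> w w' = \<psi> u u'" if *: "w \<in> sp A V3" "w' \<in> sp A V3" "u \<in> sp A V3" "u' \<in> sp A V3" "gm w w' = gm u u'" for w w' u u'
  proof -
    obtain x where x: "x \<in> sp A V1" "w - u = mb A (ma A x)" "w' - u' = mc A (ma A x)"
      using gm_eq[OF *] by blast
    have "\<psi> (w - u) (w' - u') = ma X (\<phi> (ma A x))" using x c1 by simp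
    then have "\<psi> w w' - \<psi> u u' = ma X (\<phi> (ma A x))"
      using lin2_diff[OF \<psi>(1) A_sub that(1-4)] by simp
    then show ?thesis using c2[OF x(1)] module_mp_0[OF X] by simp
  qed
  let ?R2 = "\<lambda>n y. \<exists>w\<in>sp A V3. \<exists>w'\<in>sp A V3. n = gm w w' & y = \<psi> w w'"
  have "\<exists>f. lin (sp N V2) f & (\<forall>n\<in>sp N V2. ?R2 n (f n))"
  proof (rule lin_select[OF N_sub])
    fix n y n' y' assume "?R2 n y" "?R2 n' y'"
    then obtain w w' u u' where w: "w \<in> sp A V3" "w' \<in> sp A V3" "u \<in> sp A V3" "u' \<in> sp A V3"
      "n = gm w w'" "y = \<psi> w w'" "n' = gm u u'" "y' = \<psi> u u'" by blast
    then show "?R2 (n + n') (y + y')"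
      using lin2_add[OF gm_lin w(1-4)] lin2_add[OF \<psi>(1) w(1-4)] subsp_add[OF A_sub]
      by (intro bexI[of _ "w + u"] bexI[of _ "w' + u'"]) auto
  next
    fix c n y assume "?R2 n y"
    then obtain w w' where w: "w \<in> sp A V3" "w' \<in> sp A V3" "n = gm w w'" "y = \<psi> w w'" by blast
    then show "?R2 (vscale c n) (vscale c y)"
      using lin2_scale[OF gm_lin w(1,2)] lin2_scale[OF \<psi>(1) w(1,2)] subsp_scale[OF A_sub]
      by (intro bexI[of _ "vscale c w"] bexI[of _ "vscale c w'"]) auto
  qed (use gm_surj in blast)
  then obtain F2 where F2: "lin (sp N V2) F2" "\<And>n. n \<in> sp N V2 ==> ?R2 n (F2 n)" by blast
  have F2gm: "F2 (gm w w') = \<psi> w w'" if *: "w \<in> sp A V3" "w' \<in> sp A V3" for w w'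
  proof -
    obtain u u' where "u \<in> sp A V3" "u' \<in> sp A V3" "gm w w' = gm u u'" "F2 (gm w w') = \<psi> u u'"
      using F2(2)[OF gm_in[OF *]] by blast
    then show ?thesis using wd[OF *, of u u'] by simp
  qed
  have F2X: "F2 n \<in> sp X V2" if "n \<in> sp N V2" for n
    using F2(2)[OF that] \<psi>(2) by auto
  let ?R1 = "\<lambda>n y. n \<in> sp N V1 & (\<exists>x\<in>sp A V2. ma N n = gm (mb A x) (mc A x) & y = \<phi> x)"
  \<comment> \<open>By joint injectivity of the arrows, two representatives of an element of
    \<open>N\<^sub>1\<close> differ by some \<open>ma A t\<close>, which \<open>\<phi>\<close>
    kills.\<close>
  have wd1: "\<phi> x = \<phi> x'" if *: "x \<in> sp A V2" "x' \<in> sp A V2"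
      "gm (mb A x) (mc A x) = gm (mb A x') (mc A x')" for x x'
  proof -
    have "x - x' \<in> sp A V2" by (rule subsp_diff[OF A_sub that(1,2)])
    moreover obtain t where t: "t \<in> sp A V1" "mb A (x - x') = mb A (ma A t)" "mc A (x - x') = mc A (ma A t)"
      using gm_eq[OF _ _ _ _ *(3)] *(1,2) lin_diff[OF Qmod_lin(2)[OF A] A_sub *(1,2)] lin_diff[OF Qmod_lin(3)[OF A] A_sub *(1,2)]
      by auto
    ultimately have "x - x' = ma A t" using bc_eq[of "x - x'" "ma A t"] by simp
    then have "\<phi> (x - x') = 0" using c2[OF t(1)] by simp
    then show ?thesis using lin_diff[OF \<phi>(1) A_sub that(1,2)] by simp
  qed
  have "\<exists>f. lin (sp N V1) f & (\<forall>n\<in>sp N V1. ?R1 n (f n))"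
  proof (rule lin_select[OF N_sub])
    fix n y n' y' assume "?R1 n y" "?R1 n' y'"
    then obtain x x' where x: "n \<in> sp N V1" "n' \<in> sp N V1" "x \<in> sp A V2" "x' \<in> sp A V2"
      "ma N n = gm (mb A x) (mc A x)" "y = \<phi> x" "ma N n' = gm (mb A x') (mc A x')" "y' = \<phi> x'" by blast
    have "ma N (n + n') = gm (mb A (x + x')) (mc A (x + x'))"
      using lin_add[OF gm_bc_lin x(3,4)] lin_add[OF Qmod_lin(1)[OF N] x(1,2)] x by simp
    moreover have "y + y' = \<phi> (x + x')" using lin_add[OF \<phi>(1) x(3,4)] x by simp
    ultimately show "?R1 (n + n') (y + y')" using x subsp_add[OF A_sub x(3,4)] subsp_add[OF N_sub x(1,2)] by blast
  next
    fix c n y assume "?R1 n y"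
    then obtain x where x: "n \<in> sp N V1" "x \<in> sp A V2" "ma N n = gm (mb A x) (mc A x)" "y = \<phi> x" by blast
    have "ma N (vscale c n) = gm (mb A (vscale c x)) (mc A (vscale c x))"
      using lin_scale[OF gm_bc_lin x(2)] lin_scale[OF Qmod_lin(1)[OF N] x(1)] x by simp
    moreover have "vscale c y = \<phi> (vscale c x)" using lin_scale[OF \<phi>(1) x(2)] x by simp
    ultimately show "?R1 (vscale c n) (vscale c y)"
      using x subsp_scale[OF A_sub x(2)] subsp_scale[OF N_sub x(1)] by blast
  next
    fix n assume n: "n \<in> sp N V1"
    then obtain x where "x \<in> sp A V2" "ma N n = gm (mb A x) (mc A x)" using a_image[of "ma N n"] by blast
    then show "\<exists>y. ?R1 n y" using n by blast
  qed
  then obtain F1 where F1: "lin (sp N V1) F1" "\<And>n. n \<in> sp N V1 ==> ?R1 n (F1 n)" by blast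
  have F1\<phi>: "F1 n = \<phi> x" if *: "n \<in> sp N V1" "x \<in> sp A V2" "ma N n = gm (mb A x) (mc A x)" for n x
  proof -
    obtain x' where "x' \<in> sp A V2" "ma N n = gm (mb A x') (mc A x')" "F1 n = \<phi> x'" using F1(2)[OF *(1)] by blast
    then show ?thesis using wd1[OF *(2), of x'] *(3) by simp
  qed
  have bl: "lin (vprod (sp N V2) (sp N V2)) (\<lambda>z. mb X (F2 (vfst z)) + mc X (F2 (vsnd z)))"
    unfolding lin_def
    by (auto simp: vprod_iff F2X lin_add[OF F2(1)] lin_scale[OF F2(1)] lin_add[OF Qmod_lin(2)[OF X]] lin_add[OF Qmod_lin(3)[OF X]]
      lin_scale[OF Qmod_lin(2)[OF X]] lin_scale[OF Qmod_lin(3)[OF X]] fun_vs.scale_right_distrib algebra_simps)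
  let ?p = "\<lambda>z. mb N (vfst z) + mc N (vsnd z)" and ?q = "\<lambda>z. mb X (F2 (vfst z)) + mc X (F2 (vsnd z))"
  let ?S = "vprod (sp N V2) (sp N V2)"
  have S: "subsp ?S" by (rule vprod_subspace[OF N_sub N_sub])
  let ?R3 = "\<lambda>n y. \<exists>z\<in>?S. n = ?p z & y = ?q z"
  have wd3: "?q z = ?q z'" if "z \<in> ?S" "z' \<in> ?S" "?p z = ?p z'" for z z'
  proof -
    have d: "z - z' \<in> ?S" by (rule subsp_diff[OF S that(1,2)])
    have "?p (z - z') = 0" using lin_diff[OF N3_lin S that(1,2)] that(3) by simp
    then obtain w where w: "w \<in> sp A V3" "vfst (z - z') = gm w 0" "vsnd (z - z') = gm 0 w"
      using N3_rel[of "vfst (z - z')" "vsnd (z - z')"] d by (auto simp: vprod_iff)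
    have "?q (z - z') = mb X (\<psi> w 0) + mc X (\<psi> 0 w)" using w F2gm by simp
    then show ?thesis using lin_diff[OF bl S that(1,2)] c3[OF w(1)] by simp
  qed
  have "\<exists>f. lin (sp N V3) f & (\<forall>n\<in>sp N V3. ?R3 n (f n))"
  proof (rule lin_select[OF N_sub])
    fix n y n' y' assume "?R3 n y" "?R3 n' y'"
    then obtain z z' where z: "z \<in> ?S" "z' \<in> ?S" "n = ?p z" "y = ?q z" "n' = ?p z'" "y' = ?q z'" by blast
    have "n + n' = ?p (z + z')" "y + y' = ?q (z + z')"
      using lin_add[OF N3_lin z(1,2)] lin_add[OF bl z(1,2)] z by simp_all
    then show "?R3 (n + n') (y + y')" using subsp_add[OF S z(1,2)] by blast
  next
    fix c n y assume "?R3 n y"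
    then obtain z where z: "z \<in> ?S" "n = ?p z" "y = ?q z" by blast
    have "vscale c n = ?p (vscale c z)" "vscale c y = ?q (vscale c z)"
      using lin_scale[OF N3_lin z(1)] lin_scale[OF bl z(1)] z by simp_all
    then show "?R3 (vscale c n) (vscale c y)" using subsp_scale[OF S z(1)] by blast
  next
    fix n assume "n \<in> sp N V3"
    then obtain m m' where "m \<in> sp N V2" "m' \<in> sp N V2" "n = mb N m + mc N m'" using N3_gen by blast
    then have "vpair m m' \<in> ?S" "n = ?p (vpair m m')" by (auto simp: vprod_iff)
    then show "\<exists>y. ?R3 n y" by blast
  qed
  then obtain F3 where F3: "lin (sp N V3) F3" "\<And>n. n \<in> sp N V3 ==> ?R3 n (F3 n)" by blast
  have F3p: "F3 (?p z) = ?q z" if "z \<in> ?S" for z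
  proof -
    have "?p z \<in> sp N V3" using that subsp_add[OF N_sub] by (auto simp: vprod_iff)
    then obtain z' where "z' \<in> ?S" "?p z = ?p z'" "F3 (?p z) = ?q z'" using F3(2) by blast
    then show ?thesis using wd3[OF that] by simp
  qed
  have F20: "F2 0 = 0" using lin_0[OF F2(1) N_0] .
  have F3b: "F3 (mb N m) = mb X (F2 m)" "F3 (mc N m) = mc X (F2 m)" if "m \<in> sp N V2" for m
    using F3p[of "vpair m 0"] F3p[of "vpair 0 m"] that by (simp_all add: vprod_iff module_mp_0[OF N] module_mp_0[OF X] F20)
  let ?F = "\<lambda>v. case v of V1 => F1 | V2 => F2 | V3 => F3"
  have "F3 n \<in> sp X V3" if "n \<in> sp N V3" for n
    using F3(2)[OF that] F2X Qmod_mp(2,3)[OF X] module_add[OF X] by (auto simp: vprod_iff)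
  moreover have "F1 n \<in> sp X V1" if "n \<in> sp N V1" for n using F1(2)[OF that] \<phi>(2) by auto
  moreover have "F2 (ma N n) = ma X (F1 n)" if n: "n \<in> sp N V1" for n
  proof -
    obtain x where "x \<in> sp A V2" "ma N n = gm (mb A x) (mc A x)" "F1 n = \<phi> x" using F1(2)[OF n] by blast
    then show ?thesis using F2gm c1 by simp
  qed
  ultimately have "Qhom N X ?F"
    using F1(1) F2(1) F3(1) F2X F3b unfolding qhom_Q_iff all_vertex by simp
  then show ?thesis using F2gm F1\<phi> by (intro exI[of _ ?F]) simp
qed

text \<open>\<open>N\<^sub>3\<close> is generated from \<open>N\<^sub>2\<close>, and the component
  at 1 is detected at 2 by the injective map of \<open>X\<close>. So homomorphisms from
  \<open>N\<close> to such an \<open>X\<close> are determined at the vertex 2.\<close>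

lemma qhom_zero_V2:
  assumes X: "Qmod X" and G: "Qhom N X G" "\<And>n. n \<in> sp N V2 ==> G V2 n = 0"
    and inj: "\<And>x. x \<in> sp X V1 ==> ma X x = 0 ==> x = 0"
  shows "qzero N G"
  unfolding qzero_def all_vertex
proof (intro conjI ballI)
  show "G V1 x = 0" if "x \<in> sp N V1" for x
    using inj[OF qhom_sp[OF G(1) that]] qhom_Q_mp(1)[OF G(1) that] G(2)[OF N_mp(1)[OF that]] by simp
  show "G V2 x = 0" if "x \<in> sp N V2" for x using G(2) that .
  show "G V3 x = 0" if x: "x \<in> sp N V3" for x
  proof -
    obtain m m' where m: "m \<in> sp N V2" "m' \<in> sp N V2" "x = mb N m + mc N m'" using N3_gen[OF x] by blast
    then have "G V3 x = G V3 (mb N m) + G V3 (mc N m')" using qhom_plus[OF G(1)] by simp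
    then show ?thesis using m qhom_Q_mp(2,3)[OF G(1)] G(2) module_mp_0[OF X] by simp
  qed
qed

end

text \<open>Expresses that \<open>G\<close> is the transform of \<open>F\<close>. Only the vertex 2
  is mentioned because homomorphisms between transforms are determined there.\<close>

definition induced :: "('b, 'k::field) qrep => (('b => 'k) => ('b => 'k) => ('c => 'k)) =>
    (('d => 'k) => ('d => 'k) => ('e => 'k)) => (vertex => ('b => 'k) => ('d => 'k)) =>
    (vertex => ('c => 'k) => ('e => 'k)) => bool" where
  "induced A gm gm' F G \<longleftrightarrow> (\<forall>w\<in>sp A V3. \<forall>w'\<in>sp A V3. G V2 (gm w w') = gm' (F V3 w) (F V3 w'))"

lemma inducedD: "induced A gm gm' F G ==> w \<in> sp A V3 ==> w' \<in> sp A V3 ==> G V2 (gm w w') = gm' (F V3 w) (F V3 w')"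
  by (simp add: induced_def)

lemma induced_comp:
  assumes "induced A gm gm' F G" "induced B gm' gm'' F' G'" "Qhom A B F"
  shows "induced A gm gm'' (\<lambda>v x. F' v (F v x)) (\<lambda>v x. G' v (G v x))"
  unfolding induced_def
  using inducedD[OF assms(1)] inducedD[OF assms(2)] qhom_sp[OF assms(3)] by simp

locale cox_pair = A: cox A N gm + B: cox B N' gm'
  for A :: "('b, 'k::field) qrep" and N :: "('c, 'k) qrep" and gm
    and B :: "('d, 'k) qrep" and N' :: "('e, 'k) qrep" and gm'
begin

text \<open>The universal property of \<open>N\<close> is applied to \<open>gm'\<close> composed
  with \<open>F\<close>; at the vertex 1 this takes a linear choice of preimages in
  \<open>N'\<^sub>1\<close>.\<close>

lemma induced_exists:
  assumes F: "Qhom A B F"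
  shows "\<exists>G. Qhom N N' G & induced A gm gm' F G"
proof -
  have FV: "\<And>v x. x \<in> sp A v ==> F v x \<in> sp B v" using qhom_sp[OF F] by blast
  let ?R = "\<lambda>x n. x \<in> sp A V2 & n \<in> sp N' V1 & ma N' n = gm' (mb B (F V2 x)) (mc B (F V2 x))"
  have lbc: "lin (sp A V2) (\<lambda>x. gm' (mb B (F V2 x)) (mc B (F V2 x)))"
    by (rule lin_comp[OF qhom_lin[OF F] _ B.gm_bc_lin]) (use FV in auto)
  have "\<exists>\<phi>. lin (sp A V2) \<phi> & (\<forall>x\<in>sp A V2. ?R x (\<phi> x))"
  proof (rule lin_select[OF A.A_sub])
    fix x n x' n' assume "?R x n" "?R x' n'"
    then show "?R (x + x') (n + n')"
      using lin_add[OF lbc, of x x'] lin_add[OF Qmod_lin(1)[OF B.N], of n n'] subsp_add[OF A.A_sub, of x V2 x']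
        subsp_add[OF B.N_sub, of n V1 n'] by simp
  next
    fix c x n assume "?R x n"
    then show "?R (vscale c x) (vscale c n)"
      using lin_scale[OF lbc, of x c] lin_scale[OF Qmod_lin(1)[OF B.N], of n c] subsp_scale[OF A.A_sub, of x V2 c]
        subsp_scale[OF B.N_sub, of n V1 c] by simp
  next
    fix x assume "x \<in> sp A V2"
    then show "\<exists>n. ?R x n" using B.a_image[of "gm' (mb B (F V2 x)) (mc B (F V2 x))"] FV by blast
  qed
  then obtain \<phi> where \<phi>: "lin (sp A V2) \<phi>" "\<And>x. x \<in> sp A V2 ==> ?R x (\<phi> x)" by blast
  have l3: "lin2 (sp A V3) (\<lambda>w w'. gm' (F V3 w) (F V3 w'))"
    using B.gm_lin qhom_plus[OF F] qhom_scale[OF F] FV unfolding lin2_def by simp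
  have "\<exists>G. Qhom N N' G & (\<forall>w\<in>sp A V3. \<forall>w'\<in>sp A V3. G V2 (gm w w') = gm' (F V3 w) (F V3 w')) &
    (\<forall>n\<in>sp N V1. \<forall>x\<in>sp A V2. ma N n = gm (mb A x) (mc A x) --> G V1 n = \<phi> x)"
  proof (rule A.qhom_universal[OF B.N l3 _ \<phi>(1)])
    show "ma N' (\<phi> x) = gm' (F V3 (mb A x)) (F V3 (mc A x))" if "x \<in> sp A V2" for x
      using \<phi>(2)[OF that] qhom_Q_mp(2,3)[OF F that] by simp
    show "\<phi> (ma A x) = 0" if x: "x \<in> sp A V1" for x
    proof (rule B.a_inj)
      show "ma N' (\<phi> (ma A x)) = 0"
        using \<phi>(2)[of "ma A x"] qhom_Q_mp(1)[OF F x] x B.gm_a0[OF FV[OF x]] by simp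
    qed (use \<phi>(2) x in simp)
    show "mb N' (gm' (F V3 w) (F V3 0)) + mc N' (gm' (F V3 0) (F V3 w)) = 0" if "w \<in> sp A V3" for w
      using B.N3_rel[of "gm' (F V3 w) 0" "gm' 0 (F V3 w)"] FV[OF that] B.gm_in qhom_0[OF F A.A] by auto
  qed (use \<phi>(2) FV B.gm_in in auto)
  then show ?thesis unfolding induced_def by blast
qed

text \<open>The transform can be undone: \<open>A\<^sub>3\<close> is the kernel of
  \<open>N\<^sub>2 \<times> N\<^sub>2 -> N\<^sub>3\<close>, \<open>A\<^sub>2\<close> consists of the
  pairs from \<open>A\<^sub>3\<close> that \<open>gm\<close> sends into the image of
  \<open>N\<^sub>1\<close>, and \<open>A\<^sub>1\<close> is the kernel of \<open>gm\<close>.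
  \<open>F\<close> is read off from \<open>G\<close> in this order.\<close>

lemma induced_full:
  assumes G: "Qhom N N' G"
  shows "\<exists>F. Qhom A B F & induced A gm gm' F G"
proof -
  have GV: "\<And>v x. x \<in> sp N v ==> G v x \<in> sp N' v" using qhom_sp[OF G] by blast
  have lg: "lin (sp A V3) (\<lambda>w. G V2 (gm w 0))" "lin (sp A V3) (\<lambda>w. G V2 (gm 0 w))"
    by (rule lin_comp[OF lin2_compose[OF A.gm_lin] _ qhom_lin[OF G]]; auto simp: lin_def A.gm_in)+
  have lg': "lin (sp B V3) (\<lambda>w. gm' w 0)" "lin (sp B V3) (\<lambda>w. gm' 0 w)"
    by (rule lin2_compose[OF B.gm_lin]; auto simp: lin_def)+
  let ?R3 = "\<lambda>w y. w \<in> sp A V3 & y \<in> sp B V3 & G V2 (gm w 0) = gm' y 0 & G V2 (gm 0 w) = gm' 0 y"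
  have "\<exists>f. lin (sp A V3) f & (\<forall>w\<in>sp A V3. ?R3 w (f w))"
  proof (rule lin_select[OF A.A_sub])
    fix x n x' n' assume "?R3 x n" "?R3 x' n'"
    then show "?R3 (x + x') (n + n')"
      using lin_add[OF lg(1), of x x'] lin_add[OF lg(2), of x x'] lin_add[OF lg'(1), of n n'] lin_add[OF lg'(2), of n n']
        subsp_add[OF A.A_sub, of x V3 x'] subsp_add[OF B.A_sub, of n V3 n'] by simp
  next
    fix c x n assume "?R3 x n"
    then show "?R3 (vscale c x) (vscale c n)"
      using lin_scale[OF lg(1), of x c] lin_scale[OF lg(2), of x c] lin_scale[OF lg'(1), of n c] lin_scale[OF lg'(2), of n c]
        subsp_scale[OF A.A_sub, of x V3 c] subsp_scale[OF B.A_sub, of n V3 c] by simp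
  next
    fix w assume w: "w \<in> sp A V3"
    have g: "gm w 0 \<in> sp N V2" "gm 0 w \<in> sp N V2" using A.gm_in w by auto
    \<comment> \<open>\<open>G\<close> carries the relation of \<open>w\<close> to a relation in
      \<open>N'\<close>, which is the relation of some \<open>y\<close>; this \<open>y\<close> is
      the value of \<open>F\<close> at \<open>w\<close>.\<close>
    have "mb N (gm w 0) + mc N (gm 0 w) = 0" using A.N3_rel[OF g] w by blast
    then have "G V3 (mb N (gm w 0)) + G V3 (mc N (gm 0 w)) = 0"
      using lin_add[OF qhom_lin[OF G], of "mb N (gm w 0)" V3 "mc N (gm 0 w)"] g qhom_0[OF G A.N] by simp
    then have "mb N' (G V2 (gm w 0)) + mc N' (G V2 (gm 0 w)) = 0" using qhom_Q_mp(2,3)[OF G] g by simp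
    then show "\<exists>y. ?R3 w y" using B.N3_rel[of "G V2 (gm w 0)" "G V2 (gm 0 w)"] GV g w by blast
  qed
  then obtain F3 where F3: "lin (sp A V3) F3" "\<And>w. w \<in> sp A V3 ==> ?R3 w (F3 w)" by blast
  have GF: "G V2 (gm w w') = gm' (F3 w) (F3 w')" if w: "w \<in> sp A V3" "w' \<in> sp A V3" for w w'
  proof -
    have "G V2 (gm w w') = G V2 (gm w 0) + G V2 (gm 0 w')"
      using lin2_split[OF A.gm_lin A.A_sub w] lin_add[OF qhom_lin[OF G], of "gm w 0" V2 "gm 0 w'"] A.gm_in w by simp
    also have "\<dots> = gm' (F3 w) (F3 w')" using lin2_split[OF B.gm_lin B.A_sub, of "F3 w" "F3 w'"] F3(2) w by simp
    finally show ?thesis .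
  qed
  let ?R2 = "\<lambda>x y. x \<in> sp A V2 & y \<in> sp B V2 & mb B y = F3 (mb A x) & mc B y = F3 (mc A x)"
  have lf: "lin (sp A V2) (\<lambda>x. F3 (mb A x))" "lin (sp A V2) (\<lambda>x. F3 (mc A x))"
    by (rule lin_comp[OF Qmod_lin(2)[OF A.A] _ F3(1)], auto) (rule lin_comp[OF Qmod_lin(3)[OF A.A] _ F3(1)], auto)
  have "\<exists>f. lin (sp A V2) f & (\<forall>x\<in>sp A V2. ?R2 x (f x))"
  proof (rule lin_select[OF A.A_sub])
    fix x n x' n' assume "?R2 x n" "?R2 x' n'"
    then show "?R2 (x + x') (n + n')"
      using lin_add[OF lf(1), of x x'] lin_add[OF lf(2), of x x'] lin_add[OF Qmod_lin(2)[OF B.A], of n n'] lin_add[OF Qmod_lin(3)[OF B.A], of n n']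
        subsp_add[OF A.A_sub, of x V2 x'] subsp_add[OF B.A_sub, of n V2 n'] by simp
  next
    fix c x n assume "?R2 x n"
    then show "?R2 (vscale c x) (vscale c n)"
      using lin_scale[OF lf(1), of x c] lin_scale[OF lf(2), of x c] lin_scale[OF Qmod_lin(2)[OF B.A], of n c] lin_scale[OF Qmod_lin(3)[OF B.A], of n c]
        subsp_scale[OF A.A_sub, of x V2 c] subsp_scale[OF B.A_sub, of n V2 c] by simp
  next
    fix x assume x: "x \<in> sp A V2"
    obtain n where n: "n \<in> sp N V1" "ma N n = gm (mb A x) (mc A x)" using A.a_image x by blast
    then have "ma N' (G V1 n) = gm' (F3 (mb A x)) (F3 (mc A x))"
      using qhom_Q_mp(1)[OF G n(1)] GF x by simp
    then obtain y where y: "y \<in> sp B V2" "gm' (F3 (mb A x)) (F3 (mc A x)) = gm' (mb B y) (mc B y)"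
      using B.a_image GV[OF n(1)] by metis
    then obtain t where t: "t \<in> sp B V1" "F3 (mb A x) - mb B y = mb B (ma B t)" "F3 (mc A x) - mc B y = mc B (ma B t)"
      using B.gm_eq[OF _ _ _ _ y(2)] F3(2) x by auto
    \<comment> \<open>The preimage \<open>y\<close> is right only modulo the kernel of
      \<open>gm'\<close>; adding \<open>ma B t\<close> makes both components exact.\<close>
    have ty: "y + ma B t \<in> sp B V2" using subsp_add[OF B.A_sub] y t by simp
    have "mb B (y + ma B t) = F3 (mb A x)" "mc B (y + ma B t) = F3 (mc A x)"
      using lin_add[OF Qmod_lin(2)[OF B.A] y(1), of "ma B t"] lin_add[OF Qmod_lin(3)[OF B.A] y(1), of "ma B t"]
        t(1) t(2,3)[unfolded diff_eq_eq] by (simp_all add: add.commute)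
    then show "\<exists>y. ?R2 x y" using ty x by blast
  qed
  then obtain F2 where F2: "lin (sp A V2) F2" "\<And>x. x \<in> sp A V2 ==> ?R2 x (F2 x)" by blast
  let ?R1 = "\<lambda>x y. x \<in> sp A V1 & y \<in> sp B V1 & ma B y = F2 (ma A x)"
  have lf1: "lin (sp A V1) (\<lambda>x. F2 (ma A x))"
    by (rule lin_comp[OF Qmod_lin(1)[OF A.A] _ F2(1)]) auto
  have "\<exists>f. lin (sp A V1) f & (\<forall>x\<in>sp A V1. ?R1 x (f x))"
  proof (rule lin_select[OF A.A_sub])
    fix x n x' n' assume "?R1 x n" "?R1 x' n'"
    then show "?R1 (x + x') (n + n')"
      using lin_add[OF lf1, of x x'] lin_add[OF Qmod_lin(1)[OF B.A], of n n']
        subsp_add[OF A.A_sub, of x V1 x'] subsp_add[OF B.A_sub, of n V1 n'] by simp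
  next
    fix c x n assume "?R1 x n"
    then show "?R1 (vscale c x) (vscale c n)"
      using lin_scale[OF lf1, of x c] lin_scale[OF Qmod_lin(1)[OF B.A], of n c]
        subsp_scale[OF A.A_sub, of x V1 c] subsp_scale[OF B.A_sub, of n V1 c] by simp
  next
    fix x assume x: "x \<in> sp A V1"
    let ?y = "F2 (ma A x)"
    have y: "?y \<in> sp B V2" "mb B ?y = F3 (mb A (ma A x))" "mc B ?y = F3 (mc A (ma A x))"
      using F2(2) x by auto
    have "gm' (mb B ?y) (mc B ?y) = 0"
      using GF[of "mb A (ma A x)" "mc A (ma A x)"] A.gm_a0[OF x] qhom_0[OF G A.N] x y by simp
    then obtain s where "s \<in> sp B V1" "mb B ?y = mb B (ma B s)" "mc B ?y = mc B (ma B s)"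
      using B.gm_0[of "mb B ?y" "mc B ?y"] y(1) by auto
    then show "\<exists>y. ?R1 x y" using x y(1) B.bc_eq[of ?y "ma B s"] by auto
  qed
  then obtain F1 where F1: "lin (sp A V1) F1" "\<And>x. x \<in> sp A V1 ==> ?R1 x (F1 x)" by blast
  let ?F = "\<lambda>v. case v of V1 => F1 | V2 => F2 | V3 => F3"
  have "Qhom A B ?F"
    unfolding qhom_Q_iff all_vertex using F1 F2 F3 by simp
  then show ?thesis using GF unfolding induced_def by (intro exI[of _ ?F]) simp
qed

lemma induced_faithful:
  assumes F: "Qhom A B F" and G: "Qhom N N' G" and FG: "induced A gm gm' F G" and z: "qzero N G"
  shows "qzero A F"
proof -
  have F3: "F V3 w = 0" if w: "w \<in> sp A V3" for w
  proof (rule B.gm_inj[OF qhom_sp[OF F w]])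
    show "gm' (F V3 w) 0 = 0" "gm' 0 (F V3 w) = 0"
      using inducedD[OF FG w A.A_0] inducedD[OF FG A.A_0 w] z w A.gm_in qhom_0[OF F A.A] by (auto simp: qzero_def)
  qed
  have F2: "F V2 x = 0" if x: "x \<in> sp A V2" for x
    by (rule B.bc_inj[OF qhom_sp[OF F x]]) (use qhom_Q_mp(2,3)[OF F x] F3 x in \<open>simp_all flip: qhom_Q_mp(2,3)[OF F x]\<close>)
  have "F V1 x = 0" if x: "x \<in> sp A V1" for x
    by (rule kgood_a[OF B.good qhom_sp[OF F x]]) (use F2 x in \<open>simp flip: qhom_Q_mp(1)[OF F x]\<close>)
  then show ?thesis unfolding qzero_def all_vertex using F2 F3 by blast
qed

text \<open>By fullness. This carries the vanishing of homomorphisms along the orbits.\<close>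

lemma qzero_preserved:
  assumes z: "\<And>F. Qhom A B F ==> qzero A F" and G: "Qhom N N' G"
  shows "qzero N G"
proof -
  obtain F where F: "Qhom A B F" "induced A gm gm' F G" using induced_full[OF G] by blast
  have "qzero A F" by (rule z[OF F(1)])
  then show ?thesis
  proof (intro A.qhom_zero_V2[OF B.N G])
    fix n assume "n \<in> sp N V2"
    then obtain w w' where "w \<in> sp A V3" "w' \<in> sp A V3" "n = gm w w'" using A.gm_surj by blast
    then show "G V2 n = 0" using inducedD[OF F(2)] \<open>qzero A F\<close> lin2_0[OF B.gm_lin B.A_sub] by (simp add: qzero_def)
  qed (use B.a_inj in blast)
qed

end

definition brick :: "('b, 'k::field) qrep => bool" where
  "brick M \<longleftrightarrow> (\<forall>F. Qhom M M F --> (\<exists>c. \<forall>v. \<forall>x\<in>sp M v. F v x = vscale c x))"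

text \<open>An endomorphism of \<open>N\<close> is the transform of a scalar. At 2 it is visibly
  that scalar; injectivity at 1 and generation at 3 do the rest.\<close>

lemma (in cox) brick_N:
  assumes "brick A"
  shows "brick N"
  unfolding brick_def
proof (intro allI impI)
  fix G assume G: "Qhom N N G"
  interpret AA: cox_pair A N gm A N gm by unfold_locales
  obtain F where F: "Qhom A A F" "induced A gm gm F G" using AA.induced_full[OF G] by blast
  then obtain c where c: "\<And>v x. x \<in> sp A v ==> F v x = vscale c x" using assms unfolding brick_def by blast
  have G2: "G V2 n = vscale c n" if n: "n \<in> sp N V2" for n
  proof -
    obtain w w' where "w \<in> sp A V3" "w' \<in> sp A V3" "n = gm w w'" using gm_surj[OF n] by blast
    then show ?thesis using inducedD[OF F(2)] c lin2_scale[OF gm_lin] by simp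
  qed
  have G1: "G V1 n = vscale c n" if n: "n \<in> sp N V1" for n
    by (rule aN_eq[OF qhom_sp[OF G n] subsp_scale[OF N_sub n]])
      (use G2 n lin_scale[OF Qmod_lin(1)[OF N] n] in \<open>simp flip: qhom_Q_mp(1)[OF G n]\<close>)
  have G3: "G V3 n = vscale c n" if "n \<in> sp N V3" for n
  proof -
    obtain m m' where m: "m \<in> sp N V2" "m' \<in> sp N V2" "n = mb N m + mc N m'" using N3_gen[OF \<open>n \<in> _\<close>] by blast
    then have "G V3 n = mb N (G V2 m) + mc N (G V2 m')"
      using lin_add[OF qhom_lin[OF G], of "mb N m" V3 "mc N m'"] qhom_Q_mp(2,3)[OF G] by simp
    then show ?thesis using m G2 lin_scale[OF Qmod_lin(2)[OF N]] lin_scale[OF Qmod_lin(3)[OF N]] by (simp add: fun_vs.scale_right_distrib)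
  qed
  show "\<exists>c. \<forall>v. \<forall>x\<in>sp N v. G v x = vscale c x"
    by (rule exI[of _ c]) (use G1 G2 G3 in \<open>simp add: all_vertex\<close>)
qed

section \<open>Auslander-Reiten sequences\<close>

lemma sum_apply: "(\<Sum>i\<in>I. f i) x = (\<Sum>i\<in>I. f i x :: 'k::ab_group_add)"
proof (induction I rule: infinite_finite_induct)
  case (insert i I)
  then show ?case by (simp only: sum.insert[OF insert(1,2)] plus_fun_apply)
qed auto

lemma functional_props:
  assumes "functional (\<xi> :: ('b => 'k::field) => 'k)"
  shows "\<xi> (x + y) = \<xi> x + \<xi> y" "\<xi> (vscale c x) = c * \<xi> x" "\<xi> (x - y) = \<xi> x - \<xi> y" "\<xi> (- x) = - \<xi> x" "\<xi> 0 = 0"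
    "\<xi> (\<Sum>i\<in>I. g i) = (\<Sum>i\<in>I. \<xi> (g i))"
  using vector_space_pair.linear_add[OF functional_pair assms] vector_space_pair.linear_scale[OF functional_pair assms]
    vector_space_pair.linear_diff[OF functional_pair assms] vector_space_pair.linear_neg[OF functional_pair assms]
    vector_space_pair.linear_0[OF functional_pair assms] vector_space_pair.linear_sum[OF functional_pair assms]
  by blast+

lemma lin_eq_on_span:
  assumes "lin S f" "lin S g" "subsp S" "B \<subseteq> S" "\<And>x. x \<in> B ==> f x = g x" "x \<in> vspan B"
  shows "x \<in> S & f x = g x"
  using assms(6)
proof (induction rule: fun_vs.span_induct_alt)
  case base
  show ?case using subsp_0[OF assms(3)] by (simp only: lin_0[OF assms(1)] lin_0[OF assms(2)])
next
  case (step c x y)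
  then have x: "x \<in> S" "vscale c x \<in> S" "y \<in> S" using assms(4) subsp_scale[OF assms(3)] by blast+
  have "f (vscale c x + y) = g (vscale c x + y)"
    using lin_add[OF assms(1) x(2,3)] lin_add[OF assms(2) x(2,3)]
     lin_scale[OF assms(1) x(1)] lin_scale[OF assms(2) x(1)] assms(5)[OF step(1)] step by simp
  then show ?case using subsp_add[OF assms(3) x(2,3)] by blast
qed

lemma lin_combine:
  shows "lin S f ==> lin S g ==> lin S (\<lambda>x. f x + g x)" "lin S f ==> lin S g ==> lin S (\<lambda>x. f x - g x)"
    "lin S f ==> lin S (\<lambda>x. vscale c (f x))"
  unfolding lin_def
  by (simp_all add: fun_vs.scale_right_distrib fun_vs.scale_right_diff_distrib algebra_simps fun_vs.scale_left_commute)

lemma lin_rank1: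
  assumes "functional \<xi>"
  shows "lin S (\<lambda>x. vscale (\<xi> x) w)"
  unfolding lin_def by (simp add: functional_props[OF assms] fun_vs.scale_left_distrib)

text \<open>Fredholm alternative for the cocycles of extensions of \<open>X\<close> by \<open>A\<close>: a linear functional \<open>\<Lambda>\<close> that
  vanishes on all coboundaries is the trace pairing with a homomorphism \<open>N \<rightarrow> X\<close>.\<close>

theorem (in cox) ext_vanish:
  fixes X :: "('d, 'k) qrep"
  assumes X: "Qmod X" and H: "\<And>F. Qhom N X F ==> qzero N F"
    and d1: "lin (sp X V1) d1" "\<And>x. x \<in> sp X V1 ==> d1 x \<in> sp A V2"
    and db: "lin (sp X V2) db" "\<And>x. x \<in> sp X V2 ==> db x \<in> sp A V3"
    and dc: "lin (sp X V2) dc" "\<And>x. x \<in> sp X V2 ==> dc x \<in> sp A V3"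
  shows "\<exists>r. (\<forall>v. lin (sp X v) (r v)) & (\<forall>v. \<forall>x\<in>sp X v. r v x \<in> sp A v) &
    (\<forall>x\<in>sp X V1. d1 x = ma A (r V1 x) - r V2 (ma X x)) &
    (\<forall>x\<in>sp X V2. db x = mb A (r V2 x) - r V3 (mb X x)) &
    (\<forall>x\<in>sp X V2. dc x = mc A (r V2 x) - r V3 (mc X x))"
proof -
  obtain B1 where B1: "finite B1" "vindep B1" "vspan B1 = sp X V1" using fd_basis[OF module_fd[OF X]] by blast
  obtain B2 where B2: "finite B2" "vindep B2" "vspan B2 = sp X V2" using fd_basis[OF module_fd[OF X]] by blast
  have BX: "\<And>x. x \<in> B1 ==> x \<in> sp X V1" "\<And>x. x \<in> B2 ==> x \<in> sp X V2"
    using B1(3) B2(3) fun_vs.span_base by blast+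
  note Xs = module_subspace[OF X] and Xmp = Qmod_mp[OF X] and Xl = Qmod_lin[OF X] and Al = Qmod_lin[OF A]
  \<comment> \<open>Cocycles are stored by their values on bases as vectors of one function space,
    where a functional can separate a cocycle from the coboundaries.\<close>
  define enc :: "(('d => 'k) => ('b => 'k)) => (('d => 'k) => ('b => 'k)) => (('d => 'k) => ('b => 'k)) => (arrow \<times> ('d => 'k) \<times> 'b => 'k)"
    where "enc e1 eb ec = (\<lambda>(a, x, i). case a of A12 => if x \<in> B1 then e1 x i else 0
      | A23 => if x \<in> B2 then eb x i else 0 | B23 => if x \<in> B2 then ec x i else 0)" for e1 eb ec
  define cob where "cob r = enc (\<lambda>x. ma A (r V1 x) - r V2 (ma X x)) (\<lambda>x. mb A (r V2 x) - r V3 (mb X x))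
      (\<lambda>x. mc A (r V2 x) - r V3 (mc X x))" for r
  define Rs where "Rs = {r. \<forall>v. lin (sp X v) (r v) & (\<forall>x\<in>sp X v. r v x \<in> sp A v)}"
  have RsD: "\<And>r v. r \<in> Rs ==> lin (sp X v) (r v)" "\<And>r v x. r \<in> Rs ==> x \<in> sp X v ==> r v x \<in> sp A v"
    by (auto simp: Rs_def)
  have enc_cong: "enc e1 eb ec = enc e1' eb' ec'"
    if "\<And>x. x \<in> B1 ==> e1 x = e1' x" "\<And>x. x \<in> B2 ==> eb x = eb' x" "\<And>x. x \<in> B2 ==> ec x = ec' x" for e1 eb ec e1' eb' ec'
    unfolding enc_def using that by (auto simp: fun_eq_iff split: arrow.split)
  have enc_eqD: "(\<forall>x\<in>B1. e1 x = e1' x) & (\<forall>x\<in>B2. eb x = eb' x) & (\<forall>x\<in>B2. ec x = ec' x)"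
    if eq: "enc e1 eb ec = enc e1' eb' ec'" for e1 eb ec e1' eb' ec'
  proof -
    have *: "enc e1 eb ec (a, x, i) = enc e1' eb' ec' (a, x, i)" for a x i using eq by simp
    show ?thesis
    proof (intro conjI ballI ext)
      fix x i show "x \<in> B1 ==> e1 x i = e1' x i" using *[of A12 x i] by (simp add: enc_def)
      show "x \<in> B2 ==> eb x i = eb' x i" using *[of A23 x i] by (simp add: enc_def)
      show "x \<in> B2 ==> ec x i = ec' x i" using *[of B23 x i] by (simp add: enc_def)
    qed
  qed
  have enc_add: "enc e1 eb ec + enc e1' eb' ec' = enc (\<lambda>x. e1 x + e1' x) (\<lambda>x. eb x + eb' x) (\<lambda>x. ec x + ec' x)"
    and enc_scale: "vscale c (enc e1 eb ec) = enc (\<lambda>x. vscale c (e1 x)) (\<lambda>x. vscale c (eb x)) (\<lambda>x. vscale c (ec x))"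
    for e1 eb ec e1' eb' ec' c
    by (auto simp: enc_def fun_eq_iff vscale_def split: arrow.split)
  let ?Im = "cob ` Rs"
  have sub: "subsp ?Im"
    unfolding subsp_def
  proof (intro conjI ballI allI)
    have "(\<lambda>v x. 0) \<in> Rs" by (simp add: Rs_def lin_def)
    moreover have "cob (\<lambda>v x. 0) = 0"
      unfolding cob_def enc_def by (auto simp: fun_eq_iff module_mp_0[OF A] split: arrow.split)
    ultimately show "0 \<in> ?Im" by (metis image_eqI)
  next
    fix y z assume "y \<in> ?Im" "z \<in> ?Im"
    then obtain r s where rs: "r \<in> Rs" "y = cob r" "s \<in> Rs" "z = cob s" by blast
    have "(\<lambda>v x. r v x + s v x) \<in> Rs"
      using rs(1,3) subsp_add[OF A_sub] by (auto simp: Rs_def intro: lin_combine(1))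
    moreover have "cob (\<lambda>v x. r v x + s v x) = y + z"
      unfolding rs cob_def enc_add
      by (rule enc_cong) (use lin_add[OF Al(1)] lin_add[OF Al(2)] lin_add[OF Al(3)] RsD[OF rs(1)] RsD[OF rs(3)] BX in \<open>simp_all add: algebra_simps\<close>)
    ultimately show "y + z \<in> ?Im" using image_eqI[of "y + z" cob "\<lambda>v x. r v x + s v x"] by simp
  next
    fix c y assume "y \<in> ?Im"
    then obtain r where rs: "r \<in> Rs" "y = cob r" by blast
    have "(\<lambda>v x. vscale c (r v x)) \<in> Rs"
      using rs(1) subsp_scale[OF A_sub] by (auto simp: Rs_def intro: lin_combine(3))
    moreover have "cob (\<lambda>v x. vscale c (r v x)) = vscale c y"
      unfolding rs cob_def enc_scale
      by (rule enc_cong) (use lin_scale[OF Al(1)] lin_scale[OF Al(2)] lin_scale[OF Al(3)] RsD[OF rs(1)] BX in \<open>simp_all add: fun_vs.scale_right_diff_distrib\<close>)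
    ultimately show "vscale c y \<in> ?Im" using image_eqI[of "vscale c y" cob "\<lambda>v x. vscale c (r v x)"] by simp
  qed
  have "enc d1 db dc \<in> ?Im"
  proof (rule ccontr)
    assume "enc d1 db dc \<notin> ?Im"
    then obtain \<Lambda> where \<Lambda>: "functional \<Lambda>" "\<And>r. r \<in> Rs ==> \<Lambda> (cob r) = 0" "\<Lambda> (enc d1 db dc) = 1"
      using separating_functional[OF sub \<open>enc d1 db dc \<notin> ?Im\<close>] by auto
    define \<delta> :: "arrow => ('d => 'k) => ('b => 'k) => (arrow \<times> ('d => 'k) \<times> 'b => 'k)"
      where "\<delta> a x w = (\<lambda>(a', x', i). if a' = a & x' = x then w i else 0)" for a x w
    have \<delta>_lin: "\<delta> a x (w + w') = \<delta> a x w + \<delta> a x w'" "\<delta> a x (vscale c w) = vscale c (\<delta> a x w)" for a x w w' c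
      by (auto simp: \<delta>_def fun_eq_iff vscale_def)
    define L where "L a x w = \<Lambda> (\<delta> a x w)" for a x w
    have L_lin: "L a x (w + w') = L a x w + L a x w'" "L a x (vscale c w) = c * L a x w" for a x w w' c
      by (simp_all add: L_def \<delta>_lin functional_props[OF \<Lambda>(1)])
    have L_minus: "L a x (- w) = - L a x w" for a x w using L_lin(2)[of a x "-1" w] by simp
    have L_0: "L a x 0 = 0" for a x using L_lin(2)[of a x 0 0] by simp
    have enc_sum: "enc e1 eb ec = (\<Sum>x\<in>B1. \<delta> A12 x (e1 x)) + ((\<Sum>x\<in>B2. \<delta> A23 x (eb x)) + (\<Sum>x\<in>B2. \<delta> B23 x (ec x)))" for e1 eb ec
    proof (rule ext)
      fix p :: "arrow \<times> ('d => 'k) \<times> 'b"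
      obtain a x i where p: "p = (a, x, i)" by (cases p)
      show "enc e1 eb ec p = ((\<Sum>x\<in>B1. \<delta> A12 x (e1 x)) + ((\<Sum>x\<in>B2. \<delta> A23 x (eb x)) + (\<Sum>x\<in>B2. \<delta> B23 x (ec x)))) p"
        unfolding plus_fun_apply sum_apply p enc_def \<delta>_def
        using B1(1) B2(1) by (cases a) simp_all
    qed
    have \<Lambda>_enc: "\<Lambda> (enc e1 eb ec) = (\<Sum>x\<in>B1. L A12 x (e1 x)) + ((\<Sum>x\<in>B2. L A23 x (eb x)) + (\<Sum>x\<in>B2. L B23 x (ec x)))" for e1 eb ec
      unfolding enc_sum functional_props[OF \<Lambda>(1)] L_def ..
    \<comment> \<open>The transposes of the components of \<open>\<Lambda>\<close>: under the trace
      form, a functional on linear maps from \<open>X\<close> to \<open>A\<close> is a linear map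
      from \<open>A\<close> to \<open>X\<close>.\<close>
    define \<psi>1 where "\<psi>1 w = (\<Sum>x\<in>B2. vscale (L A23 x w) x)" for w
    define \<psi>2 where "\<psi>2 w = (\<Sum>x\<in>B2. vscale (L B23 x w) x)" for w
    define \<phi> where "\<phi> w = (\<Sum>x\<in>B1. vscale (L A12 x w) x)" for w
    have \<psi>X: "\<psi>1 w \<in> sp X V2" "\<psi>2 w \<in> sp X V2" "\<phi> w \<in> sp X V1" for w
      unfolding \<psi>1_def \<psi>2_def \<phi>_def
      using BX by (auto intro!: subsp_sum[OF Xs] subsp_scale[OF Xs])
    have sums: "(\<Sum>x\<in>B. vscale (f x + g x) x) = (\<Sum>x\<in>B. vscale (f x) x) + (\<Sum>x\<in>B. vscale (g x) x)"
      "(\<Sum>x\<in>B. vscale (c * f x) x) = vscale c (\<Sum>x\<in>B. vscale (f x) x)" for B :: "('d => 'k) set" and f g c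
      unfolding fun_vs.scale_left_distrib sum.distrib fun_vs.scale_sum_right by simp_all
    have \<psi>_lin: "\<psi>1 (w + w') = \<psi>1 w + \<psi>1 w'" "\<psi>1 (vscale c w) = vscale c (\<psi>1 w)"
      "\<psi>2 (w + w') = \<psi>2 w + \<psi>2 w'" "\<psi>2 (vscale c w) = vscale c (\<psi>2 w)"
      "\<phi> (w + w') = \<phi> w + \<phi> w'" "\<phi> (vscale c w) = vscale c (\<phi> w)" for w w' c
      unfolding \<psi>1_def \<psi>2_def \<phi>_def L_lin by (rule sums)+
    have \<psi>_0: "\<psi>1 0 = 0" "\<psi>2 0 = 0" using \<psi>_lin(2,4)[of 0 0] by simp_all
    have eval: "\<xi> (f (\<Sum>x\<in>B. vscale (g x) x)) = (\<Sum>x\<in>B. g x * \<xi> (f x))"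
      if "functional \<xi>" "lin (sp X v) f" "\<And>x. x \<in> B ==> x \<in> sp X v"
      for \<xi> :: "('d => 'k) => 'k" and f :: "('d => 'k) => ('d => 'k)" and g B v
    proof -
      have "f (\<Sum>x\<in>B. vscale (g x) x) = (\<Sum>x\<in>B. f (vscale (g x) x))"
        by (rule lin_sum[OF that(2) Xs]) (use that(3) subsp_scale[OF Xs] in blast)
      also have "\<dots> = (\<Sum>x\<in>B. vscale (g x) (f x))" by (rule sum.cong) (use lin_scale[OF that(2)] that(3) in auto)
      finally show ?thesis by (simp only: functional_props(2,6)[OF that(1)])
    qed
    have id: "lin (sp X v) (\<lambda>x. x)" for v by (simp add: lin_def)
    have c3: "mb X (\<psi>1 w) + mc X (\<psi>2 w) = 0" if w: "w \<in> sp A V3" for w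
    proof (rule functional_nonzero)
      fix \<xi> :: "('d => 'k) => 'k" assume \<xi>: "functional \<xi>"
      \<comment> \<open>A cochain of rank one at the vertex 3. That \<open>\<Lambda>\<close> kills
        its coboundary is the relation \<open>c3\<close>, tested by \<open>\<xi>\<close>; cochains
        at 2 and 1 give \<open>c1\<close> and \<open>c2\<close> in the same way.\<close>
      define r where "r = (\<lambda>v x. if v = V3 then vscale (\<xi> x) w else 0)"
      have "r \<in> Rs" unfolding Rs_def r_def
        using lin_rank1[OF \<xi>] w subsp_scale[OF A_sub] by (auto simp: lin_def)
      then have "0 = \<Lambda> (cob r)" using \<Lambda>(2) by simp
      also have "cob r = enc (\<lambda>x. 0) (\<lambda>x. - vscale (\<xi> (mb X x)) w) (\<lambda>x. - vscale (\<xi> (mc X x)) w)"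
        unfolding cob_def r_def by (simp add: module_mp_0[OF A])
      also have "\<Lambda> \<dots> = - ((\<Sum>x\<in>B2. L A23 x w * \<xi> (mb X x)) + (\<Sum>x\<in>B2. L B23 x w * \<xi> (mc X x)))"
        unfolding \<Lambda>_enc by (simp add: L_minus L_lin L_0 sum_negf mult.commute)
      also have "\<dots> = - (\<xi> (mb X (\<psi>1 w)) + \<xi> (mc X (\<psi>2 w)))"
        unfolding \<psi>1_def \<psi>2_def using eval[OF \<xi> Xl(2) BX(2)] eval[OF \<xi> Xl(3) BX(2)] by simp
      finally have "\<xi> (mb X (\<psi>1 w)) + \<xi> (mc X (\<psi>2 w)) = 0" by (metis neg_equal_0_iff_equal)
      then show "\<xi> (mb X (\<psi>1 w) + mc X (\<psi>2 w)) = 0" by (simp add: functional_props[OF \<xi>])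
    qed
    have c1: "ma X (\<phi> w) = \<psi>1 (mb A w) + \<psi>2 (mc A w)" if w: "w \<in> sp A V2" for w
    proof -
      have "ma X (\<phi> w) - (\<psi>1 (mb A w) + \<psi>2 (mc A w)) = 0"
      proof (rule functional_nonzero)
        fix \<xi> :: "('d => 'k) => 'k" assume \<xi>: "functional \<xi>"
        define r where "r = (\<lambda>v x. if v = V2 then vscale (\<xi> x) w else 0)"
        have "r \<in> Rs" unfolding Rs_def r_def
          using lin_rank1[OF \<xi>] w subsp_scale[OF A_sub] by (auto simp: lin_def)
        then have "0 = \<Lambda> (cob r)" using \<Lambda>(2) by simp
        also have "cob r = enc (\<lambda>x. - vscale (\<xi> (ma X x)) w) (\<lambda>x. vscale (\<xi> x) (mb A w)) (\<lambda>x. vscale (\<xi> x) (mc A w))"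
          unfolding cob_def r_def using lin_scale[OF Al(2) w] lin_scale[OF Al(3) w] by (simp add: module_mp_0[OF A])
        also have "\<Lambda> \<dots> = - (\<Sum>x\<in>B1. L A12 x w * \<xi> (ma X x)) + ((\<Sum>x\<in>B2. L A23 x (mb A w) * \<xi> x) + (\<Sum>x\<in>B2. L B23 x (mc A w) * \<xi> x))"
          unfolding \<Lambda>_enc by (simp add: L_minus L_lin L_0 sum_negf mult.commute)
        also have "\<dots> = - \<xi> (ma X (\<phi> w)) + (\<xi> (\<psi>1 (mb A w)) + \<xi> (\<psi>2 (mc A w)))"
          unfolding \<psi>1_def \<psi>2_def \<phi>_def using eval[OF \<xi> Xl(1) BX(1)] eval[OF \<xi> id BX(2)] by simp
        finally show "\<xi> (ma X (\<phi> w) - (\<psi>1 (mb A w) + \<psi>2 (mc A w))) = 0" by (simp add: functional_props[OF \<xi>])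
      qed
      then show ?thesis by simp
    qed
    have c2: "\<phi> (ma A t) = 0" if t: "t \<in> sp A V1" for t
    proof (rule functional_nonzero)
      fix \<xi> :: "('d => 'k) => 'k" assume \<xi>: "functional \<xi>"
      define r where "r = (\<lambda>v x. if v = V1 then vscale (\<xi> x) t else 0)"
      have "r \<in> Rs" unfolding Rs_def r_def
        using lin_rank1[OF \<xi>] t subsp_scale[OF A_sub] by (auto simp: lin_def)
      then have "0 = \<Lambda> (cob r)" using \<Lambda>(2) by simp
      also have "cob r = enc (\<lambda>x. vscale (\<xi> x) (ma A t)) (\<lambda>x. 0) (\<lambda>x. 0)"
        unfolding cob_def r_def using lin_scale[OF Al(1) t] by (simp add: module_mp_0[OF A])
      also have "\<Lambda> \<dots> = (\<Sum>x\<in>B1. L A12 x (ma A t) * \<xi> x)"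
        unfolding \<Lambda>_enc by (simp add: L_lin L_0 mult.commute)
      also have "\<dots> = \<xi> (\<phi> (ma A t))"
        unfolding \<phi>_def using eval[OF \<xi> id BX(1)] by simp
      finally show "\<xi> (\<phi> (ma A t)) = 0" by simp
    qed
    \<comment> \<open>The three relations are those of the universal property, so
      \<open>\<Lambda>\<close> becomes a homomorphism from \<open>N\<close> to \<open>X\<close>,
      which is zero by \<open>H\<close>.\<close>
    have "\<exists>F. Qhom N X F & (\<forall>w\<in>sp A V3. \<forall>w'\<in>sp A V3. F V2 (gm w w') = \<psi>1 w + \<psi>2 w') &
      (\<forall>n\<in>sp N V1. \<forall>x\<in>sp A V2. ma N n = gm (mb A x) (mc A x) --> F V1 n = \<phi> x)"
    proof (rule qhom_universal[OF X])
      show "lin2 (sp A V3) (\<lambda>w w'. \<psi>1 w + \<psi>2 w')"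
        unfolding lin2_def by (simp add: \<psi>_lin fun_vs.scale_right_distrib algebra_simps)
      show "lin (sp A V2) \<phi>" unfolding lin_def by (simp add: \<psi>_lin)
    qed (use \<psi>X c1 c2 c3 \<psi>_0 subsp_add[OF Xs] in auto)
    then obtain F where F: "Qhom N X F" "\<And>w w'. w \<in> sp A V3 ==> w' \<in> sp A V3 ==> F V2 (gm w w') = \<psi>1 w + \<psi>2 w'"
      "\<And>n x. n \<in> sp N V1 ==> x \<in> sp A V2 ==> ma N n = gm (mb A x) (mc A x) ==> F V1 n = \<phi> x" by blast
    have z: "qzero N F" by (rule H[OF F(1)])
    have \<psi>0: "\<psi>1 w = 0" "\<psi>2 w = 0" if w: "w \<in> sp A V3" for w
      using F(2)[OF w A_0] F(2)[OF A_0 w] z gm_in[OF w A_0] gm_in[OF A_0 w] \<psi>_0 by (auto simp: qzero_def)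
    have \<phi>0: "\<phi> x = 0" if x: "x \<in> sp A V2" for x
    proof -
      obtain n where "n \<in> sp N V1" "ma N n = gm (mb A x) (mc A x)" using a_image x by blast
      then show ?thesis using F(3)[OF _ x] z by (auto simp: qzero_def)
    qed
    \<comment> \<open>\<open>\<psi>1 w\<close> and \<open>\<psi>2 w\<close> are expansions in the
      basis \<open>B2\<close>, so their vanishing makes every coefficient vanish.\<close>
    have L0: "L A23 x w = 0" "L B23 x w = 0" if "x \<in> B2" "w \<in> sp A V3" for x w
      using fun_vs.independentD[OF B2(2,1) order_refl _ that(1), of "\<lambda>x. L A23 x w"]
        fun_vs.independentD[OF B2(2,1) order_refl _ that(1), of "\<lambda>x. L B23 x w"] \<psi>0[OF that(2)]
      unfolding \<psi>1_def \<psi>2_def by blast+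
    have L1: "L A12 x w = 0" if "x \<in> B1" "w \<in> sp A V2" for x w
      using fun_vs.independentD[OF B1(2,1) order_refl _ that(1), of "\<lambda>x. L A12 x w"] \<phi>0[OF that(2)]
      unfolding \<phi>_def by blast
    have "\<Lambda> (enc d1 db dc) = 0"
      unfolding \<Lambda>_enc using L0 L1 BX d1(2) db(2) dc(2) by simp
    then show False using \<Lambda>(3) by simp
  qed
  then obtain r where r: "r \<in> Rs" "enc d1 db dc = cob r" by blast
  have on_B: "(\<forall>x\<in>B1. d1 x = ma A (r V1 x) - r V2 (ma X x)) & (\<forall>x\<in>B2. db x = mb A (r V2 x) - r V3 (mb X x)) &
    (\<forall>x\<in>B2. dc x = mc A (r V2 x) - r V3 (mc X x))"
    using enc_eqD r(2) unfolding cob_def by blast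
  have im: "r v ` sp X v \<subseteq> sp A v" for v using RsD(2)[OF r(1)] by blast
  have l1: "lin (sp X V1) (\<lambda>x. ma A (r V1 x) - r V2 (ma X x))"
    by (rule lin_combine(2)[OF lin_comp[OF RsD(1)[OF r(1)] im Al(1)] lin_comp[OF Xl(1) _ RsD(1)[OF r(1)]]]) (use Xmp in auto)
  have l2: "lin (sp X V2) (\<lambda>x. mb A (r V2 x) - r V3 (mb X x))"
    by (rule lin_combine(2)[OF lin_comp[OF RsD(1)[OF r(1)] im Al(2)] lin_comp[OF Xl(2) _ RsD(1)[OF r(1)]]]) (use Xmp in auto)
  have l3: "lin (sp X V2) (\<lambda>x. mc A (r V2 x) - r V3 (mc X x))"
    by (rule lin_combine(2)[OF lin_comp[OF RsD(1)[OF r(1)] im Al(3)] lin_comp[OF Xl(3) _ RsD(1)[OF r(1)]]]) (use Xmp in auto)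
  have B1s: "B1 \<subseteq> sp X V1" and B2s: "B2 \<subseteq> sp X V2" using BX by blast+
  have "d1 x = ma A (r V1 x) - r V2 (ma X x)" if "x \<in> sp X V1" for x
    using lin_eq_on_span[OF d1(1) l1 Xs B1s, of x] on_B that B1(3) by blast
  moreover have "db x = mb A (r V2 x) - r V3 (mb X x)" if "x \<in> sp X V2" for x
    using lin_eq_on_span[OF db(1) l2 Xs B2s, of x] on_B that B2(3) by blast
  moreover have "dc x = mc A (r V2 x) - r V3 (mc X x)" if "x \<in> sp X V2" for x
    using lin_eq_on_span[OF dc(1) l3 Xs B2s, of x] on_B that B2(3) by blast
  ultimately show ?thesis using RsD[OF r(1)] by blast
qed

text \<open>A family of vectors is one vector indexed by pairs, to which \<open>lin_select\<close>
  applies.\<close>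

lemma lin_select_family:
  fixes R :: "('b => 'k::field) => ('j => 'c => 'k) => bool"
  assumes S: "subsp S"
    and add: "\<And>x y x' y'. R x y ==> R x' y' ==> R (x + x') (\<lambda>j. y j + y' j)"
    and scale: "\<And>c x y. R x y ==> R (vscale c x) (\<lambda>j. vscale c (y j))"
    and ex: "\<And>x. x \<in> S ==> \<exists>y. R x y"
  shows "\<exists>f. (\<forall>j. lin S (f j)) & (\<forall>x\<in>S. R x (\<lambda>j. f j x))"
proof -
  let ?d = "\<lambda>z j b. z (j, b)" and ?e = "\<lambda>y (j, b). y j b"
  have d: "?d (z + z') = (\<lambda>j. ?d z j + ?d z' j)" "?d (vscale c z) = (\<lambda>j. vscale c (?d z j))"
    for z z' :: "'j \<times> 'c => 'k" and c by (auto simp: fun_eq_iff vscale_def)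
  have "\<exists>f. lin S f & (\<forall>x\<in>S. R x (?d (f x)))"
  proof (rule lin_select[OF S])
    show "R (x + x') (?d (y + y'))" if "R x (?d y)" "R x' (?d y')" for x y x' y'
      unfolding d by (rule add[OF that])
    show "R (vscale c x) (?d (vscale c y))" if "R x (?d y)" for c x y
      unfolding d by (rule scale[OF that])
    show "\<exists>y. R x (?d y)" if "x \<in> S" for x
    proof -
      obtain y where "R x y" using ex[OF \<open>x \<in> S\<close>] by blast
      then have "R x (?d (?e y))" by simp
      then show ?thesis by blast
    qed
  qed
  then obtain f where f: "lin S f" "\<forall>x\<in>S. R x (?d (f x))" by blast
  have "lin S (\<lambda>x. ?d (f x) j)" for j
    using f(1) unfolding lin_def by (simp add: fun_eq_iff vscale_def)
  then show ?thesis using f(2) by (intro exI[of _ "\<lambda>j x. ?d (f x) j"]) simp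
qed

subsection \<open>Exact sequences\<close>

abbreviation "tot J \<beta> v y \<equiv> \<Sum>j\<in>J. \<beta> j v (y j)"

text \<open>Exactness of \<open>A -> sum of the Y j -> M -> 0\<close>. The sum is not formed as a
  module; its elements are families \<open>y\<close>, which keeps all modules over one index type.
  Signs are absorbed into the maps, so the composite is a plain sum.\<close>

definition exact_seq :: "('b, 'k::field) qrep => 'j set => ('j => ('b, 'k) qrep) =>
    ('b, 'k) qrep => ('j => vertex => ('b => 'k) => ('b => 'k)) =>
    ('j => vertex => ('b => 'k) => ('b => 'k)) => bool" where
  "exact_seq A J Y M \<alpha> \<beta> \<longleftrightarrow>
    (\<forall>j\<in>J. Qmod (Y j) & Qhom A (Y j) (\<alpha> j) & Qhom (Y j) M (\<beta> j)) &
    (\<forall>v. \<forall>m\<in>sp M v. \<exists>y. (\<forall>j\<in>J. y j \<in> sp (Y j) v) & m = tot J \<beta> v y) &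
    (\<forall>v. \<forall>w\<in>sp A v. (\<Sum>j\<in>J. \<beta> j v (\<alpha> j v w)) = 0) &
    (\<forall>v y. (\<forall>j\<in>J. y j \<in> sp (Y j) v) & tot J \<beta> v y = 0 --> (\<exists>w\<in>sp A v. \<forall>j\<in>J. y j = \<alpha> j v w))"

lemma exact_seqD:
  assumes "exact_seq A J Y M \<alpha> \<beta>"
  shows "j \<in> J ==> Qmod (Y j)" "j \<in> J ==> Qhom A (Y j) (\<alpha> j)" "j \<in> J ==> Qhom (Y j) M (\<beta> j)"
    and "m \<in> sp M v ==> \<exists>y. (\<forall>j\<in>J. y j \<in> sp (Y j) v) & m = tot J \<beta> v y"
    and "w \<in> sp A v ==> (\<Sum>j\<in>J. \<beta> j v (\<alpha> j v w)) = 0"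
    and "(\<And>j. j \<in> J ==> y j \<in> sp (Y j) v) ==> tot J \<beta> v y = 0 ==> \<exists>w\<in>sp A v. \<forall>j\<in>J. y j = \<alpha> j v w"
  using assms unfolding exact_seq_def by blast+

lemma sum_qhom:
  assumes "\<forall>j\<in>J. Qhom (Y j) M (\<beta> j)" "\<forall>j\<in>J. y j \<in> sp (Y j) v"
  shows "\<forall>j\<in>J. y' j \<in> sp (Y j) v ==> (\<Sum>j\<in>J. \<beta> j v (y j + y' j)) = tot J \<beta> v y + tot J \<beta> v y'"
    and "(\<Sum>j\<in>J. \<beta> j v (vscale c (y j))) = vscale c (tot J \<beta> v y)"
proof -
  note l = qhom_lin[OF bspec[OF assms(1)]]
  show "(\<Sum>j\<in>J. \<beta> j v (y j + y' j)) = tot J \<beta> v y + tot J \<beta> v y'"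
    if "\<forall>j\<in>J. y' j \<in> sp (Y j) v"
  proof -
    have "(\<Sum>j\<in>J. \<beta> j v (y j + y' j)) = (\<Sum>j\<in>J. \<beta> j v (y j) + \<beta> j v (y' j))"
      by (rule sum.cong[OF refl]) (use lin_add[OF l] assms(2) that in blast)
    then show ?thesis by (simp only: sum.distrib)
  qed
  have "(\<Sum>j\<in>J. \<beta> j v (vscale c (y j))) = (\<Sum>j\<in>J. vscale c (\<beta> j v (y j)))"
    by (rule sum.cong[OF refl]) (use lin_scale[OF l] assms(2) in blast)
  then show "(\<Sum>j\<in>J. \<beta> j v (vscale c (y j))) = vscale c (tot J \<beta> v y)"
    by (simp only: fun_vs.scale_sum_right)
qed

lemma sum_qhom_diff:
  assumes "\<forall>j\<in>J. Qhom (Y j) M (\<beta> j)" "\<forall>j\<in>J. Qmod (Y j)" "\<forall>j\<in>J. y j \<in> sp (Y j) v" "\<forall>j\<in>J. y' j \<in> sp (Y j) v"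
  shows "(\<Sum>j\<in>J. \<beta> j v (y j - y' j)) = tot J \<beta> v y - tot J \<beta> v y'"
proof -
  have "(\<Sum>j\<in>J. \<beta> j v (y j - y' j)) = (\<Sum>j\<in>J. \<beta> j v (y j) - \<beta> j v (y' j))"
    by (rule sum.cong[OF refl])
      (use qhom_minus[OF bspec[OF assms(1)] module_subspace[OF bspec[OF assms(2)]]] assms(3,4) in blast)
  then show ?thesis by (simp only: sum_subtractf)
qed

lemma sum_qhom_mp:
  assumes M: "Qmod M" and \<beta>: "\<forall>j\<in>J. Qhom (Y j) M (\<beta> j)" and y: "\<forall>j\<in>J. y j \<in> sp (Y j) (src quiver_Q a)"
  shows "(\<Sum>j\<in>J. \<beta> j (tgt quiver_Q a) (mp (Y j) a (y j))) = mp M a (\<Sum>j\<in>J. \<beta> j (src quiver_Q a) (y j))"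
proof -
  have "(\<Sum>j\<in>J. \<beta> j (tgt quiver_Q a) (mp (Y j) a (y j))) = (\<Sum>j\<in>J. mp M a (\<beta> j (src quiver_Q a) (y j)))"
    by (rule sum.cong[OF refl]) (use qhom_mp[OF bspec[OF \<beta>]] y in blast)
  also have "\<dots> = mp M a (\<Sum>j\<in>J. \<beta> j (src quiver_Q a) (y j))"
    by (rule lin_sum[OF module_lin[OF M] module_subspace[OF M], symmetric]) (use qhom_sp[OF bspec[OF \<beta>]] y in blast)
  finally show ?thesis .
qed

text \<open>One direction of the Auslander-Reiten formula at work. A vertexwise linear lift of
  \<open>\<eta>\<close> fails to commute with the arrows by a cocycle of \<open>X\<close> with
  values in \<open>A\<close>; by \<open>H\<close> and \<open>ext_vanish\<close> it is a coboundary,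
  and subtracting the cochain makes the lift a homomorphism.\<close>

theorem lifting:
  fixes X :: "('d, 'k::field) qrep" and N A :: "('b, 'k) qrep"
  assumes cox: "cox A N gm" and ex: "exact_seq A J Y N \<alpha> \<beta>" and X: "Qmod X" and \<eta>: "Qhom X N \<eta>"
    and H: "\<And>F. Qhom N X F ==> qzero N F"
  shows "\<exists>h. (\<forall>j\<in>J. Qhom X (Y j) (h j)) & (\<forall>v. \<forall>x\<in>sp X v. \<eta> v x = (\<Sum>j\<in>J. \<beta> j v (h j v x)))"
proof -
  interpret cox A N gm by (rule cox)
  note Y = exact_seqD(1)[OF ex] and \<alpha> = exact_seqD(2)[OF ex] and \<beta> = exact_seqD(3)[OF ex]
  have \<beta>B: "\<forall>j\<in>J. Qhom (Y j) N (\<beta> j)" and YB: "\<forall>j\<in>J. Qmod (Y j)" using \<beta> Y by blast+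
  note Ys = module_subspace[OF Y]
  have "\<exists>s. (\<forall>j. lin (sp X v) (s j)) & (\<forall>x\<in>sp X v. x \<in> sp X v & (\<forall>j\<in>J. s j x \<in> sp (Y j) v) & \<eta> v x = (\<Sum>j\<in>J. \<beta> j v (s j x)))" for v
  proof (rule lin_select_family[OF module_subspace[OF X], where R = "\<lambda>x y. x \<in> sp X v & (\<forall>j\<in>J. y j \<in> sp (Y j) v) & \<eta> v x = tot J \<beta> v y"])
    fix x y x' y'
    assume "x \<in> sp X v & (\<forall>j\<in>J. y j \<in> sp (Y j) v) & \<eta> v x = tot J \<beta> v y"
      "x' \<in> sp X v & (\<forall>j\<in>J. y' j \<in> sp (Y j) v) & \<eta> v x' = tot J \<beta> v y'"
    then show "x + x' \<in> sp X v & (\<forall>j\<in>J. y j + y' j \<in> sp (Y j) v) & \<eta> v (x + x') = (\<Sum>j\<in>J. \<beta> j v (y j + y' j))"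
      using module_add[OF X, of x v x'] subsp_add[OF Ys] lin_add[OF qhom_lin[OF \<eta>], of x v x']
        sum_qhom(1)[OF \<beta>B, where y = y and v = v and y' = y'] by simp
  next
    fix c x y
    assume "x \<in> sp X v & (\<forall>j\<in>J. y j \<in> sp (Y j) v) & \<eta> v x = tot J \<beta> v y"
    then show "vscale c x \<in> sp X v & (\<forall>j\<in>J. vscale c (y j) \<in> sp (Y j) v) & \<eta> v (vscale c x) = (\<Sum>j\<in>J. \<beta> j v (vscale c (y j)))"
      using module_scale[OF X, of x v c] subsp_scale[OF Ys] qhom_scale[OF \<eta>, of x v c]
        sum_qhom(2)[OF \<beta>B, where y = y and v = v and c = c] by simp
  next
    fix x assume "x \<in> sp X v"
    then show "\<exists>y. x \<in> sp X v & (\<forall>j\<in>J. y j \<in> sp (Y j) v) & \<eta> v x = tot J \<beta> v y"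
      using exact_seqD(4)[OF ex qhom_sp[OF \<eta>]] by blast
  qed
  then have "\<forall>v. \<exists>s. (\<forall>j. lin (sp X v) (s j)) & (\<forall>x\<in>sp X v. (\<forall>j\<in>J. s j x \<in> sp (Y j) v) & \<eta> v x = (\<Sum>j\<in>J. \<beta> j v (s j x)))"
    by blast
  then obtain s0 where s0: "\<And>v j. lin (sp X v) (s0 v j)" "\<And>v j x. x \<in> sp X v ==> j \<in> J ==> s0 v j x \<in> sp (Y j) v"
    "\<And>v x. x \<in> sp X v ==> \<eta> v x = (\<Sum>j\<in>J. \<beta> j v (s0 v j x))"
    unfolding choice_iff by blast
  \<comment> \<open>The failure of the linear lift \<open>s0\<close> to commute with the arrow
    \<open>a\<close>. The maps \<open>\<beta>\<close> kill it, so it comes from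
    \<open>A\<close>.\<close>
  let ?t = "\<lambda>a j x. mp (Y j) a (s0 (src quiver_Q a) j x) - s0 (tgt quiver_Q a) j (mp X a x)"
  have lt: "lin (sp X (src quiver_Q a)) (?t a j)" if "j \<in> J" for a j
    by (rule lin_combine(2)[OF lin_comp[OF s0(1) _ module_lin[OF Y[OF that]]] lin_comp[OF module_lin[OF X] _ s0(1)]])
      (use s0(2) that module_mp[OF X] in auto)
  have tY: "?t a j x \<in> sp (Y j) (tgt quiver_Q a)" if "j \<in> J" "x \<in> sp X (src quiver_Q a)" for a j x
    using subsp_diff[OF Ys[OF that(1)] module_mp[OF Y[OF that(1)] s0(2)[OF that(2,1)]] s0(2)[OF module_mp[OF X that(2)] that(1)]] .
  have "\<exists>d. lin (sp X (src quiver_Q a)) d & (\<forall>x\<in>sp X (src quiver_Q a). x \<in> sp X (src quiver_Q a) & d x \<in> sp A (tgt quiver_Q a) &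
      (\<forall>j\<in>J. ?t a j x = \<alpha> j (tgt quiver_Q a) (d x)))" for a
  proof (rule lin_select[OF module_subspace[OF X], where R = "\<lambda>x w. x \<in> sp X (src quiver_Q a) & w \<in> sp A (tgt quiver_Q a) &
      (\<forall>j\<in>J. ?t a j x = \<alpha> j (tgt quiver_Q a) w)"], goal_cases)
    case (1 x w x' w')
    then have x: "x \<in> sp X (src quiver_Q a)" "x' \<in> sp X (src quiver_Q a)" "w \<in> sp A (tgt quiver_Q a)" "w' \<in> sp A (tgt quiver_Q a)" by auto
    have "?t a j (x + x') = \<alpha> j (tgt quiver_Q a) (w + w')" if j: "j \<in> J" for j
      using lin_add[OF lt[OF j] x(1,2)] qhom_plus[OF \<alpha>[OF j] x(3,4)] 1 j by simp
    then show ?case using module_add[OF X x(1,2)] subsp_add[OF A_sub x(3,4)] by blast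
  next
    case (2 c x w)
    then have x: "x \<in> sp X (src quiver_Q a)" "w \<in> sp A (tgt quiver_Q a)" by auto
    have "?t a j (vscale c x) = \<alpha> j (tgt quiver_Q a) (vscale c w)" if j: "j \<in> J" for j
      using lin_scale[OF lt[OF j] x(1)] qhom_scale[OF \<alpha>[OF j] x(2)] 2 j by simp
    then show ?case using module_scale[OF X x(1)] subsp_scale[OF A_sub x(2)] by blast
  next
    case (3 x)
    have "(\<Sum>j\<in>J. \<beta> j (tgt quiver_Q a) (?t a j x)) =
        (\<Sum>j\<in>J. \<beta> j (tgt quiver_Q a) (mp (Y j) a (s0 (src quiver_Q a) j x))) - (\<Sum>j\<in>J. \<beta> j (tgt quiver_Q a) (s0 (tgt quiver_Q a) j (mp X a x)))"
      by (rule sum_qhom_diff[OF \<beta>B YB]) (use s0(2) 3 module_mp[OF X] module_mp[OF Y] in auto)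
    also have "\<dots> = mp N a (\<eta> (src quiver_Q a) x) - \<eta> (tgt quiver_Q a) (mp X a x)"
      using sum_qhom_mp[OF N \<beta>B, where y = "\<lambda>j. s0 (src quiver_Q a) j x" and a = a] s0(2,3) 3 module_mp[OF X 3] by simp
    also have "\<dots> = 0" using qhom_mp[OF \<eta> 3] by simp
    finally show ?case using exact_seqD(6)[OF ex, of "\<lambda>j. ?t a j x" "tgt quiver_Q a"] tY 3 by blast
  qed
  then have "\<forall>a. \<exists>d. lin (sp X (src quiver_Q a)) d & (\<forall>x\<in>sp X (src quiver_Q a). d x \<in> sp A (tgt quiver_Q a) &
      (\<forall>j\<in>J. ?t a j x = \<alpha> j (tgt quiver_Q a) (d x)))" by blast
  then obtain d where d: "\<And>a. lin (sp X (src quiver_Q a)) (d a)" "\<And>a x. x \<in> sp X (src quiver_Q a) ==> d a x \<in> sp A (tgt quiver_Q a)"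
      "\<And>a x j. x \<in> sp X (src quiver_Q a) ==> j \<in> J ==> ?t a j x = \<alpha> j (tgt quiver_Q a) (d a x)"
    unfolding choice_iff by blast
  have "\<exists>r. (\<forall>v. lin (sp X v) (r v)) & (\<forall>v. \<forall>x\<in>sp X v. r v x \<in> sp A v) &
    (\<forall>x\<in>sp X V1. d A12 x = ma A (r V1 x) - r V2 (ma X x)) &
    (\<forall>x\<in>sp X V2. d A23 x = mb A (r V2 x) - r V3 (mb X x)) &
    (\<forall>x\<in>sp X V2. d B23 x = mc A (r V2 x) - r V3 (mc X x))"
    using d(1)[of A12] d(1)[of A23] d(1)[of B23] d(2)[of _ A12] d(2)[of _ A23] d(2)[of _ B23]
    by (intro ext_vanish[OF X H]) simp_all
  then obtain r where r: "\<And>v. lin (sp X v) (r v)" "\<And>v x. x \<in> sp X v ==> r v x \<in> sp A v"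
    "\<And>x. x \<in> sp X V1 ==> d A12 x = ma A (r V1 x) - r V2 (ma X x)"
    "\<And>x. x \<in> sp X V2 ==> d A23 x = mb A (r V2 x) - r V3 (mb X x)"
    "\<And>x. x \<in> sp X V2 ==> d B23 x = mc A (r V2 x) - r V3 (mc X x)" by blast
  have rd: "d a x = mp A a (r (src quiver_Q a) x) - r (tgt quiver_Q a) (mp X a x)" if "x \<in> sp X (src quiver_Q a)" for a x
    using that r(3-5) by (cases a) simp_all
  define h where "h j v x = s0 v j x - \<alpha> j v (r v x)" for j v x
  have h: "Qhom X (Y j) (h j)" if j: "j \<in> J" for j
    unfolding qhom_def
  proof (intro conjI allI ballI)
    show "lin (sp X v) (h j v)" for v
      unfolding h_def by (rule lin_combine(2)[OF s0(1) lin_comp[OF r(1) _ qhom_lin[OF \<alpha>[OF j]]]]) (use r(2) in blast)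
    show "h j v x \<in> sp (Y j) v" if "x \<in> sp X v" for v x
      unfolding h_def by (rule subsp_diff[OF Ys[OF j] s0(2)[OF that j] qhom_sp[OF \<alpha>[OF j] r(2)[OF that]]])
    fix a x assume x: "x \<in> sp X (src quiver_Q a)"
    let ?u = "src quiver_Q a" and ?v = "tgt quiver_Q a"
    have "mp (Y j) a (h j ?u x) = mp (Y j) a (s0 ?u j x) - mp (Y j) a (\<alpha> j ?u (r ?u x))"
      unfolding h_def by (rule lin_diff[OF module_lin[OF Y[OF j]] Ys[OF j] s0(2)[OF x j] qhom_sp[OF \<alpha>[OF j] r(2)[OF x]]])
    also have "mp (Y j) a (\<alpha> j ?u (r ?u x)) = \<alpha> j ?v (mp A a (r ?u x))" using qhom_mp[OF \<alpha>[OF j] r(2)[OF x]] by simp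
    also have "mp A a (r ?u x) = d a x + r ?v (mp X a x)" using rd[OF x] by simp
    also have "\<alpha> j ?v (d a x + r ?v (mp X a x)) = \<alpha> j ?v (d a x) + \<alpha> j ?v (r ?v (mp X a x))"
      by (rule qhom_plus[OF \<alpha>[OF j] d(2)[OF x] r(2)[OF module_mp[OF X x]]])
    also have "\<alpha> j ?v (d a x) = mp (Y j) a (s0 ?u j x) - s0 ?v j (mp X a x)" using d(3)[OF x j] by simp
    finally have "mp (Y j) a (h j ?u x) = s0 ?v j (mp X a x) - \<alpha> j ?v (r ?v (mp X a x))"
      by (simp add: fun_diff_def)
    then show "h j ?v (mp X a x) = mp (Y j) a (h j ?u x)" by (simp only: h_def)
  qed
  have "\<eta> v x = (\<Sum>j\<in>J. \<beta> j v (h j v x))" if x: "x \<in> sp X v" for v x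
    unfolding h_def
    using sum_qhom_diff[OF \<beta>B YB, where y = "\<lambda>j. s0 v j x" and v = v and y' = "\<lambda>j. \<alpha> j v (r v x)"] s0(2,3)[OF x] qhom_sp[OF \<alpha> r(2)[OF x]]
      exact_seqD(5)[OF ex r(2)[OF x]] by simp
  then show ?thesis using h by blast
qed

section \<open>Right almost split maps and Gabriel-Roiter submodules\<close>

definition qsurj :: "('v, 'a, 'b, 'k::field) rep => ('v, 'a, 'c, 'k) rep => ('v => ('b => 'k) => ('c => 'k)) => bool" where
  "qsurj M N f \<longleftrightarrow> (\<forall>v. \<forall>y\<in>sp N v. \<exists>x\<in>sp M v. f v x = y)"

text \<open>The factorisation is asked for maps that are not surjective, the case of inclusions of
  proper submodules.\<close>

definition right_almost_split :: "('b, 'k::field) qrep => 'j set => ('j => ('b, 'k) qrep) =>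
    ('j => vertex => ('b => 'k) => ('b => 'k)) => bool" where
  "right_almost_split M J Y \<beta> \<longleftrightarrow> (\<forall>j\<in>J. Qmod (Y j) & Qhom (Y j) M (\<beta> j)) &
    (\<forall>(X :: ('b, 'k) qrep) \<eta>. Qmod X & Qhom X M \<eta> & \<not> qsurj X M \<eta> -->
      (\<exists>h. (\<forall>j\<in>J. Qhom X (Y j) (h j)) & (\<forall>v. \<forall>x\<in>sp X v. \<eta> v x = (\<Sum>j\<in>J. \<beta> j v (h j v x)))))"

lemma right_almost_splitD:
  fixes M X :: "('b, 'k::field) qrep"
  assumes "right_almost_split M J Y \<beta>"
  shows "j \<in> J ==> Qmod (Y j)" "j \<in> J ==> Qhom (Y j) M (\<beta> j)"
    and "Qmod X ==> Qhom X M \<eta> ==> \<not> qsurj X M \<eta> ==>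
      \<exists>h. (\<forall>j\<in>J. Qhom X (Y j) (h j)) & (\<forall>v. \<forall>x\<in>sp X v. \<eta> v x = (\<Sum>j\<in>J. \<beta> j v (h j v x)))"
  using assms unfolding right_almost_split_def by simp_all

text \<open>Replace \<open>X\<close> by the image of \<open>\<eta>\<close>, a proper submodule. A
  homomorphism from the brick \<open>N\<close> to it is a scalar after inclusion, and a nonzero
  scalar would make the image everything. So there are no nonzero homomorphisms to the image, and
  its inclusion lifts.\<close>

theorem exact_seq_right_almost_split:
  fixes N A :: "('b, 'k::field) qrep"
  assumes cox: "cox A N gm" and ex: "exact_seq A J Y N \<alpha> \<beta>" and brick: "brick N"
  shows "right_almost_split N J Y \<beta>"
  unfolding right_almost_split_def
proof (intro conjI ballI allI impI)
  interpret cox A N gm by (rule cox)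
  show "Qmod (Y j)" "Qhom (Y j) N (\<beta> j)" if "j \<in> J" for j using exact_seqD[OF ex] that by blast+
  fix X :: "('b, 'k) qrep" and \<eta>
  assume "Qmod X & Qhom X N \<eta> & \<not> qsurj X N \<eta>"
  then have X: "Qmod X" and \<eta>: "Qhom X N \<eta>" and ns: "\<not> qsurj X N \<eta>" by auto
  let ?I = "qimage quiver_Q X N \<eta>"
  have I: "subm ?I N" by (rule qimage_submodule[OF X N \<eta>])
  have z: "qzero N F" if F: "Qhom N ?I F" for F
  proof -
    obtain c where c: "\<And>v x. x \<in> sp N v ==> F v x = vscale c x"
      using brick qhom_extend_cod[OF I F] unfolding brick_def by blast
    have "c = 0"
    proof (rule ccontr)
      assume "c ~= 0"
      have "\<exists>x\<in>sp X v. \<eta> v x = y" if y: "y \<in> sp N v" for v y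
      proof -
        have "vscale (inverse c) (F v y) \<in> sp ?I v"
          using qhom_sp[OF F y] module_scale[OF submodule_module(1)[OF I]] by blast
        moreover have "vscale (inverse c) (F v y) = y" using c[OF y] \<open>c ~= 0\<close> by simp
        ultimately have "y \<in> \<eta> v ` sp X v" by simp
        then show ?thesis by auto
      qed
      then show False using ns unfolding qsurj_def by blast
    qed
    then show ?thesis using c by (simp add: qzero_def)
  qed
  obtain h where h: "\<And>j. j \<in> J ==> Qhom ?I (Y j) (h j)" "\<And>v x. x \<in> sp ?I v ==> x = (\<Sum>j\<in>J. \<beta> j v (h j v x))"
    using lifting[OF cox ex submodule_module(1)[OF I] qhom_inclusion[OF I] z] by blast
  have \<eta>I: "Qhom X ?I \<eta>" by (rule qhom_corestrict[OF I \<eta>]) simp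
  show "\<exists>h. (\<forall>j\<in>J. Qhom X (Y j) (h j)) & (\<forall>v. \<forall>x\<in>sp X v. \<eta> v x = (\<Sum>j\<in>J. \<beta> j v (h j v x)))"
    using h qhom_comp[OF \<eta>I h(1)] by (intro exI[of _ "\<lambda>j v x. h j v (\<eta> v x)"]) auto
qed

lemma brick_endo:
  assumes "brick M" "Qhom M M F"
  shows "qzero M F \<or> qinj M F"
proof -
  obtain c where c: "\<And>v x. x \<in> sp M v ==> F v x = vscale c x" using assms unfolding brick_def by blast
  show ?thesis by (cases "c = 0") (auto simp: qzero_def qinj_def c)
qed

text \<open>The projection onto a direct summand is an endomorphism, hence zero or
  injective.\<close>

lemma brick_indec:
  assumes M: "Qmod M" and b: "brick M" and nz: "\<not> is_zero M"
  shows "indec M"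
  unfolding indecomposable_def
proof (intro conjI allI impI M nz)
  fix U W
  assume A: "subm U M & subm W M & (\<forall>v. sp U v \<inter> sp W v = {0} & {x + y |x y. x \<in> sp U v & y \<in> sp W v} = sp M v)"
  then have U: "subm U M" and W: "subm W M" by auto
  obtain p where p: "Qhom M U p" "\<And>v x. x \<in> sp U v ==> p v x = x" "\<And>v x. x \<in> sp W v ==> p v x = 0"
    using dsum_projections[OF U W] A by auto
  from brick_endo[OF b qhom_extend_cod[OF U p(1)]] show "is_zero U \<or> is_zero W"
  proof
    assume "qzero M p"
    then have "x = 0" if "x \<in> sp U v" for v x using p(2)[OF that] submodule_sp[OF U that] by (auto simp: qzero_def)
    then show ?thesis using module_0[OF submodule_module(1)[OF U]] unfolding is_zero_def by blast
  next
    assume "qinj M p"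
    then have "x = 0" if "x \<in> sp W v" for v x using p(3)[OF that] submodule_sp[OF W that] by (auto simp: qinj_def)
    then show ?thesis using module_0[OF submodule_module(1)[OF W]] unfolding is_zero_def by blast
  qed
qed

text \<open>The image of \<open>\<beta> j\<close> is proper, so its inclusion factors through the
  \<open>Y k\<close>. By \<open>alt\<close> each composite from \<open>Y j\<close> to some
  \<open>Y k\<close> is zero or injective. If one is injective, so is \<open>\<beta> j\<close>; if
  all vanish, \<open>\<beta> j\<close> is zero.\<close>

theorem component_injective:
  assumes ras: "right_almost_split M J Y \<beta>" and M: "Qmod M" and j: "j \<in> J" and ns: "\<not> qsurj (Y j) M (\<beta> j)" and nz: "\<not> qzero (Y j) (\<beta> j)"
    and alt: "\<And>k F. k \<in> J ==> Qhom (Y j) (Y k) F ==> qzero (Y j) F \<or> qinj (Y j) F"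
  shows "qinj (Y j) (\<beta> j)"
proof -
  note Y = right_almost_splitD(1)[OF ras] and \<beta> = right_almost_splitD(2)[OF ras]
  let ?I = "qimage quiver_Q (Y j) M (\<beta> j)"
  have I: "subm ?I M" by (rule qimage_submodule[OF Y[OF j] M \<beta>[OF j]])
  have nsI: "\<not> qsurj ?I M (\<lambda>v x. x)" using ns by (force simp: qsurj_def)
  obtain h where h: "\<And>k. k \<in> J ==> Qhom ?I (Y k) (h k)" "\<And>v x. x \<in> sp ?I v ==> x = (\<Sum>k\<in>J. \<beta> k v (h k v x))"
    using right_almost_splitD(3)[OF ras submodule_module(1)[OF I] qhom_inclusion[OF I] nsI] by blast
  have hI: "Qhom (Y j) ?I (\<beta> j)" by (rule qhom_corestrict[OF I \<beta>[OF j]]) simp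
  show ?thesis
  proof (cases "\<exists>k\<in>J. qinj (Y j) (\<lambda>v x. h k v (\<beta> j v x))")
    case True
    then obtain k where k: "k \<in> J" "qinj (Y j) (\<lambda>v x. h k v (\<beta> j v x))" by blast
    then show ?thesis using qhom_0[OF h(1)[OF k(1)] submodule_module(1)[OF I]] by (auto simp: qinj_def)
  next
    case False
    have z: "h k v (\<beta> j v x) = 0" if "k \<in> J" "x \<in> sp (Y j) v" for k v x
      using alt[OF that(1) qhom_comp[OF hI h(1)[OF that(1)]]] False that unfolding qzero_def by blast
    have "qzero (Y j) (\<beta> j)"
      unfolding qzero_def
    proof (intro allI ballI)
      fix v x assume x: "x \<in> sp (Y j) v"
      have "\<beta> j v x = (\<Sum>k\<in>J. \<beta> k v (h k v (\<beta> j v x)))" using h(2)[of "\<beta> j v x" v] x by simp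
      also have "\<dots> = (\<Sum>k\<in>J. 0)" by (rule sum.cong[OF refl]) (use z x qhom_0[OF \<beta> Y] in simp)
      finally show "\<beta> j v x = 0" by simp
    qed
    then show ?thesis using nz by blast
  qed
qed

text \<open>The measure contains the length of \<open>X\<close>, so a chain realising it must reach
  \<open>X\<close>; Gabriel's property is stated for a chain ending in \<open>X\<close>.\<close>

lemma gr_measure_chain:
  assumes "indec X"
  shows "\<exists>Ms. ichain X Ms & last Ms = X & \<mu> X = len ` set Ms"
proof -
  obtain Ms where Ms: "ichain X Ms" "\<mu> X = len ` set Ms"
    using gr_measure_max(1)[OF assms] chain_lengths_iff by blast
  obtain Z where Z: "Z \<in> set Ms" "len X = len Z" using len_in_gr_measure[OF assms] Ms(2) by auto
  have "len Z \<le> len (last Ms)" using ichain_last(1)[OF Ms(1)] Z(1) len_mono by (auto simp: ichain_def)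
  then have "last Ms = X" using len_eq_imp_eq[OF ichain_last(2)[OF Ms(1)]] Z(2) by simp
  then show ?thesis using Ms by blast
qed

text \<open>The inclusion of a proper indecomposable \<open>X\<close> factors through the
  \<open>Y k\<close>, by jointly injective maps. By Gabriel's property \<open>X\<close> embeds into
  some \<open>Y k\<close> or has a smaller measure. By \<open>cmp\<close> both alternatives lead to
  a measure below that of \<open>Y j\<close>, except for an embedding into \<open>Y j\<close>
  itself, as \<open>gr_submodule_criterion\<close> requires.\<close>

theorem gr_right_almost_split:
  fixes M :: "('b, 'k::field) qrep"
  assumes fin: "finite J" and ras: "right_almost_split M J Y \<beta>" and M: "indec M" and j: "j \<in> J" and Yj: "indec (Y j)" and inj: "qinj (Y j) (\<beta> j)"
    and lt: "len (Y j) < len M"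
    and cmp: "\<And>k. k \<in> J ==> Y k = Y j \<or> indec (Y k) & gr_less (\<mu> (Y k)) (\<mu> (Y j))"
  shows "\<mu> M = insert (len M) (\<mu> (Y j))"
    and "\<exists>X. gr_submodule quiver_Q X M"
    and "gr_submodule quiver_Q X M ==> isomorphic quiver_Q X (Y j)"
proof -
  note Y = right_almost_splitD(1)[OF ras] and \<beta> = right_almost_splitD(2)[OF ras]
  have H: "gr_less (\<mu> X) (\<mu> (Y j)) \<or> (\<exists>h. Qhom X (Y j) h & qinj X h)"
    if X: "psubm X M" "indec X" for X
  proof -
    have sX: "subm X M" using X by (simp add: proper_submodule_def)
    have mX: "Qmod X" using X indec_module by blast
    have ns: "\<not> qsurj X M (\<lambda>v x. x)"
    proof
      assume "qsurj X M (\<lambda>v x. x)"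
      then have "sp X v = sp M v" for v using submodule_sp[OF sX] by (auto simp: qsurj_def)
      then show False using proper_len[OF X(1)] by (simp add: len_def)
    qed
    obtain h where h: "\<And>k. k \<in> J ==> Qhom X (Y k) (h k)" "\<And>v x. x \<in> sp X v ==> x = (\<Sum>k\<in>J. \<beta> k v (h k v x))"
      using right_almost_splitD(3)[OF ras mX qhom_inclusion[OF sX] ns] by blast
    obtain ks where ks: "set ks = J" using finite_list[OF fin] by blast
    obtain Ms where Ms: "ichain X Ms" "last Ms = X" "\<mu> X = len ` set Ms" using gr_measure_chain[OF X(2)] by blast
    have "\<exists>(Y, f)\<in>set (map (\<lambda>k. (Y k, h k)) ks). qinj X f \<or> (\<exists>C\<in>chain_lengths quiver_Q Y. gr_less (len ` set Ms) C)"
    proof (rule gabriel_main_property[OF _ _ _ Ms(2)])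
      show "x = 0" if "x \<in> sp X v" "\<forall>(Y, f)\<in>set (map (\<lambda>k. (Y k, h k)) ks). f v x = 0" for v x
      proof -
        have "(\<Sum>k\<in>J. \<beta> k v (h k v x)) = (\<Sum>k\<in>J. 0)"
          by (rule sum.cong[OF refl]) (use that(2) ks qhom_0[OF \<beta> Y] in auto)
        then show ?thesis using h(2)[OF that(1)] by simp
      qed
    qed (use Ms(1) ks Y h in \<open>auto simp: ichain_def\<close>)
    then obtain k where k: "k \<in> J" and alt: "qinj X (h k) \<or> (\<exists>C\<in>chain_lengths quiver_Q (Y k). gr_less (\<mu> X) C)"
      using ks Ms(3) by auto
    have "Y k = Y j \<or> indec (Y k) & gr_less (\<mu> (Y k)) (\<mu> (Y j))" by (rule cmp[OF k])
    moreover have "indec (Y k)" using cmp[OF k] Yj by auto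
    moreover have "gr_less (\<mu> X) (\<mu> (Y k)) \<or>
        qinj X (h k) & (\<mu> X = \<mu> (Y k) \<or> gr_less (\<mu> X) (\<mu> (Y k)))"
      using alt gr_measure_max(2)[OF \<open>indec (Y k)\<close>] gr_less_trans gr_measure_mono[OF X(2) \<open>indec (Y k)\<close> h(1)[OF k]] by metis
    ultimately show ?thesis
    proof (cases "Y k = Y j")
      case True
      then show ?thesis
        using \<open>gr_less _ _ \<or> qinj X (h k) & _\<close> h(1)[OF k] by auto
    next
      case False
      then have "gr_less (\<mu> (Y k)) (\<mu> (Y j))" using cmp[OF k] by blast
      then show ?thesis
        using \<open>gr_less _ _ \<or> qinj X (h k) & _\<close> gr_less_trans[of "\<mu> X"] by auto
    qed
  qed
  show "\<mu> M = insert (len M) (\<mu> (Y j))" "\<exists>X. gr_submodule quiver_Q X M"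
    "gr_submodule quiver_Q X M ==> isomorphic quiver_Q X (Y j)"
    using gr_submodule_criterion[OF M Yj \<beta>[OF j] inj lt H] by blast+
qed

section \<open>Exactness and the transform\<close>

lemma sum_comp_qhom:
  fixes K :: "('a, 'k::field) qrep"
  assumes M: "Qmod M" and \<alpha>: "\<And>j. j \<in> J ==> Qhom K (Y j) (\<alpha> j)" and \<beta>: "\<And>j. j \<in> J ==> Qhom (Y j) M (\<beta> j)"
  shows "Qhom K M (\<lambda>v x. \<Sum>j\<in>J. \<beta> j v (\<alpha> j v x))"
proof -
  have \<beta>': "\<forall>j\<in>J. Qhom (Y j) M (\<beta> j)" using \<beta> by blast
  show ?thesis
    unfolding qhom_def
  proof (intro conjI allI ballI)
    note \<alpha>s = qhom_sp[OF \<alpha>]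
    show "lin (sp K v) (\<lambda>x. \<Sum>j\<in>J. \<beta> j v (\<alpha> j v x))" for v
      unfolding lin_def
    proof (intro conjI ballI allI)
      fix x y :: "'a => 'k" assume xy: "x \<in> sp K v" "y \<in> sp K v"
      have "(\<Sum>j\<in>J. \<beta> j v (\<alpha> j v (x + y))) = (\<Sum>j\<in>J. \<beta> j v (\<alpha> j v x + \<alpha> j v y))"
        by (rule sum.cong[OF refl]) (simp only: qhom_plus[OF \<alpha> xy])
      also have "\<dots> = (\<Sum>j\<in>J. \<beta> j v (\<alpha> j v x)) + (\<Sum>j\<in>J. \<beta> j v (\<alpha> j v y))" by (rule sum_qhom(1)[OF \<beta>']) (use \<alpha>s xy in auto)
      finally show "(\<Sum>j\<in>J. \<beta> j v (\<alpha> j v (x + y))) = (\<Sum>j\<in>J. \<beta> j v (\<alpha> j v x)) + (\<Sum>j\<in>J. \<beta> j v (\<alpha> j v y))" .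
    next
      fix c and x :: "'a => 'k" assume x: "x \<in> sp K v"
      have "(\<Sum>j\<in>J. \<beta> j v (\<alpha> j v (vscale c x))) = (\<Sum>j\<in>J. \<beta> j v (vscale c (\<alpha> j v x)))"
        by (rule sum.cong[OF refl]) (simp only: qhom_scale[OF \<alpha> x])
      also have "\<dots> = vscale c (\<Sum>j\<in>J. \<beta> j v (\<alpha> j v x))" by (rule sum_qhom(2)[OF \<beta>']) (use \<alpha>s x in auto)
      finally show "(\<Sum>j\<in>J. \<beta> j v (\<alpha> j v (vscale c x))) = vscale c (\<Sum>j\<in>J. \<beta> j v (\<alpha> j v x))" .
    qed
    show "(\<Sum>j\<in>J. \<beta> j v (\<alpha> j v x)) \<in> sp M v" if "x \<in> sp K v" for v x
      by (rule subsp_sum[OF module_subspace[OF M]]) (use qhom_sp[OF \<beta>] \<alpha>s that in blast)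
    fix a and x :: "'a => 'k" assume x: "x \<in> sp K (src quiver_Q a)"
    have "(\<Sum>j\<in>J. \<beta> j (tgt quiver_Q a) (\<alpha> j (tgt quiver_Q a) (mp K a x))) = (\<Sum>j\<in>J. \<beta> j (tgt quiver_Q a) (mp (Y j) a (\<alpha> j (src quiver_Q a) x)))"
      by (rule sum.cong[OF refl]) (simp only: qhom_mp[OF \<alpha> x])
    also have "\<dots> = mp M a (\<Sum>j\<in>J. \<beta> j (src quiver_Q a) (\<alpha> j (src quiver_Q a) x))" by (rule sum_qhom_mp[OF M \<beta>']) (use \<alpha>s x in auto)
    finally show "(\<Sum>j\<in>J. \<beta> j (tgt quiver_Q a) (\<alpha> j (tgt quiver_Q a) (mp K a x))) = mp M a (\<Sum>j\<in>J. \<beta> j (src quiver_Q a) (\<alpha> j (src quiver_Q a) x))" .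
  qed
qed

text \<open>\<open>y\<close> and \<open>y'\<close> lie over \<open>m\<close> and \<open>m'\<close>,
  and what they generate at 3 comes from \<open>K\<close>. It is used for
  \<open>(gm w 0, gm 0 w)\<close>, the pairs that give all relations of \<open>M\<close> at
  3.\<close>

definition rel_lift :: "('a, 'k::field) qrep => 'j set => ('j => ('b, 'k) qrep) => ('j => vertex => ('a => 'k) => ('b => 'k)) =>
    ('j => vertex => ('b => 'k) => ('c => 'k)) => ('c => 'k) => ('c => 'k) => bool" where
  "rel_lift K J Y \<alpha> \<beta> m m' \<longleftrightarrow> (\<exists>y y'. (\<forall>j\<in>J. y j \<in> sp (Y j) V2) & (\<forall>j\<in>J. y' j \<in> sp (Y j) V2) &
    tot J \<beta> V2 y = m & tot J \<beta> V2 y' = m' &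
    (\<exists>x\<in>sp K V3. \<forall>j\<in>J. mb (Y j) (y j) + mc (Y j) (y' j) = \<alpha> j V3 x))"

text \<open>At 3 the \<open>Y j\<close> and \<open>M\<close> are generated from 2, so surjectivity
  is inherited, and an element of the kernel yields a relation of \<open>M\<close>. By
  \<open>lift\<close> this relation is realised in the \<open>Y j\<close> up to an element of
  \<open>K\<close>; the difference is settled by exactness at 2.\<close>

lemma exact_seq_generated:
  fixes M :: "('b, 'k::field) qrep"
  assumes cox: "cox A M gm" and K: "Qmod K" and Y: "\<And>j. j \<in> J ==> Qmod (Y j)"
    and \<alpha>: "\<And>j. j \<in> J ==> Qhom K (Y j) (\<alpha> j)" and \<beta>: "\<And>j. j \<in> J ==> Qhom (Y j) M (\<beta> j)"
    and gen: "\<And>j z. j \<in> J ==> z \<in> sp (Y j) V3 ==> \<exists>y\<in>sp (Y j) V2. \<exists>y'\<in>sp (Y j) V2. z = mb (Y j) y + mc (Y j) y'"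
    and complex: "\<And>v w. w \<in> sp K v ==> (\<Sum>j\<in>J. \<beta> j v (\<alpha> j v w)) = 0"
    and surj: "\<And>v m. v ~= V3 ==> m \<in> sp M v ==> \<exists>y. (\<forall>j\<in>J. y j \<in> sp (Y j) v) & m = tot J \<beta> v y"
    and ker: "\<And>v y. v ~= V3 ==> \<forall>j\<in>J. y j \<in> sp (Y j) v ==> tot J \<beta> v y = 0 ==> \<exists>w\<in>sp K v. \<forall>j\<in>J. y j = \<alpha> j v w"
    and lift: "\<And>w. w \<in> sp A V3 ==> rel_lift K J Y \<alpha> \<beta> (gm w 0) (gm 0 w)"
  shows "exact_seq K J Y M \<alpha> \<beta>"
proof -
  interpret cox A M gm by (rule cox)
  note Ks = module_subspace[OF K]
  have \<beta>': "\<forall>j\<in>J. Qhom (Y j) M (\<beta> j)" and Y': "\<forall>j\<in>J. Qmod (Y j)" using \<beta> Y by blast+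
  have sum: "(\<Sum>j\<in>J. \<beta> j V3 (mb (Y j) (y j) + mc (Y j) (y' j))) = mb M (tot J \<beta> V2 y) + mc M (tot J \<beta> V2 y')"
    if y: "\<forall>j\<in>J. y j \<in> sp (Y j) V2" "\<forall>j\<in>J. y' j \<in> sp (Y j) V2" for y y'
  proof -
    have "(\<Sum>j\<in>J. \<beta> j V3 (mb (Y j) (y j) + mc (Y j) (y' j))) = (\<Sum>j\<in>J. \<beta> j V3 (mb (Y j) (y j))) + (\<Sum>j\<in>J. \<beta> j V3 (mc (Y j) (y' j)))"
      by (rule sum_qhom(1)[OF \<beta>']) (use y Qmod_mp[OF Y] in auto)
    then show ?thesis using sum_qhom_mp[OF N \<beta>', of y A23] sum_qhom_mp[OF N \<beta>', of y' B23] y by simp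
  qed
  have surj3: "\<exists>y. (\<forall>j\<in>J. y j \<in> sp (Y j) V3) & m = tot J \<beta> V3 y" if m: "m \<in> sp M V3" for m
  proof -
    obtain n n' where n: "n \<in> sp M V2" "n' \<in> sp M V2" "m = mb M n + mc M n'" using N3_gen[OF m] by blast
    obtain y where y: "\<forall>j\<in>J. y j \<in> sp (Y j) V2" "n = tot J \<beta> V2 y" using surj[OF _ n(1)] by blast
    obtain y' where y': "\<forall>j\<in>J. y' j \<in> sp (Y j) V2" "n' = tot J \<beta> V2 y'" using surj[OF _ n(2)] by blast
    have "mb (Y j) (y j) + mc (Y j) (y' j) \<in> sp (Y j) V3" if "j \<in> J" for j
      using module_add[OF Y[OF that]] Qmod_mp[OF Y[OF that]] y(1) y'(1) that by blast
    then show ?thesis using sum[OF y(1) y'(1)] n(3) y(2) y'(2) by (intro exI[of _ "\<lambda>j. mb (Y j) (y j) + mc (Y j) (y' j)"]) simp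
  qed
  have ker3: "\<exists>w\<in>sp K V3. \<forall>j\<in>J. z j = \<alpha> j V3 w" if z: "\<forall>j\<in>J. z j \<in> sp (Y j) V3" "tot J \<beta> V3 z = 0" for z
  proof -
    have "\<forall>j\<in>J. \<exists>y. fst y \<in> sp (Y j) V2 & snd y \<in> sp (Y j) V2 & z j = mb (Y j) (fst y) + mc (Y j) (snd y)"
      using gen z(1) by (metis fst_conv snd_conv)
    then obtain g where g: "\<forall>j\<in>J. fst (g j) \<in> sp (Y j) V2 & snd (g j) \<in> sp (Y j) V2 & z j = mb (Y j) (fst (g j)) + mc (Y j) (snd (g j))"
      unfolding bchoice_iff by blast
    define y y' where "y j = fst (g j)" and "y' j = snd (g j)" for j
    have y: "\<forall>j\<in>J. y j \<in> sp (Y j) V2" "\<forall>j\<in>J. y' j \<in> sp (Y j) V2" and zj: "\<And>j. j \<in> J ==> z j = mb (Y j) (y j) + mc (Y j) (y' j)"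
      using g by (auto simp: y_def y'_def)
    have mem: "tot J \<beta> V2 x \<in> sp M V2" if "\<forall>j\<in>J. x j \<in> sp (Y j) V2" for x
      by (rule subsp_sum[OF N_sub]) (use qhom_sp[OF \<beta>] that in blast)
    have "tot J \<beta> V3 z = (\<Sum>j\<in>J. \<beta> j V3 (mb (Y j) (y j) + mc (Y j) (y' j)))"
      by (rule sum.cong[OF refl]) (simp only: zj)
    then have "mb M (tot J \<beta> V2 y) + mc M (tot J \<beta> V2 y') = 0"
      unfolding z(2) sum[OF y] by (rule sym)
    then obtain w where w: "w \<in> sp A V3" "tot J \<beta> V2 y = gm w 0" "tot J \<beta> V2 y' = gm 0 w"
      unfolding N3_rel[OF mem[OF y(1)] mem[OF y(2)]] by blast
    obtain u u' x where u: "\<forall>j\<in>J. u j \<in> sp (Y j) V2" "\<forall>j\<in>J. u' j \<in> sp (Y j) V2"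
        "tot J \<beta> V2 u = gm w 0" "tot J \<beta> V2 u' = gm 0 w"
      and x: "x \<in> sp K V3" "\<And>j. j \<in> J ==> mb (Y j) (u j) + mc (Y j) (u' j) = \<alpha> j V3 x" using lift[OF w(1)] unfolding rel_lift_def by blast
    \<comment> \<open>Two families at 2 with the same total differ by the image of an element of
      \<open>K\<close>.\<close>
    have d: "\<exists>t\<in>sp K V2. \<forall>j\<in>J. a j - b j = \<alpha> j V2 t"
      if *: "\<forall>j\<in>J. a j \<in> sp (Y j) V2" "\<forall>j\<in>J. b j \<in> sp (Y j) V2" "tot J \<beta> V2 a = tot J \<beta> V2 b" for a b
    proof (rule ker)
      show "(\<Sum>j\<in>J. \<beta> j V2 (a j - b j)) = 0" unfolding sum_qhom_diff[OF \<beta>' Y' *(1,2)] *(3) by (rule diff_self)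
      show "\<forall>j\<in>J. a j - b j \<in> sp (Y j) V2" using module_diff[OF Y] *(1,2) by blast
    qed simp
    obtain t where t: "t \<in> sp K V2" "\<And>j. j \<in> J ==> y j - u j = \<alpha> j V2 t" using d[OF y(1) u(1)] w(2) u(3) by auto
    obtain t' where t': "t' \<in> sp K V2" "\<And>j. j \<in> J ==> y' j - u' j = \<alpha> j V2 t'" using d[OF y(2) u(2)] w(3) u(4) by auto
    let ?w = "mb K t + mc K t' + x"
    have m: "mb K t \<in> sp K V3" "mc K t' \<in> sp K V3" using Qmod_mp[OF K] t(1) t'(1) by simp_all
    have s: "mb K t + mc K t' \<in> sp K V3" by (rule subsp_add[OF Ks m])
    have "z j = \<alpha> j V3 ?w" if j: "j \<in> J" for j
    proof -
      note l = qhom_plus[OF \<alpha>[OF j]] and Yl = Qmod_lin[OF Y[OF j]] and Ys = module_subspace[OF Y[OF j]]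
      have yj: "y j \<in> sp (Y j) V2" "u j \<in> sp (Y j) V2" "y' j \<in> sp (Y j) V2" "u' j \<in> sp (Y j) V2" using y u j by auto
      have "mb (Y j) (y j) - mb (Y j) (u j) = \<alpha> j V3 (mb K t)"
        unfolding lin_diff[OF Yl(2) Ys yj(1,2), symmetric] t(2)[OF j] by (rule qhom_Q_mp(2)[OF \<alpha>[OF j] t(1), symmetric])
      moreover have "mc (Y j) (y' j) - mc (Y j) (u' j) = \<alpha> j V3 (mc K t')"
        unfolding lin_diff[OF Yl(3) Ys yj(3,4), symmetric] t'(2)[OF j] by (rule qhom_Q_mp(3)[OF \<alpha>[OF j] t'(1), symmetric])
      ultimately have "\<alpha> j V3 ?w = (mb (Y j) (y j) - mb (Y j) (u j)) + (mc (Y j) (y' j) - mc (Y j) (u' j))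
          + (mb (Y j) (u j) + mc (Y j) (u' j))"
        unfolding l[OF s x(1)] l[OF m] x(2)[OF j] by (simp only:)
      also have "\<dots> = mb (Y j) (y j) + mc (Y j) (y' j)" by (simp only: algebra_simps)
      finally show ?thesis unfolding zj[OF j] by (rule sym)
    qed
    moreover have "?w \<in> sp K V3" by (rule subsp_add[OF Ks s x(1)])
    ultimately show ?thesis by blast
  qed
  show ?thesis
    unfolding exact_seq_def
  proof (intro conjI ballI allI impI)
    show "\<exists>y. (\<forall>j\<in>J. y j \<in> sp (Y j) v) & m = tot J \<beta> v y" if "m \<in> sp M v" for v m
      using surj[of v m] surj3[of m] that by (cases "v = V3") auto
    show "\<exists>w\<in>sp K v. \<forall>j\<in>J. y j = \<alpha> j v w" if *: "(\<forall>j\<in>J. y j \<in> sp (Y j) v) & tot J \<beta> v y = 0" for v y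
    proof (cases "v = V3")
      case True
      show ?thesis unfolding True by (rule ker3) (use * True in auto)
    next
      case False
      show ?thesis by (rule ker[OF False]) (use * in auto)
    qed
  qed (use Y \<alpha> \<beta> complex in auto)
qed

text \<open>At 1 and 2 this is a diagram chase: an element of \<open>M\<^sub>1\<close> that accounts
  for a kernel is lifted along the surjection at 1 and subtracted from the representatives. At 3 it
  follows from \<open>exact_seq_generated\<close>, as transforms are generated from 2.\<close>

theorem exact_seq_cox:
  fixes A :: "('b, 'k::field) qrep"
  assumes ex: "exact_seq A J Y M \<alpha> \<beta>" and A: "cox A A' gmA" and Y: "\<And>j. j \<in> J ==> cox (Y j) (Y' j) (gm j)" and M: "cox M M' gmM"
    and \<alpha>': "\<And>j. j \<in> J ==> Qhom A' (Y' j) (\<alpha>' j)" "\<And>j. j \<in> J ==> induced A gmA (gm j) (\<alpha> j) (\<alpha>' j)"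
    and \<beta>': "\<And>j. j \<in> J ==> Qhom (Y' j) M' (\<beta>' j)" "\<And>j. j \<in> J ==> induced (Y j) (gm j) gmM (\<beta> j) (\<beta>' j)"
  shows "exact_seq A' J Y' M' \<alpha>' \<beta>'"
proof -
  interpret A: cox A A' gmA by (rule A)
  interpret M: cox M M' gmM by (rule M)
  note \<alpha> = exact_seqD(2)[OF ex] and \<beta> = exact_seqD(3)[OF ex] and E = exact_seqD[OF ex]
  have YN: "\<And>j. j \<in> J ==> Qmod (Y' j)" and YA: "\<And>j. j \<in> J ==> Qmod (Y j)" using cox.N[OF Y] cox.A[OF Y] by auto
  have \<beta>B: "\<forall>j\<in>J. Qhom (Y j) M (\<beta> j)" and \<beta>'B: "\<forall>j\<in>J. Qhom (Y' j) M' (\<beta>' j)"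
    and YAB: "\<forall>j\<in>J. Qmod (Y j)" using \<beta> \<beta>'(1) YA YN by blast+
  have Ymp: "\<And>j x. j \<in> J ==> x \<in> sp (Y j) V1 ==> ma (Y j) x \<in> sp (Y j) V2"
     "\<And>j x. j \<in> J ==> x \<in> sp (Y j) V2 ==> mb (Y j) x \<in> sp (Y j) V3" "\<And>j x. j \<in> J ==> x \<in> sp (Y j) V2 ==> mc (Y j) x \<in> sp (Y j) V3"
    using Qmod_mp[OF YA] by auto
  have \<beta>M: "\<And>j v y. j \<in> J ==> y \<in> sp (Y j) v ==> \<beta> j v y \<in> sp M v" using qhom_sp[OF \<beta>] .
  have sumM: "\<And>v y. (\<And>j. j \<in> J ==> y j \<in> sp (Y j) v) ==> tot J \<beta> v y \<in> sp M v"
    using \<beta>M by (intro subsp_sum[OF M.A_sub]) auto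
  have sumg: "(\<Sum>j\<in>J. gmM (f j) (g j)) = gmM (\<Sum>j\<in>J. f j) (\<Sum>j\<in>J. g j)"
    if "\<And>j. j \<in> J ==> f j \<in> sp M V3" "\<And>j. j \<in> J ==> g j \<in> sp M V3" for f g :: "_ => 'b => 'k"
    using that
  proof (induction J rule: infinite_finite_induct)
    case (insert j J)
    have "(\<Sum>j\<in>J. f j) \<in> sp M V3" "(\<Sum>j\<in>J. g j) \<in> sp M V3" using insert by (auto intro!: subsp_sum[OF M.A_sub])
    then have "gmM (f j + (\<Sum>j\<in>J. f j)) (g j + (\<Sum>j\<in>J. g j)) = gmM (f j) (g j) + gmM (\<Sum>j\<in>J. f j) (\<Sum>j\<in>J. g j)"
      using lin2_add[OF M.gm_lin] insert by simp
    moreover have "(\<Sum>j\<in>J. gmM (f j) (g j)) = gmM (\<Sum>j\<in>J. f j) (\<Sum>j\<in>J. g j)" using insert by simp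
    ultimately show ?case by (simp only: sum.insert[OF insert(1,2)])
  qed (simp_all add: lin2_0[OF M.gm_lin M.A_sub])
  have sum\<beta>': "(\<Sum>j\<in>J. \<beta>' j V2 (gm j (y j) (y' j))) = gmM (tot J \<beta> V3 y) (tot J \<beta> V3 y')"
    if "\<And>j. j \<in> J ==> y j \<in> sp (Y j) V3" "\<And>j. j \<in> J ==> y' j \<in> sp (Y j) V3" for y y'
  proof -
    have "(\<Sum>j\<in>J. \<beta>' j V2 (gm j (y j) (y' j))) = (\<Sum>j\<in>J. gmM (\<beta> j V3 (y j)) (\<beta> j V3 (y' j)))"
      by (rule sum.cong[OF refl]) (use inducedD[OF \<beta>'(2)] that in blast)
    also have "\<dots> = gmM (tot J \<beta> V3 y) (tot J \<beta> V3 y')" by (rule sumg) (use \<beta>M that in auto)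
    finally show ?thesis .
  qed
  have gmY: "gm j (w - mb (Y j) (ma (Y j) t)) (w' - mc (Y j) (ma (Y j) t)) = gm j w w'"
    if "j \<in> J" "w \<in> sp (Y j) V3" "w' \<in> sp (Y j) V3" "t \<in> sp (Y j) V1" for j w w' t
    using lin2_diff[OF cox.gm_lin[OF Y[OF that(1)]] cox.A_sub[OF Y[OF that(1)]] that(2,3)] cox.gm_a0[OF Y[OF that(1)] that(4)]
      Ymp[OF that(1)] that(4) by simp
  have surj2: "\<exists>y. (\<forall>j\<in>J. y j \<in> sp (Y' j) V2) & m = tot J \<beta>' V2 y" if m: "m \<in> sp M' V2" for m
  proof -
    obtain w w' where w: "w \<in> sp M V3" "w' \<in> sp M V3" "m = gmM w w'" using M.gm_surj[OF m] by blast
    obtain y where y: "\<And>j. j \<in> J ==> y j \<in> sp (Y j) V3" "w = tot J \<beta> V3 y" using E(4)[OF w(1)] by blast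
    obtain y' where y': "\<And>j. j \<in> J ==> y' j \<in> sp (Y j) V3" "w' = tot J \<beta> V3 y'" using E(4)[OF w(2)] by blast
    show ?thesis
      by (rule exI[of _ "\<lambda>j. gm j (y j) (y' j)"]) (use sum\<beta>'[OF y(1) y'(1)] y y' w(3) cox.gm_in[OF Y] in auto)
  qed
  have ker2: "\<exists>w\<in>sp A' V2. \<forall>j\<in>J. n j = \<alpha>' j V2 w"
    if n: "\<And>j. j \<in> J ==> n j \<in> sp (Y' j) V2" "tot J \<beta>' V2 n = 0" for n
  proof -
    have "\<forall>j\<in>J. \<exists>y y'. y \<in> sp (Y j) V3 & y' \<in> sp (Y j) V3 & n j = gm j y y'" using cox.gm_surj[OF Y n(1)] by blast
    then obtain y y' where y: "\<And>j. j \<in> J ==> y j \<in> sp (Y j) V3" "\<And>j. j \<in> J ==> y' j \<in> sp (Y j) V3"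
      "\<And>j. j \<in> J ==> n j = gm j (y j) (y' j)" by metis
    have "tot J \<beta>' V2 n = gmM (tot J \<beta> V3 y) (tot J \<beta> V3 y')"
      using sum\<beta>'[OF y(1,2)] y(3) by simp
    then obtain t where t: "t \<in> sp M V1" "tot J \<beta> V3 y = mb M (ma M t)" "tot J \<beta> V3 y' = mc M (ma M t)"
      using M.gm_0[OF sumM[OF y(1)] sumM[OF y(2)]] n(2) by auto
    obtain s where s: "\<And>j. j \<in> J ==> s j \<in> sp (Y j) V1" "t = tot J \<beta> V1 s" using E(4)[OF t(1)] by blast
    have as: "(\<Sum>j\<in>J. \<beta> j V2 (ma (Y j) (s j))) = ma M t"
      using sum_qhom_mp[OF M.A \<beta>B, where y = s and a = A12] s by simp
    have bs: "(\<Sum>j\<in>J. \<beta> j V3 (mb (Y j) (ma (Y j) (s j)))) = mb M (ma M t)"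
      "(\<Sum>j\<in>J. \<beta> j V3 (mc (Y j) (ma (Y j) (s j)))) = mc M (ma M t)"
      using sum_qhom_mp[OF M.A \<beta>B, where y = "\<lambda>j. ma (Y j) (s j)" and a = A23] sum_qhom_mp[OF M.A \<beta>B, where y = "\<lambda>j. ma (Y j) (s j)" and a = B23] s Ymp as
      by simp_all
    \<comment> \<open>Subtracting the images of \<open>s j\<close> leaves the values of
      \<open>gm j\<close> unchanged and makes both totals zero, so that exactness of the given
      sequence applies at 3.\<close>
    let ?z = "\<lambda>j. y j - mb (Y j) (ma (Y j) (s j))" and ?z' = "\<lambda>j. y' j - mc (Y j) (ma (Y j) (s j))"
    have zY: "?z j \<in> sp (Y j) V3" "?z' j \<in> sp (Y j) V3" if "j \<in> J" for j
      using module_diff[OF YA[OF that]] y(1,2)[OF that] Ymp[OF that] s(1)[OF that] by simp_all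
    have "tot J \<beta> V3 ?z = 0" "tot J \<beta> V3 ?z' = 0"
      using sum_qhom_diff[OF \<beta>B YAB, where y = y and v = V3 and y' = "\<lambda>j. mb (Y j) (ma (Y j) (s j))"]
        sum_qhom_diff[OF \<beta>B YAB, where y = y' and v = V3 and y' = "\<lambda>j. mc (Y j) (ma (Y j) (s j))"] y s Ymp bs t by simp_all
    then obtain w w' where w: "w \<in> sp A V3" "\<And>j. j \<in> J ==> ?z j = \<alpha> j V3 w" "w' \<in> sp A V3" "\<And>j. j \<in> J ==> ?z' j = \<alpha> j V3 w'"
      using E(6)[of ?z V3, OF zY(1)] E(6)[of ?z' V3, OF zY(2)] by blast
    have "n j = \<alpha>' j V2 (gmA w w')" if j: "j \<in> J" for j
      using gmY[OF j y(1)[OF j] y(2)[OF j] s(1)[OF j]] y(3)[OF j] inducedD[OF \<alpha>'(2)[OF j] w(1,3)] w(2,4)[OF j] by simp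
    then show ?thesis using A.gm_in[OF w(1,3)] by blast
  qed
  have cpx2: "(\<Sum>j\<in>J. \<beta>' j V2 (\<alpha>' j V2 n)) = 0" if n: "n \<in> sp A' V2" for n
  proof -
    obtain w w' where w: "w \<in> sp A V3" "w' \<in> sp A V3" "n = gmA w w'" using A.gm_surj[OF n] by blast
    have "(\<Sum>j\<in>J. \<beta>' j V2 (\<alpha>' j V2 n)) = (\<Sum>j\<in>J. \<beta>' j V2 (gm j (\<alpha> j V3 w) (\<alpha> j V3 w')))"
      by (rule sum.cong[OF refl]) (use inducedD[OF \<alpha>'(2) w(1,2)] w(3) in simp)
    also have "\<dots> = gmM (\<Sum>j\<in>J. \<beta> j V3 (\<alpha> j V3 w)) (\<Sum>j\<in>J. \<beta> j V3 (\<alpha> j V3 w'))"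
      by (rule sum\<beta>') (use qhom_sp[OF \<alpha>] w in auto)
    also have "\<dots> = 0" by (simp only: E(5)[OF w(1)] E(5)[OF w(2)] lin2_0[OF M.gm_lin M.A_sub])
    finally show ?thesis .
  qed
  note mpM' = sum_qhom_mp[OF M.N \<beta>'B]
  have sumM': "tot J \<beta>' V1 y \<in> sp M' V1" if "\<And>j. j \<in> J ==> y j \<in> sp (Y' j) V1" for y
    using qhom_sp[OF \<beta>'(1)] that by (intro subsp_sum[OF M.N_sub]) auto
  have surj1: "\<exists>y. (\<forall>j\<in>J. y j \<in> sp (Y' j) V1) & m = tot J \<beta>' V1 y" if m: "m \<in> sp M' V1" for m
  proof -
    obtain x where x: "x \<in> sp M V2" "ma M' m = gmM (mb M x) (mc M x)" using m M.a_image[of "ma M' m"] by blast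
    obtain y where y: "\<And>j. j \<in> J ==> y j \<in> sp (Y j) V2" "x = tot J \<beta> V2 y" using E(4)[OF x(1)] by blast
    have "\<forall>j\<in>J. \<exists>n. n \<in> sp (Y' j) V1 & ma (Y' j) n = gm j (mb (Y j) (y j)) (mc (Y j) (y j))"
      using cox.a_image[OF Y] y(1) by blast
    then obtain n where n: "\<And>j. j \<in> J ==> n j \<in> sp (Y' j) V1" "\<And>j. j \<in> J ==> ma (Y' j) (n j) = gm j (mb (Y j) (y j)) (mc (Y j) (y j))"
      by metis
    have "ma M' (tot J \<beta>' V1 n) = (\<Sum>j\<in>J. \<beta>' j V2 (gm j (mb (Y j) (y j)) (mc (Y j) (y j))))"
      using mpM'[where y = n and a = A12] n by simp
    also have "\<dots> = gmM (mb M x) (mc M x)"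
      using sum\<beta>'[of "\<lambda>j. mb (Y j) (y j)" "\<lambda>j. mc (Y j) (y j)"] Ymp y(1)
        sum_qhom_mp[OF M.A \<beta>B, where y = y and a = A23] sum_qhom_mp[OF M.A \<beta>B, where y = y and a = B23] y(2) by simp
    finally have "m = tot J \<beta>' V1 n" using M.aN_eq[OF m sumM'[OF n(1)]] x(2) by simp
    then show ?thesis using n(1) by blast
  qed
  have ker1: "\<exists>w\<in>sp A' V1. \<forall>j\<in>J. n j = \<alpha>' j V1 w"
    if n: "\<And>j. j \<in> J ==> n j \<in> sp (Y' j) V1" "tot J \<beta>' V1 n = 0" for n
  proof -
    have "\<forall>j\<in>J. \<exists>x. x \<in> sp (Y j) V2 & ma (Y' j) (n j) = gm j (mb (Y j) x) (mc (Y j) x)"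
      using cox.a_image[OF Y] n(1) by blast
    then obtain x where x: "\<And>j. j \<in> J ==> x j \<in> sp (Y j) V2" "\<And>j. j \<in> J ==> ma (Y' j) (n j) = gm j (mb (Y j) (x j)) (mc (Y j) (x j))"
      by metis
    let ?x = "\<Sum>j\<in>J. \<beta> j V2 (x j)"
    have xM: "?x \<in> sp M V2" by (rule sumM[OF x(1)])
    have "gmM (mb M ?x) (mc M ?x) = (\<Sum>j\<in>J. \<beta>' j V2 (gm j (mb (Y j) (x j)) (mc (Y j) (x j))))"
      using sum\<beta>'[of "\<lambda>j. mb (Y j) (x j)" "\<lambda>j. mc (Y j) (x j)"] Ymp x(1)
        sum_qhom_mp[OF M.A \<beta>B, where y = x and a = A23] sum_qhom_mp[OF M.A \<beta>B, where y = x and a = B23] by simp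
    also have "\<dots> = ma M' (tot J \<beta>' V1 n)" using mpM'[where y = n and a = A12] n x(2) by simp
    also have "\<dots> = 0" using n(2) module_mp_0[OF M.N] by simp
    finally obtain t where t: "t \<in> sp M V1" "mb M ?x = mb M (ma M t)" "mc M ?x = mc M (ma M t)"
      using M.gm_0[of "mb M ?x" "mc M ?x"] xM by auto
    then have xt: "?x = ma M t" using M.bc_eq[OF xM] by simp
    obtain s where s: "\<And>j. j \<in> J ==> s j \<in> sp (Y j) V1" "t = tot J \<beta> V1 s" using E(4)[OF t(1)] by blast
    let ?z = "\<lambda>j. x j - ma (Y j) (s j)"
    have zY: "?z j \<in> sp (Y j) V2" if "j \<in> J" for j
      using module_diff[OF YA[OF that]] x(1)[OF that] Ymp[OF that] s(1)[OF that] by simp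
    have "tot J \<beta> V2 ?z = 0"
      using sum_qhom_diff[OF \<beta>B YAB, where y = x and v = V2 and y' = "\<lambda>j. ma (Y j) (s j)"] x(1) Ymp s xt
        sum_qhom_mp[OF M.A \<beta>B, where y = s and a = A12] by simp
    then obtain w where w: "w \<in> sp A V2" "\<And>j. j \<in> J ==> ?z j = \<alpha> j V2 w" using E(6)[of ?z V2] zY by blast
    obtain p where p: "p \<in> sp A' V1" "ma A' p = gmA (mb A w) (mc A w)" using A.a_image w(1) by blast
    have "n j = \<alpha>' j V1 p" if j: "j \<in> J" for j
    proof (rule cox.aN_eq[OF Y[OF j] n(1)[OF j] qhom_sp[OF \<alpha>'(1)[OF j] p(1)]])
      have "ma (Y' j) (\<alpha>' j V1 p) = gm j (\<alpha> j V3 (mb A w)) (\<alpha> j V3 (mc A w))"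
        using qhom_Q_mp(1)[OF \<alpha>'(1)[OF j] p(1)] p(2) inducedD[OF \<alpha>'(2)[OF j]] w(1) by simp
      also have "\<dots> = gm j (mb (Y j) (?z j)) (mc (Y j) (?z j))"
        using qhom_Q_mp(2,3)[OF \<alpha>[OF j] w(1)] w(2)[OF j] by simp
      also have "\<dots> = gm j (mb (Y j) (x j)) (mc (Y j) (x j))"
        using lin_diff[OF Qmod_lin(2)[OF YA[OF j]] module_subspace[OF YA[OF j]] x(1)[OF j] Ymp(1)[OF j s(1)[OF j]]]
          lin_diff[OF Qmod_lin(3)[OF YA[OF j]] module_subspace[OF YA[OF j]] x(1)[OF j] Ymp(1)[OF j s(1)[OF j]]]
          gmY[OF j Ymp(2)[OF j x(1)[OF j]] Ymp(3)[OF j x(1)[OF j]] s(1)[OF j]] by simp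
      finally show "ma (Y' j) (n j) = ma (Y' j) (\<alpha>' j V1 p)" using x(2)[OF j] by simp
    qed
    then show ?thesis using p(1) by blast
  qed
  have complex: "(\<Sum>j\<in>J. \<beta>' j v (\<alpha>' j v w)) = 0" if "w \<in> sp A' v" for v w
    using A.qhom_zero_V2[OF M.N sum_comp_qhom[OF M.N \<alpha>'(1) \<beta>'(1)] cpx2 M.a_inj] that unfolding qzero_def by blast
  show ?thesis
  proof (rule exact_seq_generated[OF M A.N YN \<alpha>'(1) \<beta>'(1) cox.N3_gen[OF Y] complex])
    show "\<exists>y. (\<forall>j\<in>J. y j \<in> sp (Y' j) v) & m = tot J \<beta>' v y" if "v ~= V3" "m \<in> sp M' v" for v m
      using that surj1 surj2 by (cases v) auto
    show "\<exists>w\<in>sp A' v. \<forall>j\<in>J. y j = \<alpha>' j v w" if "v ~= V3" "\<forall>j\<in>J. y j \<in> sp (Y' j) v" "tot J \<beta>' v y = 0" for v y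
      using that ker1[of y] ker2[of y] by (cases v) auto
    fix w assume w: "w \<in> sp M V3"
    obtain y where y: "\<And>j. j \<in> J ==> y j \<in> sp (Y j) V3" "w = tot J \<beta> V3 y" using E(4)[OF w] by blast
    have Y0: "\<And>j. j \<in> J ==> 0 \<in> sp (Y j) V3" using module_0[OF YA] .
    have "(\<Sum>j\<in>J. \<beta> j V3 0) = (\<Sum>j\<in>J. 0)" by (rule sum.cong[OF refl]) (use qhom_0[OF \<beta> YA] in simp)
    then have s0: "(\<Sum>j\<in>J. \<beta> j V3 0) = 0" by simp
    let ?g = "\<lambda>j. gm j (y j) 0" and ?g' = "\<lambda>j. gm j 0 (y j)"
    have gY: "?g j \<in> sp (Y' j) V2" "?g' j \<in> sp (Y' j) V2" if "j \<in> J" for j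
      using cox.gm_in[OF Y[OF that]] y(1)[OF that] Y0[OF that] by auto
    have sg: "tot J \<beta>' V2 ?g = gmM w 0" "tot J \<beta>' V2 ?g' = gmM 0 w"
      using sum\<beta>'[of y "\<lambda>j. 0"] sum\<beta>'[of "\<lambda>j. 0" y] y Y0 s0 by simp_all
    \<comment> \<open>The relation holds in each \<open>Y' j\<close> separately, so the element of
      \<open>A'\<close> can be zero.\<close>
    have "mb (Y' j) (?g j) + mc (Y' j) (?g' j) = \<alpha>' j V3 0" if j: "j \<in> J" for j
      using cox.N3_rel[OF Y[OF j] gY[OF j]] y(1)[OF j] qhom_0[OF \<alpha>'(1)[OF j] A.N] by metis
    then show "rel_lift A' J Y' \<alpha>' \<beta>' (gmM w 0) (gmM 0 w)"
      unfolding rel_lift_def using gY sg A.N_0 by (intro exI[of _ ?g] exI[of _ ?g']) blast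
  qed
qed

section \<open>Projective modules and duals\<close>

lemma opposite_opposite [simp]: "opposite (opposite G) = G"
  by (simp add: opposite_def)

section \<open>Extending linear maps and forming quotient spaces\<close>

lemma fd_finite_support:
  fixes D :: "'b set"
  assumes "finite D"
  shows "findim {f :: 'b => 'k::field. \<forall>z. f z ~= 0 --> z \<in> D}"
proof -
  let ?e = "\<lambda>z y. if y = z then 1 else 0 :: 'k"
  let ?S = "{f :: 'b => 'k. \<forall>z. f z ~= 0 --> z \<in> D}"
  have "x z ~= 0 \<or> y z ~= 0" if "x z + y z ~= 0" for x y :: "'b => 'k" and z using that by auto
  then have sub: "subsp ?S" unfolding subsp_def vscale_def by fastforce
  have "?S \<subseteq> vspan (?e ` D)"
  proof
    fix f assume f: "f \<in> ?S"
    have "f = (\<Sum>z\<in>D. vscale (f z) (?e z))"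
    proof
      fix y show "f y = (\<Sum>z\<in>D. vscale (f z) (?e z)) y"
        unfolding sum_apply using f assms by (cases "y \<in> D") (auto simp: vscale_def if_distrib cong: if_cong)
    qed
    also have "\<dots> \<in> vspan (?e ` D)"
      by (intro fun_vs.span_sum fun_vs.span_scale fun_vs.span_base) auto
    finally show "f \<in> vspan (?e ` D)" .
  qed
  moreover have "?e ` D \<subseteq> ?S" by (auto split: if_splits)
  ultimately have "vspan (?e ` D) = ?S" using fun_vs.span_subspace[OF _ _ sub] by blast
  then show ?thesis unfolding finite_dimensional_def using assms by blast
qed

lemma lin_extend:
  assumes S: "subsp S" and f: "lin S f" and W: "subsp W" "\<And>x. x \<in> S ==> f x \<in> W"
  shows "\<exists>h. (\<forall>T. lin T h) & (\<forall>x\<in>S. h x = f x) & (\<forall>x. h x \<in> W)"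
proof -
  obtain B where B: "B \<subseteq> S" "vindep B" "S \<subseteq> vspan B" "card B = vdim S" by (rule fun_vs.basis_exists[of S])
  obtain h where h: "Vector_Spaces.linear vscale vscale h" "\<forall>x\<in>B. h x = f x" "range h = vspan (f ` B)"
    using vector_space_pair.linear_independent_extend_subspace[OF fun_pair B(2), of f] by blast
  have "f ` B \<subseteq> W" using W(2) B(1) by blast
  then have "range h \<subseteq> W" using h(3) fun_vs.span_minimal[OF _ W(1)] by simp
  moreover have "h x = f x" if "x \<in> S" for x
    using lin_eq_on_span[OF linear_lin[OF h(1)] f S B(1), of x] h(2) that B(3) by blast
  ultimately show ?thesis using linear_lin[OF h(1)] by blast
qed

lemma functional_extend:
  fixes \<phi> :: "('b => 'k::field) => 'k"
  assumes S: "subsp S" and add: "\<And>x y. x \<in> S ==> y \<in> S ==> \<phi> (x + y) = \<phi> x + \<phi> y"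
    and scale: "\<And>c x. x \<in> S ==> \<phi> (vscale c x) = c * \<phi> x"
  shows "\<exists>\<xi>. functional \<xi> & (\<forall>x\<in>S. \<xi> x = \<phi> x)"
proof -
  \<comment> \<open>A functional is a linear map into the functions on \<open>unit\<close>, so
    extension of linear maps covers it.\<close>
  have "lin S (\<lambda>x (_::unit). \<phi> x)" unfolding lin_def using add scale by (auto simp: fun_eq_iff vscale_def)
  then obtain h :: "('b => 'k) => unit => 'k" where h: "Vector_Spaces.linear vscale vscale h" "\<forall>x\<in>S. h x = (\<lambda>_. \<phi> x)"
    using lin_total[OF S] by blast
  have l: "lin UNIV h" by (rule linear_lin[OF h(1)])
  have "functional (\<lambda>x. h x ())"
    using lin_add[OF l] lin_scale[OF l]
    by (auto simp: Vector_Spaces.linear_iff vscale_def fun_vs.vector_space_axioms vector_space_pair.axioms(2)[OF functional_pair])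
  then show ?thesis using h(2) by (intro exI[of _ "\<lambda>x. h x ()"]) simp
qed

text \<open>A model of the quotient of \<open>S\<close> by \<open>U\<close> inside functions on
  \<open>'y\<close>: keep the coordinates at the basis vectors outside \<open>U\<close>, and label
  these vectors by distinct elements of the infinite type.\<close>

lemma quotient_map:
  fixes S U :: "('z => 'k::field) set"
  assumes S: "findim S" and U: "subsp U" "U \<subseteq> S" and inf: "infinite (UNIV :: 'y set)"
  shows "\<exists>q :: ('z => 'k) => ('y => 'k). lin S q & (\<forall>x\<in>S. q x = 0 \<longleftrightarrow> x \<in> U)"
proof -
  obtain B0 where B0: "finite B0" "vindep B0" "vspan B0 = U" using fd_basis[OF fd_subset[OF S U]] by blast
  have "B0 \<subseteq> S" using B0(3) U(2) fun_vs.span_superset by blast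
  then obtain B where B: "B0 \<subseteq> B" "finite B" "vindep B" "vspan B = S" using fd_basis_extend[OF S B0(2)] by blast
  obtain c :: "('z => 'k) => 'y" where c: "inj_on c B"
    using infinite_arbitrarily_large[OF inf, of "card B"] card_le_inj[OF B(2)] by (metis order_refl)
  let ?r = "fun_vs.representation B"
  define q where "q x = (\<lambda>y. \<Sum>b\<in>B - B0. if y = c b then ?r x b else 0)" for x
  have rl: "?r (x + y) = (\<lambda>b. ?r x b + ?r y b)" "?r (vscale s x) = (\<lambda>b. s * ?r x b)" if "x \<in> S" "y \<in> S" for x y s
    using that B(4) fun_vs.representation_add[OF B(3)] fun_vs.representation_scale[OF B(3)] by (auto simp: fun_eq_iff)
  have "lin S q"
    unfolding lin_def q_def using rl
    by (auto simp: fun_eq_iff vscale_def sum_distrib_left intro!: sum.cong simp flip: sum.distrib)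
  moreover have "q x = 0 \<longleftrightarrow> x \<in> U" if x: "x \<in> S" for x
  proof -
    have qc: "q x (c b) = ?r x b" if b: "b \<in> B - B0" for b
    proof -
      have "q x (c b) = (\<Sum>b'\<in>B - B0. if b' = b then ?r x b' else 0)"
        unfolding q_def by (rule sum.cong) (use c b in \<open>auto dest: inj_onD\<close>)
      then show ?thesis using b B(2) by simp
    qed
    show ?thesis
    proof
      assume "q x = 0"
      then have z: "?r x b = 0" if "b \<in> B - B0" for b using qc[OF that] by simp
      have "x = (\<Sum>b\<in>B. vscale (?r x b) b)"
        using fun_vs.sum_representation_eq[OF B(3) _ B(2) order_refl, of x] x B(4) by simp
      also have "\<dots> = (\<Sum>b\<in>B0. vscale (?r x b) b)"
        by (rule sum.mono_neutral_right) (use B z in auto)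
      also have "\<dots> \<in> vspan B0" by (intro fun_vs.span_sum fun_vs.span_scale fun_vs.span_base)
      finally show "x \<in> U" using B0(3) by simp
    next
      assume "x \<in> U"
      then have "?r x = fun_vs.representation B0 x"
        using fun_vs.representation_extend[OF B(3) _ B(1)] B0(3) by simp
      then have "?r x b = 0" if "b \<in> B - B0" for b
        using fun_vs.representation_ne_zero[of B0 x b] that by auto
      then show "q x = 0" unfolding q_def by (auto simp: fun_eq_iff intro!: sum.neutral)
    qed
  qed
  ultimately show ?thesis by blast
qed

section \<open>Projective modules and duality\<close>

lemma projectiveI:
  fixes P :: "('v, 'a, 'b, 'k::field) rep"
  assumes P: "is_module G P"
    and lift: "\<And>(M :: ('v, 'a, 'b, 'k) rep) (N :: ('v, 'a, 'b, 'k) rep) g h. is_module G M ==> is_module G N ==>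
      qhom G M N g ==> (\<And>v y. y \<in> sp N v ==> \<exists>x\<in>sp M v. g v x = y) ==> qhom G P N h ==>
      \<exists>h'. qhom G P M h' & (\<forall>v. \<forall>x\<in>sp P v. g v (h' v x) = h v x)"
  shows "projective G P"
  unfolding projective_def
proof (intro conjI P allI impI ballI)
  fix M N :: "('v, 'a, 'b, 'k) rep" and g h
  assume MN: "is_module G M & is_module G N" and g: "g \<in> hom G M N" and s: "surjective M N g" and h: "h \<in> hom G P N"
  have "\<exists>x\<in>sp M v. g v x = y" if "y \<in> sp N v" for v y
  proof -
    have "y \<in> g v ` sp M v" using s that unfolding surjective_def by simp
    then show ?thesis by auto
  qed
  then obtain h' where h': "qhom G P M h'" "\<And>v x. x \<in> sp P v ==> g v (h' v x) = h v x"
    using lift[of M N g h] MN g h by (auto simp: hom_iff)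
  have "hom_comp g (cut P h') = h"
  proof (rule ext, rule ext)
    fix v x show "hom_comp g (cut P h') v x = h v x"
      using h'(2)[of x v] h qhom_0[of G M N g v] g MN by (auto simp: hom_comp_def cut_def hom_iff)
  qed
  then show "\<exists>h'\<in>hom G P M. hom_comp g h' = h" using cut_hom[OF P h'(1)] by blast
qed

lemma projectiveD:
  fixes P M N :: "('v, 'a, 'b, 'k::field) rep"
  assumes "projective G P" and M: "is_module G M" and N: "is_module G N" and g: "qhom G M N g"
    and s: "\<And>v y. y \<in> sp N v ==> \<exists>x\<in>sp M v. g v x = y" and h: "qhom G P N h"
  shows "\<exists>h'. qhom G P M h' & (\<forall>v. \<forall>x\<in>sp P v. g v (h' v x) = h v x)"
proof -
  have P: "is_module G P" using assms(1) by (simp add: projective_def)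
  have "surjective M N (cut M g)"
    unfolding surjective_def using s qhom_sp[OF g] by (auto simp: cut_def image_iff)
  then obtain h' where h': "h' \<in> hom G P M" "hom_comp (cut M g) h' = cut P h"
    using assms(1) M N cut_hom[OF M g] cut_hom[OF P h] unfolding projective_def by blast
  have "g v (h' v x) = h v x" if "x \<in> sp P v" for v x
  proof -
    have "hom_comp (cut M g) h' v x = cut P h v x" using h'(2) by simp
    moreover have "h' v x \<in> sp M v" using h'(1) qhom_sp that by (auto simp: hom_iff)
    ultimately show ?thesis using that by (simp add: hom_comp_def)
  qed
  then show ?thesis using h'(1) by (auto simp: hom_iff)
qed

lemma dual_sp_iff: "\<phi> \<in> sp (dual G M) v \<longleftrightarrow> (\<forall>x\<in>sp M v. \<forall>y\<in>sp M v. \<phi> (x + y) = \<phi> x + \<phi> y) &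
    (\<forall>c. \<forall>x\<in>sp M v. \<phi> (vscale c x) = c * \<phi> x) & (\<forall>x. x \<notin> sp M v --> \<phi> x = 0)"
  by (auto simp: dual_def linear_map_def)

lemma dual_mp: "\<phi> \<in> sp (dual G M) (tgt G a) ==> mp (dual G M) a \<phi> = \<phi> \<circ> mp M a"
  by (simp add: dual_def Let_def)

lemma dual_outside: "\<phi> \<notin> sp (dual G M) (tgt G a) ==> mp (dual G M) a \<phi> = 0"
  by (simp add: dual_def Let_def)

text \<open>Each dual space is the image of the space itself under the form from
  \<open>form_exists\<close>, hence finite-dimensional.\<close>

lemma dual_module:
  fixes M :: "('v, 'a, 'b, 'k::field) rep"
  assumes M: "is_module G M"
  shows "is_module (opposite G) (dual G M)"
proof (rule is_moduleI)
  fix v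
  obtain \<beta> :: "('b => 'k) => ('b => 'k) => 'k" where \<beta>:
    "\<forall>x\<in>sp M v. \<forall>y\<in>sp M v. \<forall>z\<in>sp M v. \<beta> (x + y) z = \<beta> x z + \<beta> y z"
    "\<forall>c. \<forall>x\<in>sp M v. \<forall>z\<in>sp M v. \<beta> (vscale c x) z = c * \<beta> x z"
    "\<forall>x\<in>sp M v. \<forall>y\<in>sp M v. \<beta> x y = \<beta> y x"
    "\<forall>\<phi>. (\<forall>x\<in>sp M v. \<forall>y\<in>sp M v. \<phi> (x + y) = \<phi> x + \<phi> y) & (\<forall>c. \<forall>x\<in>sp M v. \<phi> (vscale c x) = c * \<phi> x) -->
       (\<exists>w\<in>sp M v. \<forall>x\<in>sp M v. \<phi> x = \<beta> w x)"
    using form_exists[OF module_fd[OF M, of v]] by blast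
  let ?t = "\<lambda>w x. if x \<in> sp M v then \<beta> w x else 0"
  have "lin (sp M v) ?t" unfolding lin_def using \<beta>(1,2) by (auto simp: fun_eq_iff vscale_def)
  moreover have "?t ` sp M v = sp (dual G M) v"
  proof (intro set_eqI iffI)
    fix \<phi> assume "\<phi> \<in> ?t ` sp M v"
    then show "\<phi> \<in> sp (dual G M) v"
      using \<beta>(1-3) module_add[OF M] module_scale[OF M]
      by (auto simp: dual_sp_iff)
  next
    fix \<phi> assume p: "\<phi> \<in> sp (dual G M) v"
    then have "(\<forall>x\<in>sp M v. \<forall>y\<in>sp M v. \<phi> (x + y) = \<phi> x + \<phi> y) & (\<forall>c. \<forall>x\<in>sp M v. \<phi> (vscale c x) = c * \<phi> x)"
      by (simp add: dual_sp_iff)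
    then obtain w where w: "w \<in> sp M v" "\<forall>x\<in>sp M v. \<phi> x = \<beta> w x" using \<beta>(4) by blast
    have "\<phi> = ?t w" using w(2) p by (auto simp: fun_eq_iff dual_sp_iff)
    then show "\<phi> \<in> ?t ` sp M v" using w(1) by blast
  qed
  ultimately show "findim (sp (dual G M) v)" using lin_image_fd[OF module_fd[OF M], of v ?t] by simp
next
  fix a
  have sub: "\<phi> + \<psi> \<in> sp (dual G M) v" "vscale c \<phi> \<in> sp (dual G M) v" if "\<phi> \<in> sp (dual G M) v" "\<psi> \<in> sp (dual G M) v" for \<phi> \<psi> c v
    using that by (auto simp: dual_sp_iff vscale_def algebra_simps)
  show "lin (sp (dual G M) (src (opposite G) a)) (mp (dual G M) a)"
    unfolding lin_def using sub by (auto simp: dual_mp fun_eq_iff vscale_def)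
  show "mp (dual G M) a \<phi> \<in> sp (dual G M) (tgt (opposite G) a)" if "\<phi> \<in> sp (dual G M) (src (opposite G) a)" for \<phi>
  proof -
    have p: "\<phi> \<in> sp (dual G M) (tgt G a)" using that by simp
    have "\<phi> 0 = 0"
    proof -
      have "\<phi> (vscale 0 0) = 0 * \<phi> 0" using p module_0[OF M] unfolding dual_sp_iff by blast
      then show ?thesis by simp
    qed
    then show ?thesis
      using p lin_add[OF module_lin[OF M]] lin_scale[OF module_lin[OF M]] module_mp[OF M] module_outside[OF M]
      by (auto simp: dual_mp dual_sp_iff)
  qed
  show "mp (dual G M) a \<phi> = 0" if "\<phi> \<notin> sp (dual G M) (src (opposite G) a)" for \<phi>
    using that by (simp add: dual_outside)
qed

lemma proj_sp: "sp (proj_module G i) v = {x. \<forall>p. x p ~= 0 --> is_path G i p v}"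
  and proj_mp: "x \<in> sp (proj_module G i) (src G a) ==> mp (proj_module G i) a x = append_arrow a x"
  and proj_outside: "x \<notin> sp (proj_module G i) (src G a) ==> mp (proj_module G i) a x = 0"
  by (auto simp: proj_module_def Let_def)

lemma is_path_append: "is_path G i (p @ [a]) v \<longleftrightarrow> is_path G i p (src G a) & v = tgt G a"
  by (induction p arbitrary: i) auto

lemma append_arrow_add: "append_arrow a (x + y) = append_arrow a x + append_arrow a (y :: _ => 'k::field)"
  "append_arrow a (vscale c x) = vscale c (append_arrow a x)"
  by (auto simp: append_arrow_def fun_eq_iff vscale_def)

lemma prepend_arrow_add: "prepend_arrow a (x + y) = prepend_arrow a x + prepend_arrow a (y :: _ => 'k::field)"
  "prepend_arrow a (vscale c x) = vscale c (prepend_arrow a x)" "prepend_arrow a 0 = (0 :: _ => 'k)"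
  by (auto simp: prepend_arrow_def fun_eq_iff vscale_def)

text \<open>The two operations act at opposite ends of a path; this is why prepending an arrow is a
  homomorphism of projective modules.\<close>

lemma append_prepend: "append_arrow c (prepend_arrow a x) = prepend_arrow a (append_arrow c x)"
proof (rule ext)
  fix p show "append_arrow c (prepend_arrow a x) p = prepend_arrow a (append_arrow c x) p"
  proof (cases p)
    case (Cons d q)
    then show ?thesis by (cases q rule: rev_cases) (auto simp: append_arrow_def prepend_arrow_def butlast_append)
  qed (simp add: append_arrow_def prepend_arrow_def)
qed

lemma append_arrow_sp: "x \<in> sp (proj_module G i) (src G a) ==> append_arrow a x \<in> sp (proj_module G i) (tgt G a)"
proof -
  assume x: "x \<in> sp (proj_module G i) (src G a)"
  have "is_path G i p (tgt G a)" if "append_arrow a x p ~= 0" for p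
  proof -
    have p: "p ~= []" "last p = a" "x (butlast p) ~= 0" using that by (auto simp: append_arrow_def split: if_splits)
    then have "p = butlast p @ [a]" by (metis append_butlast_last_id)
    moreover have "is_path G i (butlast p) (src G a)" using x p(3) by (simp add: proj_sp)
    ultimately show ?thesis using is_path_append[of G i "butlast p" a] by metis
  qed
  then show ?thesis by (simp add: proj_sp)
qed

lemma prepend_arrow_sp: "x \<in> sp (proj_module G (tgt G a)) v ==> prepend_arrow a x \<in> sp (proj_module G (src G a)) v"
  unfolding proj_sp
proof (intro CollectI allI impI)
  fix p assume "x \<in> {x. \<forall>p. x p ~= 0 --> is_path G (tgt G a) p v}" "prepend_arrow a x p ~= 0"
  then show "is_path G (src G a) p v" by (cases p) (auto simp: prepend_arrow_def split: if_splits)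
qed

lemma proj_module:
  assumes "\<And>v. finite {p. is_path G i p v}"
  shows "is_module G (proj_module G i :: ('v, 'a, 'a list, 'k::field) rep)"
proof (rule is_moduleI)
  let ?P = "proj_module G i :: ('v, 'a, 'a list, 'k) rep"
  have sub: "x + y \<in> sp ?P v" "vscale c x \<in> sp ?P v" if "x \<in> sp ?P v" "y \<in> sp ?P v" for x y v c
  proof -
    have "x p ~= 0 \<or> y p ~= 0" if "(x + y) p ~= 0" for p using that by auto
    then show "x + y \<in> sp ?P v" using that unfolding proj_sp by blast
    show "vscale c x \<in> sp ?P v" using that unfolding proj_sp by (auto simp: vscale_def)
  qed
  show "findim (sp ?P v)" for v
    using fd_finite_support[OF assms, of v] by (simp add: proj_sp)
  show "lin (sp ?P (src G a)) (mp ?P a)" for a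
    unfolding lin_def using sub by (simp add: proj_mp append_arrow_add)
  show "mp ?P a x \<in> sp ?P (tgt G a)" if "x \<in> sp ?P (src G a)" for a x
    using append_arrow_sp[OF that] by (simp add: proj_mp[OF that])
qed (rule proj_outside)

lemma prepend_hom:
  assumes "h \<in> hom G X (proj_module G (tgt G a) :: ('v, 'a, 'a list, 'k::field) rep)"
  shows "(\<lambda>v x. prepend_arrow a (h v x)) \<in> hom G X (proj_module G (src G a))"
proof -
  have h: "qhom G X (proj_module G (tgt G a)) h" "\<And>v x. x \<notin> sp X v ==> h v x = 0" using assms by (auto simp: hom_iff)
  show ?thesis
    unfolding hom_iff qhom_def
  proof (intro conjI allI ballI impI)
    show "lin (sp X v) (\<lambda>x. prepend_arrow a (h v x))" for v
      unfolding lin_def using qhom_plus[OF h(1)] qhom_scale[OF h(1)] by (simp add: prepend_arrow_add)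
    show "prepend_arrow a (h v x) \<in> sp (proj_module G (src G a)) v" if "x \<in> sp X v" for v x
      by (rule prepend_arrow_sp[OF qhom_sp[OF h(1) that]])
    show "prepend_arrow a (h (tgt G c) (mp X c x)) = mp (proj_module G (src G a)) c (prepend_arrow a (h (src G c) x))"
      if x: "x \<in> sp X (src G c)" for c x
    proof -
      have "h (tgt G c) (mp X c x) = append_arrow c (h (src G c) x)"
        using qhom_mp[OF h(1) x] proj_mp[OF qhom_sp[OF h(1) x]] by simp
      then show ?thesis
        using proj_mp[OF prepend_arrow_sp[OF qhom_sp[OF h(1) x]]] by (simp add: append_prepend)
    qed
    show "prepend_arrow a (h v x) = 0" if "x \<notin> sp X v" for v x using h(2)[OF that] by (simp add: prepend_arrow_add)
  qed
qed

section \<open>The transpose of the dual\<close>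

abbreviation "Qop \<equiv> opposite quiver_Q"

section \<open>Modules over the opposite quiver\<close>

lemma path_Qop:
  "is_path Qop V1 p v \<longleftrightarrow> p = [] & v = V1"
  "is_path Qop V2 p v \<longleftrightarrow> p = [] & v = V2 \<or> p = [A12] & v = V1"
  "is_path Qop V3 p v \<longleftrightarrow> p = [] & v = V3 \<or> (p = [A23] \<or> p = [B23]) & v = V2 \<or> (p = [A23, A12] \<or> p = [B23, A12]) & v = V1"
proof -
  show 1: "is_path Qop V1 p v \<longleftrightarrow> p = [] & v = V1" for p v
  proof (cases p)
    case (Cons a q) then show ?thesis by (cases a) auto
  qed auto
  show 2: "is_path Qop V2 p v \<longleftrightarrow> p = [] & v = V2 \<or> p = [A12] & v = V1" for p v
  proof (cases p)
    case (Cons a q) then show ?thesis by (cases a) (auto simp: 1)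
  qed auto
  show "is_path Qop V3 p v \<longleftrightarrow> p = [] & v = V3 \<or> (p = [A23] \<or> p = [B23]) & v = V2 \<or> (p = [A23, A12] \<or> p = [B23, A12]) & v = V1"
  proof (cases p)
    case (Cons a q) then show ?thesis by (cases a) (auto simp: 2)
  qed auto
qed

lemma finite_path_Qop: "finite {p. is_path Qop i p v}"
  by (cases i) (simp_all add: path_Qop)

lemma qhom_Qop_iff: "qhom Qop M N f \<longleftrightarrow>
    (\<forall>v. lin (sp M v) (f v)) & (\<forall>v. \<forall>x\<in>sp M v. f v x \<in> sp N v) &
    (\<forall>x\<in>sp M V2. f V1 (ma M x) = ma N (f V2 x)) &
    (\<forall>x\<in>sp M V3. f V2 (mb M x) = mb N (f V3 x)) &
    (\<forall>x\<in>sp M V3. f V2 (mc M x) = mc N (f V3 x))"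
  by (simp add: qhom_def all_arrow)

lemma Qop_mp:
  assumes "is_module Qop M"
  shows "x \<in> sp M V2 ==> ma M x \<in> sp M V1"
    and "y \<in> sp M V3 ==> mb M y \<in> sp M V2"
    and "y \<in> sp M V3 ==> mc M y \<in> sp M V2"
  using module_mp[OF assms, of _ A12] module_mp[OF assms, of _ A23] module_mp[OF assms, of _ B23] by auto

lemma Qop_lin:
  assumes "is_module Qop M"
  shows "lin (sp M V2) (ma M)" "lin (sp M V3) (mb M)" "lin (sp M V3) (mc M)"
  using module_lin[OF assms, of A12] module_lin[OF assms, of A23] module_lin[OF assms, of B23] by auto

lemma qhom_Qop_mp:
  assumes "qhom Qop M N f"
  shows "x \<in> sp M V2 ==> f V1 (ma M x) = ma N (f V2 x)"
    and "y \<in> sp M V3 ==> f V2 (mb M y) = mb N (f V3 y)"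
    and "y \<in> sp M V3 ==> f V2 (mc M y) = mc N (f V3 y)"
  using assms by (auto simp: qhom_Qop_iff)

text \<open>In the opposite quiver \<open>A12\<close> goes from 2 to 1, so such a module is a sum of
  copies of the projectives at 1 and 2. The lifting is built directly: lift linearly at 1 and 2,
  then correct the lift at 1 on the image of the space at 2.\<close>

lemma projective_Qop_K:
  fixes K :: "('b, 'k::field) qrep"
  assumes K: "is_module Qop K" and K3: "sp K V3 = {0}" and inj: "\<And>x. x \<in> sp K V2 ==> ma K x = 0 ==> x = 0"
  shows "projective Qop K"
proof (rule projectiveI[OF K])
  fix M N :: "('b, 'k) qrep" and g h
  assume M: "is_module Qop M" and N: "is_module Qop N" and g: "qhom Qop M N g"
    and s: "\<And>v y. y \<in> sp N v ==> \<exists>x\<in>sp M v. g v x = y" and h: "qhom Qop K N h"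
  note Ks = module_subspace[OF K] and Ms = module_subspace[OF M]
  have lift: "\<exists>f. lin (sp K v) f & (\<forall>x\<in>sp K v. x \<in> sp K v & f x \<in> sp M v & g v (f x) = h v x)" for v
  proof (rule lin_select[OF Ks, where R = "\<lambda>x y. x \<in> sp K v & y \<in> sp M v & g v y = h v x"])
    fix x y x' y' assume "x \<in> sp K v & y \<in> sp M v & g v y = h v x" "x' \<in> sp K v & y' \<in> sp M v & g v y' = h v x'"
    then show "x + x' \<in> sp K v & y + y' \<in> sp M v & g v (y + y') = h v (x + x')"
      using subsp_add[OF Ks, of x v x'] subsp_add[OF Ms, of y v y'] lin_add[OF qhom_lin[OF g], of y v y'] lin_add[OF qhom_lin[OF h], of x v x'] by simp
  next
    fix c x y assume "x \<in> sp K v & y \<in> sp M v & g v y = h v x"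
    then show "vscale c x \<in> sp K v & vscale c y \<in> sp M v & g v (vscale c y) = h v (vscale c x)"
      using subsp_scale[OF Ks, of x v c] subsp_scale[OF Ms, of y v c] qhom_scale[OF g, of y v c] qhom_scale[OF h, of x v c] by simp
  next
    fix x assume "x \<in> sp K v"
    then show "\<exists>y. x \<in> sp K v & y \<in> sp M v & g v y = h v x" using s[OF qhom_sp[OF h]] by blast
  qed
  obtain f2 where f2: "lin (sp K V2) f2" "\<And>x. x \<in> sp K V2 ==> f2 x \<in> sp M V2 & g V2 (f2 x) = h V2 x" using lift[of V2] by blast
  obtain t where t: "lin (sp K V1) t" "\<And>x. x \<in> sp K V1 ==> t x \<in> sp M V1 & g V1 (t x) = h V1 x" using lift[of V1] by blast
  let ?S = "ma K ` sp K V2" and ?W = "{y \<in> sp M V1. g V1 y = 0}"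
  have W: "subsp ?W" by (rule lin_kernel_subspace[OF Ms qhom_lin[OF g]])
  have S: "subsp ?S" by (rule lin_image_subspace[OF Ks Qop_lin(1)[OF K]])
  \<comment> \<open>The failure of the two lifts to commute with \<open>ma\<close>. Injectivity of
    \<open>ma K\<close> makes it a map on the image of \<open>K\<^sub>2\<close> in
    \<open>K\<^sub>1\<close>; its values lie in the kernel of \<open>g\<close>, and extending it to
    \<open>K\<^sub>1\<close> gives the correction \<open>e\<close>.\<close>
  define dd where "dd x = ma M (f2 x) - t (ma K x)" for x
  have l: "lin (sp K V2) dd"
    unfolding dd_def
    by (rule lin_combine(2)[OF lin_comp[OF f2(1) _ Qop_lin(1)[OF M]] lin_comp[OF Qop_lin(1)[OF K] _ t(1)]])
      (use f2(2) Qop_mp(1)[OF K] in auto)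
  have "\<exists>d. lin ?S d & (\<forall>y\<in>?S. \<exists>x\<in>sp K V2. y = ma K x & d y = dd x)"
  proof (rule lin_select[OF S, where R = "\<lambda>y z. \<exists>x\<in>sp K V2. y = ma K x & z = dd x"])
    fix y z y' z' assume "\<exists>x\<in>sp K V2. y = ma K x & z = dd x" "\<exists>x\<in>sp K V2. y' = ma K x & z' = dd x"
    then obtain x x' where x: "x \<in> sp K V2" "x' \<in> sp K V2" "y = ma K x" "z = dd x" "y' = ma K x'" "z' = dd x'" by blast
    show "\<exists>x\<in>sp K V2. y + y' = ma K x & z + z' = dd x"
      by (rule bexI[of _ "x + x'"])
        (simp_all only: x lin_add[OF l x(1,2)] lin_add[OF Qop_lin(1)[OF K] x(1,2)] subsp_add[OF Ks x(1,2)] simp_thms)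
  next
    fix c y z assume "\<exists>x\<in>sp K V2. y = ma K x & z = dd x"
    then obtain x where x: "x \<in> sp K V2" "y = ma K x" "z = dd x" by blast
    show "\<exists>x\<in>sp K V2. vscale c y = ma K x & vscale c z = dd x"
      by (rule bexI[of _ "vscale c x"])
        (simp_all only: x lin_scale[OF l x(1)] lin_scale[OF Qop_lin(1)[OF K] x(1)] subsp_scale[OF Ks x(1)] simp_thms)
  qed blast
  then obtain d where d: "lin ?S d" "\<And>y. y \<in> ?S ==> \<exists>x\<in>sp K V2. y = ma K x & d y = ma M (f2 x) - t (ma K x)"
    unfolding dd_def by blast
  have dK: "d (ma K x) = ma M (f2 x) - t (ma K x)" if x: "x \<in> sp K V2" for x
  proof -
    obtain x' where x': "x' \<in> sp K V2" "ma K x = ma K x'" "d (ma K x) = ma M (f2 x') - t (ma K x')" using d(2) x by blast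
    have "x - x' = 0"
      by (rule inj) (use subsp_diff[OF Ks x x'(1)] lin_diff[OF Qop_lin(1)[OF K] Ks x x'(1)] x'(2) in simp_all)
    then show ?thesis using x'(3) by simp
  qed
  have dW: "d y \<in> ?W" if yS: "y \<in> ?S" for y
  proof -
    obtain x where x: "x \<in> sp K V2" "y = ma K x" using yS by blast
    note mem = Qop_mp(1)[OF M conjunct1[OF f2(2)[OF x(1)]]] conjunct1[OF t(2)[OF Qop_mp(1)[OF K x(1)]]]
    have "g V1 (ma M (f2 x) - t (ma K x)) = 0"
      using qhom_minus[OF g Ms mem] qhom_Qop_mp(1)[OF g, of "f2 x"] f2(2)[OF x(1)] t(2)[OF Qop_mp(1)[OF K x(1)]]
        qhom_Qop_mp(1)[OF h x(1)] by simp
    then show ?thesis using dK[OF x(1)] x(2) subsp_diff[OF Ms mem] by simp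
  qed
  obtain e where e: "\<And>T. lin T e" "\<And>y. y \<in> ?S ==> e y = d y" "\<And>y. e y \<in> ?W" using lin_extend[OF S d(1) W dW] by blast
  let ?h = "\<lambda>v x. case v of V1 => t x + e x | V2 => f2 x | V3 => 0"
  have "qhom Qop K M ?h"
    unfolding qhom_Qop_iff all_vertex
  proof (intro conjI ballI)
    show "lin (sp K V1) (?h V1)" using lin_combine(1)[OF t(1) e(1)] by simp
    show "lin (sp K V2) (?h V2)" using f2(1) by simp
    show "lin (sp K V3) (?h V3)" by (simp add: lin_def)
    show "?h V1 x \<in> sp M V1" if "x \<in> sp K V1" for x using subsp_add[OF Ms] t(2)[OF that] e(3)[of x] by simp
    show "?h V2 x \<in> sp M V2" if "x \<in> sp K V2" for x using f2(2)[OF that] by simp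
    show "?h V3 x \<in> sp M V3" for x using module_0[OF M] by simp
    show "?h V1 (ma K x) = ma M (?h V2 x)" if x: "x \<in> sp K V2" for x
      using e(2)[of "ma K x"] dK[OF x] x by simp
    show "?h V2 (mb K x) = mb M (?h V3 x)" if "x \<in> sp K V3" for x
      using that K3 module_mp_0[OF K] module_mp_0[OF M] lin_0[OF f2(1) module_0[OF K]] by simp
    show "?h V2 (mc K x) = mc M (?h V3 x)" if "x \<in> sp K V3" for x
      using that K3 module_mp_0[OF K] module_mp_0[OF M] lin_0[OF f2(1) module_0[OF K]] by simp
  qed
  moreover have "\<forall>v. \<forall>x\<in>sp K v. g v (?h v x) = h v x"
    unfolding all_vertex
  proof (intro conjI ballI)
    fix x assume x: "x \<in> sp K V1"
    have "e x \<in> sp M V1" "g V1 (e x) = 0" using e(3)[of x] by auto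
    then show "g V1 (?h V1 x) = h V1 x" using t(2)[OF x] lin_add[OF qhom_lin[OF g], of "t x" V1 "e x"] by simp
  qed (use f2(2) K3 qhom_0[OF g M] qhom_0[OF h K] in auto)
  ultimately show "\<exists>h'. qhom Qop K M h' & (\<forall>v. \<forall>x\<in>sp K v. g v (h' v x) = h v x)" by blast
qed

subsection \<open>Pairs encoded by a first letter\<close>

text \<open>A pair is stored by putting \<open>A23\<close> or \<open>B23\<close> in front of the
  paths, which keeps it over the index type \<open>arrow list\<close> that
  \<open>is_transpose\<close> demands of a presentation.\<close>

definition pr :: "(arrow list => 'k::field) => (arrow list => 'k) => (arrow list => 'k)" where
  "pr w w' = (\<lambda>l. case l of [] => 0 | c # m => if c = A23 then w m else if c = B23 then w' m else 0)"

definition selA :: "(arrow list => 'k::field) => (arrow list => 'k)" where "selA y = (\<lambda>l. y (A23 # l))"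
definition selB :: "(arrow list => 'k::field) => (arrow list => 'k)" where "selB y = (\<lambda>l. y (B23 # l))"

lemma sel_pr [simp]: "selA (pr w w') = w" "selB (pr w w') = w'"
  by (auto simp: selA_def selB_def pr_def)

lemma pr_linear: "pr (w + u) (w' + u') = pr w w' + pr u u'" "pr (vscale c w) (vscale c w') = vscale c (pr w w')" "pr 0 0 = 0"
  by (auto simp: pr_def fun_eq_iff vscale_def split: list.split)

lemma sel_linear [simp]: "selA (y + z) = selA y + selA z" "selB (y + z) = selB y + selB z"
  "selA (vscale c y) = vscale c (selA y)" "selB (vscale c y) = vscale c (selB y)" "selA 0 = 0" "selB 0 = 0"
  by (auto simp: selA_def selB_def fun_eq_iff vscale_def)

lemma pr_linear0: "pr (x + y) 0 = pr x 0 + pr y 0" "pr 0 (x + y) = pr 0 x + pr 0 y"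
  "pr (vscale c x) 0 = vscale c (pr x 0)" "pr 0 (vscale c x) = vscale c (pr 0 x)"
  by (auto simp: pr_def fun_eq_iff vscale_def split: list.split)

lemma pr_split: "pr w w' = pr w 0 + pr 0 w'"
  by (auto simp: pr_def fun_eq_iff split: list.split)

lemma vscale_apply: "vscale c f x = c * f x" by (simp add: vscale_def)

text \<open>The dual of \<open>A\<close> is generated at the vertex \<open>3\<close> (its structure maps are onto), so its projective
  cover \<open>P0\<close> is a multiple of the projective module at \<open>3\<close>, with \<open>A\<^sub>3\<close> identified with its dual by the form \<open>bf\<close>.\<close>

locale transp =
  fixes A :: "(arrow list, 'k::field) qrep" and bf :: "(arrow list => 'k) => (arrow list => 'k) => 'k"
  assumes A: "Qmod A" and good: "kgood A"
    and bf_add: "\<And>x y z. x \<in> sp A V3 ==> y \<in> sp A V3 ==> z \<in> sp A V3 ==> bf (x + y) z = bf x z + bf y z"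
    and bf_scale: "\<And>c x z. x \<in> sp A V3 ==> z \<in> sp A V3 ==> bf (vscale c x) z = c * bf x z"
    and bf_sym: "\<And>x z. x \<in> sp A V3 ==> z \<in> sp A V3 ==> bf x z = bf z x"
    and bf_rep: "\<And>\<phi>. (\<And>x y. x \<in> sp A V3 ==> y \<in> sp A V3 ==> \<phi> (x + y) = \<phi> x + \<phi> y) ==>
      (\<And>c x. x \<in> sp A V3 ==> \<phi> (vscale c x) = c * \<phi> x) ==> \<exists>w\<in>sp A V3. \<forall>x\<in>sp A V3. \<phi> x = bf w x"
begin

lemmas As = module_subspace[OF A] and A0 [simp] = module_0[OF A] and Amp [simp] = Qmod_mp[OF A]

lemma bf_add2: "x \<in> sp A V3 ==> y \<in> sp A V3 ==> z \<in> sp A V3 ==> bf z (x + y) = bf z x + bf z y"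
  using bf_add[of x y z] bf_sym[of z "x + y"] bf_sym[of z x] bf_sym[of z y] subsp_add[OF As, of x V3 y] by simp

lemma bf_scale2: "x \<in> sp A V3 ==> z \<in> sp A V3 ==> bf z (vscale c x) = c * bf z x"
  using bf_scale[of x z c] bf_sym[of z "vscale c x"] bf_sym[of z x] subsp_scale[OF As, of x V3 c] by simp

lemma bf_0 [simp]: "z \<in> sp A V3 ==> bf 0 z = 0" "z \<in> sp A V3 ==> bf z 0 = 0"
  using bf_scale[of 0 z 0] bf_scale2[of 0 z 0] by simp_all

lemma bf_nondeg:
  assumes w: "w \<in> sp A V3" and z: "\<And>x. x \<in> sp A V3 ==> bf w x = 0"
  shows "w = 0"
proof (rule functional_nonzero)
  fix \<xi> :: "(arrow list => 'k) => 'k" assume \<xi>: "functional \<xi>"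
  obtain u where "u \<in> sp A V3" "\<forall>x\<in>sp A V3. \<xi> x = bf u x"
    using bf_rep[of \<xi>] functional_props[OF \<xi>] by blast
  then show "\<xi> w = 0" using w z bf_sym[of u w] by simp
qed

definition PP :: "(arrow list => 'k) set" where "PP = {pr w w' |w w'. w \<in> sp A V3 & w' \<in> sp A V3}"

lemma PP_iff: "y \<in> PP \<longleftrightarrow> selA y \<in> sp A V3 & selB y \<in> sp A V3 & y = pr (selA y) (selB y)"
  unfolding PP_def by auto

lemma pr_PP [simp]: "pr w w' \<in> PP \<longleftrightarrow> w \<in> sp A V3 & w' \<in> sp A V3"
  by (simp add: PP_iff)

lemma PP_eq: "y \<in> PP ==> pr (selA y) (selB y) = y"
  unfolding PP_iff[of y] by (rule sym) blast

lemma PP_sel [simp]: "y \<in> PP ==> selA y \<in> sp A V3" "y \<in> PP ==> selB y \<in> sp A V3"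
  unfolding PP_iff[of y] by blast+

lemma PP_fd: "findim PP"
proof -
  let ?f = "\<lambda>z. pr (vfst z) (vsnd z)"
  have l: "lin (vprod (sp A V3) (sp A V3)) ?f" by (simp add: lin_def pr_linear)
  have "?f ` vprod (sp A V3) (sp A V3) = PP"
  proof (intro set_eqI iffI)
    fix y assume "y \<in> PP"
    then show "y \<in> ?f ` vprod (sp A V3) (sp A V3)"
      by (intro image_eqI[of _ _ "vpair (selA y) (selB y)"]) (simp_all add: PP_eq vprod_iff)
  qed (auto simp: vprod_iff)
  then show ?thesis using lin_image_fd[OF vprod_fd[OF module_fd[OF A] module_fd[OF A]] l] by simp
qed

lemmas PP_sub = fd_subspace[OF PP_fd]

definition pair :: "(arrow list => 'k) => (arrow list => 'k) => (arrow list => 'k) => 'k" where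
  "pair w w' y = bf w (selA y) + bf w' (selB y)"

lemma pair_add: "w \<in> sp A V3 ==> w' \<in> sp A V3 ==> y \<in> PP ==> z \<in> PP ==> pair w w' (y + z) = pair w w' y + pair w w' z"
  and pair_scale: "w \<in> sp A V3 ==> w' \<in> sp A V3 ==> y \<in> PP ==> pair w w' (vscale c y) = c * pair w w' y"
  by (simp_all add: pair_def bf_add2 bf_scale2 algebra_simps)

lemma pair_add2: "w \<in> sp A V3 ==> w' \<in> sp A V3 ==> u \<in> sp A V3 ==> u' \<in> sp A V3 ==> y \<in> PP ==>
    pair (w + u) (w' + u') y = pair w w' y + pair u u' y"
  and pair_scale2: "w \<in> sp A V3 ==> w' \<in> sp A V3 ==> y \<in> PP ==> pair (vscale c w) (vscale c w') y = c * pair w w' y"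
  by (simp_all add: pair_def bf_add bf_scale algebra_simps)

lemma pair_rep:
  assumes S: "subsp S" "S \<subseteq> PP" and add: "\<And>x y. x \<in> S ==> y \<in> S ==> \<phi> (x + y) = \<phi> x + \<phi> y"
    and scale: "\<And>c x. x \<in> S ==> \<phi> (vscale c x) = c * \<phi> x"
  shows "\<exists>w\<in>sp A V3. \<exists>w'\<in>sp A V3. \<forall>y\<in>S. \<phi> y = pair w w' y"
proof -
  obtain \<xi> where \<xi>: "functional \<xi>" "\<And>x. x \<in> S ==> \<xi> x = \<phi> x" using functional_extend[OF S(1) add scale] by blast
  note a = pr_linear0
  obtain w where w: "w \<in> sp A V3" "\<forall>x\<in>sp A V3. \<xi> (pr x 0) = bf w x"
    using bf_rep[of "\<lambda>x. \<xi> (pr x 0)"] by (auto simp: a functional_props[OF \<xi>(1)])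
  obtain w' where w': "w' \<in> sp A V3" "\<forall>x\<in>sp A V3. \<xi> (pr 0 x) = bf w' x"
    using bf_rep[of "\<lambda>x. \<xi> (pr 0 x)"] by (auto simp: a functional_props[OF \<xi>(1)])
  have "\<phi> y = pair w w' y" if y: "y \<in> S" for y
  proof -
    have yP: "y \<in> PP" using S(2) y by blast
    have "\<phi> y = \<xi> (pr (selA y) (selB y))" using \<xi>(2)[OF y] PP_eq[OF yP] by simp
    also have "\<dots> = \<xi> (pr (selA y) 0) + \<xi> (pr 0 (selB y))" by (subst pr_split) (rule functional_props(1)[OF \<xi>(1)])
    finally show ?thesis using w w' yP by (simp add: pair_def)
  qed
  then show ?thesis using w(1) w'(1) by blast
qed

text \<open>Double annihilator of the image of \<open>(p, q)\<close>. A functional separating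
  \<open>(w, w')\<close> from this image is itself a pairing with some \<open>(u, u')\<close>, which
  by symmetry lies in the annihilator and contradicts \<open>z\<close>.\<close>

lemma annihilator:
  assumes S: "subsp S" and p: "lin S p" "\<And>x. x \<in> S ==> p x \<in> sp A V3" and q: "lin S q" "\<And>x. x \<in> S ==> q x \<in> sp A V3"
    and w: "w \<in> sp A V3" "w' \<in> sp A V3" and z: "\<And>y. y \<in> PP ==> (\<forall>x\<in>S. pair (p x) (q x) y = 0) ==> pair w w' y = 0"
  shows "\<exists>x\<in>S. w = p x & w' = q x"
proof -
  have l: "lin S (\<lambda>x. pr (p x) (q x))"
    unfolding lin_def using lin_add[OF p(1)] lin_scale[OF p(1)] lin_add[OF q(1)] lin_scale[OF q(1)] by (simp add: pr_linear)
  let ?U = "(\<lambda>x. pr (p x) (q x)) ` S"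
  have U: "subsp ?U" by (rule lin_image_subspace[OF S l])
  have "pr w w' \<in> ?U"
  proof (rule ccontr)
    assume nU: "pr w w' \<notin> ?U"
    obtain \<xi> where \<xi>: "functional \<xi>" "\<forall>x\<in>?U. \<xi> x = 0" "\<xi> (pr w w') = 1"
      using separating_functional[OF U nU] by auto
    obtain u u' where u: "u \<in> sp A V3" "u' \<in> sp A V3" "\<And>y. y \<in> PP ==> \<xi> y = pair u u' y"
      using pair_rep[OF PP_sub order_refl, of \<xi>] functional_props[OF \<xi>(1)] by metis
    have "pair (p x) (q x) (pr u u') = 0" if x: "x \<in> S" for x
      using u(3)[of "pr (p x) (q x)"] \<xi>(2) x p(2)[OF x] q(2)[OF x] u(1,2) bf_sym[of u "p x"] bf_sym[of u' "q x"] by (simp add: pair_def)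
    then have "pair w w' (pr u u') = 0" using z[of "pr u u'"] u by simp
    then show False using \<xi>(3) u(3)[of "pr w w'"] w u(1,2) bf_sym[of u w] bf_sym[of u' w'] by (simp add: pair_def)
  qed
  then obtain x where x: "x \<in> S" "pr w w' = pr (p x) (q x)" by blast
  have "w = p x" "w' = q x" using arg_cong[OF x(2), of selA] arg_cong[OF x(2), of selB] by simp_all
  then show ?thesis using x(1) by blast
qed

text \<open>The projective at 3 of the opposite quiver has dimension 1 at 3 and 2 at the other
  vertices, and \<open>A12\<close> acts bijectively on it. \<open>P0\<close> is its tensor product
  with \<open>A\<^sub>3\<close>, with \<open>A12\<close> made the identity of
  \<open>PP\<close>.\<close>

definition P0 :: "(arrow list, 'k) qrep" where
  "P0 = \<lparr>sp = (\<lambda>v. if v = V3 then sp A V3 else PP),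
    mp = (\<lambda>a x. case a of A12 => if x \<in> PP then x else 0 | A23 => if x \<in> sp A V3 then pr x 0 else 0
      | B23 => if x \<in> sp A V3 then pr 0 x else 0)\<rparr>"

lemma P0_sp [simp]: "sp P0 V3 = sp A V3" "sp P0 V2 = PP" "sp P0 V1 = PP"
  by (simp_all add: P0_def)

lemma P0_mp: "x \<in> PP ==> ma P0 x = x" "x \<in> sp A V3 ==> mb P0 x = pr x 0" "x \<in> sp A V3 ==> mc P0 x = pr 0 x"
  by (simp_all add: P0_def)

lemma P0_module: "is_module Qop P0"
proof (rule is_moduleI)
  show "findim (sp P0 v)" for v by (cases v) (simp_all add: PP_fd module_fd[OF A])
  note a = pr_linear0
  show "lin (sp P0 (src Qop a)) (mp P0 a)" for a
    by (cases a) (simp_all add: lin_def P0_mp subsp_add[OF PP_sub] subsp_scale[OF PP_sub]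
      subsp_add[OF As] subsp_scale[OF As] a)
  show "mp P0 a x \<in> sp P0 (tgt Qop a)" if "x \<in> sp P0 (src Qop a)" for a x using that by (cases a) (simp_all add: P0_mp)
  show "mp P0 a x = 0" if "x \<notin> sp P0 (src Qop a)" for a x using that by (cases a) (simp_all add: P0_def)
qed

lemma P0_qhom_V2:
  assumes h: "qhom Qop P0 N h" and N: "is_module Qop N" and y: "y \<in> PP"
  shows "h V2 y = mb N (h V3 (selA y)) + mc N (h V3 (selB y))" "h V1 y = ma N (h V2 y)"
proof -
  have "h V2 (pr (selA y) 0 + pr 0 (selB y)) = h V2 (pr (selA y) 0) + h V2 (pr 0 (selB y))"
    by (rule qhom_plus[OF h]) (use y in simp_all)
  then show "h V2 y = mb N (h V3 (selA y)) + mc N (h V3 (selB y))"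
    using PP_eq[OF y] pr_split[of "selA y" "selB y"] qhom_Qop_mp(2)[OF h, of "selA y"] qhom_Qop_mp(3)[OF h, of "selB y"] y
    by (simp add: P0_mp)
  show "h V1 y = ma N (h V2 y)" using qhom_Qop_mp(1)[OF h, of y] y by (simp add: P0_mp)
qed

lemma P0_extend:
  assumes N: "is_module Qop N" and t: "lin (sp A V3) t" "\<And>x. x \<in> sp A V3 ==> t x \<in> sp N V3"
  shows "qhom Qop P0 N (\<lambda>v y. case v of V3 => t y | V2 => mb N (t (selA y)) + mc N (t (selB y))
      | V1 => ma N (mb N (t (selA y)) + mc N (t (selB y))))" (is "qhom _ _ _ ?h")
proof -
  note Ns = module_subspace[OF N] and Nl = Qop_lin[OF N] and Nmp = Qop_mp[OF N]
  have s: "lin PP (\<lambda>y. t (selA y))" "lin PP (\<lambda>y. t (selB y))"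
    unfolding lin_def using lin_add[OF t(1)] lin_scale[OF t(1)] by simp_all
  have l2: "lin PP (?h V2)"
    using lin_combine(1)[OF lin_comp[OF s(1) _ Nl(2)] lin_comp[OF s(2) _ Nl(3)]] t(2) by (simp add: image_subset_iff)
  have m2: "?h V2 y \<in> sp N V2" if "y \<in> PP" for y using subsp_add[OF Ns] Nmp t(2) that by simp
  have l1: "lin PP (?h V1)" using lin_comp[OF l2 _ Nl(1)] m2 by (simp add: image_subset_iff)
  have t0: "t 0 = 0" by (rule lin_0[OF t(1) A0])
  show ?thesis
    unfolding qhom_Qop_iff all_vertex
    using l1 l2 m2 t Nmp t0 by (simp add: P0_mp module_mp_0[OF N])
qed

lemma P0_projective: "projective Qop P0"
proof (rule projectiveI[OF P0_module])
  fix M N :: "(arrow list, 'k) qrep" and g h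
  assume M: "is_module Qop M" and N: "is_module Qop N" and g: "qhom Qop M N g"
    and s: "\<And>v y. y \<in> sp N v ==> \<exists>x\<in>sp M v. g v x = y" and h: "qhom Qop P0 N h"
  note Ms = module_subspace[OF M]
  have hl: "lin (sp A V3) (h V3)" using qhom_lin[OF h, of V3] by simp
  have "\<exists>f. lin (sp A V3) f & (\<forall>x\<in>sp A V3. x \<in> sp A V3 & f x \<in> sp M V3 & g V3 (f x) = h V3 x)"
  proof (rule lin_select[OF As, where R = "\<lambda>x y. x \<in> sp A V3 & y \<in> sp M V3 & g V3 y = h V3 x"])
    fix x y x' y' assume "x \<in> sp A V3 & y \<in> sp M V3 & g V3 y = h V3 x" "x' \<in> sp A V3 & y' \<in> sp M V3 & g V3 y' = h V3 x'"
    then show "x + x' \<in> sp A V3 & y + y' \<in> sp M V3 & g V3 (y + y') = h V3 (x + x')"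
      using subsp_add[OF As, of x V3 x'] subsp_add[OF Ms, of y V3 y'] lin_add[OF qhom_lin[OF g], of y V3 y'] lin_add[OF hl, of x x'] by simp
  next
    fix c x y assume "x \<in> sp A V3 & y \<in> sp M V3 & g V3 y = h V3 x"
    then show "vscale c x \<in> sp A V3 & vscale c y \<in> sp M V3 & g V3 (vscale c y) = h V3 (vscale c x)"
      using subsp_scale[OF As, of x V3 c] subsp_scale[OF Ms, of y V3 c] qhom_scale[OF g, of y V3 c] lin_scale[OF hl, of x c] by simp
  next
    fix x assume "x \<in> sp A V3"
    then show "\<exists>y. x \<in> sp A V3 & y \<in> sp M V3 & g V3 y = h V3 x" using s[OF qhom_sp[OF h], of x V3] by auto
  qed
  then obtain t where t: "lin (sp A V3) t" "\<And>x. x \<in> sp A V3 ==> t x \<in> sp M V3" "\<And>x. x \<in> sp A V3 ==> g V3 (t x) = h V3 x" by blast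
  define h' where "h' = (\<lambda>v y. case v of V3 => t y | V2 => mb M (t (selA y)) + mc M (t (selB y))
      | V1 => ma M (mb M (t (selA y)) + mc M (t (selB y))))"
  have h': "qhom Qop P0 M h'" unfolding h'_def by (rule P0_extend[OF M t(1,2)])
  have gh: "qhom Qop P0 N (\<lambda>v x. g v (h' v x))" by (rule qhom_comp[OF h' g])
  have 3: "g V3 (h' V3 x) = h V3 x" if "x \<in> sp A V3" for x using t(3)[OF that] by (simp add: h'_def)
  have 2: "g V2 (h' V2 y) = h V2 y" if "y \<in> PP" for y
    using P0_qhom_V2(1)[OF gh N that] P0_qhom_V2(1)[OF h N that] 3 that by simp
  have 1: "g V1 (h' V1 y) = h V1 y" if "y \<in> PP" for y
    using P0_qhom_V2(2)[OF gh N that] P0_qhom_V2(2)[OF h N that] 2[OF that] by simp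
  show "\<exists>h'. qhom Qop P0 M h' & (\<forall>v. \<forall>x\<in>sp P0 v. g v (h' v x) = h v x)"
    using h' 1 2 3 by (intro exI[of _ h']) (simp add: all_vertex)
qed

abbreviation "D \<equiv> dual quiver_Q A"

lemmas D_module = dual_module[OF A]

text \<open>The transposes of the paths of \<open>A\<close> ending in 3, once \<open>bf\<close> has
  identified \<open>A\<^sub>3\<close> with its dual; the map is determined by this identification at
  the vertex 3.\<close>

definition cov :: "vertex => (arrow list => 'k) => ((arrow list => 'k) => 'k)" where
  "cov v y = (case v of V3 => (\<lambda>x. if x \<in> sp A V3 then bf y x else 0)
    | V2 => (\<lambda>x. if x \<in> sp A V2 then pair (mb A x) (mc A x) y else 0)
    | V1 => (\<lambda>x. if x \<in> sp A V1 then pair (mb A (ma A x)) (mc A (ma A x)) y else 0))"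

lemma bc_lin: "lin (sp A V2) (mb A)" "lin (sp A V2) (mc A)"
  "lin (sp A V1) (\<lambda>x. mb A (ma A x))" "lin (sp A V1) (\<lambda>x. mc A (ma A x))"
  using Qmod_lin[OF A] lin_comp[OF Qmod_lin(1)[OF A] _ Qmod_lin(2)[OF A]] lin_comp[OF Qmod_lin(1)[OF A] _ Qmod_lin(3)[OF A]]
  by (simp_all add: image_subset_iff)

lemma cov_qhom: "qhom Qop P0 D cov"
  unfolding qhom_Qop_iff all_vertex
proof (intro conjI ballI)
  note l = bc_lin
  show "lin (sp P0 V1) (cov V1)" "lin (sp P0 V2) (cov V2)" "lin (sp P0 V3) (cov V3)"
    unfolding lin_def cov_def by (auto simp: fun_eq_iff vscale_apply pair_add pair_scale bf_add bf_scale)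
  show c3: "cov V3 x \<in> sp D V3" if "x \<in> sp P0 V3" for x
    using that by (simp add: dual_sp_iff cov_def bf_add2 bf_scale2 subsp_add[OF As] subsp_scale[OF As])
  show c2: "cov V2 x \<in> sp D V2" if "x \<in> sp P0 V2" for x
    using that by (simp add: dual_sp_iff cov_def subsp_add[OF As] subsp_scale[OF As] pair_add2 pair_scale2
      lin_add[OF l(1)] lin_add[OF l(2)] lin_scale[OF l(1)] lin_scale[OF l(2)])
  show "cov V1 x \<in> sp D V1" if "x \<in> sp P0 V1" for x
    using that by (simp add: dual_sp_iff cov_def subsp_add[OF As] subsp_scale[OF As] pair_add2 pair_scale2
      lin_add[OF l(3)] lin_add[OF l(4)] lin_scale[OF l(3)] lin_scale[OF l(4)])
  show "cov V1 (ma P0 x) = ma D (cov V2 x)" if x: "x \<in> sp P0 V2" for x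
  proof -
    have "ma D (cov V2 x) = cov V2 x \<circ> ma A" by (rule dual_mp) (use c2[OF x] in simp)
    moreover have "cov V1 (ma P0 x) z = (cov V2 x \<circ> ma A) z" for z
      using x module_outside[OF A, of z A12]
      by (cases "z \<in> sp A V1") (simp_all add: P0_mp cov_def pair_def module_mp_0[OF A])
    ultimately show ?thesis by (metis ext)
  qed
  show "cov V2 (mb P0 x) = mb D (cov V3 x)" if x: "x \<in> sp P0 V3" for x
  proof -
    have "mb D (cov V3 x) = cov V3 x \<circ> mb A" by (rule dual_mp) (use c3[OF x] in simp)
    moreover have "cov V2 (mb P0 x) z = (cov V3 x \<circ> mb A) z" for z
      using x module_outside[OF A, of z A23] bf_sym[of x]
      by (cases "z \<in> sp A V2") (simp_all add: P0_mp cov_def pair_def module_mp_0[OF A])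
    ultimately show ?thesis by (metis ext)
  qed
  show "cov V2 (mc P0 x) = mc D (cov V3 x)" if x: "x \<in> sp P0 V3" for x
  proof -
    have "mc D (cov V3 x) = cov V3 x \<circ> mc A" by (rule dual_mp) (use c3[OF x] in simp)
    moreover have "cov V2 (mc P0 x) z = (cov V3 x \<circ> mc A) z" for z
      using x module_outside[OF A, of z B23] bf_sym[of x]
      by (cases "z \<in> sp A V2") (simp_all add: P0_mp cov_def pair_def module_mp_0[OF A])
    ultimately show ?thesis by (metis ext)
  qed
qed

end

section \<open>Homomorphisms into the projective modules of the opposite quiver\<close>

lemma hom_sum:
  assumes "is_module G M" "is_module G N" "f \<in> hom G M N" "g \<in> hom G M N"
  shows "f + g \<in> hom G M N" "(\<lambda>v x. vscale c (f v x)) \<in> hom G M N" "(\<lambda>v x. f v x - g v x) \<in> hom G M N" "(\<lambda>v x. 0) \<in> hom G M N"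
proof -
  have *: "(\<lambda>v x. vscale c (f v x)) \<in> hom G M N" if f: "f \<in> hom G M N" for c f
    using f module_scale[OF assms(2)] lin_scale[OF module_lin[OF assms(2)]]
    by (auto simp: hom_iff qhom_def intro: lin_combine(3))
  have eq: "f + g = (\<lambda>v x. f v x + g v x)" for f g :: "'a => ('c => 'd) => ('e => 'd)" by (auto simp: fun_eq_iff)
  have add: "(\<lambda>v x. f v x + g v x) \<in> hom G M N" if "f \<in> hom G M N" "g \<in> hom G M N" for f g
    using that qhom_add[OF assms(2), of M f g] by (auto simp: hom_iff)
  show "f + g \<in> hom G M N" unfolding eq by (rule add[OF assms(3,4)])
  show "(\<lambda>v x. vscale c (f v x)) \<in> hom G M N" by (rule *[OF assms(3)])
  show "(\<lambda>v x. f v x - g v x) \<in> hom G M N" using add[OF assms(3) *[OF assms(4), of "-1"]] by simp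
  show "(\<lambda>v x. 0) \<in> hom G M N" using *[OF assms(3), of 0] by simp
qed

text \<open>For a path \<open>p\<close> this is \<open>s\<close> times the corresponding basis
  vector of a projective module.\<close>

definition dl :: "'y => 'k::zero => ('y => 'k)" where "dl p s = (\<lambda>q. if q = p then s else 0)"

lemma dl_apply: "dl p s q = (if q = p then s else 0)" by (simp add: dl_def)

lemma dl_linear: "dl p (s + t) = dl p s + dl p t" "dl p (c * s) = vscale c (dl p s)" "dl p 0 = (0 :: _ => 'k::field)"
  by (auto simp: dl_def fun_eq_iff vscale_def)

lemma dl_append: "append_arrow a (dl p s) = dl (p @ [a]) s"
  by (rule ext) (auto simp: append_arrow_def dl_def)

lemma dl_prepend: "prepend_arrow a (dl p s) = dl (a # p) s"
  by (rule ext) (auto simp: prepend_arrow_def dl_def split: if_splits)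

lemma dl_proj: "is_path G i p v ==> dl p s \<in> sp (proj_module G i) v"
  by (auto simp: proj_sp dl_def)

abbreviation Pop :: "vertex => (arrow list, 'k::field) qrep" where "Pop i \<equiv> proj_module Qop i"

lemma Pop_module: "is_module Qop (Pop i)"
  by (rule proj_module[OF finite_path_Qop])

lemma Pop_A12: "x \<in> sp (Pop i) V2 ==> ma (Pop i) x = append_arrow A12 x"
  and Pop_A23: "x \<in> sp (Pop i) V3 ==> mb (Pop i) x = append_arrow A23 x"
  and Pop_B23: "x \<in> sp (Pop i) V3 ==> mc (Pop i) x = append_arrow B23 x"
  using proj_mp[of x Qop i A12] proj_mp[of x Qop i A23] proj_mp[of x Qop i B23] by auto

context transp begin

lemma pair_0 [simp]: "w \<in> sp A V3 ==> w' \<in> sp A V3 ==> pair w w' 0 = 0"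
  by (simp add: pair_def)

text \<open>Inside the pairs from \<open>A\<^sub>3\<close>, \<open>K\<close> is at 2 the annihilator
  of the image of \<open>A\<^sub>2\<close> and at 1 that of the image of \<open>A\<^sub>1\<close>;
  at 3 it is zero because \<open>bf\<close> is nondegenerate.\<close>

definition K :: "(arrow list, 'k) qrep" where "K = qkernel Qop P0 cov"

lemma K_sub: "submodule Qop K P0"
  unfolding K_def by (rule qkernel_submodule[OF P0_module D_module cov_qhom])

lemmas K_module = submodule_module(1)[OF K_sub]

lemma K_V3: "sp K V3 = {0}"
proof -
  have "x = 0" if x: "x \<in> sp A V3" "cov V3 x = 0" for x
  proof (rule bf_nondeg[OF x(1)])
    show "bf x z = 0" if "z \<in> sp A V3" for z using fun_cong[OF x(2), of z] that by (simp add: cov_def)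
  qed
  moreover have "cov V3 0 = 0" using qhom_0[OF cov_qhom P0_module] .
  ultimately show ?thesis by (auto simp: K_def)
qed

lemma K_V2: "y \<in> sp K V2 \<longleftrightarrow> y \<in> PP & (\<forall>x\<in>sp A V2. pair (mb A x) (mc A x) y = 0)"
  by (auto simp: K_def cov_def fun_eq_iff)

lemma K_V1: "y \<in> sp K V1 \<longleftrightarrow> y \<in> PP & (\<forall>x\<in>sp A V1. pair (mb A (ma A x)) (mc A (ma A x)) y = 0)"
  by (auto simp: K_def cov_def fun_eq_iff)

lemma K_PP: "y \<in> sp K V2 ==> y \<in> PP" "y \<in> sp K V1 ==> y \<in> PP" "y \<in> sp K V2 ==> y \<in> sp K V1"
  by (auto simp: K_V1 K_V2)

lemma K_A12: "y \<in> sp K V2 ==> ma K y = y"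
  using submodule_mp[OF K_sub, of y A12] K_PP(1)[of y] by (simp add: P0_mp)

lemma K_projective: "projective Qop K"
  by (rule projective_Qop_K[OF K_module K_V3]) (simp add: K_A12)

text \<open>\<open>(p, q)\<close> embeds \<open>S\<close> into the pairs, so \<open>\<phi>\<close>
  becomes a functional on the image, which is a pairing by \<open>pair_rep\<close>.\<close>

lemma pair_surj:
  assumes S: "subsp S" and p: "lin S p" "\<And>x. x \<in> S ==> p x \<in> sp A V3" and q: "lin S q" "\<And>x. x \<in> S ==> q x \<in> sp A V3"
    and inj: "\<And>x. x \<in> S ==> p x = 0 ==> q x = 0 ==> x = 0"
    and \<phi>: "\<And>x y. x \<in> S ==> y \<in> S ==> \<phi> (x + y) = \<phi> x + \<phi> y" "\<And>c x. x \<in> S ==> \<phi> (vscale c x) = c * \<phi> x"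
  shows "\<exists>y\<in>PP. \<forall>x\<in>S. \<phi> x = pair (p x) (q x) y"
proof -
  let ?f = "\<lambda>x. pr (p x) (q x)"
  have l: "lin S ?f"
    unfolding lin_def using lin_add[OF p(1)] lin_scale[OF p(1)] lin_add[OF q(1)] lin_scale[OF q(1)] by (simp add: pr_linear)
  have finj: "x = y" if "x \<in> S" "y \<in> S" "?f x = ?f y" for x y
  proof -
    have "p x = p y" "q x = q y" using arg_cong[OF that(3), of selA] arg_cong[OF that(3), of selB] by simp_all
    then have "x - y = 0"
      using inj[OF subsp_diff[OF S that(1,2)]] lin_diff[OF p(1) S that(1,2)] lin_diff[OF q(1) S that(1,2)] by simp
    then show ?thesis by simp
  qed
  define g where "g u = (SOME x. x \<in> S & ?f x = u)" for u
  have g: "g (?f x) = x" if "x \<in> S" for x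
    unfolding g_def by (rule some_equality) (use that finj in auto)
  have "\<exists>w\<in>sp A V3. \<exists>w'\<in>sp A V3. \<forall>u\<in>?f ` S. \<phi> (g u) = pair w w' u"
  proof (rule pair_rep)
    show "subsp (?f ` S)" by (rule lin_image_subspace[OF S l])
    show "?f ` S \<subseteq> PP" using p(2) q(2) by auto
    fix u u' assume "u \<in> ?f ` S" "u' \<in> ?f ` S"
    then obtain x x' where x: "x \<in> S" "u = ?f x" "x' \<in> S" "u' = ?f x'" by blast
    have "g (u + u') = x + x'" using g[OF subsp_add[OF S x(1,3)]] lin_add[OF l x(1,3)] x by simp
    then show "\<phi> (g (u + u')) = \<phi> (g u) + \<phi> (g u')" using \<phi>(1)[OF x(1,3)] g x by simp
  next
    fix c u assume "u \<in> ?f ` S"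
    then obtain x where x: "x \<in> S" "u = ?f x" by blast
    have "g (vscale c u) = vscale c x" using g[OF subsp_scale[OF S x(1), of c]] lin_scale[OF l x(1)] x by simp
    then show "\<phi> (g (vscale c u)) = c * \<phi> (g u)" using \<phi>(2)[OF x(1)] g x by simp
  qed
  then obtain w w' where w: "w \<in> sp A V3" "w' \<in> sp A V3" "\<And>x. x \<in> S ==> \<phi> (g (?f x)) = pair w w' (?f x)" by blast
  have "\<phi> x = pair (p x) (q x) (pr w w')" if "x \<in> S" for x
    using w(3)[OF that] g[OF that] bf_sym[OF w(1) p(2)[OF that]] bf_sym[OF w(2) q(2)[OF that]] by (simp add: pair_def)
  then show ?thesis using w(1,2) by (intro bexI[of _ "pr w w'"]) simp_all
qed

lemma cov_surj: "\<phi> \<in> sp D v ==> \<exists>y\<in>sp P0 v. cov v y = \<phi>"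
proof -
  assume "\<phi> \<in> sp D v"
  then have p: "\<And>x y. x \<in> sp A v ==> y \<in> sp A v ==> \<phi> (x + y) = \<phi> x + \<phi> y"
    "\<And>c x. x \<in> sp A v ==> \<phi> (vscale c x) = c * \<phi> x" "\<And>x. x \<notin> sp A v ==> \<phi> x = 0"
    by (simp_all add: dual_sp_iff)
  show ?thesis
  proof (cases v)
    case V3
    obtain w where "w \<in> sp A V3" "\<forall>x\<in>sp A V3. \<phi> x = bf w x" using bf_rep[of \<phi>] p V3 by blast
    then show ?thesis using p(3) V3 by (intro bexI[of _ w]) (auto simp: cov_def fun_eq_iff)
  next
    case V2
    have "\<exists>y\<in>PP. \<forall>x\<in>sp A V2. \<phi> x = pair (mb A x) (mc A x) y"
      by (rule pair_surj[OF As bc_lin(1) _ bc_lin(2)]) (use p V2 kgood_bc[OF good A] in auto)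
    then obtain y where "y \<in> PP" "\<forall>x\<in>sp A V2. \<phi> x = pair (mb A x) (mc A x) y" by blast
    then show ?thesis using p(3) V2 by (intro bexI[of _ y]) (auto simp: cov_def fun_eq_iff)
  next
    case V1
    have "\<exists>y\<in>PP. \<forall>x\<in>sp A V1. \<phi> x = pair (mb A (ma A x)) (mc A (ma A x)) y"
      by (rule pair_surj[OF As bc_lin(3) _ bc_lin(4)]) (use p V1 kgood_bc[OF good A, OF Amp(1)] kgood_a[OF good] in auto)
    then obtain y where "y \<in> PP" "\<forall>x\<in>sp A V1. \<phi> x = pair (mb A (ma A x)) (mc A (ma A x)) y" by blast
    then show ?thesis using p(3) V1 by (intro bexI[of _ y]) (auto simp: cov_def fun_eq_iff)
  qed
qed

lemma generated_V3:
  assumes U: "submodule Qop U P0" and V3: "sp A V3 \<subseteq> sp U V3"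
  shows "U = P0"
proof (rule submodule_eqI[OF U submodule_refl[OF P0_module]])
  note mU = submodule_module(1)[OF U]
  have w: "pr w 0 \<in> sp U V2" "pr 0 w \<in> sp U V2" if "w \<in> sp A V3" for w
    using Qop_mp(2,3)[OF mU, of w] submodule_mp[OF U, of w A23] submodule_mp[OF U, of w B23] that V3 by (auto simp: P0_mp)
  have 2: "y \<in> sp U V2" if "y \<in> PP" for y
    using module_add[OF mU w(1)[OF PP_sel(1)[OF that]] w(2)[OF PP_sel(2)[OF that]]]
      PP_eq[OF that] pr_split[of "selA y" "selB y"] by simp
  have 1: "y \<in> sp U V1" if "y \<in> PP" for y
    using Qop_mp(1)[OF mU 2[OF that]] submodule_mp[OF U, of y A12] 2[OF that] that by (simp add: P0_mp)
  have "sp U V1 = PP" "sp U V2 = PP"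
    using submodule_sp[OF U, of _ V1] submodule_sp[OF U, of _ V2] 1 2 unfolding P0_sp by (intro set_eqI iffI; blast)+
  moreover have "sp U V3 = sp A V3"
    using submodule_sp[OF U, of _ V3] V3 unfolding P0_sp by (intro set_eqI iffI; blast)
  ultimately show "sp U v = sp P0 v" for v by (cases v) simp_all
qed

text \<open>\<open>cov\<close> is injective at 3 and \<open>P0\<close> is generated there, so no
  proper submodule of \<open>P0\<close> has the same image. For an inclusion, such as that of
  \<open>K\<close>, essentiality is immediate.\<close>

lemma presentation: "minimal_projective_presentation Qop K (cut K (\<lambda>v x. x)) P0 (cut P0 cov) D"
  unfolding minimal_projective_presentation_def
proof (intro conjI allI)
  show "projective Qop K" "projective Qop P0" by (rule K_projective P0_projective)+
  show "cut K (\<lambda>v x. x) \<in> hom Qop K P0" by (rule cut_hom[OF K_module qhom_inclusion[OF K_sub]])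
  show "cut P0 cov \<in> hom Qop P0 D" by (rule cut_hom[OF P0_module cov_qhom])
  show "surjective P0 D (cut P0 cov)"
    unfolding surjective_def using cov_surj qhom_sp[OF cov_qhom] by (auto simp: cut_def image_iff)
  show "cut K (\<lambda>v x. x) v ` sp K v = {x \<in> sp P0 v. cut P0 cov v x = 0}" for v
    by (auto simp: cut_def K_def)
  show "essential Qop P0 (cut P0 cov)"
    unfolding essential_def
  proof (intro allI impI)
    fix U assume U: "submodule Qop U P0 & (\<forall>v. cut P0 cov v ` sp U v = cut P0 cov v ` sp P0 v)"
    have "w \<in> sp U V3" if w: "w \<in> sp A V3" for w
    proof -
      have "cut P0 cov V3 w \<in> cut P0 cov V3 ` sp U V3" using U w by auto
      then obtain u where u: "u \<in> sp U V3" "cut P0 cov V3 w = cut P0 cov V3 u" by blast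
      have uA: "u \<in> sp A V3" using submodule_sp[of Qop U P0 u V3] U u(1) by auto
      have "cov V3 (w - u) = 0"
        using u(2) w uA qhom_minus[OF cov_qhom module_subspace[OF P0_module], of w V3 u] by simp
      then have "w - u \<in> sp K V3" using subsp_diff[OF As w uA] by (simp add: K_def)
      then show ?thesis using K_V3 u(1) by simp
    qed
    then have "sp A V3 \<subseteq> sp U V3" by blast
    then show "U = P0" using generated_V3[of U] U by simp
  qed
  show "essential Qop K (cut K (\<lambda>v x. x))"
    unfolding essential_def
  proof (intro allI impI)
    fix U assume U: "submodule Qop U K & (\<forall>v. cut K (\<lambda>v x. x) v ` sp U v = cut K (\<lambda>v x. x) v ` sp K v)"
    have "cut K (\<lambda>v x. x) v ` sp U v = sp U v" for v using U submodule_sp[of Qop U K _ v] by (force simp: cut_def)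
    moreover have "cut K (\<lambda>v x. x) v ` sp K v = sp K v" for v by (force simp: cut_def)
    ultimately have "sp U v = sp K v" for v using U by metis
    then show "U = K" using submodule_eqI[of Qop U K K] submodule_refl[OF K_module] U by simp
  qed
qed

abbreviation "HK i \<equiv> hom Qop K (Pop i :: (arrow list, 'k) qrep)"
abbreviation "HP i \<equiv> hom Qop P0 (Pop i :: (arrow list, 'k) qrep)"

text \<open>Agreement at 1 forces agreement at 2, because appending \<open>A12\<close> is injective,
  and \<open>K\<close> is zero at 3.\<close>

lemma HK_eqI:
  assumes h: "h \<in> HK i" "h' \<in> HK i" and eq: "\<And>y. y \<in> sp K V1 ==> h V1 y = h' V1 y"
  shows "h = h'"
proof (rule ext, rule ext)
  fix v y
  have q: "qhom Qop K (Pop i) h" "qhom Qop K (Pop i) h'" using h by (auto simp: hom_iff)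
  show "h v y = h' v y"
  proof (cases "y \<in> sp K v")
    case True
    show ?thesis
    proof (cases v)
      case V1 then show ?thesis using eq True by simp
    next
      case V2
      have y: "y \<in> sp K V2" using True V2 by simp
      have "append_arrow A12 (h V2 y) = append_arrow A12 (h' V2 y)"
        using qhom_Qop_mp(1)[OF q(1) y] qhom_Qop_mp(1)[OF q(2) y] Pop_A12[OF qhom_sp[OF q(1) y]] Pop_A12[OF qhom_sp[OF q(2) y]]
          eq[OF K_PP(3)[OF y]] K_A12[OF y] by simp
      then have "h V2 y p = h' V2 y p" for p using fun_cong[of _ _ "p @ [A12]"] by (fastforce simp: append_arrow_def)
      then show ?thesis using V2 by (simp add: fun_eq_iff)
    next
      case V3
      then show ?thesis using True K_V3 qhom_0[OF q(1) K_module] qhom_0[OF q(2) K_module] by simp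
    qed
  next
    case False
    then show ?thesis using h by (simp add: hom_iff)
  qed
qed

text \<open>The only path of the opposite quiver from 2 to 1 is \<open>[A12]\<close>, so a
  homomorphism from \<open>K\<close> to the projective at 2 is a functional on
  \<open>K\<^sub>1\<close>, that is, a pairing with some \<open>(w, w')\<close>.\<close>

definition eta :: "(arrow list => 'k) => (arrow list => 'k) => vertex => (arrow list => 'k) => (arrow list => 'k)" where
  "eta w w' = (\<lambda>v y. if y \<in> sp K v then case v of V1 => dl [A12] (pair w w' y) | V2 => dl [] (pair w w' y) | V3 => 0 else 0)"

text \<open>The pairing with the image of \<open>x\<close> vanishes on \<open>K\<^sub>2\<close> by
  the description of \<open>K\<close>, which is what a homomorphism to the projective at 1, zero at
  2, requires.\<close>

definition zeta :: "(arrow list => 'k) => vertex => (arrow list => 'k) => (arrow list => 'k)" where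
  "zeta x = (\<lambda>v y. if y \<in> sp K v & v = V1 then dl [] (pair (mb A x) (mc A x) y) else 0)"

lemma K_lin_pair:
  assumes "w \<in> sp A V3" "w' \<in> sp A V3" "v = V1 \<or> v = V2"
  shows "lin (sp K v) (\<lambda>y. dl p (pair w w' y))"
proof -
  have "sp K v \<subseteq> PP" using assms(3) K_PP by blast
  then show ?thesis unfolding lin_def using assms by (simp add: pair_add pair_scale dl_linear subset_iff)
qed

lemma lin_cong: "lin S f ==> subsp S ==> (\<And>x. x \<in> S ==> g x = f x) ==> lin S g"
  unfolding lin_def using subsp_add[of S] subsp_scale[of S] by simp

lemma eta_hom:
  assumes w: "w \<in> sp A V3" "w' \<in> sp A V3"
  shows "eta w w' \<in> HK V2"
  unfolding hom_iff qhom_Qop_iff all_vertex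
proof (intro conjI ballI allI impI)
  note Ks = module_subspace[OF K_module]
  show "lin (sp K V1) (eta w w' V1)" "lin (sp K V2) (eta w w' V2)" "lin (sp K V3) (eta w w' V3)"
    by (rule lin_cong[OF K_lin_pair[OF w, of V1 "[A12]"] Ks], simp, simp add: eta_def)
      (rule lin_cong[OF K_lin_pair[OF w, of V2 "[]"] Ks], simp, simp add: eta_def, simp add: lin_def eta_def)
  show "eta w w' V1 x \<in> sp (Pop V2) V1" "eta w w' V2 x \<in> sp (Pop V2) V2" "eta w w' V3 x \<in> sp (Pop V2) V3" for x
    unfolding eta_def using module_0[OF Pop_module]
      dl_proj[of Qop V2 "[A12]" V1 "pair w w' x"] dl_proj[of Qop V2 "[]" V2 "pair w w' x"] by (auto simp: path_Qop)
  show "eta w w' V1 (ma K x) = ma (Pop V2) (eta w w' V2 x)" if x: "x \<in> sp K V2" for x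
  proof -
    have "dl [] (pair w w' x) \<in> sp (Pop V2) V2" by (rule dl_proj) (simp add: path_Qop)
    then show ?thesis using x K_PP(3)[OF x] by (simp add: eta_def K_A12 Pop_A12 dl_append)
  qed
  show "eta w w' V2 (mb K x) = mb (Pop V2) (eta w w' V3 x)" if "x \<in> sp K V3" for x
    using that K_V3 w by (simp add: eta_def module_mp_0[OF K_module] module_mp_0[OF Pop_module] dl_linear)
  show "eta w w' V2 (mc K x) = mc (Pop V2) (eta w w' V3 x)" if "x \<in> sp K V3" for x
    using that K_V3 w by (simp add: eta_def module_mp_0[OF K_module] module_mp_0[OF Pop_module] dl_linear)
  show "eta w w' V1 x = 0" if "x \<notin> sp K V1" for x using that by (simp add: eta_def)
  show "eta w w' V2 x = 0" if "x \<notin> sp K V2" for x using that by (simp add: eta_def)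
  show "eta w w' V3 x = 0" for x by (simp add: eta_def)
qed

lemma zeta_hom:
  assumes x: "x \<in> sp A V2"
  shows "zeta x \<in> HK V1"
  unfolding hom_iff qhom_Qop_iff all_vertex
proof (intro conjI ballI allI impI)
  note Ks = module_subspace[OF K_module]
  have w: "mb A x \<in> sp A V3" "mc A x \<in> sp A V3" using x by auto
  show "lin (sp K V1) (zeta x V1)" "lin (sp K V2) (zeta x V2)" "lin (sp K V3) (zeta x V3)"
    by (rule lin_cong[OF K_lin_pair[OF w, of V1 "[]"] Ks], simp, simp add: zeta_def) (simp_all add: lin_def zeta_def)
  show "zeta x V1 y \<in> sp (Pop V1) V1" "zeta x V2 y \<in> sp (Pop V1) V2" "zeta x V3 y \<in> sp (Pop V1) V3" for y
    unfolding zeta_def using module_0[OF Pop_module]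
      dl_proj[of Qop V1 "[]" V1 "pair (mb A x) (mc A x) y"] by (auto simp: path_Qop)
  show "zeta x V1 (ma K y) = ma (Pop V1) (zeta x V2 y)" if y: "y \<in> sp K V2" for y
    using y x K_V2[of y] by (simp add: zeta_def K_A12 module_mp_0[OF Pop_module] dl_linear)
  show "zeta x V2 (mb K y) = mb (Pop V1) (zeta x V3 y)" "zeta x V2 (mc K y) = mc (Pop V1) (zeta x V3 y)" for y
    by (simp_all add: zeta_def module_mp_0[OF Pop_module])
  show "zeta x V1 y = 0" if "y \<notin> sp K V1" for y using that by (simp add: zeta_def)
  show "zeta x V2 y = 0" "zeta x V3 y = 0" for y by (simp_all add: zeta_def)
qed

lemma prepend_zeta:
  assumes x: "x \<in> sp A V2"
  shows "(\<lambda>v y. prepend_arrow A12 (zeta x v y)) = eta (mb A x) (mc A x)"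
proof (rule HK_eqI)
  show "(\<lambda>v y. prepend_arrow A12 (zeta x v y)) \<in> HK V2"
    using prepend_hom[of "zeta x" Qop K A12] zeta_hom[OF x] by simp
  show "eta (mb A x) (mc A x) \<in> HK V2" by (rule eta_hom) (use x in auto)
  show "prepend_arrow A12 (zeta x V1 y) = eta (mb A x) (mc A x) V1 y" if "y \<in> sp K V1" for y
    using that by (simp add: zeta_def eta_def dl_prepend)
qed

lemma HK_V2_rep:
  assumes h: "h \<in> HK V2"
  shows "\<exists>w\<in>sp A V3. \<exists>w'\<in>sp A V3. h = eta w w'"
proof -
  have q: "qhom Qop K (Pop V2) h" using h by (simp add: hom_iff)
  have "\<exists>w\<in>sp A V3. \<exists>w'\<in>sp A V3. \<forall>y\<in>sp K V1. h V1 y [A12] = pair w w' y"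
    by (rule pair_rep[OF module_subspace[OF K_module]]) (use K_PP qhom_plus[OF q] qhom_scale[OF q] in \<open>auto simp: vscale_apply\<close>)
  then obtain w w' where w: "w \<in> sp A V3" "w' \<in> sp A V3" "\<And>y. y \<in> sp K V1 ==> h V1 y [A12] = pair w w' y" by blast
  have "h = eta w w'"
  proof (rule HK_eqI[OF h eta_hom[OF w(1,2)]])
    fix y assume y: "y \<in> sp K V1"
    have "h V1 y p = 0" if "p ~= [A12]" for p using qhom_sp[OF q y] that by (auto simp: proj_sp path_Qop)
    then show "h V1 y = eta w w' V1 y" using w(3)[OF y] y by (auto simp: eta_def dl_apply fun_eq_iff)
  qed
  then show ?thesis using w by blast
qed

text \<open>Only the two paths from 3 to 1 carry coefficients at the vertex 1, and each coefficient
  is a functional on \<open>K\<^sub>1\<close>.\<close>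

lemma HK_V3_rep:
  assumes h: "h \<in> HK V3"
  shows "\<exists>w\<in>sp A V3. \<exists>w'\<in>sp A V3. \<exists>u\<in>sp A V3. \<exists>u'\<in>sp A V3.
    h = (\<lambda>v y. prepend_arrow A23 (eta w w' v y)) + (\<lambda>v y. prepend_arrow B23 (eta u u' v y))"
proof -
  have q: "qhom Qop K (Pop V3) h" using h by (simp add: hom_iff)
  have rep: "\<exists>w\<in>sp A V3. \<exists>w'\<in>sp A V3. \<forall>y\<in>sp K V1. h V1 y p = pair w w' y" for p
    by (rule pair_rep[OF module_subspace[OF K_module]]) (use K_PP qhom_plus[OF q] qhom_scale[OF q] in \<open>auto simp: vscale_apply\<close>)
  obtain w w' where w: "w \<in> sp A V3" "w' \<in> sp A V3" "\<And>y. y \<in> sp K V1 ==> h V1 y [A23, A12] = pair w w' y" using rep[of "[A23, A12]"] by blast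
  obtain u u' where u: "u \<in> sp A V3" "u' \<in> sp A V3" "\<And>y. y \<in> sp K V1 ==> h V1 y [B23, A12] = pair u u' y" using rep[of "[B23, A12]"] by blast
  have "h = (\<lambda>v y. prepend_arrow A23 (eta w w' v y)) + (\<lambda>v y. prepend_arrow B23 (eta u u' v y))"
  proof (rule HK_eqI[OF h])
    show "(\<lambda>v y. prepend_arrow A23 (eta w w' v y)) + (\<lambda>v y. prepend_arrow B23 (eta u u' v y)) \<in> HK V3"
      using prepend_hom[of "eta w w'" Qop K A23] prepend_hom[of "eta u u'" Qop K B23] eta_hom w u
      by (intro hom_sum(1)[OF K_module Pop_module]) simp_all
    fix y assume y: "y \<in> sp K V1"
    have z: "h V1 y p = 0" if "p ~= [A23, A12]" "p ~= [B23, A12]" for p using qhom_sp[OF q y] that by (auto simp: proj_sp path_Qop)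
    show "h V1 y = ((\<lambda>v y. prepend_arrow A23 (eta w w' v y)) + (\<lambda>v y. prepend_arrow B23 (eta u u' v y))) V1 y"
      using w(3)[OF y] u(3)[OF y] y z by (auto simp: eta_def dl_prepend dl_apply fun_eq_iff)
  qed
  then show ?thesis using w u by blast
qed

text \<open>The projective at 2 is zero at the vertex 3, where \<open>P0\<close> is
  generated.\<close>

lemma HP_V2: "h \<in> HP V2 ==> y \<in> sp P0 v ==> h v y = 0"
proof -
  assume h: "h \<in> HP V2" and y: "y \<in> sp P0 v"
  have q: "qhom Qop P0 (Pop V2) h" using h by (simp add: hom_iff)
  have 3: "h V3 x = 0" if "x \<in> sp A V3" for x
    using qhom_sp[OF q, of x V3] that by (auto simp: proj_sp path_Qop fun_eq_iff)
  have 2: "h V2 x = 0" if "x \<in> PP" for x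
    using P0_qhom_V2(1)[OF q Pop_module that] 3 that by (simp add: module_mp_0[OF Pop_module])
  have 1: "h V1 x = 0" if "x \<in> PP" for x
    using P0_qhom_V2(2)[OF q Pop_module that] 2[OF that] by (simp add: module_mp_0[OF Pop_module])
  show ?thesis using y 1 2 3 by (cases v) simp_all
qed

text \<open>A homomorphism from \<open>P0\<close> to the projective module at \<open>3\<close> is a functional \<open>bf w\<close> on \<open>A\<^sub>3\<close>.\<close>

definition theta :: "(arrow list => 'k) => vertex => (arrow list => 'k) => (arrow list => 'k)" where
  "theta w = cut P0 (\<lambda>v y. case v of V3 => dl [] (bf w y)
    | V2 => mb (Pop V3) (dl [] (bf w (selA y))) + mc (Pop V3) (dl [] (bf w (selB y)))
    | V1 => ma (Pop V3) (mb (Pop V3) (dl [] (bf w (selA y))) + mc (Pop V3) (dl [] (bf w (selB y)))))"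

lemma theta_HP: "w \<in> sp A V3 ==> theta w \<in> HP V3"
proof -
  assume w: "w \<in> sp A V3"
  have l: "lin (sp A V3) (\<lambda>y. dl [] (bf w y))" unfolding lin_def using w by (simp add: bf_add2 bf_scale2 dl_linear)
  show ?thesis
    unfolding theta_def
    by (rule cut_hom[OF P0_module P0_extend[OF Pop_module l]]) (rule dl_proj, simp add: path_Qop)
qed

lemma Pop_V3_paths:
  "ma (Pop V3) (mb (Pop V3) (dl [] s) + mc (Pop V3) (dl [] t)) = dl [A23, A12] s + dl [B23, A12] (t :: 'k)"
proof -
  have 0: "dl [] r \<in> sp (Pop V3) V3" for r :: 'k by (rule dl_proj) (simp add: path_Qop)
  have 1: "dl [A23] s \<in> sp (Pop V3) V2" "dl [B23] t \<in> sp (Pop V3) V2" by (rule dl_proj, simp add: path_Qop)+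
  have m: "mb (Pop V3) (dl [] s) = dl [A23] s" "mc (Pop V3) (dl [] t) = dl [B23] t"
    using Pop_A23[OF 0, of s] Pop_B23[OF 0, of t] by (simp_all add: dl_append)
  show ?thesis
    unfolding m using Pop_A12[OF module_add[OF Pop_module 1]] by (simp add: append_arrow_add dl_append)
qed

lemma theta_V1: "y \<in> sp K V1 ==> theta w V1 y = dl [A23, A12] (bf w (selA y)) + dl [B23, A12] (bf w (selB y))"
  using K_PP(2)[of y] by (simp add: theta_def Pop_V3_paths fun_eq_iff)

text \<open>The source of the relations \<open>(gm w 0, gm 0 w)\<close>: these restrictions are
  divided out at the vertex 3 of the transpose.\<close>

lemma theta_restrict:
  assumes w: "w \<in> sp A V3"
  shows "hom_comp (theta w) (cut K (\<lambda>v x. x)) = (\<lambda>v y. prepend_arrow A23 (eta w 0 v y)) + (\<lambda>v y. prepend_arrow B23 (eta 0 w v y))"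
proof (rule HK_eqI)
  have t: "qhom Qop P0 (Pop V3) (theta w)" using theta_HP[OF w] by (simp add: hom_iff)
  have eq: "hom_comp (theta w) (cut K (\<lambda>v x. x)) = cut K (\<lambda>v x. theta w v x)"
    by (auto simp: hom_comp_def cut_def fun_eq_iff qhom_0[OF t P0_module])
  show "hom_comp (theta w) (cut K (\<lambda>v x. x)) \<in> HK V3"
    unfolding eq by (rule cut_hom[OF K_module qhom_restrict[OF K_sub t]])
  show "(\<lambda>v y. prepend_arrow A23 (eta w 0 v y)) + (\<lambda>v y. prepend_arrow B23 (eta 0 w v y)) \<in> HK V3"
    using prepend_hom[of "eta w 0" Qop K A23] prepend_hom[of "eta 0 w" Qop K B23] eta_hom w
    by (intro hom_sum(1)[OF K_module Pop_module]) simp_all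
  fix y assume y: "y \<in> sp K V1"
  show "hom_comp (theta w) (cut K (\<lambda>v x. x)) V1 y = ((\<lambda>v y. prepend_arrow A23 (eta w 0 v y)) + (\<lambda>v y. prepend_arrow B23 (eta 0 w v y))) V1 y"
    unfolding eq using y K_PP(2)[OF y] w by (simp add: theta_V1 eta_def dl_prepend pair_def fun_eq_iff)
qed

lemma HP_V3_rep:
  assumes h: "h \<in> HP V3"
  shows "\<exists>w\<in>sp A V3. hom_comp h (cut K (\<lambda>v x. x)) = hom_comp (theta w) (cut K (\<lambda>v x. x))"
proof -
  have q: "qhom Qop P0 (Pop V3) h" using h by (simp add: hom_iff)
  have l3: "lin (sp A V3) (h V3)" using qhom_lin[OF q, of V3] by simp
  obtain w where w: "w \<in> sp A V3" "\<And>x. x \<in> sp A V3 ==> h V3 x [] = bf w x"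
    using bf_rep[of "\<lambda>x. h V3 x []"] lin_add[OF l3] lin_scale[OF l3] by (auto simp: vscale_apply)
  have 3: "h V3 x = dl [] (bf w x)" if x: "x \<in> sp A V3" for x
  proof -
    have "h V3 x p = 0" if "p ~= []" for p using qhom_sp[OF q, of x V3] x that by (auto simp: proj_sp path_Qop)
    then show ?thesis using w(2)[OF x] by (auto simp: dl_apply fun_eq_iff)
  qed
  have t: "qhom Qop P0 (Pop V3) (theta w)" using theta_HP[OF w(1)] by (simp add: hom_iff)
  have eq: "hom_comp f (cut K (\<lambda>v x. x)) = cut K (\<lambda>v x. f v x)" if "qhom Qop P0 (Pop V3) f" for f :: "vertex => (arrow list => 'k) => (arrow list => 'k)"
    by (auto simp: hom_comp_def cut_def fun_eq_iff qhom_0[OF that P0_module])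
  have "hom_comp h (cut K (\<lambda>v x. x)) = hom_comp (theta w) (cut K (\<lambda>v x. x))"
  proof (rule HK_eqI)
    show "hom_comp h (cut K (\<lambda>v x. x)) \<in> HK V3" unfolding eq[OF q] by (rule cut_hom[OF K_module qhom_restrict[OF K_sub q]])
    show "hom_comp (theta w) (cut K (\<lambda>v x. x)) \<in> HK V3" unfolding eq[OF t] by (rule cut_hom[OF K_module qhom_restrict[OF K_sub t]])
    fix y assume y: "y \<in> sp K V1"
    have sel: "selA y \<in> sp A V3" "selB y \<in> sp A V3" using K_PP(2)[OF y] by auto
    have "h V1 y = theta w V1 y"
      by (simp only: P0_qhom_V2[OF q Pop_module K_PP(2)[OF y]] 3[OF sel(1)] 3[OF sel(2)] Pop_V3_paths theta_V1[OF y])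
    then show "hom_comp h (cut K (\<lambda>v x. x)) V1 y = hom_comp (theta w) (cut K (\<lambda>v x. x)) V1 y"
      unfolding eq[OF q] eq[OF t] using y by simp
  qed
  then show ?thesis using w(1) by blast
qed

lemma eta_linear:
  assumes "w \<in> sp A V3" "w' \<in> sp A V3"
  shows "u \<in> sp A V3 ==> u' \<in> sp A V3 ==> eta (w + u) (w' + u') = eta w w' + eta u u'"
    and "eta (vscale c w) (vscale c w') = (\<lambda>v y. vscale c (eta w w' v y))"
proof -
  show "eta (w + u) (w' + u') = eta w w' + eta u u'" if u: "u \<in> sp A V3" "u' \<in> sp A V3"
  proof (rule HK_eqI)
    show "eta (w + u) (w' + u') \<in> HK V2" by (rule eta_hom) (use assms u subsp_add[OF As] in auto)
    show "eta w w' + eta u u' \<in> HK V2" by (rule hom_sum(1)[OF K_module Pop_module eta_hom[OF assms] eta_hom[OF u]])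
    show "eta (w + u) (w' + u') V1 y = (eta w w' + eta u u') V1 y" if "y \<in> sp K V1" for y
      using that K_PP(2)[OF that] assms u by (simp add: eta_def pair_add2 dl_linear)
  qed
  show "eta (vscale c w) (vscale c w') = (\<lambda>v y. vscale c (eta w w' v y))"
  proof (rule HK_eqI)
    show "eta (vscale c w) (vscale c w') \<in> HK V2" by (rule eta_hom) (use assms subsp_scale[OF As] in auto)
    show "(\<lambda>v y. vscale c (eta w w' v y)) \<in> HK V2" by (rule hom_sum(2)[OF K_module Pop_module eta_hom[OF assms] eta_hom[OF assms]])
    show "eta (vscale c w) (vscale c w') V1 y = vscale c (eta w w' V1 y)" if "y \<in> sp K V1" for y
      using that K_PP(2)[OF that] assms by (simp add: eta_def pair_scale2 dl_linear)
  qed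
qed

text \<open>\<open>K\<^sub>1\<close> is the annihilator of the image of \<open>A\<^sub>1\<close>, so
  \<open>annihilator\<close> identifies the pairings that vanish on it.\<close>

lemma eta_zero_iff:
  assumes w: "w \<in> sp A V3" "w' \<in> sp A V3"
  shows "eta w w' = (\<lambda>v y. 0) \<longleftrightarrow> (\<exists>x\<in>sp A V1. w = mb A (ma A x) & w' = mc A (ma A x))"
proof
  assume z: "eta w w' = (\<lambda>v y. 0)"
  show "\<exists>x\<in>sp A V1. w = mb A (ma A x) & w' = mc A (ma A x)"
  proof (rule annihilator[OF As bc_lin(3) _ bc_lin(4) _ w])
    fix y assume y: "y \<in> PP" "\<forall>x\<in>sp A V1. pair (mb A (ma A x)) (mc A (ma A x)) y = 0"
    then have "y \<in> sp K V1" by (simp add: K_V1)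
    then show "pair w w' y = 0" using fun_cong[OF fun_cong[OF fun_cong[OF z]], of V1 y "[A12]"] by (simp add: eta_def dl_apply)
  qed auto
next
  assume "\<exists>x\<in>sp A V1. w = mb A (ma A x) & w' = mc A (ma A x)"
  then have z: "pair w w' y = 0" if "y \<in> sp K V1" for y using that by (auto simp: K_V1)
  show "eta w w' = (\<lambda>v y. 0)"
    by (rule HK_eqI[OF eta_hom[OF w] hom_sum(4)[OF K_module Pop_module eta_hom[OF w] eta_hom[OF w]]])
      (use z in \<open>simp add: eta_def dl_linear\<close>)
qed

text \<open>At the vertex 2 nothing is divided out, since \<open>P0\<close> has no nonzero maps to
  the projective at 2; so \<open>e V2\<close> after \<open>eta\<close> serves as \<open>gm\<close>.
  At 1 the image of the structure map consists of the pairings that vanish on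
  \<open>K\<^sub>2\<close>. At 3 the two arrows prepend \<open>A23\<close> and \<open>B23\<close>,
  and the maps \<open>theta w\<close> are the relations.\<close>

theorem cox_of_transpose:
  fixes N :: "(arrow list, 'k) qrep"
  assumes N: "Qmod N"
    and lin: "\<And>i. linear_map (\<lambda>c h v x. vscale c (h v x)) vscale (HK i) (sp N i) (e i)"
    and com: "\<And>a h. h \<in> HK (tgt Qop a) ==> e (src Qop a) (\<lambda>v x. prepend_arrow a (h v x)) = mp N a (e (tgt Qop a) h)"
    and surj: "\<And>i. e i ` HK i = sp N i"
    and ker: "\<And>i. {h \<in> HK i. e i h = 0} = {hom_comp h (cut K (\<lambda>v x. x)) |h. h \<in> HP i}"
  shows "cox A N (\<lambda>w w'. e V2 (eta w w'))"
proof -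
  have e_in: "e i h \<in> sp N i" if "h \<in> HK i" for i h using lin[of i] that by (simp add: linear_map_def)
  have e_add: "e i (h + h') = e i h + e i h'" if "h \<in> HK i" "h' \<in> HK i" for i h h' using lin[of i] that by (simp add: linear_map_def)
  have e_scale: "e i (\<lambda>v x. vscale c (h v x)) = vscale c (e i h)" if "h \<in> HK i" for i h c using lin[of i] that by (simp add: linear_map_def)
  have comA: "ma N (e V1 h) = e V2 (\<lambda>v x. prepend_arrow A12 (h v x))" if "h \<in> HK V1" for h using com[of h A12] that by simp
  have comB: "mb N (e V2 h) = e V3 (\<lambda>v x. prepend_arrow A23 (h v x))" "mc N (e V2 h) = e V3 (\<lambda>v x. prepend_arrow B23 (h v x))"
    if "h \<in> HK V2" for h using com[of h A23] com[of h B23] that by simp_all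
  have ker2: "e V2 h = 0 \<longleftrightarrow> h = (\<lambda>v y. 0)" if h: "h \<in> HK V2" for h
  proof
    assume "e V2 h = 0"
    then obtain h' where h': "h' \<in> HP V2" "h = hom_comp h' (cut K (\<lambda>v x. x))" using ker[of V2] h by blast
    have "h' v (cut K (\<lambda>v x. x) v y) = 0" for v y
    proof (rule HP_V2[OF h'(1)])
      show "cut K (\<lambda>v x. x) v y \<in> sp P0 v" using submodule_sp[OF K_sub, of y v] module_0[OF P0_module] by (simp add: cut_def)
    qed
    then show "h = (\<lambda>v y. 0)" using h'(2) by (simp add: hom_comp_def comp_def)
  next
    assume "h = (\<lambda>v y. 0)"
    then have "(\<lambda>v x. vscale 0 (h v x)) = h" by simp
    then show "e V2 h = 0" using e_scale[OF h, of 0] by simp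
  qed
  show ?thesis
  proof
    show "Qmod A" "Qmod N" "kgood A" by (rule A N good)+
    show "e V2 (eta w w') \<in> sp N V2" if "w \<in> sp A V3" "w' \<in> sp A V3" for w w' by (rule e_in[OF eta_hom[OF that]])
    show "lin2 (sp A V3) (\<lambda>w w'. e V2 (eta w w'))"
      unfolding lin2_def by (simp add: eta_linear e_add e_scale eta_hom)
    show "\<exists>w\<in>sp A V3. \<exists>w'\<in>sp A V3. n = e V2 (eta w w')" if n: "n \<in> sp N V2" for n
    proof -
      have "n \<in> e V2 ` HK V2" using surj[of V2] n by simp
      then obtain h where "h \<in> HK V2" "n = e V2 h" by blast
      then show ?thesis using HK_V2_rep by blast
    qed
    show "e V2 (eta w w') = 0 \<longleftrightarrow> (\<exists>x\<in>sp A V1. w = mb A (ma A x) & w' = mc A (ma A x))"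
      if w: "w \<in> sp A V3" "w' \<in> sp A V3" for w w' using ker2[OF eta_hom[OF w]] eta_zero_iff[OF w] by simp
    show "n = 0" if n: "n \<in> sp N V1" "ma N n = 0" for n
    proof -
      have "n \<in> e V1 ` HK V1" using surj[of V1] n by simp
      then obtain h where h: "h \<in> HK V1" "n = e V1 h" by blast
      have "(\<lambda>v x. prepend_arrow A12 (h v x)) \<in> HK V2" using prepend_hom[of h Qop K A12] h(1) by simp
      then have z: "(\<lambda>v x. prepend_arrow A12 (h v x)) = (\<lambda>v y. 0)" using ker2 comA[OF h(1)] n(2) h(2) by simp
      have "h v y p = 0" for v y p using fun_cong[OF fun_cong[OF fun_cong[OF z, of v], of y], of "A12 # p"] by (simp add: prepend_arrow_def)
      then have "(\<lambda>v x. vscale 0 (h v x)) = h" by (simp add: fun_eq_iff)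
      then show ?thesis using e_scale[OF h(1), of 0] h(2) by simp
    qed
    show "(\<exists>n\<in>sp N V1. ma N n = y) \<longleftrightarrow> (\<exists>x\<in>sp A V2. y = e V2 (eta (mb A x) (mc A x)))" for y
    proof
      assume "\<exists>n\<in>sp N V1. ma N n = y"
      then obtain n where n: "n \<in> e V1 ` HK V1" "ma N n = y" using surj[of V1] by auto
      then obtain h where h: "h \<in> HK V1" "n = e V1 h" by blast
      have ph: "(\<lambda>v x. prepend_arrow A12 (h v x)) \<in> HK V2" using prepend_hom[of h Qop K A12] h(1) by simp
      then obtain w w' where w: "w \<in> sp A V3" "w' \<in> sp A V3" "(\<lambda>v x. prepend_arrow A12 (h v x)) = eta w w'" using HK_V2_rep by blast
      \<comment> \<open>All paths in the values of this homomorphism begin with \<open>A12\<close>,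
        so the coefficient at the empty path is zero. Hence the pairing with \<open>(w, w')\<close>
        kills \<open>K\<^sub>2\<close>, the annihilator of the image of
        \<open>A\<^sub>2\<close>.\<close>
      have "\<exists>x\<in>sp A V2. w = mb A x & w' = mc A x"
      proof (rule annihilator[OF As bc_lin(1) _ bc_lin(2) _ w(1,2)])
        fix z assume "z \<in> PP" "\<forall>x\<in>sp A V2. pair (mb A x) (mc A x) z = 0"
        then have "z \<in> sp K V2" by (simp add: K_V2)
        then show "pair w w' z = 0"
          using fun_cong[OF fun_cong[OF fun_cong[OF w(3), of V2], of z], of "[]"] by (simp add: eta_def dl_apply prepend_arrow_def)
      qed auto
      then show "\<exists>x\<in>sp A V2. y = e V2 (eta (mb A x) (mc A x))" using comA[OF h(1)] n(2) h(2) w(3) by metis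
    next
      assume "\<exists>x\<in>sp A V2. y = e V2 (eta (mb A x) (mc A x))"
      then obtain x where x: "x \<in> sp A V2" "y = e V2 (eta (mb A x) (mc A x))" by blast
      have "ma N (e V1 (zeta x)) = y" using comA[OF zeta_hom[OF x(1)]] prepend_zeta[OF x(1)] x(2) by simp
      then show "\<exists>n\<in>sp N V1. ma N n = y" using e_in[OF zeta_hom[OF x(1)]] by blast
    qed
    show "\<exists>m\<in>sp N V2. \<exists>m'\<in>sp N V2. n = mb N m + mc N m'" if n: "n \<in> sp N V3" for n
    proof -
      have "n \<in> e V3 ` HK V3" using surj[of V3] n by simp
      then obtain h where h: "h \<in> HK V3" "n = e V3 h" by blast
      then obtain w w' u u' where w: "w \<in> sp A V3" "w' \<in> sp A V3" "u \<in> sp A V3" "u' \<in> sp A V3"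
        "h = (\<lambda>v y. prepend_arrow A23 (eta w w' v y)) + (\<lambda>v y. prepend_arrow B23 (eta u u' v y))" using HK_V3_rep by blast
      have "e V3 h = mb N (e V2 (eta w w')) + mc N (e V2 (eta u u'))"
        unfolding w(5) comB(1)[OF eta_hom[OF w(1,2)]] comB(2)[OF eta_hom[OF w(3,4)]]
        by (rule e_add) (use prepend_hom[of _ Qop K A23] prepend_hom[of _ Qop K B23] eta_hom w in simp_all)
      then show ?thesis using h(2) e_in[OF eta_hom] w by blast
    qed
    show "mb N m + mc N m' = 0 \<longleftrightarrow> (\<exists>w\<in>sp A V3. m = e V2 (eta w 0) & m' = e V2 (eta 0 w))"
      if m: "m \<in> sp N V2" "m' \<in> sp N V2" for m m'
    proof -
      have sum: "mb N (e V2 (eta w w')) + mc N (e V2 (eta u u')) =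
          e V3 ((\<lambda>v y. prepend_arrow A23 (eta w w' v y)) + (\<lambda>v y. prepend_arrow B23 (eta u u' v y)))"
        if w: "w \<in> sp A V3" "w' \<in> sp A V3" "u \<in> sp A V3" "u' \<in> sp A V3" for w w' u u'
        unfolding comB(1)[OF eta_hom[OF w(1,2)]] comB(2)[OF eta_hom[OF w(3,4)]]
        by (rule e_add[symmetric]) (use prepend_hom[of _ Qop K A23] prepend_hom[of _ Qop K B23] eta_hom w in simp_all)
      have inHK: "(\<lambda>v y. prepend_arrow A23 (eta w w' v y)) + (\<lambda>v y. prepend_arrow B23 (eta u u' v y)) \<in> HK V3"
        if w: "w \<in> sp A V3" "w' \<in> sp A V3" "u \<in> sp A V3" "u' \<in> sp A V3" for w w' u u'
        using prepend_hom[of "eta w w'" Qop K A23] prepend_hom[of "eta u u'" Qop K B23] eta_hom w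
        by (intro hom_sum(1)[OF K_module Pop_module]) simp_all
      show ?thesis
      proof
        assume z: "mb N m + mc N m' = 0"
        have "m \<in> e V2 ` HK V2" "m' \<in> e V2 ` HK V2" using surj[of V2] m by simp_all
        then obtain w w' u u' where w: "w \<in> sp A V3" "w' \<in> sp A V3" "u \<in> sp A V3" "u' \<in> sp A V3"
          "m = e V2 (eta w w')" "m' = e V2 (eta u u')" using HK_V2_rep by blast
        let ?h = "(\<lambda>v y. prepend_arrow A23 (eta w w' v y)) + (\<lambda>v y. prepend_arrow B23 (eta u u' v y))"
        have "e V3 ?h = 0" using sum[OF w(1-4)] z w(5,6) by simp
        then have "?h \<in> {hom_comp h (cut K (\<lambda>v x. x)) |h. h \<in> HP V3}" using ker[of V3] inHK[OF w(1-4)] by blast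
        then obtain x where x: "x \<in> sp A V3" "?h = (\<lambda>v y. prepend_arrow A23 (eta x 0 v y)) + (\<lambda>v y. prepend_arrow B23 (eta 0 x v y))"
          using HP_V3_rep theta_restrict by force
        \<comment> \<open>Comparing coefficients at paths that begin with \<open>A23\<close> and
          with \<open>B23\<close> separates the two summands.\<close>
        have *: "?h V1 y p = ((\<lambda>v y. prepend_arrow A23 (eta x 0 v y)) + (\<lambda>v y. prepend_arrow B23 (eta 0 x v y))) V1 y p" for y p
          using x(2) by simp
        have "eta w w' = eta x 0"
        proof (rule HK_eqI[OF eta_hom[OF w(1,2)] eta_hom[OF x(1) A0]])
          fix y assume "y \<in> sp K V1"
          then show "eta w w' V1 y = eta x 0 V1 y" using *[of y "[A23, A12]"] by (simp add: eta_def dl_prepend dl_apply fun_eq_iff)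
        qed
        moreover have "eta u u' = eta 0 x"
        proof (rule HK_eqI[OF eta_hom[OF w(3,4)] eta_hom[OF A0 x(1)]])
          fix y assume "y \<in> sp K V1"
          then show "eta u u' V1 y = eta 0 x V1 y" using *[of y "[B23, A12]"] by (simp add: eta_def dl_prepend dl_apply fun_eq_iff)
        qed
        ultimately show "\<exists>w\<in>sp A V3. m = e V2 (eta w 0) & m' = e V2 (eta 0 w)" using w(5,6) x(1) by auto
      next
        assume "\<exists>w\<in>sp A V3. m = e V2 (eta w 0) & m' = e V2 (eta 0 w)"
        then obtain w where w: "w \<in> sp A V3" "m = e V2 (eta w 0)" "m' = e V2 (eta 0 w)" by blast
        have "hom_comp (theta w) (cut K (\<lambda>v x. x)) \<in> {h \<in> HK V3. e V3 h = 0}" using ker[of V3] theta_HP[OF w(1)] by blast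
        then show "mb N m + mc N m' = 0" using sum[OF w(1) A0 A0 w(1)] w(2,3) theta_restrict[OF w(1)] by simp
      qed
    qed
  qed
qed

end

section \<open>Independence of the presentation, and existence of a transpose\<close>

lemma hom_comp_hom:
  assumes "f \<in> hom G M N" "g \<in> hom G N L" "is_module G N"
  shows "hom_comp g f \<in> hom G M L"
  using assms qhom_comp[of G M N f L g] qhom_0[of G N L g] by (auto simp: hom_iff hom_comp_def comp_def)

text \<open>Projectivity tests lifting only on modules over the index type of the projective,
  whereas the dual lives over another type; a copy brings it into range.\<close>

lemma module_copy:
  fixes M :: "('v, 'a, 'z, 'k::field) rep"
  assumes M: "is_module G M" and inf: "infinite (UNIV :: 'y set)"
  shows "\<exists>(M' :: ('v, 'a, 'y, 'k) rep) f. is_module G M' & qhom G M M' f & qinj M f"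
proof -
  have "\<exists>q :: ('z => 'k) => ('y => 'k). lin (sp M v) q & (\<forall>x\<in>sp M v. q x = 0 \<longleftrightarrow> x \<in> {0})" for v
    by (rule quotient_map[OF module_fd[OF M] fun_vs.subspace_single_0 _ inf]) (use module_0[OF M] in blast)
  then have "\<forall>v. \<exists>q :: ('z => 'k) => ('y => 'k). lin (sp M v) q & (\<forall>x\<in>sp M v. q x = 0 \<longleftrightarrow> x = 0)" by simp
  then obtain q :: "'v => ('z => 'k) => ('y => 'k)" where q: "\<And>v. lin (sp M v) (q v)" "\<And>v x. x \<in> sp M v ==> q v x = 0 \<longleftrightarrow> x = 0"
    unfolding choice_iff by blast
  have qinj: "x = y" if "x \<in> sp M v" "y \<in> sp M v" "q v x = q v y" for v x y
    using q(2)[OF module_diff[OF M that(1,2)]] lin_diff[OF q(1) module_subspace[OF M] that(1,2)] that(3) by simp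
  define r where "r v y = (SOME x. x \<in> sp M v & q v x = y)" for v y
  have r: "r v (q v x) = x" if "x \<in> sp M v" for v x
    unfolding r_def by (rule some_equality) (use that qinj in auto)
  let ?M = "\<lparr>sp = (\<lambda>v. q v ` sp M v), mp = (\<lambda>a y. if y \<in> q (src G a) ` sp M (src G a) then q (tgt G a) (mp M a (r (src G a) y)) else 0)\<rparr>"
  have mp: "mp ?M a (q (src G a) x) = q (tgt G a) (mp M a x)" if "x \<in> sp M (src G a)" for a x
    using that r by simp
  have "is_module G ?M"
  proof (rule is_moduleI)
    show "findim (sp ?M v)" for v using lin_image_fd[OF module_fd[OF M] q(1)] by simp
    show "lin (sp ?M (src G a)) (mp ?M a)" for a
      unfolding lin_def
    proof (intro conjI ballI allI)
      fix y z assume "y \<in> sp ?M (src G a)" "z \<in> sp ?M (src G a)"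
      then obtain x x' where x: "x \<in> sp M (src G a)" "x' \<in> sp M (src G a)" "y = q (src G a) x" "z = q (src G a) x'" by auto
      have "mp ?M a (q (src G a) (x + x')) = q (tgt G a) (mp M a (x + x'))" by (rule mp[OF module_add[OF M x(1,2)]])
      also have "\<dots> = q (tgt G a) (mp M a x) + q (tgt G a) (mp M a x')"
        using lin_add[OF module_lin[OF M] x(1,2)] lin_add[OF q(1) module_mp[OF M x(1)] module_mp[OF M x(2)]] by simp
      also have "\<dots> = mp ?M a y + mp ?M a z" using mp[OF x(1)] mp[OF x(2)] x(3,4) by simp
      finally show "mp ?M a (y + z) = mp ?M a y + mp ?M a z" using lin_add[OF q(1) x(1,2)] x(3,4) by simp
    next
      fix c y assume "y \<in> sp ?M (src G a)"
      then obtain x where x: "x \<in> sp M (src G a)" "y = q (src G a) x" by auto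
      have "mp ?M a (q (src G a) (vscale c x)) = q (tgt G a) (mp M a (vscale c x))" by (rule mp[OF module_scale[OF M x(1)]])
      also have "\<dots> = vscale c (q (tgt G a) (mp M a x))"
        using lin_scale[OF module_lin[OF M] x(1)] lin_scale[OF q(1) module_mp[OF M x(1)]] by simp
      also have "\<dots> = vscale c (mp ?M a y)" using mp[OF x(1)] x(2) by simp
      finally show "mp ?M a (vscale c y) = vscale c (mp ?M a y)" using lin_scale[OF q(1) x(1)] x(2) by simp
    qed
    show "mp ?M a y \<in> sp ?M (tgt G a)" if "y \<in> sp ?M (src G a)" for a y
      using that r module_mp[OF M] by auto
  qed simp
  moreover have "qhom G M ?M q" unfolding qhom_def using q(1) mp by simp
  moreover have "qinj M q" using q(2) by (simp add: qinj_def)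
  ultimately show ?thesis by blast
qed

lemma infinite_arrow_lists: "infinite (UNIV :: arrow list set)"
  by (rule infinite_UNIV_listI)

lemma presentationD:
  assumes "minimal_projective_presentation G P1 f P0 g X"
  shows "projective G P1" "projective G P0" "qhom G P1 P0 f" "qhom G P0 X g" "f \<in> hom G P1 P0"
    and "\<And>v y. y \<in> sp X v ==> \<exists>x\<in>sp P0 v. g v x = y" "\<And>v. f v ` sp P1 v = {x \<in> sp P0 v. g v x = 0}"
    and "\<And>U. submodule G U P0 ==> (\<And>v. g v ` sp U v = g v ` sp P0 v) ==> U = P0"
    and "\<And>U. submodule G U P1 ==> (\<And>v. f v ` sp U v = f v ` sp P1 v) ==> U = P1"
proof -
  note a = assms[unfolded minimal_projective_presentation_def essential_def surjective_def hom_iff]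
  show "projective G P1" "projective G P0" "qhom G P1 P0 f" "qhom G P0 X g" using a by blast+
  show "f \<in> hom G P1 P0" using assms by (simp add: minimal_projective_presentation_def)
  show "\<exists>x\<in>sp P0 v. g v x = y" if "y \<in> sp X v" for v y
  proof -
    have "y \<in> g v ` sp P0 v" using a that by blast
    then show ?thesis by auto
  qed
  show "f v ` sp P1 v = {x \<in> sp P0 v. g v x = 0}" for v using a by blast
  show "U = P0" if "submodule G U P0" "\<And>v. g v ` sp U v = g v ` sp P0 v" for U using a that by blast
  show "U = P1" if "submodule G U P1" "\<And>v. f v ` sp U v = f v ` sp P1 v" for U using a that by blast
qed

lemma is_transposeE:
  fixes G :: "('v, 'a) quiver" and T :: "('v, 'a, 'a list, 'k::field) rep"
  assumes "is_transpose G X T"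
  obtains P1 P0 :: "('v, 'a, 'a list, 'k) rep" and f g e where "is_module (opposite G) T" "minimal_projective_presentation G P1 f P0 g X"
    "\<And>i. linear_map (\<lambda>c h v x. vscale c (h v x)) vscale (hom G P1 (proj_module G i)) (sp T i) (e i)"
    "\<And>a h. h \<in> hom G P1 (proj_module G (tgt G a)) ==> e (src G a) (\<lambda>v x. prepend_arrow a (h v x)) = mp T a (e (tgt G a) h)"
    "\<And>i. e i ` hom G P1 (proj_module G i) = sp T i"
    "\<And>i. {h \<in> hom G P1 (proj_module G i). e i h = 0} = {hom_comp h f |h. h \<in> hom G P0 (proj_module G i)}"
  using assms unfolding is_transpose_def
  by (elim conjE exE) (rule that, assumption, assumption, erule spec, erule allE, drule(1) bspec, assumption, erule spec, erule spec)

text \<open>The image of \<open>h\<close> has the same image under \<open>g\<close> as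
  \<open>P0\<close>, so it is all of \<open>P0\<close> by essentiality; counting dimensions then
  gives injectivity.\<close>

lemma cover_endo_bij:
  fixes P0 :: "('b, 'k::field) qrep"
  assumes P: "is_module G P0" and h: "qhom G P0 P0 h" and gh: "\<And>v x. x \<in> sp P0 v ==> g v (h v x) = g v x"
    and ess: "\<And>U. submodule G U P0 ==> (\<And>v. g v ` sp U v = g v ` sp P0 v) ==> U = P0"
  shows "qinj P0 h" "\<And>v y. y \<in> sp P0 v ==> \<exists>x\<in>sp P0 v. h v x = y"
proof -
  have I: "submodule G (qimage G P0 P0 h) P0" by (rule qimage_submodule[OF P P h])
  have eq: "qimage G P0 P0 h = P0"
  proof (rule ess[OF I])
    fix v
    have "g v ` sp (qimage G P0 P0 h) v = (\<lambda>x. g v (h v x)) ` sp P0 v" by (auto simp: image_image)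
    also have "\<dots> = g v ` sp P0 v" by (rule image_cong) (simp_all add: gh)
    finally show "g v ` sp (qimage G P0 P0 h) v = g v ` sp P0 v" .
  qed
  show "\<exists>x\<in>sp P0 v. h v x = y" if "y \<in> sp P0 v" for v y
  proof -
    have "y \<in> sp (qimage G P0 P0 h) v" unfolding eq by (rule that)
    then have "y \<in> h v ` sp P0 v" by (simp only: sp_qimage)
    then show ?thesis by auto
  qed
  have "len (qkernel G P0 h) = 0" using rank_nullity_len[OF P h] eq by simp
  then have "is_zero (qkernel G P0 h)" using is_zero_len[OF submodule_module(1)[OF qkernel_submodule[OF P P h]]] by simp
  then show "qinj P0 h" by (auto simp: is_zero_def qinj_def)
qed

context transp begin

text \<open>Every minimal projective presentation of the dual is isomorphic to the explicit one.\<close>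

theorem cox_of_is_transpose:
  assumes "is_transpose Qop D N"
  shows "\<exists>gm. cox A N gm"
proof -
  obtain R1 R0 :: "(arrow list, 'k) qrep" and f g
      and e :: "vertex => (vertex => (arrow list => 'k) => (arrow list => 'k)) => (arrow list => 'k)"
    where N: "Qmod N" and pres: "minimal_projective_presentation Qop R1 f R0 g D"
    and lin: "\<And>i. linear_map (\<lambda>c h v x. vscale c (h v x)) vscale (hom Qop R1 (Pop i)) (sp N i) (e i)"
    and com: "\<And>a h. h \<in> hom Qop R1 (Pop (tgt Qop a)) ==> e (src Qop a) (\<lambda>v x. prepend_arrow a (h v x)) = mp N a (e (tgt Qop a) h)"
    and surj: "\<And>i. e i ` hom Qop R1 (Pop i) = sp N i"
    and ker: "\<And>i. {h \<in> hom Qop R1 (Pop i). e i h = 0} = {hom_comp h f |h. h \<in> hom Qop R0 (Pop i)}"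
    by (rule is_transposeE[OF assms, unfolded opposite_opposite]) (rule that, assumption+)
  note pr = presentationD[OF pres] and pr0 = presentationD[OF presentation]
  have m1: "is_module Qop R1" and m0: "is_module Qop R0" using pr(1,2) by (auto simp: projective_def)
  obtain D' :: "(arrow list, 'k) qrep" and j where D': "is_module Qop D'" "qhom Qop D D' j" "qinj D j"
    using module_copy[OF D_module infinite_arrow_lists] by blast
  let ?I = "qimage Qop D D' j"
  have I: "submodule Qop ?I D'" by (rule qimage_submodule[OF D_module D'(1,2)])
  have mI: "is_module Qop ?I" by (rule submodule_module(1)[OF I])
  have jI: "qhom Qop D ?I j" by (rule qhom_corestrict[OF I D'(2)]) simp
  have jeq: "x = y" if "x \<in> sp D v" "y \<in> sp D v" "j v x = j v y" for v x y by (rule qinj_eq[OF D'(3) D'(2) D_module, where x = x and v = v and y = y]) (fact that)+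
  have covI: "qhom Qop P0 ?I (\<lambda>v x. j v (cov v x))" by (rule qhom_comp[OF cov_qhom jI])
  have gI: "qhom Qop R0 ?I (\<lambda>v x. j v (g v x))" by (rule qhom_comp[OF pr(4) jI])
  have sc: "\<exists>x\<in>sp P0 v. j v (cov v x) = y" if "y \<in> sp ?I v" for v y using that cov_surj by force
  have sg: "\<exists>x\<in>sp R0 v. j v (g v x) = y" if "y \<in> sp ?I v" for v y using that pr(6) by force
  obtain u where u: "qhom Qop R0 P0 u" "\<And>v x. x \<in> sp R0 v ==> j v (cov v (u v x)) = j v (g v x)"
    using projectiveD[OF pr(2) P0_module mI covI sc gI] by blast
  obtain w where w: "qhom Qop P0 R0 w" "\<And>v x. x \<in> sp P0 v ==> j v (g v (w v x)) = j v (cov v x)"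
    using projectiveD[OF P0_projective m0 mI gI sg covI] by blast
  have cu: "cov v (u v x) = g v x" if "x \<in> sp R0 v" for v x
    by (rule jeq[OF qhom_sp[OF cov_qhom qhom_sp[OF u(1) that]] qhom_sp[OF pr(4) that] u(2)[OF that]])
  have gw: "g v (w v x) = cov v x" if "x \<in> sp P0 v" for v x
    by (rule jeq[OF qhom_sp[OF pr(4) qhom_sp[OF w(1) that]] qhom_sp[OF cov_qhom that] w(2)[OF that]])
  \<comment> \<open>The lifts \<open>u\<close> and \<open>w\<close> compose, in either order, to
    endomorphisms over the cover, which are bijective by essentiality.\<close>
  have "qinj R0 (\<lambda>v x. w v (u v x))"
    by (rule cover_endo_bij(1)[where g = g, OF m0 qhom_comp[OF u(1) w(1)] _ pr(8)]) (use gw[OF qhom_sp[OF u(1)]] cu in auto)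
  then have uinj: "qinj R0 u" using qhom_0[OF w(1) P0_module] by (auto simp: qinj_def)
  have usurj: "\<exists>x\<in>sp R0 v. u v x = y" if y: "y \<in> sp P0 v" for v y
  proof -
    have "\<exists>x\<in>sp P0 v. u v (w v x) = y"
      by (rule cover_endo_bij(2)[where g = "cut P0 cov", OF P0_module qhom_comp[OF w(1) u(1)] _ pr0(8) y]) (use cu[OF qhom_sp[OF w(1)]] gw qhom_sp[OF u(1) qhom_sp[OF w(1)]] in \<open>auto simp: cut_def\<close>)
    then show ?thesis using qhom_sp[OF w(1)] by blast
  qed
  obtain u' where u': "qhom Qop P0 R0 u'" "\<And>v x. x \<in> sp R0 v ==> u' v (u v x) = x" using qhom_inverse[OF m0 u(1) uinj usurj] by blast
  have uK: "u v (f v x) \<in> sp K v" if "x \<in> sp R1 v" for v x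
  proof -
    have "f v x \<in> {x \<in> sp R0 v. g v x = 0}" using pr(7)[of v] that by blast
    then show ?thesis using cu[of "f v x" v] qhom_sp[OF u(1), of "f v x" v] by (simp add: K_def)
  qed
  have phi: "qhom Qop R1 K (\<lambda>v x. u v (f v x))" by (rule qhom_corestrict[OF K_sub qhom_comp[OF pr(3) u(1)] uK])
  have phi_surj: "\<exists>x\<in>sp R1 v. u v (f v x) = y" if y: "y \<in> sp K v" for v y
  proof -
    have yP: "y \<in> sp P0 v" "cov v y = 0" using y by (auto simp: K_def)
    obtain x where x: "x \<in> sp R0 v" "u v x = y" using usurj[OF yP(1)] by blast
    have "x \<in> f v ` sp R1 v" using pr(7)[of v] x cu[OF x(1)] yP(2) by simp
    then show ?thesis using x(2) by auto
  qed
  have idK: "qhom Qop K K (\<lambda>v x. x)" by (rule qhom_inclusion[OF submodule_refl[OF K_module]])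
  obtain s where s: "qhom Qop K R1 s" "\<And>v x. x \<in> sp K v ==> u v (f v (s v x)) = x"
    using projectiveD[OF K_projective m1 K_module phi phi_surj idK] by blast
  \<comment> \<open>\<open>s\<close> splits the map from \<open>R1\<close> to \<open>K\<close>, so
    its image has the same image in \<open>R0\<close> as \<open>R1\<close> does. Essentiality of
    \<open>f\<close> makes \<open>s\<close> surjective, hence inverse to that map.\<close>
  have simg: "qimage Qop K R1 s = R1"
  proof (rule pr(9)[OF qimage_submodule[OF K_module m1 s(1)]])
    fix v show "f v ` sp (qimage Qop K R1 s) v = f v ` sp R1 v"
    proof (intro set_eqI iffI)
      fix y assume "y \<in> f v ` sp R1 v"
      then obtain x where x: "x \<in> sp R1 v" "y = f v x" by blast
      let ?z = "s v (u v (f v x))"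
      have z: "?z \<in> sp R1 v" "u v (f v ?z) = u v (f v x)" using qhom_sp[OF s(1) uK[OF x(1)]] s(2)[OF uK[OF x(1)]] by auto
      have "f v ?z = f v x" by (rule qinj_eq[where x = "f v ?z" and y = "f v x" and v = v, OF uinj u(1) m0 qhom_sp[OF pr(3) z(1)] qhom_sp[OF pr(3) x(1)] z(2)])
      moreover have "?z \<in> sp (qimage Qop K R1 s) v" using uK[OF x(1)] by simp
      ultimately show "y \<in> f v ` sp (qimage Qop K R1 s) v" using x(2) by (metis imageI)
    qed (use qhom_sp[OF s(1)] in auto)
  qed
  have sphi: "s v (u v (f v x)) = x" if "x \<in> sp R1 v" for v x
  proof -
    have "x \<in> s v ` sp K v" using that sp_qimage[of Qop K R1 s v] unfolding simg by simp
    then show ?thesis using s(2) by auto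
  qed
  define \<phi> where "\<phi> = cut R1 (\<lambda>v x. u v (f v x))"
  have \<phi>: "\<phi> \<in> hom Qop R1 K" unfolding \<phi>_def by (rule cut_hom[OF m1 phi])
  have \<sigma>: "cut K s \<in> hom Qop K R1" by (rule cut_hom[OF K_module s(1)])
  have s\<phi>: "hom_comp (hom_comp k (cut K s)) \<phi> = k" if k: "k \<in> hom Qop R1 (Pop i)" for k i
  proof (rule ext, rule ext)
    fix v x
    show "hom_comp (hom_comp k (cut K s)) \<phi> v x = k v x"
    proof (cases "x \<in> sp R1 v")
      case True
      then show ?thesis using uK sphi by (simp add: hom_comp_def \<phi>_def)
    next
      case False
      have "k v 0 = 0" using k qhom_0[OF _ m1] by (auto simp: hom_iff)
      then show ?thesis using False k qhom_0[OF s(1) K_module] by (simp add: hom_comp_def \<phi>_def cut_def hom_iff)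
    qed
  qed
  \<comment> \<open>The projection \<open>e\<close> transported along the isomorphism
    \<open>\<phi>\<close>; the value 0 elsewhere is the convention of
    \<open>linear_map\<close>.\<close>
  define e' where "e' i h = (if h \<in> HK i then e i (hom_comp h \<phi>) else 0)" for i h
  have h\<phi>: "hom_comp h \<phi> \<in> hom Qop R1 (Pop i)" if "h \<in> HK i" for h i by (rule hom_comp_hom[OF \<phi> that K_module])
  have "cox A N (\<lambda>w w'. e' V2 (eta w w'))"
  proof (rule cox_of_transpose[OF N])
    fix i
    show "linear_map (\<lambda>c h v x. vscale c (h v x)) vscale (HK i) (sp N i) (e' i)"
      unfolding linear_map_def
    proof (intro conjI ballI allI impI)
      fix h assume h: "h \<in> HK i"
      show "e' i h \<in> sp N i" using lin[of i] h\<phi>[OF h] h by (simp add: e'_def linear_map_def)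
      fix c
      have eq: "hom_comp (\<lambda>v x. vscale c (h v x)) \<phi> = (\<lambda>v x. vscale c (hom_comp h \<phi> v x))" by (simp add: hom_comp_def comp_def)
      show "e' i (\<lambda>v x. vscale c (h v x)) = vscale c (e' i h)"
        using lin[of i] h\<phi>[OF h] h hom_sum(2)[OF K_module Pop_module h h] unfolding e'_def eq linear_map_def by simp
      fix h' assume h': "h' \<in> HK i"
      have eq: "hom_comp (h + h') \<phi> = hom_comp h \<phi> + hom_comp h' \<phi>" by (simp add: hom_comp_def fun_eq_iff)
      show "e' i (h + h') = e' i h + e' i h'"
        using lin[of i] h\<phi>[OF h] h\<phi>[OF h'] h h' hom_sum(1)[OF K_module Pop_module h h'] unfolding e'_def eq linear_map_def by simp
    qed (simp add: e'_def)
    show "e' i ` HK i = sp N i"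
    proof (intro set_eqI iffI)
      fix n assume "n \<in> sp N i"
      then obtain k where k: "k \<in> hom Qop R1 (Pop i)" "n = e i k" using surj[of i] by blast
      have "hom_comp k (cut K s) \<in> HK i" by (rule hom_comp_hom[OF \<sigma> k(1) m1])
      then show "n \<in> e' i ` HK i" using s\<phi>[OF k(1)] k(2) by (intro image_eqI[of _ _ "hom_comp k (cut K s)"]) (simp_all add: e'_def)
    qed (use lin[of i] h\<phi> in \<open>auto simp: e'_def linear_map_def\<close>)
    show "{h \<in> HK i. e' i h = 0} = {hom_comp h (cut K (\<lambda>v x. x)) |h. h \<in> HP i}"
    proof (intro set_eqI iffI)
      fix h assume "h \<in> {h \<in> HK i. e' i h = 0}"
      then have h: "h \<in> HK i" "e i (hom_comp h \<phi>) = 0" by (auto simp: e'_def)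
      then obtain k where k: "k \<in> hom Qop R0 (Pop i)" "hom_comp h \<phi> = hom_comp k f" using ker[of i] h\<phi>[OF h(1)] by blast
      let ?h = "hom_comp k (cut P0 u')"
      have "?h \<in> HP i" by (rule hom_comp_hom[OF cut_hom[OF P0_module u'(1)] k(1) m0])
      moreover have "h = hom_comp ?h (cut K (\<lambda>v x. x))"
      proof (rule ext, rule ext)
        fix v y show "h v y = hom_comp ?h (cut K (\<lambda>v x. x)) v y"
        proof (cases "y \<in> sp K v")
          case True
          then obtain x where x: "x \<in> sp R1 v" "u v (f v x) = y" using phi_surj by blast
          have "h v y = hom_comp h \<phi> v x" using x by (simp add: hom_comp_def \<phi>_def)
          also have "\<dots> = k v (f v x)" unfolding k(2) by (simp add: hom_comp_def)
          also have "\<dots> = hom_comp ?h (cut K (\<lambda>v x. x)) v y"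
            using True submodule_sp[OF K_sub True] u'(2)[OF qhom_sp[OF pr(3) x(1)]] x(2) by (simp add: hom_comp_def)
          finally show ?thesis .
        next
          case False
          have "k v 0 = 0" using k(1) qhom_0[OF _ m0] by (auto simp: hom_iff)
          then show ?thesis using False h(1) qhom_0[OF u'(1) P0_module] by (simp add: hom_comp_def cut_def hom_iff)
        qed
      qed
      ultimately show "h \<in> {hom_comp h (cut K (\<lambda>v x. x)) |h. h \<in> HP i}" by blast
    next
      fix h assume "h \<in> {hom_comp h (cut K (\<lambda>v x. x)) |h. h \<in> HP i}"
      then obtain h' where h': "h' \<in> HP i" "h = hom_comp h' (cut K (\<lambda>v x. x))" by blast
      have inK: "cut K (\<lambda>v x. x) \<in> hom Qop K P0" by (rule cut_hom[OF K_module qhom_inclusion[OF K_sub]])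
      have h: "h \<in> HK i" unfolding h'(2) by (rule hom_comp_hom[OF inK h'(1) P0_module])
      have "hom_comp h' (cut R0 u) \<in> hom Qop R0 (Pop i)" by (rule hom_comp_hom[OF cut_hom[OF m0 u(1)] h'(1) P0_module])
      moreover have "hom_comp h \<phi> = hom_comp (hom_comp h' (cut R0 u)) f"
      proof (rule ext, rule ext)
        fix v x show "hom_comp h \<phi> v x = hom_comp (hom_comp h' (cut R0 u)) f v x"
        proof (cases "x \<in> sp R1 v")
          case True
          then show ?thesis using uK qhom_sp[OF pr(3)] by (simp add: hom_comp_def \<phi>_def h'(2))
        next
          case False
          have "f v x = 0" using pr(5) False by (simp add: hom_iff)
          then show ?thesis using False qhom_0[OF u(1) m0] module_0[OF m0] module_0[OF K_module]
            by (simp add: hom_comp_def \<phi>_def h'(2) cut_def)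
        qed
      qed
      ultimately have "hom_comp h \<phi> \<in> {h \<in> hom Qop R1 (Pop i). e i h = 0}" using ker[of i] by blast
      then show "h \<in> {h \<in> HK i. e' i h = 0}" using h by (simp add: e'_def)
    qed
  next
    fix a h assume h: "h \<in> HK (tgt Qop a)"
    have "(\<lambda>v x. prepend_arrow a (h v x)) \<in> HK (src Qop a)" by (rule prepend_hom[OF h])
    moreover have "hom_comp (\<lambda>v x. prepend_arrow a (h v x)) \<phi> = (\<lambda>v x. prepend_arrow a (hom_comp h \<phi> v x))" by (simp add: hom_comp_def comp_def)
    ultimately show "e' (src Qop a) (\<lambda>v x. prepend_arrow a (h v x)) = mp N a (e' (tgt Qop a) h)"
      using com[OF h\<phi>[OF h]] h by (simp add: e'_def)
  qed
  then show ?thesis by blast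
qed

text \<open>The cokernel has to live over \<open>arrow list\<close>. A homomorphism from
  \<open>K\<close> is determined by its values on a basis of \<open>K\<^sub>1\<close>, which encodes
  it in a finite-dimensional function space; \<open>quotient_map\<close> divides this by the
  restrictions of homomorphisms from \<open>P0\<close>.\<close>

theorem transpose_exists: "\<exists>N. is_transpose Qop D N"
proof -
  let ?f = "cut K (\<lambda>v x. x)"
  have f: "?f \<in> hom Qop K P0" by (rule cut_hom[OF K_module qhom_inclusion[OF K_sub]])
  obtain B where B: "finite B" "vindep B" "vspan B = sp K V1" using fd_basis[OF module_fd[OF K_module]] by blast
  have BK: "B \<subseteq> sp K V1" using B(3) fun_vs.span_superset by blast
  define \<Phi> :: "(vertex => (arrow list => 'k) => (arrow list => 'k)) => ((arrow list => 'k) \<times> arrow list => 'k)"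
    where "\<Phi> h = (\<lambda>(y, p). if y \<in> B then h V1 y p else 0)" for h
  define S where "S i = {z :: (arrow list => 'k) \<times> arrow list => 'k. \<forall>q. z q ~= 0 --> q \<in> B \<times> {p. is_path Qop i p V1}}" for i
  have Sfd: "findim (S i)" for i
    unfolding S_def by (rule fd_finite_support) (use B(1) finite_path_Qop in blast)
  have \<Phi>_lin: "\<Phi> (h + h') = \<Phi> h + \<Phi> h'" "\<Phi> (\<lambda>v x. vscale c (h v x)) = vscale c (\<Phi> h)" for h h' c
    by (auto simp: \<Phi>_def fun_eq_iff vscale_def)
  have \<Phi>S: "\<Phi> h \<in> S i" if h: "h \<in> HK i" for h i
  proof -
    have "is_path Qop i p V1" if "y \<in> B" "h V1 y p ~= 0" for y p
      using qhom_sp[of Qop K "Pop i" h y V1] h that BK by (auto simp: hom_iff proj_sp)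
    then show ?thesis by (auto simp: S_def \<Phi>_def split: if_splits)
  qed
  have \<Phi>_inj: "h = h'" if h: "h \<in> HK i" "h' \<in> HK i" "\<Phi> h = \<Phi> h'" for h h' i
  proof (rule HK_eqI[OF h(1,2)])
    fix y assume y: "y \<in> sp K V1"
    have eqB: "h V1 b = h' V1 b" if "b \<in> B" for b
      using fun_cong[OF h(3), of "(b, _)"] that by (auto simp: \<Phi>_def fun_eq_iff)
    have l: "lin (sp K V1) (h V1)" "lin (sp K V1) (h' V1)" using h(1,2) qhom_lin by (auto simp: hom_iff)
    show "h V1 y = h' V1 y"
      using lin_eq_on_span[OF l module_subspace[OF K_module] BK eqB, of y] y B(3) by simp
  qed
  define R where "R i = {hom_comp h ?f |h. h \<in> HP i}" for i
  have RH: "R i \<subseteq> HK i" for i unfolding R_def using hom_comp_hom[OF f _ P0_module] by blast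
  have RU: "subsp (\<Phi> ` R i)" for i
    unfolding subsp_def
  proof (intro conjI ballI allI)
    have z: "(\<lambda>v x. 0) \<in> HP i" unfolding hom_iff qhom_def lin_def by (simp add: module_0[OF Pop_module] module_mp_0[OF Pop_module])
    have "hom_comp (\<lambda>v x. 0) ?f \<in> R i" unfolding R_def using z by blast
    moreover have "\<Phi> (hom_comp (\<lambda>v x. 0) ?f) = 0" by (auto simp: \<Phi>_def hom_comp_def fun_eq_iff)
    ultimately show "0 \<in> \<Phi> ` R i" by (metis imageI)
    fix z z' assume "z \<in> \<Phi> ` R i" "z' \<in> \<Phi> ` R i"
    then obtain h h' where h: "h \<in> HP i" "h' \<in> HP i" "z = \<Phi> (hom_comp h ?f)" "z' = \<Phi> (hom_comp h' ?f)" by (auto simp: R_def)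
    have "hom_comp (h + h') ?f = hom_comp h ?f + hom_comp h' ?f" by (simp add: hom_comp_def fun_eq_iff)
    moreover have "hom_comp (h + h') ?f \<in> R i" unfolding R_def using hom_sum(1)[OF P0_module Pop_module h(1,2)] by blast
    ultimately show "z + z' \<in> \<Phi> ` R i" using h(3,4) \<Phi>_lin(1)[of "hom_comp h ?f" "hom_comp h' ?f"] by (metis imageI)
  next
    fix c z assume "z \<in> \<Phi> ` R i"
    then obtain h where h: "h \<in> HP i" "z = \<Phi> (hom_comp h ?f)" by (auto simp: R_def)
    have "hom_comp (\<lambda>v x. vscale c (h v x)) ?f = (\<lambda>v x. vscale c (hom_comp h ?f v x))" by (simp add: hom_comp_def comp_def)
    moreover have "hom_comp (\<lambda>v x. vscale c (h v x)) ?f \<in> R i" unfolding R_def using hom_sum(2)[OF P0_module Pop_module h(1) h(1)] by blast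
    moreover have "vscale c z = \<Phi> (\<lambda>v x. vscale c (hom_comp h ?f v x))" unfolding h(2) \<Phi>_lin(2) ..
    ultimately show "vscale c z \<in> \<Phi> ` R i" by (simp only: imageI)
  qed
  have "\<exists>q :: ((arrow list => 'k) \<times> arrow list => 'k) => (arrow list => 'k). lin (S i) q & (\<forall>x\<in>S i. q x = 0 \<longleftrightarrow> x \<in> \<Phi> ` R i)" for i
    by (rule quotient_map[OF Sfd RU _ infinite_arrow_lists]) (use RH \<Phi>S in blast)
  then have "\<forall>i. \<exists>q :: ((arrow list => 'k) \<times> arrow list => 'k) => (arrow list => 'k). lin (S i) q & (\<forall>x\<in>S i. q x = 0 \<longleftrightarrow> x \<in> \<Phi> ` R i)" by blast
  then obtain q :: "vertex => ((arrow list => 'k) \<times> arrow list => 'k) => (arrow list => 'k)"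
    where q: "\<And>i. lin (S i) (q i)" "\<And>i x. x \<in> S i ==> q i x = 0 \<longleftrightarrow> x \<in> \<Phi> ` R i" unfolding choice_iff by blast
  define e where "e i h = (if h \<in> HK i then q i (\<Phi> h) else 0)" for i h
  have e_add: "e i (h + h') = e i h + e i h'" if "h \<in> HK i" "h' \<in> HK i" for i h h'
    using that hom_sum(1)[OF K_module Pop_module that] lin_add[OF q(1) \<Phi>S \<Phi>S] by (simp add: e_def \<Phi>_lin)
  have e_scale: "e i (\<lambda>v x. vscale c (h v x)) = vscale c (e i h)" if "h \<in> HK i" for i h c
    using that hom_sum(2)[OF K_module Pop_module that that] lin_scale[OF q(1) \<Phi>S] by (simp add: e_def \<Phi>_lin)
  have e_ker: "e i h = 0 \<longleftrightarrow> h \<in> R i" if h: "h \<in> HK i" for i h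
  proof -
    have "e i h = 0 \<longleftrightarrow> \<Phi> h \<in> \<Phi> ` R i" using h q(2)[OF \<Phi>S[OF h]] by (simp add: e_def)
    also have "\<dots> \<longleftrightarrow> h \<in> R i" using \<Phi>_inj[OF h] RH[of i] by auto
    finally show ?thesis .
  qed
  \<comment> \<open>Makes the structure maps of \<open>T\<close> independent of representatives: if
    a difference extends to \<open>P0\<close>, so does the difference after prepending an
    arrow.\<close>
  have e_prepend: "e (src Qop a) (\<lambda>v x. prepend_arrow a (h v x)) = e (src Qop a) (\<lambda>v x. prepend_arrow a (h' v x))"
    if h: "h \<in> HK (tgt Qop a)" "h' \<in> HK (tgt Qop a)" "e (tgt Qop a) h = e (tgt Qop a) h'" for a h h'
  proof -
    let ?d = "\<lambda>v x. h v x - h' v x"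
    have d: "?d \<in> HK (tgt Qop a)" by (rule hom_sum(3)[OF K_module Pop_module h(1,2)])
    have hd: "h' + ?d = h" by (auto simp: fun_eq_iff)
    have "e (tgt Qop a) ?d = 0" using e_add[OF h(2) d] h(3) unfolding hd by simp
    then obtain k where k: "k \<in> HP (tgt Qop a)" "?d = hom_comp k ?f" using e_ker[OF d] by (auto simp: R_def)
    have pd: "(\<lambda>v x. prepend_arrow a (?d v x)) \<in> HK (src Qop a)" and ph: "(\<lambda>v x. prepend_arrow a (h' v x)) \<in> HK (src Qop a)"
      by (rule prepend_hom[OF d] prepend_hom[OF h(2)])+
    have "(\<lambda>v x. prepend_arrow a (?d v x)) = hom_comp (\<lambda>v x. prepend_arrow a (k v x)) ?f"
      unfolding fun_cong[OF fun_cong[OF k(2)]] by (simp add: hom_comp_def comp_def)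
    then have "(\<lambda>v x. prepend_arrow a (?d v x)) \<in> R (src Qop a)" unfolding R_def using prepend_hom[OF k(1)] by blast
    then have z: "e (src Qop a) (\<lambda>v x. prepend_arrow a (?d v x)) = 0" using e_ker[OF pd] by blast
    have "(\<lambda>v x. prepend_arrow a (h' v x)) + (\<lambda>v x. prepend_arrow a (?d v x)) = (\<lambda>v x. prepend_arrow a (h v x))"
      by (auto simp: fun_eq_iff prepend_arrow_def)
    then show ?thesis using e_add[OF ph pd] z by simp
  qed
  define T :: "(arrow list, 'k) qrep" where
    "T = \<lparr>sp = (\<lambda>i. e i ` HK i), mp = (\<lambda>a y. if y \<in> e (tgt Qop a) ` HK (tgt Qop a)
      then e (src Qop a) (\<lambda>v x. prepend_arrow a ((SOME h. h \<in> HK (tgt Qop a) & e (tgt Qop a) h = y) v x)) else 0)\<rparr>"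
  have T_sp: "sp T i = e i ` HK i" for i by (simp add: T_def)
  have T_mp: "mp T a (e (tgt Qop a) h) = e (src Qop a) (\<lambda>v x. prepend_arrow a (h v x))" if h: "h \<in> HK (tgt Qop a)" for a h
  proof -
    let ?h = "SOME h'. h' \<in> HK (tgt Qop a) & e (tgt Qop a) h' = e (tgt Qop a) h"
    have "?h \<in> HK (tgt Qop a) & e (tgt Qop a) ?h = e (tgt Qop a) h" by (rule someI[of _ h]) (use h in simp)
    then have "e (src Qop a) (\<lambda>v x. prepend_arrow a (?h v x)) = e (src Qop a) (\<lambda>v x. prepend_arrow a (h v x))"
      using e_prepend[of ?h a h] h by blast
    then show ?thesis using h unfolding T_def by simp
  qed
  have HKsub: "subsp (\<Phi> ` HK i)" for i
    unfolding subsp_def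
  proof (intro conjI ballI allI)
    have z: "(\<lambda>v x. 0) \<in> HK i" unfolding hom_iff qhom_def lin_def by (simp add: module_0[OF Pop_module] module_mp_0[OF Pop_module])
    moreover have "\<Phi> (\<lambda>v x. 0) = 0" by (auto simp: \<Phi>_def fun_eq_iff)
    ultimately show "0 \<in> \<Phi> ` HK i" by (metis imageI)
    fix z z' assume "z \<in> \<Phi> ` HK i" "z' \<in> \<Phi> ` HK i"
    then obtain h h' where h: "h \<in> HK i" "h' \<in> HK i" "z = \<Phi> h" "z' = \<Phi> h'" by (elim imageE)
    show "z + z' \<in> \<Phi> ` HK i" unfolding h(3,4) \<Phi>_lin(1)[symmetric] by (rule imageI[OF hom_sum(1)[OF K_module Pop_module h(1,2)]])
  next
    fix c z assume "z \<in> \<Phi> ` HK i"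
    then obtain h where h: "h \<in> HK i" "z = \<Phi> h" by (elim imageE)
    show "vscale c z \<in> \<Phi> ` HK i" unfolding h(2) \<Phi>_lin(2)[symmetric] by (rule imageI[OF hom_sum(2)[OF K_module Pop_module h(1) h(1)]])
  qed
  have "Qmod T"
  proof (rule is_moduleI)
    fix i
    have "\<Phi> ` HK i \<subseteq> S i" using \<Phi>S by blast
    then have "findim (q i ` (\<Phi> ` HK i))"
      using lin_image_fd[OF fd_subset[OF Sfd HKsub] lin_subset[OF q(1)]] by blast
    moreover have "q i ` (\<Phi> ` HK i) = sp T i" unfolding T_sp e_def by (auto simp: image_image)
    ultimately show "findim (sp T i)" by simp
  next
    fix a
    have st: "src quiver_Q a = tgt Qop a" "tgt quiver_Q a = src Qop a" by simp_all
    show "lin (sp T (src quiver_Q a)) (mp T a)"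
      unfolding lin_def st T_sp
    proof (intro conjI ballI allI)
      fix y z assume "y \<in> e (tgt Qop a) ` HK (tgt Qop a)" "z \<in> e (tgt Qop a) ` HK (tgt Qop a)"
      then obtain h h' where h: "h \<in> HK (tgt Qop a)" "h' \<in> HK (tgt Qop a)" "y = e (tgt Qop a) h" "z = e (tgt Qop a) h'" by blast
      have "mp T a (y + z) = mp T a (e (tgt Qop a) (h + h'))" using e_add[OF h(1,2)] h(3,4) by simp
      also have "\<dots> = e (src Qop a) (\<lambda>v x. prepend_arrow a ((h + h') v x))" by (rule T_mp[OF hom_sum(1)[OF K_module Pop_module h(1,2)]])
      also have "(\<lambda>v x. prepend_arrow a ((h + h') v x)) = (\<lambda>v x. prepend_arrow a (h v x)) + (\<lambda>v x. prepend_arrow a (h' v x))"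
        by (auto simp: fun_eq_iff prepend_arrow_def)
      also have "e (src Qop a) \<dots> = mp T a y + mp T a z"
        using e_add[OF prepend_hom[OF h(1)] prepend_hom[OF h(2)]] T_mp[OF h(1)] T_mp[OF h(2)] h(3,4) by simp
      finally show "mp T a (y + z) = mp T a y + mp T a z" .
    next
      fix c y assume "y \<in> e (tgt Qop a) ` HK (tgt Qop a)"
      then obtain h where h: "h \<in> HK (tgt Qop a)" "y = e (tgt Qop a) h" by blast
      have "mp T a (vscale c y) = mp T a (e (tgt Qop a) (\<lambda>v x. vscale c (h v x)))" using e_scale[OF h(1)] h(2) by simp
      also have "\<dots> = e (src Qop a) (\<lambda>v x. prepend_arrow a (vscale c (h v x)))" by (rule T_mp[OF hom_sum(2)[OF K_module Pop_module h(1) h(1)]])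
      also have "\<dots> = vscale c (mp T a y)" using e_scale[OF prepend_hom[OF h(1)]] T_mp[OF h(1)] h(2) by (simp add: prepend_arrow_add)
      finally show "mp T a (vscale c y) = vscale c (mp T a y)" .
    qed
    show "mp T a y \<in> sp T (tgt quiver_Q a)" if y: "y \<in> sp T (src quiver_Q a)" for y
    proof -
      obtain h where h: "y = e (tgt Qop a) h" "h \<in> HK (tgt Qop a)" using y[unfolded st T_sp] by (rule imageE)
      show ?thesis unfolding h(1) T_mp[OF h(2)] st T_sp by (rule imageI[OF prepend_hom[OF h(2)]])
    qed
    show "mp T a y = 0" if "y \<notin> sp T (src quiver_Q a)" for y
      using that unfolding st T_sp by (simp add: T_def)
  qed
  have "is_transpose Qop D T"
    unfolding is_transpose_def opposite_opposite
  proof (rule conjI[OF D_module], rule conjI[OF \<open>Qmod T\<close>], rule exI[of _ K], rule exI[of _ P0], rule exI[of _ ?f],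
      rule exI[of _ "cut P0 cov"], rule conjI[OF presentation], rule exI[of _ e], intro conjI)
    show "\<forall>i. linear_map (\<lambda>c h v x. vscale c (h v x)) vscale (HK i) (sp T i) (e i)"
      unfolding linear_map_def T_sp using e_add e_scale by (auto simp: e_def)
    show "\<forall>a. \<forall>h\<in>HK (tgt Qop a). e (src Qop a) (\<lambda>v x. prepend_arrow a (h v x)) = mp T a (e (tgt Qop a) h)"
      using T_mp by simp
    show "\<forall>i. {h \<in> HK i. e i h = 0} = {hom_comp h ?f |h. h \<in> HP i}"
    proof
      fix i show "{h \<in> HK i. e i h = 0} = {hom_comp h ?f |h. h \<in> HP i}"
        using e_ker[of _ i] RH[of i] unfolding R_def[symmetric] by blast
    qed
  qed (simp add: T_sp)
  then show ?thesis by blast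
qed

end

text \<open>A transpose exists, so the choice made by \<open>tau_inv\<close> is one; and every
  transpose is a transform.\<close>

theorem cox_tau_inv:
  fixes A :: "(arrow list, 'k::field) qrep"
  assumes "Qmod A" "kgood A"
  shows "\<exists>gm. cox A (tau_inv quiver_Q A) gm"
proof -
  obtain bf :: "(arrow list => 'k) => (arrow list => 'k) => 'k" where bf:
    "\<forall>x\<in>sp A V3. \<forall>y\<in>sp A V3. \<forall>z\<in>sp A V3. bf (x + y) z = bf x z + bf y z"
    "\<forall>c. \<forall>x\<in>sp A V3. \<forall>z\<in>sp A V3. bf (vscale c x) z = c * bf x z"
    "\<forall>x\<in>sp A V3. \<forall>y\<in>sp A V3. bf x y = bf y x"
    "\<forall>\<phi>. (\<forall>x\<in>sp A V3. \<forall>y\<in>sp A V3. \<phi> (x + y) = \<phi> x + \<phi> y) & (\<forall>c. \<forall>x\<in>sp A V3. \<phi> (vscale c x) = c * \<phi> x) -->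
       (\<exists>w\<in>sp A V3. \<forall>x\<in>sp A V3. \<phi> x = bf w x)"
    using form_exists[OF module_fd[OF assms(1), of V3]] by blast
  interpret transp A bf by unfold_locales (use assms bf in simp_all)
  have "is_transpose Qop D (tau_inv quiver_Q A)"
    unfolding tau_inv_def by (rule someI_ex[OF transpose_exists])
  then show ?thesis by (rule cox_of_is_transpose)
qed

section \<open>Projectives of the quiver\<close>

lemma support_span:
  fixes x :: "'y => 'k::field"
  assumes "finite D" "\<And>p. x p ~= 0 ==> p \<in> D"
  shows "x \<in> vspan ((\<lambda>p. dl p 1) ` D)"
proof -
  have "x = (\<Sum>p\<in>D. vscale (x p) (dl p 1))"
  proof
    fix q show "x q = (\<Sum>p\<in>D. vscale (x p) (dl p 1)) q"
      unfolding sum_apply using assms by (cases "q \<in> D") (auto simp: vscale_def dl_def if_distrib cong: if_cong)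
  qed
  also have "\<dots> \<in> vspan ((\<lambda>p. dl p 1) ` D)"
    by (intro fun_vs.span_sum fun_vs.span_scale fun_vs.span_base) auto
  finally show ?thesis .
qed

lemma dl_add_support:
  assumes "a ~= b"
  shows "(\<forall>p. x p ~= 0 --> p = a \<or> p = b) \<longleftrightarrow> (\<exists>s t. x = dl a s + dl b (t :: 'k::field))"
proof
  assume "\<forall>p. x p ~= 0 --> p = a \<or> p = b"
  then have "x = dl a (x a) + dl b (x b)" using assms by (auto simp: fun_eq_iff dl_def)
  then show "\<exists>s t. x = dl a s + dl b t" by blast
qed (auto simp: dl_def split: if_splits)

lemma dl_support: "(\<forall>p. x p ~= 0 --> p = a) \<longleftrightarrow> (\<exists>s. x = dl a (s :: 'k::field))"
proof
  assume "\<forall>p. x p ~= 0 --> p = a"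
  then have "x = dl a (x a)" by (auto simp: fun_eq_iff dl_def)
  then show "\<exists>s. x = dl a s" by blast
qed (auto simp: dl_def split: if_splits)

lemma dl_eq_0 [simp]: "dl p s = 0 \<longleftrightarrow> s = (0 :: 'k::field)"
  by (auto simp: dl_def fun_eq_iff)

lemma dim_finite_support:
  assumes "finite D"
  shows "vdim {x :: 'y => 'k::field. \<forall>p. x p ~= 0 --> p \<in> D} = card D"
  using assms
proof (induction D)
  case empty
  have "{x :: 'y => 'k. \<forall>p. x p ~= 0 --> p \<in> {}} = {0}" by (auto simp: fun_eq_iff)
  then show ?case using fd_dim_0[OF fd_zero] by simp
next
  case (insert a D)
  let ?S = "\<lambda>D. {x :: 'y => 'k. \<forall>p. x p ~= 0 --> p \<in> D}" and ?f = "\<lambda>x. dl a (x a :: 'k)"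
  have fd: "findim (?S (insert a D))" by (rule fd_finite_support) (simp add: insert)
  have l: "lin (?S (insert a D)) ?f" unfolding lin_def by (simp add: dl_linear vscale_def[of _ "x :: 'y => 'k" for x])
  have ker: "{x \<in> ?S (insert a D). ?f x = 0} = ?S D" using insert(2) by auto
  have "?f ` ?S (insert a D) = vspan {dl a 1}"
  proof (intro set_eqI iffI)
    fix y assume "y \<in> ?f ` ?S (insert a D)"
    then obtain x :: "'y => 'k" where y: "y = dl a (x a)" by blast
    have "y = vscale (x a) (dl a 1)" unfolding y dl_linear(2)[symmetric] by simp
    then show "y \<in> vspan {dl a 1}" by (simp add: fun_vs.span_singleton)
  next
    fix y assume "y \<in> vspan {dl a (1::'k)}"
    then obtain c where "y = vscale c (dl a 1)" by (auto simp: fun_vs.span_singleton)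
    then have "y = dl a c" by (simp add: dl_linear(2)[symmetric])
    then show "y \<in> ?f ` ?S (insert a D)" by (intro image_eqI[of _ _ "dl a c"]) (auto simp: dl_def split: if_splits)
  qed
  then have "vdim (?f ` ?S (insert a D)) = 1"
    using fun_vs.dim_span_eq_card_independent[of "{dl a (1::'k)}"] fun_vs.dependent_single[of "dl a (1::'k)"] by simp
  then show ?case using rank_nullity[OF fd l] insert unfolding ker by simp
qed

lemma fold_mp_sp:
  assumes "is_module G X" "is_path G i p v" "y \<in> sp X i"
  shows "fold (mp X) p y \<in> sp X v"
  using assms(2,3)
proof (induction p arbitrary: i y)
  case (Cons a p)
  then show ?case using module_mp[OF assms(1), of y a] by auto
qed simp

lemma proj_hom_dl:
  fixes X :: "('v, 'a, 'b, 'k::field) rep"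
  assumes F: "qhom G (proj_module G i) X F" and p: "is_path G i p v"
  shows "F v (dl p s) = fold (mp X) p (F i (dl [] s))"
  using p
proof (induction p arbitrary: v rule: rev_induct)
  case (snoc a p)
  then have p: "is_path G i p (src G a)" "v = tgt G a" by (auto simp: is_path_append)
  have "F v (dl (p @ [a]) s) = F (tgt G a) (mp (proj_module G i) a (dl p s))"
    by (simp add: proj_mp[OF dl_proj[OF p(1)]] dl_append p(2))
  also have "\<dots> = mp X a (F (src G a) (dl p s))" by (rule qhom_mp[OF F dl_proj[OF p(1)]])
  finally show ?case using snoc.IH[OF p(1)] by simp
qed simp

lemma proj_span:
  assumes "finite {p. is_path G i p v}"
  shows "sp (proj_module G i :: ('v, 'a, 'a list, 'k::field) rep) v \<subseteq> vspan ((\<lambda>p. dl p 1) ` {p. is_path G i p v})"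
  using support_span[OF assms] by (auto simp: proj_sp)

lemma proj_hom_eq:
  fixes X :: "('v, 'a, 'b, 'k::field) rep"
  assumes fin: "\<And>v. finite {p. is_path G i p v}"
    and F: "qhom G (proj_module G i) X F" and F': "qhom G (proj_module G i) X F'"
    and eq: "F i (dl [] 1) = F' i (dl [] 1)" and x: "x \<in> sp (proj_module G i) v"
  shows "F v x = F' v x"
proof -
  have P: "is_module G (proj_module G i :: ('v, 'a, 'a list, 'k) rep)" by (rule proj_module[OF fin])
  let ?B = "(\<lambda>p. dl p (1::'k)) ` {p. is_path G i p v}"
  have B: "?B \<subseteq> sp (proj_module G i) v" by (rule image_subsetI) (simp add: dl_proj)
  have agree: "F v y = F' v y" if y: "y \<in> ?B" for y
  proof -
    obtain p where p: "is_path G i p v" "y = dl p 1" using y by blast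
    show ?thesis unfolding p(2) proj_hom_dl[OF F p(1)] proj_hom_dl[OF F' p(1)] eq ..
  qed
  have xB: "x \<in> vspan ?B" using proj_span[OF fin] x by (rule subsetD)
  have "x \<in> sp (proj_module G i) v & F v x = F' v x"
    by (rule lin_eq_on_span[OF qhom_lin[OF F] qhom_lin[OF F'] module_subspace[OF P] B agree xB])
  then show ?thesis ..
qed

text \<open>Paths act on \<open>y\<close> by \<open>fold (mp X)\<close>; the homomorphism extends
  this action linearly from the path basis.\<close>

lemma proj_hom_exists:
  fixes X :: "('v, 'a, 'b, 'k::field) rep"
  assumes fin: "\<And>v. finite {p. is_path G i p v}" and X: "is_module G X" and y: "y \<in> sp X i"
  shows "\<exists>F. qhom G (proj_module G i) X F & (\<forall>s. F i (dl [] s) = vscale s y)"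
proof -
  define F where "F v x = (\<Sum>p | is_path G i p v. vscale (x p) (fold (mp X) p y))" for v and x :: "'a list => 'k"
  have act: "fold (mp X) p y \<in> sp X v" if "is_path G i p v" for p v by (rule fold_mp_sp[OF X that y])
  have "qhom G (proj_module G i) X F"
    unfolding qhom_def
  proof (intro conjI allI ballI)
    show "lin (sp (proj_module G i) v) (F v)" for v
      unfolding lin_def F_def
      by (simp add: fun_vs.scale_left_distrib sum.distrib vscale_def[of _ "x :: 'a list => 'k" for x] fun_vs.scale_sum_right)
    show "F v x \<in> sp X v" for v x
      unfolding F_def by (intro subsp_sum[OF module_subspace[OF X]] module_scale[OF X]) (use act in simp)
    fix a and x :: "'a list => 'k" assume x: "x \<in> sp (proj_module G i) (src G a)"
    let ?g = "\<lambda>p. vscale (append_arrow a x p) (fold (mp X) p y)" and ?D = "{p. is_path G i p (src G a)}"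
    have "mp X a (F (src G a) x) = (\<Sum>p\<in>?D. mp X a (vscale (x p) (fold (mp X) p y)))"
      unfolding F_def by (rule lin_sum[OF module_lin[OF X] module_subspace[OF X]])
        (use act module_scale[OF X] in simp)
    also have "\<dots> = (\<Sum>p\<in>?D. ?g (p @ [a]))"
    proof (rule sum.cong[OF refl])
      fix p assume "p \<in> ?D"
      then have "fold (mp X) p y \<in> sp X (src G a)" using act by simp
      then show "mp X a (vscale (x p) (fold (mp X) p y)) = ?g (p @ [a])" using lin_scale[OF module_lin[OF X]] by (simp add: append_arrow_def)
    qed
    also have "\<dots> = sum ?g ((\<lambda>p. p @ [a]) ` ?D)" by (subst sum.reindex) (auto simp: inj_on_def)
    \<comment> \<open>A path that does not arise by appending \<open>a\<close> contributes nothing,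
      as \<open>append_arrow\<close> vanishes there.\<close>
    also have "\<dots> = sum ?g {p. is_path G i p (tgt G a)}"
    proof (rule sum.mono_neutral_left[OF fin])
      show "\<forall>p\<in>{p. is_path G i p (tgt G a)} - (\<lambda>p. p @ [a]) ` ?D. ?g p = 0"
      proof
        fix p assume p: "p \<in> {p. is_path G i p (tgt G a)} - (\<lambda>p. p @ [a]) ` ?D"
        have "append_arrow a x p = 0"
        proof (rule ccontr)
          assume n: "append_arrow a x p ~= 0"
          then have "p = butlast p @ [a]" "x (butlast p) ~= 0" by (auto simp: append_arrow_def split: if_splits)
          then show False using x p unfolding proj_sp by blast
        qed
        then show "?g p = 0" by simp
      qed
    qed (auto simp: is_path_append)
    finally show "F (tgt G a) (mp (proj_module G i) a x) = mp X a (F (src G a) x)" unfolding proj_mp[OF x] F_def ..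
  qed
  moreover have "F i (dl [] s) = vscale s y" for s
  proof -
    have "F i (dl [] s) = (\<Sum>p\<in>{[]}. vscale (dl [] s p) (fold (mp X) p y))"
      unfolding F_def by (rule sum.mono_neutral_right[OF fin]) (auto simp: dl_def)
    then show ?thesis by (simp add: dl_def)
  qed
  ultimately show ?thesis by blast
qed

lemma prepend_qhom:
  assumes "src G a = i" "tgt G a = j"
  shows "qhom G (proj_module G j :: ('v, 'a, 'a list, 'k::field) rep) (proj_module G i) (\<lambda>v. prepend_arrow a)"
  unfolding qhom_def assms[symmetric]
proof (intro conjI allI ballI)
  show sp: "prepend_arrow a x \<in> sp (proj_module G (src G a)) v" if "x \<in> sp (proj_module G (tgt G a)) v" for v x
    by (rule prepend_arrow_sp[OF that])
  show "prepend_arrow a (mp (proj_module G (tgt G a)) b x) = mp (proj_module G (src G a)) b (prepend_arrow a x)"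
    if "x \<in> sp (proj_module G (tgt G a)) (src G b)" for b and x :: "'a list => 'k"
    unfolding proj_mp[OF that] proj_mp[OF sp[OF that]] append_prepend ..
qed (simp add: lin_def prepend_arrow_add)

lemma prepend_qinj: "qinj (proj_module G j :: ('v, 'a, 'a list, 'k::field) rep) (\<lambda>v. prepend_arrow a)"
proof -
  have "x p = 0" if "prepend_arrow a x = 0" for x :: "'a list => 'k" and p
    using fun_cong[OF that, of "a # p"] by (simp add: prepend_arrow_def)
  then show ?thesis by (auto simp: qinj_def fun_eq_iff)
qed

text \<open>Removes a leading \<open>a\<close>, undoing \<open>prepend_arrow\<close>. The condition
  \<open>z\<close> controls the empty path, whose coefficient appending \<open>a\<close> would
  otherwise move to \<open>[a]\<close>.\<close>

lemma strip_qhom: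
  fixes X :: "('v, 'a, 'b, 'k::field) rep"
  assumes \<eta>: "qhom G X (proj_module G (src G a)) \<eta>" and z: "\<And>v x. x \<in> sp X v ==> \<eta> v x [] = 0"
  shows "qhom G X (proj_module G (tgt G a)) (\<lambda>v x p. \<eta> v x (a # p))"
proof -
  have sp: "(\<lambda>p. \<eta> v x (a # p)) \<in> sp (proj_module G (tgt G a)) v" if x: "x \<in> sp X v" for v x
  proof -
    have "is_path G (src G a) (a # p) v" if "\<eta> v x (a # p) ~= 0" for p
      using qhom_sp[OF \<eta> x] that unfolding proj_sp by blast
    then show ?thesis by (auto simp: proj_sp)
  qed
  show ?thesis
    unfolding qhom_def
  proof (intro conjI allI ballI)
    show "lin (sp X v) (\<lambda>x p. \<eta> v x (a # p))" for v
      unfolding lin_def using qhom_plus[OF \<eta>] qhom_scale[OF \<eta>] by (auto simp: fun_eq_iff vscale_def)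
    show "(\<lambda>p. \<eta> v x (a # p)) \<in> sp (proj_module G (tgt G a)) v" if "x \<in> sp X v" for v x by (rule sp[OF that])
    fix b x assume x: "x \<in> sp X (src G b)"
    have "\<eta> (tgt G b) (mp X b x) = append_arrow b (\<eta> (src G b) x)"
      using qhom_mp[OF \<eta> x] proj_mp[OF qhom_sp[OF \<eta> x]] by simp
    then show "(\<lambda>p. \<eta> (tgt G b) (mp X b x) (a # p)) = mp (proj_module G (tgt G a)) b (\<lambda>p. \<eta> (src G b) x (a # p))"
      unfolding proj_mp[OF sp[OF x]] using z[OF x] by (auto simp: append_arrow_def)
  qed
qed

section \<open>The three indecomposable projectives\<close>

lemma path_Q:
  "is_path quiver_Q V3 p v \<longleftrightarrow> p = [] & v = V3"
  "is_path quiver_Q V2 p v \<longleftrightarrow> p = [] & v = V2 \<or> (p = [A23] \<or> p = [B23]) & v = V3"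
  "is_path quiver_Q V1 p v \<longleftrightarrow> p = [] & v = V1 \<or> p = [A12] & v = V2 \<or> (p = [A12, A23] \<or> p = [A12, B23]) & v = V3"
proof -
  show 3: "is_path quiver_Q V3 p v \<longleftrightarrow> p = [] & v = V3" for p v
  proof (cases p)
    case (Cons a q) then show ?thesis by (cases a) auto
  qed auto
  show 2: "is_path quiver_Q V2 p v \<longleftrightarrow> p = [] & v = V2 \<or> (p = [A23] \<or> p = [B23]) & v = V3" for p v
  proof (cases p)
    case (Cons a q) then show ?thesis by (cases a) (auto simp: 3)
  qed auto
  show "is_path quiver_Q V1 p v \<longleftrightarrow> p = [] & v = V1 \<or> p = [A12] & v = V2 \<or> (p = [A12, A23] \<or> p = [A12, B23]) & v = V3"
  proof (cases p)
    case (Cons a q) then show ?thesis by (cases a) (auto simp: 2)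
  qed auto
qed

lemma finite_path_Q: "finite {p. is_path quiver_Q i p v}"
  by (cases i) (simp_all add: path_Q)

abbreviation (input) "Pr i \<equiv> proj_module quiver_Q i :: (arrow list, 'k::field) qrep"

lemma Pr_module: "Qmod (Pr i)" by (rule proj_module[OF finite_path_Q])

lemma Pr_sp:
  "x \<in> sp (Pr V3) V1 \<longleftrightarrow> x = 0" "x \<in> sp (Pr V3) V2 \<longleftrightarrow> x = 0" "x \<in> sp (Pr V3) V3 \<longleftrightarrow> (\<exists>s. x = dl [] s)"
  "x \<in> sp (Pr V2) V1 \<longleftrightarrow> x = 0" "x \<in> sp (Pr V2) V2 \<longleftrightarrow> (\<exists>s. x = dl [] s)"
  "x \<in> sp (Pr V2) V3 \<longleftrightarrow> (\<exists>s t. x = dl [A23] s + dl [B23] t)"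
  "x \<in> sp (Pr V1) V1 \<longleftrightarrow> (\<exists>s. x = dl [] s)" "x \<in> sp (Pr V1) V2 \<longleftrightarrow> (\<exists>s. x = dl [A12] s)"
  "x \<in> sp (Pr V1) V3 \<longleftrightarrow> (\<exists>s t. x = dl [A12, A23] s + dl [A12, B23] t)"
  by (simp_all add: proj_sp path_Q dl_support dl_add_support) (auto simp: fun_eq_iff)

lemma Pr_generator: "sp (Pr i) i = {dl [] s |s. True}"
  by (cases i) (auto simp: Pr_sp)

lemma Pr_mp: "is_path quiver_Q i p (src quiver_Q a) ==> mp (Pr i) a (dl p s) = dl (p @ [a]) s"
  by (simp add: proj_mp[OF dl_proj] dl_append)

lemma Pr_mps:
  "mb (Pr V2) (dl [] s) = dl [A23] s" "mc (Pr V2) (dl [] s) = dl [B23] s"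
  "ma (Pr V1) (dl [] s) = dl [A12] s" "mb (Pr V1) (dl [A12] s) = dl [A12, A23] s" "mc (Pr V1) (dl [A12] s) = dl [A12, B23] s"
  by (simp_all add: Pr_mp path_Q)

lemma dim_Pr: "vdim (sp (Pr i) v) = card {p. is_path quiver_Q i p v}"
  using dim_finite_support[OF finite_path_Q, of i v] by (simp add: proj_sp)

lemma dim_Prs:
  "vdim (sp (Pr V3) V1) = 0" "vdim (sp (Pr V3) V2) = 0" "vdim (sp (Pr V3) V3) = 1"
  "vdim (sp (Pr V2) V1) = 0" "vdim (sp (Pr V2) V2) = 1" "vdim (sp (Pr V2) V3) = 2"
  "vdim (sp (Pr V1) V1) = 1" "vdim (sp (Pr V1) V2) = 1" "vdim (sp (Pr V1) V3) = 2"
  by (simp_all add: dim_Pr path_Q Collect_disj_eq)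

lemma Pr_brick: "brick (Pr i :: (arrow list, 'k::field) qrep)"
  unfolding brick_def
proof (intro allI impI)
  fix F assume F: "Qhom (Pr i :: (arrow list, 'k) qrep) (Pr i) F"
  let ?e = "dl [] 1 :: arrow list => 'k"
  have "?e \<in> sp (Pr i) i" by (auto simp: Pr_generator)
  then have "F i ?e \<in> sp (Pr i) i" by (rule qhom_sp[OF F])
  then obtain c where c: "F i ?e = dl [] c" by (auto simp: Pr_generator)
  have s: "Qhom (Pr i :: (arrow list, 'k) qrep) (Pr i) (\<lambda>v. vscale c)"
    unfolding qhom_def
  proof (intro conjI allI ballI)
    show "vscale c x \<in> sp (Pr i) v" if "x \<in> sp (Pr i) v" for v x
      by (rule module_scale[OF Pr_module that])
    show "vscale c (mp (Pr i) a x) = mp (Pr i) a (vscale c x)" if "x \<in> sp (Pr i) (src quiver_Q a)" for a x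
      by (rule lin_scale[OF module_lin[OF Pr_module] that, symmetric])
  qed (simp add: lin_def fun_vs.scale_right_distrib fun_vs.scale_left_commute)
  have "F i ?e = vscale c ?e" using c by (simp add: dl_linear(2)[symmetric])
  then show "\<exists>c. \<forall>v. \<forall>x\<in>sp (Pr i) v. F v x = vscale c x" using proj_hom_eq[OF finite_path_Q F s] by blast
qed

text \<open>A nonzero \<open>U\<close> is the whole line of multiples of \<open>p\<close>, and it
  generates a plane because its images under the two arrows are independent.\<close>

lemma kgood_line:
  fixes A :: "('b, 'k::field) qrep"
  assumes A: "Qmod A" and inj: "\<And>x. x \<in> sp A V1 ==> ma A x = 0 ==> x = 0"
    and line: "\<And>x. x \<in> sp A V2 ==> \<exists>s. x = dl p s" "\<And>s. mb A (dl p s) = dl q s" "\<And>s. mc A (dl p s) = dl r s" "q ~= r"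
  shows "kgood A"
  unfolding kgood_def
proof (intro conjI allI ballI impI)
  fix U assume "subsp U & U \<subseteq> sp A V2 & U ~= {0}"
  then have U: "subsp U" "U \<subseteq> sp A V2" "U ~= {0}" by auto
  then obtain u where "u \<in> U" "u ~= 0" using subsp_0[OF U(1)] by blast
  then obtain t where t: "t ~= 0" "dl p t \<in> U" using line(1) U(2) by force
  have all: "dl p s \<in> U" for s
  proof -
    have "vscale (s / t) (dl p t) \<in> U" by (rule subsp_scale[OF U(1) t(2)])
    then show ?thesis using t(1) by (simp add: dl_linear(2)[symmetric])
  qed
  have "U = {x. \<forall>z. x z ~= 0 --> z \<in> {p}}" using line(1) U(2) all by (auto simp: dl_support)
  then have 1: "vdim U = 1" using dim_finite_support[of "{p}"] by simp
  let ?I = "{mb A u + mc A u' |u u'. u \<in> U & u' \<in> U}"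
  have "?I = {x. \<forall>z. x z ~= 0 --> z \<in> {q, r}}"
  proof (intro set_eqI iffI)
    fix x assume "x \<in> ?I"
    then obtain u u' where u: "u \<in> U" "u' \<in> U" "x = mb A u + mc A u'" by blast
    obtain s s' where "u = dl p s" "u' = dl p s'" using line(1) U(2) u(1,2) by blast
    then show "x \<in> {x. \<forall>z. x z ~= 0 --> z \<in> {q, r}}" using u(3) line by (auto simp: dl_def split: if_splits)
  next
    fix x assume "x \<in> {x. \<forall>z. x z ~= (0::'k) --> z \<in> {q, r}}"
    then obtain s t where "x = dl q s + dl r t" using dl_add_support[OF line(4), of x] by auto
    then have "x = mb A (dl p s) + mc A (dl p t)" using line by simp
    then show "x \<in> ?I" using all by blast
  qed
  then have "vdim ?I = card {q, r}" using dim_finite_support[of "{q, r}"] by simp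
  then have "vdim ?I = 2" using line(4) by simp
  then show "vdim U < vdim ?I" using 1 by simp
qed (use inj in blast)

lemma Pr_kgood: "kgood (Pr i)"
proof (cases i)
  case V1
  show ?thesis unfolding V1 by (rule kgood_line[OF Pr_module, of _ "[A12]" "[A12, A23]" "[A12, B23]"]) (auto simp: Pr_sp Pr_mps)
next
  case V2
  show ?thesis unfolding V2 by (rule kgood_line[OF Pr_module, of _ "[]" "[A23]" "[B23]"]) (auto simp: Pr_sp Pr_mps)
next
  case V3
  show ?thesis unfolding V3 kgood_def using Pr_sp(1,2) subsp_0 by blast
qed

text \<open>A nonzero coefficient at the empty path would put the generator, and with it the whole
  module, into the image.\<close>

lemma Pr_nonsurjective:
  fixes X :: "('b, 'k::field) qrep"
  assumes X: "Qmod X" and \<eta>: "Qhom X (Pr i) \<eta>" and ns: "\<not> qsurj X (Pr i) \<eta>" and x: "x \<in> sp X v"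
  shows "\<eta> v x [] = 0"
proof (rule ccontr)
  assume nz: "\<eta> v x [] ~= 0"
  let ?I = "qimage quiver_Q X (Pr i) \<eta>"
  have I: "subm ?I (Pr i)" by (rule qimage_submodule[OF X Pr_module \<eta>])
  note Is = module_subspace[OF submodule_module(1)[OF I]]
  have "v = i" using qhom_sp[OF \<eta> x] nz unfolding proj_sp by force
  then obtain r where r: "\<eta> i x = dl [] r" using qhom_sp[OF \<eta> x] by (auto simp: Pr_generator)
  have "r ~= 0" using nz r \<open>v = i\<close> by (simp add: dl_def)
  have "\<eta> i x \<in> sp ?I i" using x \<open>v = i\<close> by simp
  then have "vscale (1 / r) (dl [] r) \<in> sp ?I i" unfolding r by (rule subsp_scale[OF Is])
  then have e: "dl [] 1 \<in> sp ?I i" using \<open>r ~= 0\<close> by (simp only: dl_linear(2)[symmetric]) simp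
  have gen: "dl p 1 \<in> sp ?I w" if "is_path quiver_Q i p w" for p w
    using that
  proof (induction p arbitrary: w rule: rev_induct)
    case (snoc a p)
    then have p: "is_path quiver_Q i p (src quiver_Q a)" "w = tgt quiver_Q a" by (auto simp: is_path_append)
    have "mp ?I a (dl p 1) = dl (p @ [a]) 1" using submodule_mp[OF I snoc.IH[OF p(1)]] Pr_mp[OF p(1)] by simp
    then show ?case using module_mp[OF submodule_module(1)[OF I] snoc.IH[OF p(1)]] p(2) by simp
  qed (use e in simp)
  have "sp (Pr i) w \<subseteq> sp ?I w" for w
  proof (rule order_trans[OF proj_span[OF finite_path_Q] fun_vs.span_minimal[OF _ Is]])
    show "(\<lambda>p. dl p 1) ` {p. is_path quiver_Q i p w} \<subseteq> sp ?I w" by (rule image_subsetI) (rule gen, simp)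
  qed
  then show False using ns unfolding qsurj_def by (force simp: subset_iff)
qed

text \<open>A map that is not surjective lands in the radical, which is the direct sum of the
  projectives at the ends of the arrows out of \<open>i\<close>; the first letter of a path tells
  the summands apart.\<close>

lemma Pr_right_almost_split:
  fixes a :: "'j::finite => arrow"
  assumes a: "bij_betw a UNIV {b. src quiver_Q b = i}"
  shows "right_almost_split (Pr i :: (arrow list, 'k::field) qrep) UNIV (\<lambda>j. Pr (tgt quiver_Q (a j))) (\<lambda>j v. prepend_arrow (a j))"
  unfolding right_almost_split_def
proof (intro conjI ballI allI impI)
  have src: "src quiver_Q (a j) = i" for j using a by (auto simp: bij_betw_def)
  show "Qmod (Pr (tgt quiver_Q (a j)))" for j by (rule Pr_module)
  show "Qhom (Pr (tgt quiver_Q (a j))) (Pr i) (\<lambda>v. prepend_arrow (a j))" for j by (rule prepend_qhom) (simp_all add: src)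
  fix X :: "(arrow list, 'k) qrep" and \<eta>
  assume "Qmod X & Qhom X (Pr i) \<eta> & \<not> qsurj X (Pr i) \<eta>"
  then have X: "Qmod X" and \<eta>: "Qhom X (Pr i) \<eta>" and ns: "\<not> qsurj X (Pr i) \<eta>" by auto
  note z = Pr_nonsurjective[OF X \<eta> ns]
  show "\<exists>h. (\<forall>j\<in>UNIV. Qhom X (Pr (tgt quiver_Q (a j))) (h j)) & (\<forall>v. \<forall>x\<in>sp X v. \<eta> v x = (\<Sum>j\<in>UNIV. prepend_arrow (a j) (h j v x)))"
  proof (intro exI[of _ "\<lambda>j v x p. \<eta> v x (a j # p)"] conjI ballI allI)
    show "Qhom X (Pr (tgt quiver_Q (a j))) (\<lambda>v x p. \<eta> v x (a j # p))" for j
      using strip_qhom[of quiver_Q X "a j" \<eta>] \<eta> z by (simp add: src)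
    fix v x assume x: "x \<in> sp X v"
    have *: "\<eta> v x p = (\<Sum>j\<in>UNIV. prepend_arrow (a j) (\<lambda>p. \<eta> v x (a j # p)) p)" for p
    proof (cases p)
      case Nil
      then show ?thesis using z[OF x] by (simp add: prepend_arrow_def)
    next
      case (Cons b q)
      have eq: "(\<Sum>j\<in>UNIV. prepend_arrow (a j) (\<lambda>p. \<eta> v x (a j # p)) p) = (\<Sum>j\<in>UNIV. if b = a j then \<eta> v x p else 0)"
        by (rule sum.cong) (simp_all add: Cons prepend_arrow_def)
      show ?thesis
      proof (cases "src quiver_Q b = i")
        case True
        then obtain k where k: "b = a k" using a by (auto simp: bij_betw_def)
        have "(\<Sum>j\<in>UNIV. if b = a j then \<eta> v x p else 0) = (\<Sum>j\<in>{k}. \<eta> v x p)"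
          by (rule sum.mono_neutral_cong_right) (use a in \<open>auto simp: k bij_betw_def inj_on_def\<close>)
        then show ?thesis unfolding eq by simp
      next
        case False
        then have "\<eta> v x p = 0" using qhom_sp[OF \<eta> x] Cons unfolding proj_sp by auto
        then show ?thesis unfolding eq by (simp add: sum.neutral)
      qed
    qed
    show "\<eta> v x = (\<Sum>j\<in>UNIV. prepend_arrow (a j) (\<lambda>p. \<eta> v x (a j # p)))" by (rule ext) (simp only: sum_apply, rule *)
  qed
qed

definition step :: "bool => arrow" where "step b = (if b then A23 else B23)"

lemma sum_bool: "(\<Sum>b\<in>UNIV. F b) = F True + F False"
  by (simp add: UNIV_bool add.commute)

lemma sum_option_bool: "(\<Sum>b\<in>UNIV. F b) = F None + (F (Some True) + F (Some False))"
  by (simp add: UNIV_option_conv UNIV_bool add.commute)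

lemma sum_unit: "(\<Sum>b\<in>(UNIV :: unit set). F b) = F ()"
  by (simp add: UNIV_unit)

section \<open>Mesh sequences\<close>

text \<open>The composite starts in a projective module, so it vanishes once it vanishes on the
  generator.\<close>

lemma exact_seq_Pr:
  fixes M :: "(arrow list, 'k::field) qrep"
  assumes cox: "cox (Pr i) M gm" and Y: "\<And>j. j \<in> J ==> Qmod (Y j)"
    and \<alpha>: "\<And>j. j \<in> J ==> Qhom (Pr i) (Y j) (\<alpha> j)" and \<beta>: "\<And>j. j \<in> J ==> Qhom (Y j) M (\<beta> j)"
    and gen: "\<And>j z. j \<in> J ==> z \<in> sp (Y j) V3 ==> \<exists>y\<in>sp (Y j) V2. \<exists>y'\<in>sp (Y j) V2. z = mb (Y j) y + mc (Y j) y'"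
    and complex: "(\<Sum>j\<in>J. \<beta> j i (\<alpha> j i (dl [] 1))) = 0"
    and surj: "\<And>v m. v ~= V3 ==> m \<in> sp M v ==> \<exists>y. (\<forall>j\<in>J. y j \<in> sp (Y j) v) & m = tot J \<beta> v y"
    and ker: "\<And>v y. v ~= V3 ==> \<forall>j\<in>J. y j \<in> sp (Y j) v ==> tot J \<beta> v y = 0 ==> \<exists>w\<in>sp (Pr i) v. \<forall>j\<in>J. y j = \<alpha> j v w"
    and lift: "\<And>w. w \<in> sp (Pr i) V3 ==> rel_lift (Pr i) J Y \<alpha> \<beta> (gm w 0) (gm 0 w)"
  shows "exact_seq (Pr i) J Y M \<alpha> \<beta>"
proof -
  interpret cox "Pr i" M gm by (rule cox)
  have Z: "Qhom (Pr i) M (\<lambda>v x. 0)" unfolding qhom_def lin_def using module_mp_0[OF N] by simp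
  show ?thesis
    by (rule exact_seq_generated[OF cox A Y \<alpha> \<beta> gen proj_hom_eq[OF finite_path_Q sum_comp_qhom[OF N \<alpha> \<beta>] Z complex] surj ker lift])
qed

text \<open>The three meshes share the maps \<open>f\<close> and \<open>s\<close>, so they are
  carried along together. \<open>bool\<close> indexes the pairs of irreducible maps between the same
  two modules, and \<open>None\<close> stands for the term \<open>A V1\<close> of the middle mesh.
  The nonvanishing clauses are the input for injectivity of the irreducible maps.\<close>

definition mesh :: "(vertex => ('b, 'k::field) qrep) => (vertex => ('b, 'k) qrep) =>
    (bool => vertex => ('b => 'k) => ('b => 'k)) => (bool => vertex => ('b => 'k) => ('b => 'k)) =>
    (vertex => ('b => 'k) => ('b => 'k)) => (vertex => ('b => 'k) => ('b => 'k)) =>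
    (bool => vertex => ('b => 'k) => ('b => 'k)) => (vertex => ('b => 'k) => ('b => 'k)) => bool" where
  "mesh A N p f u s p' u' \<longleftrightarrow>
    exact_seq (A V3) UNIV (\<lambda>b. A V2) (N V3) p f &
    exact_seq (A V2) UNIV (case_option (A V1) (\<lambda>b. N V3)) (N V2) (case_option u f) (case_option s p') &
    exact_seq (A V1) (UNIV :: unit set) (\<lambda>b. N V2) (N V1) (\<lambda>b. s) (\<lambda>b. u') &
    \<not> qzero (A V2) (f True) & \<not> qzero (A V1) s & \<not> qzero (N V3) (p' True) & \<not> qzero (N V3) (\<lambda>v x. u' v (p' True v x))"

lemma all_option_bool: "(\<forall>j. P j) \<longleftrightarrow> P None & (\<forall>b :: bool. P (Some b))"
  by (metis option.exhaust)

text \<open>All maps are transformed: \<open>exact_seq_cox\<close> keeps the sequences exact, and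
  faithfulness keeps the four maps nonzero.\<close>

lemma mesh_step:
  assumes m: "mesh A A' p f u s p' u'" and c: "\<And>v. cox (A v) (N v) (gm v)" "\<And>v. cox (A' v) (N' v) (gm' v)"
  shows "\<exists>P F U S P' U'. mesh N N' P F U S P' U'"
proof -
  have c32: "cox_pair (A V3) (N V3) (gm V3) (A V2) (N V2) (gm V2)"
    and c23: "cox_pair (A V2) (N V2) (gm V2) (A' V3) (N' V3) (gm' V3)"
    and c21: "cox_pair (A V2) (N V2) (gm V2) (A V1) (N V1) (gm V1)"
    and c12: "cox_pair (A V1) (N V1) (gm V1) (A' V2) (N' V2) (gm' V2)"
    and c32': "cox_pair (A' V3) (N' V3) (gm' V3) (A' V2) (N' V2) (gm' V2)"
    and c21': "cox_pair (A' V2) (N' V2) (gm' V2) (A' V1) (N' V1) (gm' V1)"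
    and c31': "cox_pair (A' V3) (N' V3) (gm' V3) (A' V1) (N' V1) (gm' V1)"
    by (simp_all only: cox_pair_def c simp_thms)
  note M = m[unfolded mesh_def]
  have e1: "exact_seq (A V3) UNIV (\<lambda>b. A V2) (A' V3) p f" and e2: "exact_seq (A V2) UNIV (case_option (A V1) (\<lambda>b. A' V3)) (A' V2) (case_option u f) (case_option s p')"
    and e3: "exact_seq (A V1) (UNIV :: unit set) (\<lambda>b. A' V2) (A' V1) (\<lambda>b. s) (\<lambda>b. u')" using M by blast+
  have h: "Qhom (A V3) (A V2) (p b)" "Qhom (A V2) (A' V3) (f b)" "Qhom (A V2) (A V1) u"
      "Qhom (A V1) (A' V2) s" "Qhom (A' V3) (A' V2) (p' b)" "Qhom (A' V2) (A' V1) u'" for b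
    using exact_seqD(2,3)[OF e1, of b] exact_seqD(2,3)[OF e2, of None] exact_seqD(2,3)[OF e2, of "Some b"] exact_seqD(3)[OF e3] by simp_all
  obtain P where P: "\<And>b. Qhom (N V3) (N V2) (P b)" "\<And>b. induced (A V3) (gm V3) (gm V2) (p b) (P b)"
    using cox_pair.induced_exists[OF c32 h(1)] by metis
  obtain F where F: "\<And>b. Qhom (N V2) (N' V3) (F b)" "\<And>b. induced (A V2) (gm V2) (gm' V3) (f b) (F b)"
    using cox_pair.induced_exists[OF c23 h(2)] by metis
  obtain U where U: "Qhom (N V2) (N V1) U" "induced (A V2) (gm V2) (gm V1) u U"
    using cox_pair.induced_exists[OF c21 h(3)] by blast
  obtain S where S: "Qhom (N V1) (N' V2) S" "induced (A V1) (gm V1) (gm' V2) s S"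
    using cox_pair.induced_exists[OF c12 h(4)] by blast
  obtain P' where P': "\<And>b. Qhom (N' V3) (N' V2) (P' b)" "\<And>b. induced (A' V3) (gm' V3) (gm' V2) (p' b) (P' b)"
    using cox_pair.induced_exists[OF c32' h(5)] by metis
  obtain U' where U': "Qhom (N' V2) (N' V1) U'" "induced (A' V2) (gm' V2) (gm' V1) u' U'"
    using cox_pair.induced_exists[OF c21' h(6)] by blast
  have "exact_seq (N V3) UNIV (\<lambda>b. N V2) (N' V3) P F"
    by (rule exact_seq_cox[OF e1 c(1) c(1) c(2) P F])
  moreover have "exact_seq (N V2) UNIV (case_option (N V1) (\<lambda>b. N' V3)) (N' V2) (case_option U F) (case_option S P')"
  proof (rule exact_seq_cox[OF e2 c(1) _ c(2)])
    fix j :: "bool option"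
    show "cox (case_option (A V1) (\<lambda>b. A' V3) j) (case_option (N V1) (\<lambda>b. N' V3) j) (case_option (gm V1) (\<lambda>b. gm' V3) j)"
      "Qhom (N V2) (case_option (N V1) (\<lambda>b. N' V3) j) (case_option U F j)"
      "induced (A V2) (gm V2) (case_option (gm V1) (\<lambda>b. gm' V3) j) (case_option u f j) (case_option U F j)"
      "Qhom (case_option (N V1) (\<lambda>b. N' V3) j) (N' V2) (case_option S P' j)"
      "induced (case_option (A V1) (\<lambda>b. A' V3) j) (case_option (gm V1) (\<lambda>b. gm' V3) j) (gm' V2) (case_option s p' j) (case_option S P' j)"
      by (cases j; simp add: c F U S P')+
  qed
  moreover have "exact_seq (N V1) (UNIV :: unit set) (\<lambda>b. N' V2) (N' V1) (\<lambda>b. S) (\<lambda>b. U')"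
    by (rule exact_seq_cox[OF e3 c(1) c(2) c(2) S U'])
  moreover have "\<not> qzero (N V2) (F True)" "\<not> qzero (N V1) S" "\<not> qzero (N' V3) (P' True)"
    using M cox_pair.induced_faithful[OF c23 h(2) F] cox_pair.induced_faithful[OF c12 h(4) S] cox_pair.induced_faithful[OF c32' h(5) P'] by blast+
  moreover have "\<not> qzero (N' V3) (\<lambda>v x. U' v (P' True v x))"
    using M cox_pair.induced_faithful[OF c31' qhom_comp[OF h(5,6)] qhom_comp[OF P'(1) U'(1)] induced_comp[OF P'(2) U'(2) h(5)]] by blast
  ultimately show ?thesis unfolding mesh_def by blast
qed

locale mesh_base = c1: cox "Pr V1" N1 gm1 + c2: cox "Pr V2" N2 gm2 + c3: cox "Pr V3" N3 gm3
  for N1 N2 N3 :: "(arrow list, 'k::field) qrep" and gm1 gm2 gm3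
begin

lemma dl_mem [simp]: "dl [] s \<in> sp (Pr V3) V3" "dl [A23] s \<in> sp (Pr V2) V3" "dl [B23] s \<in> sp (Pr V2) V3"
    "dl [] s \<in> sp (Pr V2) V2" "dl [] s \<in> sp (Pr V1) V1" "dl [A12] s \<in> sp (Pr V1) V2" "dl [A12, A23] s \<in> sp (Pr V1) V3" "dl [A12, B23] s \<in> sp (Pr V1) V3"
  by (simp_all add: dl_proj path_Q)

lemma Pr_V2_add [simp]: "dl [A23] s + dl [B23] t \<in> sp (Pr V2) V3"
  using Pr_sp(6) by blast

lemma N3_V1: "n \<in> sp N3 V1 \<longleftrightarrow> n = 0"
proof
  assume n: "n \<in> sp N3 V1"
  then obtain x where "x \<in> sp (Pr V3) V2" "ma N3 n = gm3 (mb (Pr V3) x) (mc (Pr V3) x)" using c3.a_image by blast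
  then have "ma N3 n = 0" using lin2_0[OF c3.gm_lin c3.A_sub] by (simp add: Pr_sp module_mp_0[OF Pr_module])
  then show "n = 0" by (rule c3.a_inj[OF n])
qed simp

lemma N1_V1: "n \<in> sp N1 V1 \<longleftrightarrow> n = 0"
proof
  assume n: "n \<in> sp N1 V1"
  then obtain x where x: "x \<in> sp (Pr V1) V2" "ma N1 n = gm1 (mb (Pr V1) x) (mc (Pr V1) x)" using c1.a_image by blast
  obtain r where "x = ma (Pr V1) (dl [] r)" using x(1) by (auto simp: Pr_sp Pr_mps)
  then have "ma N1 n = 0" using x(2) c1.gm_a0[of "dl [] r"] by simp
  then show "n = 0" by (rule c1.a_inj[OF n])
qed simp

lemma N3_V2: "n \<in> sp N3 V2 ==> \<exists>s t. n = gm3 (dl [] s) (dl [] t)"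
  using c3.gm_surj[of n] unfolding Bex_def Pr_sp by blast

lemma N2_V2: "n \<in> sp N2 V2 ==> \<exists>a b c d. n = gm2 (dl [A23] a + dl [B23] b) (dl [A23] c + dl [B23] d)"
  using c2.gm_surj[of n] unfolding Bex_def Pr_sp by blast

lemma gm3_0: "gm3 (dl [] s) (dl [] t) = 0 \<longleftrightarrow> s = 0 & t = 0"
  using c3.gm_0[OF dl_mem(1) dl_mem(1), of s t] by (simp add: Pr_sp module_mp_0[OF Pr_module])

lemma dl_add_eq_0: "a ~= b ==> dl a s + dl b t = 0 \<longleftrightarrow> s = 0 & t = (0 :: 'k)"
  by (auto simp: fun_eq_iff dl_def)

lemma gm3_split: "gm3 (dl [] r + dl [] 0) (dl [] 0 + dl [] t) = gm3 (dl [] r) (dl [] 0) + gm3 (dl [] 0) (dl [] t)"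
  by (rule lin2_add[OF c3.gm_lin dl_mem(1) dl_mem(1) dl_mem(1) dl_mem(1)])

lemma gm2_0: "gm2 (dl [A23] a + dl [B23] b) (dl [A23] c + dl [B23] d) = 0 \<longleftrightarrow> a = 0 & b = 0 & c = 0 & d = 0"
  by (subst c2.gm_0) (auto simp: Pr_sp module_mp_0[OF Pr_module] dl_add_eq_0)

lemma gm2_diag_0: "gm2 (dl [A23] a) (dl [B23] d) = 0 \<longleftrightarrow> a = 0 & d = 0"
  using gm2_0[of a 0 0 d] by (simp add: dl_linear)

theorem mesh_exists: "\<exists>p f u s p' u'. mesh (case_vertex (Pr V1) (Pr V2) (Pr V3)) (case_vertex N1 N2 N3) p f u s p' u'"
proof -
  define p where "p b = (\<lambda>v :: vertex. prepend_arrow (step b) :: (arrow list => 'k) => _)" for b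
  define u where "u = (\<lambda>v :: vertex. prepend_arrow A12 :: (arrow list => 'k) => _)"
  have p: "Qhom (Pr V3) (Pr V2) (p b)" for b unfolding p_def by (rule prepend_qhom) (simp_all add: step_def)
  have u: "Qhom (Pr V2) (Pr V1) u" unfolding u_def by (rule prepend_qhom) simp_all
  have pv: "p True v (dl [] s) = dl [A23] s" "p False v (dl [] s) = dl [B23] s" for v s by (simp_all add: p_def step_def dl_prepend)
  have uv: "u v (dl q s) = dl (A12 # q) s" "u v (x + y) = u v x + u v y" "u v 0 = 0" for v q s x y by (simp_all add: u_def dl_prepend prepend_arrow_add)
  have p0: "p b v 0 = 0" for b v by (simp add: p_def prepend_arrow_add)
  have gms: "gm3 (vscale r w) (vscale r w') = vscale r (gm3 w w')" if "w \<in> sp (Pr V3) V3" "w' \<in> sp (Pr V3) V3" for r w w'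
    by (rule lin2_scale[OF c3.gm_lin that])
  \<comment> \<open>The images of the generator of \<open>Pr V2\<close> under the two maps
    \<open>f\<close>: the standard basis of \<open>sp N3 V2\<close>, a plane since
    \<open>Pr V3\<close> is a line at 3 and zero at 1.\<close>
  define y where "y b = (if b then gm3 (dl [] 1) (dl [] 0) else gm3 (dl [] 0) (dl [] 1))" for b
  have "y b \<in> sp N3 V2" for b unfolding y_def using c3.gm_in dl_mem(1) by simp
  then have "\<forall>b. \<exists>F. Qhom (Pr V2) N3 F & (\<forall>s. F V2 (dl [] s) = vscale s (y b))"
    using proj_hom_exists[OF finite_path_Q c3.N] by blast
  then obtain f where f: "\<And>b. Qhom (Pr V2) N3 (f b)" "\<And>b s. f b V2 (dl [] s) = vscale s (y b)" unfolding choice_iff by blast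
  have fv: "f True V2 (dl [] s) = gm3 (dl [] s) (dl [] 0)" "f False V2 (dl [] s) = gm3 (dl [] 0) (dl [] s)" for s
    unfolding f(2) y_def if_True if_False using gms[of "dl [] 1" "dl [] 0" s] gms[of "dl [] 0" "dl [] 1" s]
    by (simp_all only: dl_mem dl_linear(2)[symmetric] mult_zero_right mult_1_right simp_thms)
  have bc: "mb (Pr V2) (dl [] r) = dl [A23] r" "mc (Pr V2) (dl [] r) = dl [B23] r" for r by (rule Pr_mps)+
  \<comment> \<open>The sign makes the middle mesh a complex: the maps \<open>p'\<close> after
    \<open>f\<close> send the generator to \<open>gm2 (dl [A23] 1) (dl [B23] 1)\<close> in total,
    which \<open>s\<close> after \<open>u\<close> has to cancel.\<close>
  have "\<exists>n\<in>sp N2 V1. ma N2 n = gm2 (dl [A23] (- 1)) (dl [B23] (- 1))"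
    unfolding c2.a_image using bc[of "- 1"] dl_mem(4)[of "- 1"] by metis
  then obtain n0 where n0: "n0 \<in> sp N2 V1" "ma N2 n0 = gm2 (dl [A23] (- 1)) (dl [B23] (- 1))" by blast
  obtain s where s: "Qhom (Pr V1) N2 s" "\<And>r. s V1 (dl [] r) = vscale r n0"
    using proj_hom_exists[OF finite_path_Q c2.N n0(1)] by blast
  have sa: "ma N2 (s V1 (dl [] r)) = gm2 (dl [A23] (- r)) (dl [B23] (- r))" for r
  proof -
    have "ma N2 (s V1 (dl [] r)) = vscale r (gm2 (dl [A23] (- 1)) (dl [B23] (- 1)))"
      unfolding s(2) lin_scale[OF Qmod_lin(1)[OF c2.N] n0(1)] n0(2) ..
    also have "\<dots> = gm2 (dl [A23] (- r)) (dl [B23] (- r))"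
      using lin2_scale[OF c2.gm_lin dl_mem(2,3), of r "- 1" "- 1"] by (simp add: dl_linear(2)[symmetric])
    finally show ?thesis .
  qed
  have sv: "s V2 (dl [A12] r) = gm2 (dl [A23] (- r)) (dl [B23] (- r))" for r
    using qhom_Q_mp(1)[OF s(1) dl_mem(5), of r] by (simp only: Pr_mps sa)
  interpret c32: cox_pair "Pr V3" N3 gm3 "Pr V2" N2 gm2 ..
  interpret c21: cox_pair "Pr V2" N2 gm2 "Pr V1" N1 gm1 ..
  obtain p' where p': "\<And>b. Qhom N3 N2 (p' b)" "\<And>b. induced (Pr V3) gm3 gm2 (p b) (p' b)"
    using c32.induced_exists[OF p] by metis
  obtain u' where u': "Qhom N2 N1 u'" "induced (Pr V2) gm2 gm1 u u'"
    using c21.induced_exists[OF u] by blast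
  have pv': "p' True V2 (gm3 (dl [] r) (dl [] t)) = gm2 (dl [A23] r) (dl [A23] t)"
      "p' False V2 (gm3 (dl [] r) (dl [] t)) = gm2 (dl [B23] r) (dl [B23] t)" for r t
    unfolding inducedD[OF p'(2) dl_mem(1) dl_mem(1)] pv by (rule refl)+
  have uv': "u' V2 (gm2 (dl [A23] a + dl [B23] b) (dl [A23] c + dl [B23] d)) =
      gm1 (dl [A12, A23] a + dl [A12, B23] b) (dl [A12, A23] c + dl [A12, B23] d)" for a b c d
    unfolding inducedD[OF u'(2) Pr_V2_add Pr_V2_add] uv by (rule refl)
  \<comment> \<open>The second map of the middle mesh at 2, in coordinates. Its kernel is
    \<open>a = d = r\<close>, \<open>b = c = 0\<close>, the image of \<open>Pr V2\<close>.\<close>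
  have sum2: "s V2 (dl [A12] r) + (p' True V2 (gm3 (dl [] a) (dl [] c)) + p' False V2 (gm3 (dl [] b) (dl [] d))) =
      gm2 (dl [A23] (a - r) + dl [B23] b) (dl [A23] c + dl [B23] (d - r))" for r a b c d
  proof -
    have "s V2 (dl [A12] r) + (p' True V2 (gm3 (dl [] a) (dl [] c)) + p' False V2 (gm3 (dl [] b) (dl [] d))) =
      gm2 (dl [A23] (- r)) (dl [B23] (- r)) + gm2 (dl [A23] a + dl [B23] b) (dl [A23] c + dl [B23] d)"
      unfolding sv pv' lin2_add[OF c2.gm_lin dl_mem(2) dl_mem(2) dl_mem(3) dl_mem(3)] ..
    also have "\<dots> = gm2 (dl [A23] (- r) + (dl [A23] a + dl [B23] b)) (dl [B23] (- r) + (dl [A23] c + dl [B23] d))"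
      by (rule lin2_add[OF c2.gm_lin dl_mem(2) dl_mem(3) Pr_V2_add Pr_V2_add, symmetric])
    also have "dl [A23] (- r) + (dl [A23] a + dl [B23] b) = (dl [A23] (a - r) + dl [B23] b :: arrow list => 'k)"
      by (auto simp: fun_eq_iff dl_def)
    also have "dl [B23] (- r) + (dl [A23] c + dl [B23] d) = (dl [A23] c + dl [B23] (d - r) :: arrow list => 'k)"
      by (auto simp: fun_eq_iff dl_def)
    finally show ?thesis .
  qed
  have Pr1_gen: "\<exists>m\<in>sp (Pr V1) V2. \<exists>m'\<in>sp (Pr V1) V2. z = mb (Pr V1) m + mc (Pr V1) m'" if "z \<in> sp (Pr V1) V3" for z
    using that unfolding Pr_sp(9) using Pr_mps(4,5) dl_mem(6) by metis
  have Pr2_gen: "\<exists>m\<in>sp (Pr V2) V2. \<exists>m'\<in>sp (Pr V2) V2. z = mb (Pr V2) m + mc (Pr V2) m'" if "z \<in> sp (Pr V2) V3" for z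
    using that unfolding Pr_sp(6) using bc dl_mem(4) by metis
  have f3: "f b V3 (dl [A23] r) = mb N3 (f b V2 (dl [] r))" "f b V3 (dl [B23] r) = mc N3 (f b V2 (dl [] r))" for b r
    using qhom_Q_mp(2,3)[OF f(1) dl_mem(4)] by (simp_all only: bc)
  have rel: "mb N3 (gm3 (dl [] r) (dl [] 0)) + mc N3 (gm3 (dl [] 0) (dl [] r)) = 0" for r
    using c3.N3_rel[OF c3.gm_in c3.gm_in, of "dl [] r" 0 0 "dl [] r"] dl_mem(1)[of r] by (auto simp: dl_linear(3))
  have e1: "exact_seq (Pr V3) UNIV (\<lambda>b. Pr V2) N3 p f"
  proof (rule exact_seq_Pr[OF c3.cox_axioms Pr_module p f(1) Pr2_gen])
    show "(\<Sum>b\<in>UNIV. f b V3 (p b V3 (dl [] 1))) = 0" unfolding sum_bool pv f3 fv by (rule rel)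
    fix v and m :: "arrow list => 'k" assume v: "v ~= V3" and m: "m \<in> sp N3 v"
    show "\<exists>y. (\<forall>b\<in>UNIV. y b \<in> sp (Pr V2) v) & m = (\<Sum>b\<in>UNIV. f b v (y b))"
    proof (cases v)
      case V1
      then have "m = 0" using m N3_V1 by simp
      then show ?thesis unfolding sum_bool using qhom_0[OF f(1) Pr_module] V1 by (intro exI[of _ "\<lambda>b. 0"]) simp
    next
      case V2
      then obtain r t where m: "m = gm3 (dl [] r) (dl [] t)" using m N3_V2 by blast
      have "m = f True V2 (dl [] r) + f False V2 (dl [] t)"
        unfolding m fv using gm3_split[of r t] by (simp add: dl_linear(3))
      then show ?thesis unfolding sum_bool V2 by (intro exI[of _ "\<lambda>b. dl [] (if b then r else t)"]) simp
    qed (use v in simp)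
  next
    fix v and y :: "bool => arrow list => 'k"
    assume v: "v ~= V3" and y: "\<forall>b\<in>UNIV. y b \<in> sp (Pr V2) v" and z: "(\<Sum>b\<in>UNIV. f b v (y b)) = 0"
    show "\<exists>w\<in>sp (Pr V3) v. \<forall>b\<in>UNIV. y b = p b v w"
    proof (cases v)
      case V1
      then show ?thesis using y p0 by (auto simp: Pr_sp)
    next
      case V2
      then obtain r t where rt: "y True = dl [] r" "y False = dl [] t" using y Pr_sp(5) by blast
      have "gm3 (dl [] r) (dl [] t) = 0"
        using z gm3_split[of r t]
        unfolding sum_bool V2 rt fv by (simp add: dl_linear(3))
      then have "y b = 0" for b unfolding gm3_0 using rt by (cases b) auto
      then show ?thesis using p0 V2 by (auto simp: Pr_sp)
    qed (use v in simp)
  next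
    fix w :: "arrow list => 'k" assume "w \<in> sp (Pr V3) V3"
    then obtain r where w: "w = dl [] r" using Pr_sp(3) by blast
    have f0: "f b V2 0 = 0" for b by (rule qhom_0[OF f(1) Pr_module])
    show "rel_lift (Pr V3) UNIV (\<lambda>b. Pr V2) p f (gm3 w 0) (gm3 0 w)"
      unfolding rel_lift_def
    proof (rule exI[of _ "\<lambda>b. if b then dl [] r else 0"], rule exI[of _ "\<lambda>b. if b then 0 else dl [] r"], intro conjI bexI[of _ w] ballI)
      show "(\<Sum>b\<in>UNIV. f b V2 (if b then dl [] r else 0)) = gm3 w 0" unfolding sum_bool w using fv(1)[of r] f0 by (simp add: dl_linear(3))
      show "(\<Sum>b\<in>UNIV. f b V2 (if b then 0 else dl [] r)) = gm3 0 w" unfolding sum_bool w using fv(2)[of r] f0 by (simp add: dl_linear(3))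
      show "mb (Pr V2) (if b then dl [] r else 0) + mc (Pr V2) (if b then 0 else dl [] r) = p b V3 w" for b
        using pv[of V3 r] bc by (cases b) (simp_all add: w module_mp_0[OF Pr_module])
    qed (simp_all add: w subsp_0[OF module_subspace[OF Pr_module]])
  qed
  let ?Y = "case_option (Pr V1) (\<lambda>b :: bool. N3)"
  have s2: "exact_seq (Pr V2) UNIV ?Y N2 (case_option u f) (case_option s p')"
  proof (rule exact_seq_Pr[OF c2.cox_axioms])
    fix j :: "bool option"
    show "Qmod (?Y j)" "Qhom (Pr V2) (?Y j) (case_option u f j)"
      "Qhom (?Y j) N2 (case_option s p' j)"
      by (cases j; simp add: c3.N Pr_module u f s p')+
    fix z assume "z \<in> sp (?Y j) V3"
    then show "\<exists>y\<in>sp (?Y j) V2. \<exists>y'\<in>sp (?Y j) V2.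
        z = mb (?Y j) y + mc (?Y j) y'"
      by (cases j) (use Pr1_gen c3.N3_gen in auto)
  next
    show "(\<Sum>j\<in>UNIV. case_option s p' j V2 (case_option u f j V2 (dl [] 1))) = 0"
      unfolding sum_option_bool option.case fv uv sum2 gm2_0 by simp
  next
    fix v and m :: "arrow list => 'k" assume v: "v ~= V3" and m: "m \<in> sp N2 v"
    show "\<exists>y. (\<forall>j\<in>UNIV. y j \<in> sp (?Y j) v) & m = (\<Sum>j\<in>UNIV. case_option s p' j v (y j))"
    proof (cases v)
      case V1
      then obtain x where "x \<in> sp (Pr V2) V2" "ma N2 m = gm2 (mb (Pr V2) x) (mc (Pr V2) x)" using m c2.a_image by blast
      then obtain r where r: "ma N2 m = gm2 (dl [A23] r) (dl [B23] r)" using Pr_sp(5) bc by metis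
      have "m = s V1 (dl [] (- r))"
        by (rule c2.aN_eq[OF m[unfolded V1] qhom_sp[OF s(1) dl_mem(5)]]) (simp add: r sa)
      then show ?thesis unfolding sum_option_bool V1 option.case ball_UNIV all_option_bool
        by (intro exI[of _ "case_option (dl [] (- r)) (\<lambda>b. 0)"]) (simp add: qhom_0[OF p'(1) c3.N])
    next
      case V2
      then obtain a b c d where m: "m = gm2 (dl [A23] a + dl [B23] b) (dl [A23] c + dl [B23] d)" using m N2_V2 by blast
      have "m = s V2 (dl [A12] 0) + (p' True V2 (gm3 (dl [] a) (dl [] c)) + p' False V2 (gm3 (dl [] b) (dl [] d)))"
        unfolding sum2 m by simp
      then show ?thesis unfolding sum_option_bool V2 option.case ball_UNIV all_option_bool
        by (intro exI[of _ "case_option (dl [A12] 0) (\<lambda>h. if h then gm3 (dl [] a) (dl [] c) else gm3 (dl [] b) (dl [] d))"]) (simp add: c3.gm_in)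
    qed (use v in simp)
  next
    fix v and y :: "bool option => arrow list => 'k"
    assume v: "v ~= V3" and y: "\<forall>j\<in>UNIV. y j \<in> sp (?Y j) v" and z: "(\<Sum>j\<in>UNIV. case_option s p' j v (y j)) = 0"
    have yN: "y None \<in> sp (Pr V1) v" "y (Some b) \<in> sp N3 v" for b using y[rule_format, of None] y[rule_format, of "Some b"] by simp_all
    show "\<exists>w\<in>sp (Pr V2) v. \<forall>j\<in>UNIV. y j = case_option u f j v w"
    proof (cases v)
      case V1
      then obtain r where r: "y None = dl [] r" using yN(1) Pr_sp(7) by blast
      have y0: "y (Some b) = 0" for b using yN(2)[of b] V1 N3_V1 by simp
      have "s V1 (dl [] r) = 0" using z unfolding sum_option_bool V1 option.case r y0 qhom_0[OF p'(1) c3.N] by simp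
      then have "gm2 (dl [A23] (- r)) (dl [B23] (- r)) = 0" unfolding sa[symmetric] by (simp add: module_mp_0[OF c2.N])
      then have "y None = 0" unfolding r gm2_diag_0 by simp
      then have "\<forall>j. y j = case_option u f j V1 0" unfolding all_option_bool using y0 uv(3) qhom_0[OF f(1) Pr_module] by simp
      then show ?thesis unfolding V1 using Pr_sp(4) by blast
    next
      case V2
      then obtain r where r: "y None = dl [A12] r" using yN(1) Pr_sp(8) by blast
      obtain a c where ac: "y (Some True) = gm3 (dl [] a) (dl [] c)" using N3_V2 yN(2)[of True] V2 by blast
      obtain b d where bd: "y (Some False) = gm3 (dl [] b) (dl [] d)" using N3_V2 yN(2)[of False] V2 by blast
      have "a = r" "b = 0" "c = 0" "d = r" using z unfolding sum_option_bool V2 option.case r ac bd sum2 gm2_0 by simp_all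
      then have "y (Some h) = f h V2 (dl [] r)" for h using ac bd fv by (cases h) simp_all
      then have "\<forall>j. y j = case_option u f j V2 (dl [] r)" unfolding all_option_bool using r uv(1) by simp
      then show ?thesis unfolding V2 using dl_mem(4) by blast
    qed (use v in simp)
  next
    fix w :: "arrow list => 'k" assume "w \<in> sp (Pr V2) V3"
    then obtain r t where w: "w = dl [A23] r + dl [B23] t" using Pr_sp(6) by blast
    \<comment> \<open>The relation of \<open>w\<close> splits into the relations of the two copies
      of \<open>N3\<close> for \<open>r\<close> and \<open>t\<close>; the component in
      \<open>Pr V1\<close> is zero.\<close>
    let ?y = "case_option (dl [A12] 0) (\<lambda>b. if b then gm3 (dl [] r) (dl [] 0) else gm3 (dl [] t) (dl [] 0))"
    let ?z = "case_option (dl [A12] 0) (\<lambda>b. if b then gm3 (dl [] 0) (dl [] r) else gm3 (dl [] 0) (dl [] t))"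
    show "rel_lift (Pr V2) UNIV ?Y (case_option u f) (case_option s p') (gm2 w 0) (gm2 0 w)"
      unfolding rel_lift_def
    proof (rule exI[of _ ?y], rule exI[of _ ?z], intro conjI bexI[of _ 0])
      show "\<forall>j\<in>UNIV. ?y j \<in> sp (?Y j) V2" "\<forall>j\<in>UNIV. ?z j \<in> sp (?Y j) V2"
        unfolding ball_UNIV all_option_bool option.case by (simp_all add: c3.gm_in)
      show "(\<Sum>j\<in>UNIV. case_option s p' j V2 (?y j)) = gm2 w 0" "(\<Sum>j\<in>UNIV. case_option s p' j V2 (?z j)) = gm2 0 w"
        unfolding sum_option_bool option.case if_True if_False sum2 w by (simp_all add: dl_linear(3))
      have "mb (Pr V1) (dl [A12] 0) + mc (Pr V1) (dl [A12] 0) = u V3 0"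
        unfolding uv(3) dl_linear(3) module_mp_0[OF Pr_module] by simp
      then show "\<forall>j\<in>UNIV. mb (?Y j) (?y j) + mc (?Y j) (?z j) = case_option u f j V3 0"
        unfolding ball_UNIV all_option_bool option.case using rel qhom_0[OF f(1) Pr_module] by simp
    qed simp
  qed
  have s3: "exact_seq (Pr V1) (UNIV :: unit set) (\<lambda>b. N2) N1 (\<lambda>b. s) (\<lambda>b. u')"
  proof (rule exact_seq_Pr[OF c1.cox_axioms c2.N s(1) u'(1) c2.N3_gen])
    show "(\<Sum>b\<in>(UNIV :: unit set). u' V1 (s V1 (dl [] 1))) = 0"
      unfolding sum_unit using qhom_sp[OF u'(1) qhom_sp[OF s(1) dl_mem(5)]] N1_V1 by simp
  next
    fix v and m :: "arrow list => 'k" assume v: "v ~= V3" and m: "m \<in> sp N1 v"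
    have "\<exists>y\<in>sp N2 v. m = u' v y"
    proof (cases v)
      case V1
      then have "m = 0" using m N1_V1 by simp
      then show ?thesis using qhom_0[OF u'(1) c2.N] V1 by (intro bexI[of _ 0]) simp_all
    next
      case V2
      then obtain w w' where w: "w \<in> sp (Pr V1) V3" "w' \<in> sp (Pr V1) V3" "m = gm1 w w'" using c1.gm_surj m by blast
      then obtain a b c d where "w = dl [A12, A23] a + dl [A12, B23] b" "w' = dl [A12, A23] c + dl [A12, B23] d" unfolding Pr_sp(9) by blast
      then have "m = u' V2 (gm2 (dl [A23] a + dl [B23] b) (dl [A23] c + dl [B23] d))" unfolding uv' using w(3) by simp
      then show ?thesis unfolding V2 using c2.gm_in[OF Pr_V2_add Pr_V2_add] by blast
    qed (use v in simp)
    then obtain y where "y \<in> sp N2 v" "m = u' v y" by blast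
    then show "\<exists>y. (\<forall>b\<in>(UNIV :: unit set). y b \<in> sp N2 v) & m = (\<Sum>b\<in>UNIV. u' v (y b))"
      unfolding sum_unit by (intro exI[of _ "\<lambda>b. y"]) simp
  next
    fix v and y :: "unit => arrow list => 'k"
    assume v: "v ~= V3" and y: "\<forall>b\<in>UNIV. y b \<in> sp N2 v" and z: "(\<Sum>b\<in>UNIV. u' v (y b)) = 0"
    have "\<exists>w\<in>sp (Pr V1) v. y () = s v w"
    proof (cases v)
      case V1
      then obtain x where "x \<in> sp (Pr V2) V2" "ma N2 (y ()) = gm2 (mb (Pr V2) x) (mc (Pr V2) x)" using y c2.a_image by blast
      then obtain r where r: "ma N2 (y ()) = gm2 (dl [A23] r) (dl [B23] r)" using Pr_sp(5) bc by metis
      have "y () \<in> sp N2 V1" using y V1 by simp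
      then have "y () = s V1 (dl [] (- r))"
        by (rule c2.aN_eq[OF _ qhom_sp[OF s(1) dl_mem(5)]]) (simp add: r sa)
      then show ?thesis unfolding V1 using dl_mem(5) by blast
    next
      case V2
      then obtain a b c d where abcd: "y () = gm2 (dl [A23] a + dl [B23] b) (dl [A23] c + dl [B23] d)" using y N2_V2 by blast
      let ?w = "dl [A12, A23] a + dl [A12, B23] b" and ?w' = "dl [A12, A23] c + dl [A12, B23] d"
      have "gm1 ?w ?w' = 0" using z unfolding sum_unit V2 abcd uv' .
      moreover have "?w \<in> sp (Pr V1) V3" "?w' \<in> sp (Pr V1) V3" using Pr_sp(9) by blast+
      ultimately obtain x where x: "x \<in> sp (Pr V1) V1" "?w = mb (Pr V1) (ma (Pr V1) x)" "?w' = mc (Pr V1) (ma (Pr V1) x)"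
        using c1.gm_0[of ?w ?w'] by blast
      obtain r where "x = dl [] r" using x(1) Pr_sp(7) by blast
      then have eq: "?w = dl [A12, A23] r" "?w' = dl [A12, B23] r" using x(2,3) by (simp_all only: Pr_mps)
      have "a = r" "b = 0" "c = 0" "d = r"
        using fun_cong[OF eq(1), of "[A12, A23]"] fun_cong[OF eq(1), of "[A12, B23]"] fun_cong[OF eq(2), of "[A12, A23]"] fun_cong[OF eq(2), of "[A12, B23]"]
        by (simp_all add: dl_def)
      then have "y () = s V2 (dl [A12] (- r))" unfolding abcd sv by (simp add: dl_linear(3))
      then show ?thesis unfolding V2 using dl_mem(6) by blast
    qed (use v in simp)
    then show "\<exists>w\<in>sp (Pr V1) v. \<forall>b\<in>UNIV. y b = s v w" by (simp add: UNIV_unit)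
  next
    fix w :: "arrow list => 'k" assume "w \<in> sp (Pr V1) V3"
    then obtain r t where w: "w = dl [A12, A23] r + dl [A12, B23] t" using Pr_sp(9) by blast
    let ?w = "dl [A23] r + dl [B23] t"
    have eq: "u' V2 (gm2 ?w 0) = gm1 w 0" "u' V2 (gm2 0 ?w) = gm1 0 w"
      using uv'[of r t 0 0] uv'[of 0 0 r t] by (simp_all add: dl_linear(3) w)
    have rel2: "mb N2 (gm2 ?w 0) + mc N2 (gm2 0 ?w) = 0" using c2.N3_rel[OF c2.gm_in c2.gm_in, of ?w 0 0 ?w] Pr_V2_add[of r t] by auto
    show "rel_lift (Pr V1) (UNIV :: unit set) (\<lambda>b. N2) (\<lambda>b. s) (\<lambda>b. u') (gm1 w 0) (gm1 0 w)"
      unfolding rel_lift_def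
    proof (rule exI[of _ "\<lambda>b. gm2 ?w 0"], rule exI[of _ "\<lambda>b. gm2 0 ?w"], unfold sum_unit, intro conjI ballI)
      show "\<exists>x\<in>sp (Pr V1) V3. \<forall>b\<in>(UNIV :: unit set). mb N2 (gm2 ?w 0) + mc N2 (gm2 0 ?w) = s V3 x"
      proof (rule bexI[of _ 0], rule ballI)
        show "mb N2 (gm2 ?w 0) + mc N2 (gm2 0 ?w) = s V3 0" unfolding qhom_0[OF s(1) Pr_module] by (rule rel2)
      qed simp
    qed (use eq Pr_V2_add[of r t] in \<open>simp_all add: c2.gm_in\<close>)
  qed
  have "f True V2 (dl [] 1) ~= 0" unfolding fv gm3_0 by simp
  then have nf: "\<not> qzero (Pr V2) (f True)" unfolding qzero_def using dl_mem(4) by blast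
  have "s V2 (dl [A12] 1) ~= 0" unfolding sv gm2_diag_0 by simp
  then have ns: "\<not> qzero (Pr V1) s" unfolding qzero_def using dl_mem(6) by blast
  \<comment> \<open>One witness for both remaining maps. If its image in \<open>N1\<close> vanished,
    some element of \<open>Pr V1\<close> at 1 would have coefficient 1 along one path to 3 and 0
    along the other, whereas both coefficients agree.\<close>
  let ?n = "gm3 (dl [] 1) (dl [] 0)"
  have n: "?n \<in> sp N3 V2" by (rule c3.gm_in[OF dl_mem(1) dl_mem(1)])
  have pn: "p' True V2 ?n = gm2 (dl [A23] 1 + dl [B23] 0) (dl [A23] 0 + dl [B23] 0)" unfolding pv' by (simp add: dl_linear(3))
  have "u' V2 (p' True V2 ?n) ~= 0"
  proof
    assume "u' V2 (p' True V2 ?n) = 0"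
    then have "gm1 (dl [A12, A23] 1) 0 = 0" unfolding pn uv' by (simp add: dl_linear(3))
    then obtain x :: "arrow list => 'k" where x: "x \<in> sp (Pr V1) V1" "dl [A12, A23] 1 = mb (Pr V1) (ma (Pr V1) x)" "0 = mc (Pr V1) (ma (Pr V1) x)"
      using c1.gm_0[OF dl_mem(7) c1.A_0] by blast
    obtain r where "x = dl [] r" using x(1) Pr_sp(7) by blast
    then have eq: "(dl [A12, A23] 1 :: arrow list => 'k) = dl [A12, A23] r" "0 = (dl [A12, B23] r :: arrow list => 'k)" using x(2,3) by (simp_all only: Pr_mps)
    show False using fun_cong[OF eq(1), of "[A12, A23]"] fun_cong[OF eq(2), of "[A12, B23]"] by (simp add: dl_def)
  qed
  then have nu: "\<not> qzero N3 (\<lambda>v x. u' v (p' True v x))" unfolding qzero_def using n by blast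
  then have np: "\<not> qzero N3 (p' True)" unfolding qzero_def using qhom_0[OF u'(1) c2.N] by metis
  have "mesh (case_vertex (Pr V1) (Pr V2) (Pr V3)) (case_vertex N1 N2 N3) p f u s p' u'"
    unfolding mesh_def vertex.case using e1 s2 s3 nf ns np nu by blast
  then show ?thesis by blast
qed

text \<open>\<open>Pr V1\<close> is generated at 1, where \<open>N3\<close> is zero.\<close>

lemma hom_Pr_V1_zero: "Qhom (Pr V1) N3 F ==> qzero (Pr V1) F"
proof -
  assume F: "Qhom (Pr V1) N3 F"
  have Z: "Qhom (Pr V1) N3 (\<lambda>v x. 0)" unfolding qhom_def lin_def using module_mp_0[OF c3.N] by simp
  have "F V1 (dl [] 1) = 0" using qhom_sp[OF F dl_mem(5)] N3_V1 by blast
  then show ?thesis unfolding qzero_def using proj_hom_eq[OF finite_path_Q F Z] by blast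
qed

text \<open>The two generators of \<open>N3\<close> at 2 satisfy one relation at 3. In
  \<open>Pr V1\<close> the space at 2 is a line with independent images under the two arrows, so the
  relation forces both generators to go to zero.\<close>

lemma hom_N3_zero:
  assumes G: "Qhom N3 (Pr V1) G"
  shows "qzero N3 G"
proof (rule c3.qhom_zero_V2[OF Pr_module G])
  have g: "gm3 (dl [] r) (dl [] t) \<in> sp N3 V2" for r t by (rule c3.gm_in[OF dl_mem(1) dl_mem(1)])
  fix n assume "n \<in> sp N3 V2"
  then obtain r t where n: "n = gm3 (dl [] r) (dl [] t)" using N3_V2 by blast
  obtain a where a: "G V2 (gm3 (dl [] 1) (dl [] 0)) = dl [A12] a" using qhom_sp[OF G g] Pr_sp(8) by blast
  obtain b where b: "G V2 (gm3 (dl [] 0) (dl [] 1)) = dl [A12] b" using qhom_sp[OF G g] Pr_sp(8) by blast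
  have "mb N3 (gm3 (dl [] 1) (dl [] 0)) + mc N3 (gm3 (dl [] 0) (dl [] 1)) = 0"
    using c3.N3_rel[OF c3.gm_in c3.gm_in, of "dl [] 1" 0 0 "dl [] 1"] dl_mem(1)[of 1] by (auto simp: dl_linear(3))
  then have "G V3 (mb N3 (gm3 (dl [] 1) (dl [] 0)) + mc N3 (gm3 (dl [] 0) (dl [] 1))) = 0" using qhom_0[OF G c3.N] by simp
  then have "dl [A12, A23] a + dl [A12, B23] b = 0"
    unfolding qhom_plus[OF G Qmod_mp(2)[OF c3.N g] Qmod_mp(3)[OF c3.N g]] qhom_Q_mp(2)[OF G g] qhom_Q_mp(3)[OF G g] a b Pr_mps .
  then have "a = 0" "b = 0" by (simp_all add: dl_add_eq_0)
  have split: "n = vscale r (gm3 (dl [] 1) (dl [] 0)) + vscale t (gm3 (dl [] 0) (dl [] 1))"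
    using gm3_split[of r t]
      lin2_scale[OF c3.gm_lin dl_mem(1) dl_mem(1), of r 1 0] lin2_scale[OF c3.gm_lin dl_mem(1) dl_mem(1), of t 0 1]
    unfolding n by (simp add: dl_linear(2)[symmetric] dl_linear(3))
  show "G V2 n = 0"
    unfolding split qhom_plus[OF G subsp_scale[OF c3.N_sub g] subsp_scale[OF c3.N_sub g]]
      qhom_scale[OF G g] a b \<open>a = 0\<close> \<open>b = 0\<close> by (simp add: dl_linear(3))
qed (auto simp: Pr_sp Pr_mps)

end

section \<open>The three families of modules\<close>

lemma qsurj_len:
  assumes "is_module G M" "qhom G M N f" "qsurj M N f"
  shows "len N \<le> len M"
proof -
  have "f v ` sp M v = sp N v" for v
  proof (intro equalityI image_subsetI subsetI)
    show "f v x \<in> sp N v" if "x \<in> sp M v" for x by (rule qhom_sp[OF assms(2) that])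
    fix y assume "y \<in> sp N v"
    then obtain x where "x \<in> sp M v" "f v x = y" using assms(3) unfolding qsurj_def by blast
    then show "y \<in> f v ` sp M v" by blast
  qed
  then have "len (qimage G M N f) = len N" by (simp add: len_def)
  then show ?thesis using len_image_le[OF assms(1,2)] by simp
qed

text \<open>The formula for the measure is kept next to the statement on submodules because the
  comparison of the candidates computes with it.\<close>

definition gr_reduces :: "('b, 'k::field) qrep => ('b, 'k) qrep => bool" where
  "gr_reduces M Y \<longleftrightarrow> \<mu> M = insert (len M) (\<mu> Y) & (\<exists>X. gr_submodule quiver_Q X M) &
    (\<forall>X. gr_submodule quiver_Q X M --> isomorphic quiver_Q X Y)"

text \<open>Supplies the injectivity of the irreducible map: \<open>lt\<close> excludes
  surjectivity, endomorphisms of the brick \<open>Y j\<close> are zero or injective, and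
  \<open>alt\<close> leaves no nonzero maps to the other candidates.\<close>

lemma gr_reducesI:
  fixes M :: "('b, 'k::field) qrep"
  assumes fin: "finite J" and ras: "right_almost_split M J Y \<beta>" and M: "indec M" and j: "j \<in> J" and Yj: "indec (Y j)" "brick (Y j)"
    and nz: "\<not> qzero (Y j) (\<beta> j)" and lt: "len (Y j) < len M"
    and alt: "\<And>k. k \<in> J ==> Y k = Y j \<or> (indec (Y k) & gr_less (\<mu> (Y k)) (\<mu> (Y j)) & (\<forall>F. Qhom (Y j) (Y k) F --> qzero (Y j) F))"
  shows "gr_reduces M (Y j)"
proof -
  have ns: "\<not> qsurj (Y j) M (\<beta> j)"
    using qsurj_len[OF indec_module[OF Yj(1)] right_almost_splitD(2)[OF ras j]] lt by auto
  have "qinj (Y j) (\<beta> j)"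
  proof (rule component_injective[OF ras indec_module[OF M] j ns nz])
    show "qzero (Y j) F \<or> qinj (Y j) F" if "k \<in> J" "Qhom (Y j) (Y k) F" for k F
      using alt[OF that(1)] that(2) brick_endo[OF Yj(2), of F] by auto
  qed
  then have "\<mu> M = insert (len M) (\<mu> (Y j))" "\<exists>X. gr_submodule quiver_Q X M" "gr_submodule quiver_Q X M ==> isomorphic quiver_Q X (Y j)" for X
    using gr_right_almost_split[OF fin ras M j Yj(1) _ lt] alt by blast+
  then show ?thesis unfolding gr_reduces_def by blast
qed

text \<open>\<open>m\<close> is the first difference, since \<open>n\<close> comes later: of two
  continuations of a common beginning the one with the smaller number wins.\<close>

lemma gr_less_insert_min:
  assumes "m < n" "\<And>k. k \<in> I ==> k < m"
  shows "gr_less (insert n I) (insert m I)"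
  unfolding gr_less_iff using assms by (intro bexI[of _ m]) force+

lemma gr_less_insert_top: "(\<And>k. k \<in> I ==> k < n) ==> gr_less J I ==> gr_less J (insert n I)"
  using gr_less_trans[OF _ gr_less_insert_right] by blast

text \<open>A single family indexed by the vertex, so that inductions treat the three orbits at
  once.\<close>

locale tau_orbits =
  fixes P :: "vertex => nat => (arrow list, 'k::field) qrep"
  assumes P_def: "P v i = (tau_inv quiver_Q ^^ i) (Pr v)"
begin

lemma P_induct: "Qmod (P v i) & kgood (P v i) & brick (P v i)"
proof (induction i)
  case 0
  show ?case by (simp add: P_def Pr_module Pr_kgood Pr_brick)
next
  case (Suc i)
  have "P v (Suc i) = tau_inv quiver_Q (P v i)" by (simp add: P_def)
  then obtain gm where c: "cox (P v i) (P v (Suc i)) gm" using cox_tau_inv[of "P v i"] Suc by auto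
  show ?case using cox.N[OF c] cox.kgood_N[OF c] cox.brick_N[OF c] Suc by blast
qed

lemma P_module: "Qmod (P v i)" and P_brick: "brick (P v i)"
  using P_induct by blast+

lemma P_cox: "\<exists>gm. cox (P v i) (P v (Suc i)) gm"
  using cox_tau_inv[of "P v i"] P_induct[of v i] by (auto simp: P_def)

lemma P_mesh_base: "\<exists>N1 N2 N3 gm1 gm2 gm3. mesh_base N1 N2 N3 gm1 gm2 gm3 & N1 = P V1 (Suc 0) & N2 = P V2 (Suc 0) & N3 = P V3 (Suc 0)"
  using P_cox[of V1 0] P_cox[of V2 0] P_cox[of V3 0] by (auto simp: mesh_base_def P_def)

lemma P_mesh: "\<exists>p f u s p' u'. mesh (\<lambda>v. P v i) (\<lambda>v. P v (Suc i)) p f u s p' u'"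
proof (induction i)
  case 0
  have eq: "case_vertex (P V1 i) (P V2 i) (P V3 i) = (\<lambda>v. P v i)" for i by (rule ext) (simp split: vertex.split)
  obtain N1 N2 N3 gm1 gm2 gm3 where b: "mesh_base N1 N2 N3 gm1 gm2 gm3"
    "N1 = P V1 (Suc 0)" "N2 = P V2 (Suc 0)" "N3 = P V3 (Suc 0)" using P_mesh_base by blast
  have Pr: "P v 0 = Pr v" for v by (simp add: P_def)
  show ?case using mesh_base.mesh_exists[OF b(1)] unfolding b(2-4) Pr[symmetric] eq .
next
  case (Suc i)
  then obtain p f u s p' u' where m: "mesh (\<lambda>v. P v i) (\<lambda>v. P v (Suc i)) p f u s p' u'" by blast
  have "\<exists>gm. \<forall>v. cox (P v j) (P v (Suc j)) (gm v)" for j using P_cox[of _ j] by (intro choice allI)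
  then obtain gm where gm: "\<And>j v. cox (P v j) (P v (Suc j)) (gm j v)" by metis
  show ?case by (rule mesh_step[OF m, where N = "\<lambda>v. P v (Suc i)" and N' = "\<lambda>v. P v (Suc (Suc i))", OF gm gm])
qed

text \<open>Checked for the first pair of candidates and carried along the orbits by fullness of the
  transform.\<close>

lemma P_hom_zero:
  shows "Qhom (P V1 i) (P V3 (Suc i)) F ==> qzero (P V1 i) F"
    and "Qhom (P V3 (Suc i)) (P V1 i) G ==> qzero (P V3 (Suc i)) G"
proof -
  have "(\<forall>F. Qhom (P V1 i) (P V3 (Suc i)) F --> qzero (P V1 i) F) &
      (\<forall>F. Qhom (P V3 (Suc i)) (P V1 i) F --> qzero (P V3 (Suc i)) F)"
  proof (induction i)
    case 0
    obtain N1 N2 N3 gm1 gm2 gm3 where b: "mesh_base N1 N2 N3 gm1 gm2 gm3" "N3 = P V3 (Suc 0)" using P_mesh_base by blast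
    have Pr: "P V1 0 = Pr V1" by (simp add: P_def)
    show ?case unfolding Pr b(2)[symmetric] using mesh_base.hom_Pr_V1_zero[OF b(1)] mesh_base.hom_N3_zero[OF b(1)] by blast
  next
    case (Suc i)
    obtain gm where 1: "cox (P V1 i) (P V1 (Suc i)) gm" using P_cox[of V1 i] by (elim exE)
    obtain gm' where 3: "cox (P V3 (Suc i)) (P V3 (Suc (Suc i))) gm'" using P_cox[of V3 "Suc i"] by (elim exE)
    have c: "cox_pair (P V1 i) (P V1 (Suc i)) gm (P V3 (Suc i)) (P V3 (Suc (Suc i))) gm'"
      "cox_pair (P V3 (Suc i)) (P V3 (Suc (Suc i))) gm' (P V1 i) (P V1 (Suc i)) gm"
      using 1 3 by (simp_all add: cox_pair_def)
    show ?case
    proof (intro conjI allI impI)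
      show "qzero (P V1 (Suc i)) F" if "Qhom (P V1 (Suc i)) (P V3 (Suc (Suc i))) F" for F
        by (rule cox_pair.qzero_preserved[OF c(1) _ that]) (use Suc in blast)
      show "qzero (P V3 (Suc (Suc i))) F" if "Qhom (P V3 (Suc (Suc i))) (P V1 (Suc i)) F" for F
        by (rule cox_pair.qzero_preserved[OF c(2) _ that]) (use Suc in blast)
    qed
  qed
  then show "Qhom (P V1 i) (P V3 (Suc i)) F ==> qzero (P V1 i) F"
    and "Qhom (P V3 (Suc i)) (P V1 i) G ==> qzero (P V3 (Suc i)) G" by blast+
qed

subsection \<open>Lengths\<close>

lemma P_dim_step:
  "vdim (sp (P v (Suc i)) V1) + vdim (sp (P v i) V1) = vdim (sp (P v i) V2)"
  "vdim (sp (P v (Suc i)) V2) + vdim (sp (P v i) V1) = 2 * vdim (sp (P v i) V3)"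
  "vdim (sp (P v (Suc i)) V3) + vdim (sp (P v i) V3) = 2 * vdim (sp (P v (Suc i)) V2)"
  using P_cox[of v i] cox.dim_V1 cox.dim_V2 cox.dim_V3 by blast+

text \<open>The defects of the three identities depend linearly on the dimension vectors, so they
  obey the same recursion as these under the transform; they vanish for \<open>i = 0\<close>, hence
  always.\<close>

lemma P_dim_mesh:
  "vdim (sp (P V3 i) v) + vdim (sp (P V3 (Suc i)) v) = 2 * vdim (sp (P V2 i) v)"
  "vdim (sp (P V2 i) v) + vdim (sp (P V2 (Suc i)) v) = vdim (sp (P V1 i) v) + 2 * vdim (sp (P V3 (Suc i)) v)"
  "vdim (sp (P V1 i) v) + vdim (sp (P V1 (Suc i)) v) = vdim (sp (P V2 (Suc i)) v)"
proof -
  define D where "D u i v = int (vdim (sp (P u i) v))" for u i v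
  have s: "D u (Suc i) V1 = D u i V2 - D u i V1" "D u (Suc i) V2 = 2 * D u i V3 - D u i V1"
      "D u (Suc i) V3 = 3 * D u i V3 - 2 * D u i V1" for u i
    using P_dim_step[of u i] unfolding D_def by linarith+
  define E1 where "E1 i v = D V3 i v + D V3 (Suc i) v - 2 * D V2 i v" for i v
  define E2 where "E2 i v = D V2 i v + D V2 (Suc i) v - D V1 i v - 2 * D V3 (Suc i) v" for i v
  define E3 where "E3 i v = D V1 i v + D V1 (Suc i) v - D V2 (Suc i) v" for i v
  have E: "E (Suc i) V1 = E i V2 - E i V1 & E (Suc i) V2 = 2 * E i V3 - E i V1 & E (Suc i) V3 = 3 * E i V3 - 2 * E i V1"
    if "E \<in> {E1, E2, E3}" for E i
    using that by (auto simp: E1_def E2_def E3_def s)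
  \<comment> \<open>One step of the recursion from the dimension vectors (1,1,2), (0,1,2), (0,0,1)
    of the projectives.\<close>
  have E0: "E1 0 v = 0 & E2 0 v = 0 & E3 0 v = 0" for v
    unfolding E1_def E2_def E3_def by (cases v) (simp_all add: s, simp_all add: D_def P_def dim_Prs)
  have Ez: "E i v = 0" if "E \<in> {E1, E2, E3}" for E i v
  proof (induction i arbitrary: v)
    case 0
    show ?case using E0 that by auto
  next
    case (Suc i)
    then show ?case using E[OF that, of i] by (cases v) simp_all
  qed
  have "E1 i v = 0" "E2 i v = 0" "E3 i v = 0" by (rule Ez, simp)+
  then have "D V3 i v + D V3 (Suc i) v = 2 * D V2 i v" "D V2 i v + D V2 (Suc i) v = D V1 i v + 2 * D V3 (Suc i) v"
      "D V1 i v + D V1 (Suc i) v = D V2 (Suc i) v"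
    unfolding E1_def E2_def E3_def by linarith+
  then show "vdim (sp (P V3 i) v) + vdim (sp (P V3 (Suc i)) v) = 2 * vdim (sp (P V2 i) v)"
    "vdim (sp (P V2 i) v) + vdim (sp (P V2 (Suc i)) v) = vdim (sp (P V1 i) v) + 2 * vdim (sp (P V3 (Suc i)) v)"
    "vdim (sp (P V1 i) v) + vdim (sp (P V1 (Suc i)) v) = vdim (sp (P V2 (Suc i)) v)"
    unfolding D_def by linarith+
qed

lemma P_len_mesh:
  "len (P V3 i) + len (P V3 (Suc i)) = 2 * len (P V2 i)"
  "len (P V2 i) + len (P V2 (Suc i)) = len (P V1 i) + 2 * len (P V3 (Suc i))"
  "len (P V1 i) + len (P V1 (Suc i)) = len (P V2 (Suc i))"
  using P_dim_mesh(1)[of i V1] P_dim_mesh(1)[of i V2] P_dim_mesh(1)[of i V3] P_dim_mesh(2)[of i V1] P_dim_mesh(2)[of i V2] P_dim_mesh(2)[of i V3]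
    P_dim_mesh(3)[of i V1] P_dim_mesh(3)[of i V2] P_dim_mesh(3)[of i V3]
  by (simp_all only: len_def add_mult_distrib2)

lemma P_len_0: "len (P V1 0) = 4" "len (P V2 0) = 3" "len (P V3 0) = 1"
  by (simp_all add: len_def P_def dim_Prs)

lemma P_len_less: "len (P V3 i) < len (P V2 i)" and P_len_pos: "0 < len (P V1 i)"
proof -
  have "len (P V3 i) < len (P V2 i) & 0 < len (P V1 i)"
  proof (induction i)
    case (Suc i)
    then show ?case using P_len_mesh[of i] by linarith
  qed (simp add: P_len_0)
  then show "len (P V3 i) < len (P V2 i)" "0 < len (P V1 i)" by blast+
qed

text \<open>These inequalities decide which numbers are added last to a measure. For
  \<open>V1\<close>, \<open>V2\<close>, \<open>V3\<close> the lengths start with 4, 3, 1 and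
  continue with 7, 11, 5.\<close>

lemma P_len_order:
  "len (P V2 i) < len (P V3 (Suc i))" "len (P V1 (Suc i)) < len (P V2 (Suc i))" "len (P V3 (Suc i)) < len (P V1 (Suc i))"
  "len (P V1 i) < len (P V2 (Suc i))" "len (P V1 i) < len (P V1 (Suc i))"
proof -
  show "len (P V2 i) < len (P V3 (Suc i))" for i using P_len_mesh(1)[of i] P_len_less[of i] by linarith
  show *: "len (P V1 (Suc i)) < len (P V2 (Suc i))" for i using P_len_mesh(3)[of i] P_len_pos[of i] by linarith
  show "len (P V3 (Suc i)) < len (P V1 (Suc i))" using P_len_mesh[of i] P_len_less[of i] by linarith
  show "len (P V1 i) < len (P V2 (Suc i))" using P_len_mesh(3)[of i] P_len_pos[of "Suc i"] by linarith
  show "len (P V1 i) < len (P V1 (Suc i))"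
  proof (cases i)
    case 0
    then show ?thesis using P_len_mesh[of 0] P_len_0 by simp
  next
    case (Suc n)
    show ?thesis using P_len_mesh[of i] P_len_less[of i] *[of n] unfolding Suc by linarith
  qed
qed

lemma P_indec: "indec (P v i)"
proof (rule brick_indec[OF P_module P_brick])
  have "0 < len (P V3 i)" using P_len_0(3) P_len_order(1) by (cases i) (simp, metis gr_zeroI less_nat_zero_code)
  then have "0 < len (P v i)" using P_len_less[of i] P_len_pos[of i] by (cases v) auto
  then show "\<not> is_zero (P v i)" using is_zero_len[OF P_module] by simp
qed

subsection \<open>Gabriel-Roiter submodules\<close>

text \<open>For projectives the radical takes the place of a mesh. All arrows out of
  \<open>i\<close> end in the same vertex, which leaves one candidate.\<close>

lemma gr_P_0:
  fixes a :: "'j::finite => arrow"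
  assumes a: "bij_betw a UNIV {b. src quiver_Q b = i}" "\<And>j. tgt quiver_Q (a j) = k" and lt: "len (P k 0) < len (P i 0)"
  shows "gr_reduces (P i 0) (P k 0)"
proof -
  have Pr: "P v 0 = Pr v" for v by (simp add: P_def)
  have ras: "right_almost_split (P i 0) UNIV (\<lambda>j. P k 0) (\<lambda>j v. prepend_arrow (a j))"
    unfolding Pr using Pr_right_almost_split[OF a(1)] by (simp only: a(2))
  have nz: "\<not> qzero (P k 0) (\<lambda>v. prepend_arrow (a j))" for j
  proof
    assume "qzero (P k 0) (\<lambda>v. prepend_arrow (a j))"
    then have "x = 0" if "x \<in> sp (P k 0) v" for v x using prepend_qinj[of quiver_Q k "a j"] that unfolding Pr qzero_def qinj_def by blast
    then have "is_zero (P k 0)" unfolding is_zero_def using module_0[OF P_module] by blast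
    then show False using P_indec[of k 0] by (simp add: indecomposable_def)
  qed
  show ?thesis using gr_reducesI[OF _ ras P_indec UNIV_I P_indec P_brick nz lt] by simp
qed

lemma gr_P2_0: "gr_reduces (P V2 0) (P V3 0)"
proof (rule gr_P_0[of step])
  have "{b. src quiver_Q b = V2} = {A23, B23}" by (auto, metis arrow.exhaust quiver_Q_sel(1) vertex.distinct(1))
  then show "bij_betw step UNIV {b. src quiver_Q b = V2}" by (auto simp: bij_betw_def inj_on_def step_def UNIV_bool)
  show "tgt quiver_Q (step j) = V3" for j by (simp add: step_def)
qed (simp add: P_len_0)

lemma gr_P1_0: "gr_reduces (P V1 0) (P V2 0)"
proof (rule gr_P_0[of "\<lambda>j :: unit. A12"])
  have "{b. src quiver_Q b = V1} = {A12}" by (auto, metis arrow.exhaust quiver_Q_sel(2,3) vertex.distinct(1))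
  then show "bij_betw (\<lambda>j :: unit. A12) UNIV {b. src quiver_Q b = V1}" by (auto simp: bij_betw_def inj_on_def)
qed (simp_all add: P_len_0)

text \<open>The first mesh has two copies of the same middle term, so there is nothing to
  compare.\<close>

lemma gr_P3: "gr_reduces (P V3 (Suc i)) (P V2 i)"
proof -
  obtain p f u s p' u' where m: "mesh (\<lambda>v. P v i) (\<lambda>v. P v (Suc i)) p f u s p' u'" using P_mesh by blast
  obtain gm where c: "cox (P V3 i) (P V3 (Suc i)) gm" using P_cox by blast
  have ras: "right_almost_split (P V3 (Suc i)) UNIV (\<lambda>b. P V2 i) f"
    using m exact_seq_right_almost_split[OF c _ P_brick] unfolding mesh_def by blast
  have nz: "\<not> qzero (P V2 i) (f True)" using m unfolding mesh_def by blast
  show ?thesis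
    using gr_reducesI[OF _ ras P_indec UNIV_I P_indec P_brick nz] P_len_order(1)[of i] by simp
qed

text \<open>The middle mesh offers two candidates without nonzero maps between them. The comparison
  of their measures is left as a hypothesis, because it is settled only afterwards by an induction
  that uses this lemma.\<close>

lemma gr_P2:
  shows "gr_less (\<mu> (P V3 (Suc i))) (\<mu> (P V1 i)) ==> gr_reduces (P V2 (Suc i)) (P V1 i)"
    and "gr_less (\<mu> (P V1 i)) (\<mu> (P V3 (Suc i))) ==> gr_reduces (P V2 (Suc i)) (P V3 (Suc i))"
proof -
  obtain p f u s p' u' where m: "mesh (\<lambda>v. P v i) (\<lambda>v. P v (Suc i)) p f u s p' u'" using P_mesh by blast
  obtain gm where c: "cox (P V2 i) (P V2 (Suc i)) gm" using P_cox by blast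
  let ?Y = "case_option (P V1 i) (\<lambda>b :: bool. P V3 (Suc i))"
  have ras: "right_almost_split (P V2 (Suc i)) UNIV ?Y (case_option s p')"
    using m exact_seq_right_almost_split[OF c _ P_brick] unfolding mesh_def by blast
  have "\<not> qzero (P V1 i) s" "\<not> qzero (P V3 (Suc i)) (p' True)" using m unfolding mesh_def by blast+
  then have nz: "\<not> qzero (?Y None) (case_option s p' None)" "\<not> qzero (?Y (Some True)) (case_option s p' (Some True))" by simp_all
  have Y: "indec (?Y j)" "brick (?Y j)" for j by (cases j; simp add: P_indec P_brick)+
  show "gr_reduces (P V2 (Suc i)) (P V1 i)" if "gr_less (\<mu> (P V3 (Suc i))) (\<mu> (P V1 i))"
  proof -
    have alt: "?Y k = ?Y None \<or> (indec (?Y k) & gr_less (\<mu> (?Y k)) (\<mu> (?Y None)) & (\<forall>F. Qhom (?Y None) (?Y k) F --> qzero (?Y None) F))" for k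
      using that P_hom_zero(1)[of i] P_indec by (cases k) auto
    show ?thesis using gr_reducesI[OF _ ras P_indec UNIV_I Y nz(1) _ alt] P_len_order(4)[of i] by simp
  qed
  show "gr_reduces (P V2 (Suc i)) (P V3 (Suc i))" if "gr_less (\<mu> (P V1 i)) (\<mu> (P V3 (Suc i)))"
  proof -
    have alt: "?Y k = ?Y (Some True) \<or> (indec (?Y k) & gr_less (\<mu> (?Y k)) (\<mu> (?Y (Some True))) &
        (\<forall>F. Qhom (?Y (Some True)) (?Y k) F --> qzero (?Y (Some True)) F))" for k
      using that P_hom_zero(2)[of i] P_indec by (cases k) auto
    show ?thesis using gr_reducesI[OF _ ras P_indec UNIV_I Y nz(2) _ alt] P_len_less[of "Suc i"] by simp
  qed
qed

text \<open>A non-surjective map to \<open>P V1 (Suc i)\<close> lifts to \<open>P V2 (Suc i)\<close>, where it is again not surjective;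
  the component through \<open>P V1 i\<close> dies because \<open>u' \<circ> s = 0\<close>.\<close>

lemma gr_P1: "gr_reduces (P V1 (Suc i)) (P V3 (Suc i))"
proof -
  obtain p f u s p' u' where m: "mesh (\<lambda>v. P v i) (\<lambda>v. P v (Suc i)) p f u s p' u'" using P_mesh by blast
  obtain gm1 where c1: "cox (P V1 i) (P V1 (Suc i)) gm1" using P_cox by blast
  obtain gm2 where c2: "cox (P V2 i) (P V2 (Suc i)) gm2" using P_cox by blast
  have e2: "exact_seq (P V2 i) UNIV (case_option (P V1 i) (\<lambda>b. P V3 (Suc i))) (P V2 (Suc i)) (case_option u f) (case_option s p')"
    and e3: "exact_seq (P V1 i) (UNIV :: unit set) (\<lambda>b. P V2 (Suc i)) (P V1 (Suc i)) (\<lambda>b. s) (\<lambda>b. u')"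
    using m unfolding mesh_def by blast+
  note ras2 = exact_seq_right_almost_split[OF c2 e2 P_brick] and ras1 = exact_seq_right_almost_split[OF c1 e3 P_brick]
  have p': "Qhom (P V3 (Suc i)) (P V2 (Suc i)) (p' b)" for b using exact_seqD(3)[OF e2, of "Some b"] by simp
  have s: "Qhom (P V1 i) (P V2 (Suc i)) s" using exact_seqD(2)[OF e3] by simp
  have u': "Qhom (P V2 (Suc i)) (P V1 (Suc i)) u'" using exact_seqD(3)[OF e3] by simp
  have us: "u' v (s v w) = 0" if "w \<in> sp (P V1 i) v" for v w using exact_seqD(5)[OF e3 that] unfolding sum_unit .
  have ras: "right_almost_split (P V1 (Suc i)) UNIV (\<lambda>b. P V3 (Suc i)) (\<lambda>b v x. u' v (p' b v x))"
    unfolding right_almost_split_def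
  proof (intro conjI ballI allI impI)
    show "Qhom (P V3 (Suc i)) (P V1 (Suc i)) (\<lambda>v x. u' v (p' b v x))" for b by (rule qhom_comp[OF p' u'])
    fix X :: "(arrow list, 'k) qrep" and \<eta>
    assume "Qmod X & Qhom X (P V1 (Suc i)) \<eta> & \<not> qsurj X (P V1 (Suc i)) \<eta>"
    then have X: "Qmod X" and \<eta>: "Qhom X (P V1 (Suc i)) \<eta>" and ns: "\<not> qsurj X (P V1 (Suc i)) \<eta>" by auto
    obtain h0 where h0: "\<forall>j\<in>(UNIV :: unit set). Qhom X (P V2 (Suc i)) (h0 j)" "\<forall>v. \<forall>x\<in>sp X v. \<eta> v x = (\<Sum>j\<in>(UNIV :: unit set). u' v (h0 j v x))"
      using right_almost_splitD(3)[OF ras1 X \<eta> ns] by blast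
    define h where "h = h0 ()"
    have h: "Qhom X (P V2 (Suc i)) h" "\<And>v x. x \<in> sp X v ==> \<eta> v x = u' v (h v x)" using h0 by (simp_all add: h_def sum_unit)
    have "\<not> qsurj X (P V2 (Suc i)) h"
    proof
      assume hs: "qsurj X (P V2 (Suc i)) h"
      have "\<exists>x\<in>sp X v. \<eta> v x = y" if y: "y \<in> sp (P V1 (Suc i)) v" for v y
      proof -
        obtain z where z: "\<forall>j\<in>(UNIV :: unit set). z j \<in> sp (P V2 (Suc i)) v" "y = (\<Sum>j\<in>(UNIV :: unit set). u' v (z j))"
          using exact_seqD(4)[OF e3 y] by blast
        obtain x where x: "x \<in> sp X v" "h v x = z ()" using hs z(1) unfolding qsurj_def by blast
        have "\<eta> v x = y" unfolding h(2)[OF x(1)] x(2) z(2) sum_unit ..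
        then show ?thesis using x(1) by blast
      qed
      then show False using ns unfolding qsurj_def by blast
    qed
    then obtain g where g: "\<forall>j\<in>UNIV. Qhom X (case_option (P V1 i) (\<lambda>b. P V3 (Suc i)) j) (g j)"
        "\<forall>v. \<forall>x\<in>sp X v. h v x = (\<Sum>j\<in>UNIV. case_option s p' j v (g j v x))"
      using right_almost_splitD(3)[OF ras2 X h(1)] by blast
    have gN: "Qhom X (P V1 i) (g None)" and gS: "Qhom X (P V3 (Suc i)) (g (Some b))" for b
      using g(1)[rule_format, of None] g(1)[rule_format, of "Some b"] by simp_all
    show "\<exists>h. (\<forall>j\<in>UNIV. Qhom X (P V3 (Suc i)) (h j)) & (\<forall>v. \<forall>x\<in>sp X v. \<eta> v x = (\<Sum>j\<in>UNIV. u' v (p' j v (h j v x))))"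
    proof (intro exI[of _ "\<lambda>b. g (Some b)"] conjI ballI allI)
      fix v x assume x: "x \<in> sp X v"
      let ?a = "s v (g None v x)" and ?b = "p' True v (g (Some True) v x)" and ?c = "p' False v (g (Some False) v x)"
      have mem: "?a \<in> sp (P V2 (Suc i)) v" "?b \<in> sp (P V2 (Suc i)) v" "?c \<in> sp (P V2 (Suc i)) v"
        using qhom_sp[OF s qhom_sp[OF gN x]] qhom_sp[OF p' qhom_sp[OF gS x]] by blast+
      have bc: "?b + ?c \<in> sp (P V2 (Suc i)) v" by (rule module_add[OF P_module mem(2,3)])
      have hv: "h v x = ?a + (?b + ?c)" using g(2) x unfolding sum_option_bool option.case by blast
      show "\<eta> v x = (\<Sum>j\<in>UNIV. u' v (p' j v (g (Some j) v x)))"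
        unfolding sum_bool h(2)[OF x] hv qhom_plus[OF u' mem(1) bc] qhom_plus[OF u' mem(2,3)] us[OF qhom_sp[OF gN x]] by (rule add_0_left)
    qed (rule gS)
  qed (rule P_module)
  have nz: "\<not> qzero (P V3 (Suc i)) (\<lambda>v x. u' v (p' True v x))" using m unfolding mesh_def by blast
  show ?thesis
    using gr_reducesI[OF _ ras P_indec UNIV_I P_indec P_brick nz] P_len_order(3)[of i] by simp
qed

lemma \<mu>_bound: "k \<in> \<mu> (P v i) ==> k \<le> len (P v i)"
  by (rule gr_measure_bound[OF P_indec])

text \<open>The winner at \<open>i\<close> is the Gabriel-Roiter submodule of
  \<open>P V2 (Suc i)\<close> and so enters the measure of \<open>P V3 (Suc (Suc i))\<close>,
  whereas the measure of \<open>P V1 (Suc i)\<close> always extends that of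
  \<open>P V3 (Suc i)\<close>. Hence the outcome depends on whether \<open>P V3 (Suc i)\<close> won,
  and it alternates.\<close>

theorem compare_P:
  "if even i then gr_less (\<mu> (P V3 (Suc i))) (\<mu> (P V1 i)) else gr_less (\<mu> (P V1 i)) (\<mu> (P V3 (Suc i)))"
proof (induction i)
  case 0
  have "\<mu> (P V3 (Suc 0)) = insert (len (P V3 (Suc 0))) (\<mu> (P V2 0))" "\<mu> (P V1 0) = insert (len (P V1 0)) (\<mu> (P V2 0))"
    using gr_P3[of 0] gr_P1_0 by (simp_all add: gr_reduces_def)
  \<comment> \<open>Here 4 is compared with 5: both measures extend \<open>\<mu> (P V2 0)\<close> by
    the length of the module.\<close>
  moreover have "len (P V1 0) < len (P V3 (Suc 0))" "len (P V2 0) < len (P V1 0)" using P_len_0 P_len_mesh(1)[of 0] by simp_all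
  moreover have "k < len (P V1 0)" if "k \<in> \<mu> (P V2 0)" for k using \<mu>_bound[OF that] calculation(4) by simp
  ultimately have "gr_less (\<mu> (P V3 (Suc 0))) (\<mu> (P V1 0))" by (simp add: gr_less_insert_min)
  then show ?case by simp
next
  case (Suc i)
  have m3: "\<mu> (P V3 (Suc (Suc i))) = insert (len (P V3 (Suc (Suc i)))) (\<mu> (P V2 (Suc i)))"
    and m1: "\<mu> (P V1 (Suc i)) = insert (len (P V1 (Suc i))) (\<mu> (P V3 (Suc i)))"
    using gr_P3[of "Suc i"] gr_P1[of i] by (simp_all add: gr_reduces_def)
  note l = P_len_order[of i] P_len_order(1)[of "Suc i"]
  show ?case
  proof (cases "even i")
    case True
    then have less: "gr_less (\<mu> (P V3 (Suc i))) (\<mu> (P V1 i))" using Suc by simp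
    then have m2: "\<mu> (P V2 (Suc i)) = insert (len (P V2 (Suc i))) (\<mu> (P V1 i))" using gr_P2(1) by (simp add: gr_reduces_def)
    \<comment> \<open>\<open>P V1 (Suc i)\<close> is built on the loser \<open>P V3 (Suc i)\<close>,
      and its own length is too large to reverse the comparison; the other side is built on the
      winner and only grows.\<close>
    have "gr_less (\<mu> (P V1 (Suc i))) (\<mu> (P V1 i))"
      unfolding m1 by (rule gr_less_insert_left[OF less]) (use \<mu>_bound[of _ V1 i] l(5) in fastforce)
    then have "gr_less (\<mu> (P V1 (Suc i))) (\<mu> (P V2 (Suc i)))"
      unfolding m2 by (rule gr_less_insert_top[rotated]) (use \<mu>_bound[of _ V1 i] l(4) in fastforce)
    then have "gr_less (\<mu> (P V1 (Suc i))) (\<mu> (P V3 (Suc (Suc i))))"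
      unfolding m3 by (rule gr_less_insert_top[rotated]) (use \<mu>_bound[of _ V2 "Suc i"] l(6) in fastforce)
    then show ?thesis using True by simp
  next
    case False
    then have "gr_less (\<mu> (P V1 i)) (\<mu> (P V3 (Suc i)))" using Suc by simp
    then have m2: "\<mu> (P V2 (Suc i)) = insert (len (P V2 (Suc i))) (\<mu> (P V3 (Suc i)))" using gr_P2(2) by (simp add: gr_reduces_def)
    \<comment> \<open>Both measures now extend \<open>\<mu> (P V3 (Suc i))\<close>, and
      \<open>P V1 (Suc i)\<close> does so by the smaller length. The further length in
      \<open>m3\<close> lies beyond all of \<open>\<mu> (P V1 (Suc i))\<close>.\<close>
    have "gr_less (\<mu> (P V2 (Suc i))) (\<mu> (P V1 (Suc i)))"
      unfolding m2 m1 by (rule gr_less_insert_min[OF l(2)]) (use \<mu>_bound[of _ V3 "Suc i"] l(3) in fastforce)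
    then have "gr_less (\<mu> (P V3 (Suc (Suc i)))) (\<mu> (P V1 (Suc i)))"
      unfolding m3 by (rule gr_less_insert_left) (use \<mu>_bound[of _ V1 "Suc i"] l(2,6) in fastforce)
    then show ?thesis using False by simp
  qed
qed

end

theorem proposition3p1:
  fixes P1 P2 P3 :: "nat \<Rightarrow> (vertex, arrow, arrow list, 'k::alg_closed_field) rep"
  defines "P1 \<equiv> \<lambda>i. (tau_inv quiver_Q ^^ i) (proj_module quiver_Q V1)"
    and "P2 \<equiv> \<lambda>i. (tau_inv quiver_Q ^^ i) (proj_module quiver_Q V2)"
    and "P3 \<equiv> \<lambda>i. (tau_inv quiver_Q ^^ i) (proj_module quiver_Q V3)"
  shows "(\<forall>i. (\<exists>X. gr_submodule quiver_Q X (P3 (i + 1))) \<and>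
              (\<forall>X. gr_submodule quiver_Q X (P3 (i + 1)) \<longrightarrow> isomorphic quiver_Q X (P2 i)))
       \<and> (\<forall>i\<ge>1. (\<exists>X. gr_submodule quiver_Q X (P1 i)) \<and>
              (\<forall>X. gr_submodule quiver_Q X (P1 i) \<longrightarrow> isomorphic quiver_Q X (P3 i)))
       \<and> (\<forall>i. (\<exists>X. gr_submodule quiver_Q X (P2 i)) \<and>
              (\<forall>X. gr_submodule quiver_Q X (P2 i) \<longrightarrow>
                 (if odd i then isomorphic quiver_Q X (P1 (i - 1)) else isomorphic quiver_Q X (P3 i))))"
proof -
  interpret tau_orbits "\<lambda>v i. (tau_inv quiver_Q ^^ i) (proj_module quiver_Q v) :: (vertex, arrow, arrow list, 'k) rep"
    by unfold_locales (rule refl)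
  have 3: "gr_reduces (P3 (i + 1)) (P2 i)" for i using gr_P3[of i] by (simp only: P2_def P3_def Suc_eq_plus1)
  have 1: "gr_reduces (P1 i) (P3 i)" if "i \<ge> 1" for i
    using that gr_P1[of "i - 1"] by (cases i) (simp_all add: P1_def P3_def)
  have 2: "if odd i then gr_reduces (P2 i) (P1 (i - 1)) else gr_reduces (P2 i) (P3 i)" for i
  proof (cases i)
    case 0
    then show ?thesis using gr_P2_0 by (simp add: P2_def P3_def)
  next
    case (Suc n)
    \<comment> \<open>The comparison concerns \<open>n = i - 1\<close>, so odd \<open>i\<close>
      belongs to the even case of \<open>compare_P\<close>.\<close>
    show ?thesis
    proof (cases "even n")
      case True
      then have "gr_reduces (P2 i) (P1 (i - 1))" using compare_P[of n] gr_P2(1)[of n] Suc by (simp add: P1_def P2_def P3_def)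
      then show ?thesis using Suc True by simp
    next
      case False
      then have "gr_reduces (P2 i) (P3 i)" using compare_P[of n] gr_P2(2)[of n] Suc by (simp add: P1_def P2_def P3_def)
      then show ?thesis using Suc False by simp
    qed
  qed
  show ?thesis using 1 2 3 unfolding gr_reduces_def by (meson even_Suc)
qed

end
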